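(* Let $r>1$ and $n\ge 1$ be integers, let $p$ be a positive divisor of $r$, and suppose that $W=G(r,p,n)$ acts irreducibly on $\mathfrak h=\mathbb C^n$. Let $h=r(n-1)+r/p$ if $p<r$ and $h=r(n-1)$ if $p=r$, and let $V=\mathbb C\{x_1^{h+1},\dots,x_n^{h+1}\}\subseteq S(\mathfrak h^* )=\mathbb C[x_1,\dots,x_n]$, a $W$-module. Then there is a $W$-equivariant graded quotient $L$ of the diagonal coinvariant ring $R$ of $W$ (i.e. $L=R/K$ with $K$ a $W$-stable ideal that is homogeneous for the $\mathbb Z$-grading in which $\mathfrak h^*$ has degree $1$ and $\mathfrak h$ has degree $-1$) such that for each $w\in W$ $$\sum_{i}\operatorname{tr}\bigl(w,(L\otimes\Lambda^nV)_i\bigr)\,t^i=\frac{\det(1-t^{h+1}w_V)}{\det(1-t\,w_{\mathfrak h^*})},$$ where $w_V$ and $w_{\mathfrak h^*}$ denote $w$ regarded as an endomorphism of $V$ and $\mathfrak h^*$ respectively, and $L\otimes\Lambda^nV$ is graded using the $\mathbb Z$-grading of $L$ in which the image of $\mathfrak h^*$ has degree $1$ and the image of $\mathfrak h$ has degree $-1$, with $\Lambda^nV$ placed in degree $e_1+\cdots+e_n$, where $e_1,\dots,e_n$ are the exponents of $V$. Moreover, the image of $S(\mathfrak h^* )$ in $L$ is isomorphic to the ordinary coinvariant ring $S(\mathfrak h^* )/J$ of $W$.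
   Context: $G(r,1,n)$ is the group of $n\times n$ monomial matrices whose nonzero entries are $r$-th roots of $1$; for $p\mid r$, $G(r,p,n)$ is the subgroup of those matrices for which the product of the nonzero entries is an $(r/p)$-th root of $1$. It acts on $\mathfrak h=\mathbb C^n$ (standard basis $y_1,\dots,y_n$) and contragrediently on $\mathfrak h^*$ (dual basis $x_1,\dots,x_n$), hence on $S(\mathfrak h^* )=\mathbb C[x_1,\dots,x_n]$ and on $S(\mathfrak h^*\oplus\mathfrak h)$. The diagonal coinvariant ring is $R=S(\mathfrak h^*\oplus\mathfrak h)/I$, where $I$ is the ideal generated by the $W$-invariants in $S(\mathfrak h^*\oplus \mathfrak h)$ with zero constant term. The ordinary coinvariant ring is $S(\mathfrak h^* )/J$, where $J$ is the ideal generated by the positive degree elements of $S(\mathfrak h^* )^W$. For an irreducible $W$-module $V$ of dimension $l$, its exponents are the integers $e_1\le\dots\le e_l$ determined by $\sum_{i\ge0}[(S(\mathfrak h^* )/J)_i:V]\,t^i=\sum_{i=1}^l t^{e_i}$, where $(S(\mathfrak h^* )/J)_i$ is the $i$-th graded piece and $[\,\cdot:V]$ denotes the multiplicity of $V$. *)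

theory Defs
  imports
    "HOL-Analysis.Analysis"
    "HOL-Computational_Algebra.Formal_Laurent_Series"
    "HOL-Library.Poly_Mapping"
    "HOL-Algebra.Module"
    "HOL-Algebra.QuotRing"
    "HOL-Algebra.Algebraic_Closure_Type"
begin

section \<open>Complex vector spaces as modules over the complex numbers\<close>

abbreviation complex_field :: "complex ring"
  where "complex_field \<equiv> ring_of_type_algebra"

definition is_basis :: "(complex, 'a, 'm) module_scheme \<Rightarrow> 'i set \<Rightarrow> ('i \<Rightarrow> 'a) \<Rightarrow> bool"
  where "is_basis M I b \<longleftrightarrow> finite I \<and> b ` I \<subseteq> carrier M \<and>
    (\<forall>v\<in>carrier M. \<exists>!c. c \<in> I \<rightarrow>\<^sub>E UNIV \<and> v = (\<Oplus>\<^bsub>M\<^esub>i\<in>I. c i \<odot>\<^bsub>M\<^esub> b i))"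

definition coords ::
    "(complex, 'a, 'm) module_scheme \<Rightarrow> 'i set \<Rightarrow> ('i \<Rightarrow> 'a) \<Rightarrow> 'a \<Rightarrow> 'i \<Rightarrow> complex"
  where "coords M I b v =
    (THE c. c \<in> I \<rightarrow>\<^sub>E UNIV \<and> v = (\<Oplus>\<^bsub>M\<^esub>i\<in>I. c i \<odot>\<^bsub>M\<^esub> b i))"

text \<open>Dimension and trace are \<open>0\<close> by convention if \<open>M\<close> is not finite-dimensional.\<close>

definition vdim :: "(complex, 'a, 'm) module_scheme \<Rightarrow> nat"
  where "vdim M = (if \<exists>d b. is_basis M {..<d::nat} b
    then THE d. \<exists>b. is_basis M {..<d} b else 0)"

definition endo_trace :: "(complex, 'a, 'm) module_scheme \<Rightarrow> ('a \<Rightarrow> 'a) \<Rightarrow> complex"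
  where "endo_trace M T =
    (let d = vdim M; b = (SOME b. is_basis M {..<d} b)
     in \<Sum>k<d. coords M {..<d} b (T (b k)) k)"

definition endo_matrix ::
    "(complex, 'a, 'm) module_scheme \<Rightarrow> ('n::finite \<Rightarrow> 'a) \<Rightarrow> ('a \<Rightarrow> 'a) \<Rightarrow> complex^'n^'n"
  where "endo_matrix M b T = (\<chi> i j. coords M UNIV b (T (b j)) i)"

definition lin_span :: "(complex, 'a, 'm) module_scheme \<Rightarrow> 'a set \<Rightarrow> 'a set"
  where "lin_span M B = \<Inter>{H. submodule H complex_field M \<and> B \<subseteq> H}"


section \<open>Representations and graded representations\<close>

text \<open>The ring fields \<open>mult\<close> and \<open>one\<close> inherited from \<^type>\<open>module\<close> are meaningful
  only for representations that are algebras.\<close>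

record ('g, 'a) rep = "(complex, 'a) module" +
  act :: "'g \<Rightarrow> 'a \<Rightarrow> 'a"

record ('g, 'a) grep = "('g, 'a) rep" +
  gr :: "int \<Rightarrow> 'a set"

definition act_stable :: "'g set \<Rightarrow> ('g, 'a, 'm) rep_scheme \<Rightarrow> 'a set \<Rightarrow> bool"
  where "act_stable W M H \<longleftrightarrow> (\<forall>w\<in>W. act M w ` H \<subseteq> H)"

definition irreducible_rep :: "'g set \<Rightarrow> ('g, 'a, 'm) rep_scheme \<Rightarrow> bool"
  where "irreducible_rep W M \<longleftrightarrow> carrier M \<noteq> {\<zero>\<^bsub>M\<^esub>} \<and>
    (\<forall>H. submodule H complex_field M \<and> act_stable W M H \<longrightarrow> H = {\<zero>\<^bsub>M\<^esub>} \<or> H = carrier M)"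

definition invariants :: "'g set \<Rightarrow> ('g, 'a, 'm) rep_scheme \<Rightarrow> 'a set"
  where "invariants W M = {x \<in> carrier M. \<forall>w\<in>W. act M w x = x}"

definition homogeneous :: "('g, 'a, 'm) grep_scheme \<Rightarrow> 'a set \<Rightarrow> bool"
  where "homogeneous M K \<longleftrightarrow>
    (\<forall>k\<in>K. \<exists>D f. finite D \<and> (\<forall>d\<in>D. f d \<in> K \<inter> gr M d) \<and> k = (\<Oplus>\<^bsub>M\<^esub>d\<in>D. f d))"

definition sub_grep :: "('g, 'a, 'm) grep_scheme \<Rightarrow> 'a set \<Rightarrow> ('g, 'a, 'm) grep_scheme"
  where "sub_grep M H = M\<lparr>carrier := H, gr := (\<lambda>d. gr M d \<inter> H)\<rparr>"

definition piece :: "('g, 'a, 'm) grep_scheme \<Rightarrow> int \<Rightarrow> ('g, 'a, 'm) grep_scheme"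
  where "piece M d = M\<lparr>carrier := gr M d\<rparr>"

text \<open>As with \<^const>\<open>rcoset_mult\<close>, operations on cosets are unions over representatives.\<close>

definition quot_grep :: "('g, 'a, 'm) grep_scheme \<Rightarrow> 'a set \<Rightarrow> ('g, 'a set) grep"
  where "quot_grep M N =
    \<lparr>carrier = carrier (M Quot N), monoid.mult = monoid.mult (M Quot N), one = one (M Quot N),
     zero = zero (M Quot N), add = add (M Quot N),
     smult = (\<lambda>c C. \<Union>x\<in>C. N +>\<^bsub>M\<^esub> (c \<odot>\<^bsub>M\<^esub> x)),
     act = (\<lambda>g C. \<Union>x\<in>C. N +>\<^bsub>M\<^esub> act M g x),
     gr = (\<lambda>d. (\<lambda>x. N +>\<^bsub>M\<^esub> x) ` gr M d)\<rparr>"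

definition graded_iso ::
    "'g set \<Rightarrow> ('g, 'a, 'm) grep_scheme \<Rightarrow> ('g, 'b, 'k) grep_scheme \<Rightarrow> bool"
  where "graded_iso W A B \<longleftrightarrow> (\<exists>\<phi>\<in>ring_iso A B.
    (\<forall>c. \<forall>x\<in>carrier A. \<phi> (c \<odot>\<^bsub>A\<^esub> x) = c \<odot>\<^bsub>B\<^esub> \<phi> x) \<and>
    (\<forall>w\<in>W. \<forall>x\<in>carrier A. \<phi> (act A w x) = act B w (\<phi> x)) \<and>
    (\<forall>d. \<phi> ` gr A d = gr B d))"

definition equiv_hom ::
    "'g set \<Rightarrow> ('g, 'a, 'm) rep_scheme \<Rightarrow> ('g, 'b, 'k) rep_scheme \<Rightarrow> (complex, 'a \<Rightarrow> 'b) module"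
  where "equiv_hom W V M =
    \<lparr>carrier = {f \<in> carrier V \<rightarrow>\<^sub>E carrier M.
       (\<forall>x\<in>carrier V. \<forall>y\<in>carrier V. f (x \<oplus>\<^bsub>V\<^esub> y) = f x \<oplus>\<^bsub>M\<^esub> f y) \<and>
       (\<forall>c. \<forall>x\<in>carrier V. f (c \<odot>\<^bsub>V\<^esub> x) = c \<odot>\<^bsub>M\<^esub> f x) \<and>
       (\<forall>w\<in>W. \<forall>x\<in>carrier V. f (act V w x) = act M w (f x))},
     monoid.mult = undefined, one = undefined,
     zero = (\<lambda>x\<in>carrier V. \<zero>\<^bsub>M\<^esub>),
     add = (\<lambda>f f'. \<lambda>x\<in>carrier V. f x \<oplus>\<^bsub>M\<^esub> f' x),
     smult = (\<lambda>c f. \<lambda>x\<in>carrier V. c \<odot>\<^bsub>M\<^esub> f x)\<rparr>"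

text \<open>\<open>[M : V] = dim Hom\<^sub>W(V, M)\<close>, for irreducible \<open>V\<close> over the complex numbers.\<close>

definition multiplicity_in :: "'g set \<Rightarrow> ('g, 'b, 'k) rep_scheme \<Rightarrow> ('g, 'a, 'm) rep_scheme \<Rightarrow> nat"
  where "multiplicity_in W M V = vdim (equiv_hom W V M)"

text \<open>This is the comparison of the coefficients of \<open>t\<^sup>i\<close> in \<open>\<Sum>\<^sub>i [A\<^sub>i : V] t\<^sup>i = \<Sum>\<^sub>j t\<^bsup>e\<^sub>j\<^esup>\<close>;
  \<open>A\<close> is the coinvariant algebra in the intended application.\<close>

definition exponents_in ::
    "'g set \<Rightarrow> ('g, 'b, 'k) grep_scheme \<Rightarrow> ('g, 'a, 'm) rep_scheme \<Rightarrow> nat list"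
  where "exponents_in W A V = (THE es. sorted es \<and> length es = vdim V \<and>
    (\<forall>i. multiplicity_in W (piece A (int i)) V = count_list es i))"


section \<open>Tensor products and exterior powers\<close>

text \<open>The vector space with basis \<open>B\<close>; the action is induced from one on \<open>B\<close>, and \<open>D d\<close> is the
  set of basis elements of degree \<open>d\<close>.\<close>

definition free_grep ::
    "'x set \<Rightarrow> ('g \<Rightarrow> 'x \<Rightarrow> 'x) \<Rightarrow> (int \<Rightarrow> 'x set) \<Rightarrow> ('g, 'x \<Rightarrow>\<^sub>0 complex) grep"
  where "free_grep B \<alpha> D =
    \<lparr>carrier = {f. Poly_Mapping.keys f \<subseteq> B}, monoid.mult = undefined, one = undefined,
     zero = 0, add = (+),
     smult = (\<lambda>c. Poly_Mapping.map ((*) c)),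
     act = (\<lambda>g f. \<Sum>x\<in>Poly_Mapping.keys f. Poly_Mapping.single (\<alpha> g x) (Poly_Mapping.lookup f x)),
     gr = (\<lambda>d. {f. Poly_Mapping.keys f \<subseteq> D d})\<rparr>"

abbreviation gen :: "'x \<Rightarrow> 'x \<Rightarrow>\<^sub>0 complex"
  where "gen x \<equiv> Poly_Mapping.single x 1"

definition tensor_relations ::
    "(complex, 'a, 'm) module_scheme \<Rightarrow> (complex, 'b, 'k) module_scheme \<Rightarrow> ('a \<times> 'b \<Rightarrow>\<^sub>0 complex) set"
  where "tensor_relations A B =
      {gen (a \<oplus>\<^bsub>A\<^esub> a', b) - gen (a, b) - gen (a', b) | a a' b.
         a \<in> carrier A \<and> a' \<in> carrier A \<and> b \<in> carrier B}
    \<union> {gen (a, b \<oplus>\<^bsub>B\<^esub> b') - gen (a, b) - gen (a, b') | a b b'.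
         a \<in> carrier A \<and> b \<in> carrier B \<and> b' \<in> carrier B}
    \<union> {gen (c \<odot>\<^bsub>A\<^esub> a, b) - Poly_Mapping.single (a, b) c | c a b.
         a \<in> carrier A \<and> b \<in> carrier B}
    \<union> {gen (a, c \<odot>\<^bsub>B\<^esub> b) - Poly_Mapping.single (a, b) c | c a b.
         a \<in> carrier A \<and> b \<in> carrier B}"

definition tensor ::
    "('g, 'a, 'm) grep_scheme \<Rightarrow> ('g, 'b, 'k) grep_scheme \<Rightarrow> ('g, ('a \<times> 'b \<Rightarrow>\<^sub>0 complex) set) grep"
  where "tensor A B =
    (let F = free_grep (carrier A \<times> carrier B) (\<lambda>g. map_prod (act A g) (act B g))
               (\<lambda>d. \<Union>j. gr A j \<times> gr B (d - j))
     in quot_grep F (lin_span F (tensor_relations A B)))"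

definition ext_relations :: "nat \<Rightarrow> (complex, 'a, 'm) module_scheme \<Rightarrow> ('a list \<Rightarrow>\<^sub>0 complex) set"
  where "ext_relations k V =
      {gen (us @ (a \<oplus>\<^bsub>V\<^esub> a') # vs) - gen (us @ a # vs) - gen (us @ a' # vs) | us vs a a'.
         set us \<union> set vs \<union> {a, a'} \<subseteq> carrier V \<and> Suc (length us + length vs) = k}
    \<union> {gen (us @ (c \<odot>\<^bsub>V\<^esub> a) # vs) - Poly_Mapping.single (us @ a # vs) c | us vs a c.
         set us \<union> set vs \<union> {a} \<subseteq> carrier V \<and> Suc (length us + length vs) = k}
    \<union> {gen vs | vs. set vs \<subseteq> carrier V \<and> length vs = k \<and> \<not> distinct vs}"

text \<open>The \<open>k\<close>-th exterior power of \<open>V\<close>, placed in degree \<open>e\<close>; the list \<open>[v\<^sub>1, \<dots>, v\<^sub>k]\<close> stands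
  for \<open>v\<^sub>1 \<and> \<dots> \<and> v\<^sub>k\<close>.\<close>

definition ext_power ::
    "nat \<Rightarrow> int \<Rightarrow> ('g, 'a, 'm) rep_scheme \<Rightarrow> ('g, ('a list \<Rightarrow>\<^sub>0 complex) set) grep"
  where "ext_power k e V =
    (let B = {vs. set vs \<subseteq> carrier V \<and> length vs = k};
         F = free_grep B (\<lambda>g. map (act V g)) (\<lambda>d. if d = e then B else {})
     in quot_grep F (lin_span F (ext_relations k V)))"


section \<open>The groups \<open>G(r, p, n)\<close> and their reflection representation\<close>

text \<open>Here \<open>n = CARD('n)\<close>.\<close>

definition monomial_matrix :: "complex^'n^'n \<Rightarrow> bool"
  where "monomial_matrix A \<longleftrightarrow> (\<forall>i. \<exists>!j. A $ i $ j \<noteq> 0) \<and> (\<forall>j. \<exists>!i. A $ i $ j \<noteq> 0)"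

definition G_group :: "nat \<Rightarrow> nat \<Rightarrow> (complex^'n^'n) set"
  where "G_group r p = {A. monomial_matrix A \<and>
    (\<forall>i j. A $ i $ j \<noteq> 0 \<longrightarrow> (A $ i $ j) ^ r = 1) \<and>
    (\<Prod>(i, j)\<in>{(i, j). A $ i $ j \<noteq> 0}. A $ i $ j) ^ (r div p) = 1}"

definition std_rep :: "(complex^'n^'n, complex^'n) rep"
  where "std_rep = \<lparr>carrier = UNIV, monoid.mult = undefined, one = undefined, zero = 0, add = (+),
    smult = (*s), act = (*v)\<rparr>"


section \<open>Polynomials\<close>

text \<open>\<open>S(h\<^sup>* \<oplus> h)\<close> is the polynomial ring in the variables \<open>x\<^sub>i\<close> (indexed by \<open>Inl i\<close>) and
  \<open>y\<^sub>i\<close> (indexed by \<open>Inr i\<close>).\<close>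

type_synonym 'n bipoly = "(('n + 'n) \<Rightarrow>\<^sub>0 nat) \<Rightarrow>\<^sub>0 complex"

definition Const :: "complex \<Rightarrow> 'n bipoly"
  where "Const c = Poly_Mapping.single 0 c"

definition Var :: "'n + 'n \<Rightarrow> 'n bipoly"
  where "Var v = Poly_Mapping.single (Poly_Mapping.single v 1) 1"

definition subst :: "('n + 'n \<Rightarrow> 'n bipoly) \<Rightarrow> 'n bipoly \<Rightarrow> 'n bipoly"
  where "subst \<sigma> f = (\<Sum>m\<in>Poly_Mapping.keys f. Const (Poly_Mapping.lookup f m) *
    (\<Prod>v\<in>Poly_Mapping.keys m. \<sigma> v ^ Poly_Mapping.lookup m v))"

text \<open>\<open>w y\<^sub>i = \<Sum>\<^sub>j w\<^sub>j\<^sub>i y\<^sub>j\<close> and, contragrediently, \<open>w x\<^sub>i = x\<^sub>i \<circ> w\<^sup>-\<^sup>1 = \<Sum>\<^sub>j (w\<^sup>-\<^sup>1)\<^sub>i\<^sub>j x\<^sub>j\<close>.\<close>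

fun var_act :: "complex^'n^'n \<Rightarrow> 'n + 'n \<Rightarrow> 'n::finite bipoly"
  where
    "var_act w (Inl i) = (\<Sum>j\<in>UNIV. Const (matrix_inv w $ i $ j) * Var (Inl j))"
  | "var_act w (Inr i) = (\<Sum>j\<in>UNIV. Const (w $ j $ i) * Var (Inr j))"

definition mon_deg :: "(('n::finite + 'n) \<Rightarrow>\<^sub>0 nat) \<Rightarrow> int"
  where "mon_deg m = (\<Sum>i\<in>UNIV. int (Poly_Mapping.lookup m (Inl i)))
    - (\<Sum>i\<in>UNIV. int (Poly_Mapping.lookup m (Inr i)))"

definition poly_alg :: "(complex^'n^'n, 'n::finite bipoly) grep"
  where "poly_alg = \<lparr>carrier = UNIV, monoid.mult = (*), one = 1, zero = 0, add = (+),
    smult = (\<lambda>c f. Const c * f),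
    act = (\<lambda>w. subst (var_act w)),
    gr = (\<lambda>d. {f. \<forall>m\<in>Poly_Mapping.keys f. mon_deg m = d})\<rparr>"

definition x_polys :: "'n bipoly set"
  where "x_polys = {f. \<forall>m\<in>Poly_Mapping.keys f. Poly_Mapping.keys m \<subseteq> range Inl}"

definition x_alg :: "(complex^'n^'n, 'n::finite bipoly) grep"
  where "x_alg = sub_grep poly_alg x_polys"

definition power_rep :: "nat \<Rightarrow> (complex^'n^'n, 'n::finite bipoly) grep"
  where "power_rep k = sub_grep poly_alg (lin_span poly_alg (range (\<lambda>i. Var (Inl i) ^ k)))"


section \<open>Coinvariants\<close>

definition diag_ideal :: "(complex^'n^'n) set \<Rightarrow> 'n::finite bipoly set"
  where "diag_ideal W =
    Idl\<^bsub>poly_alg\<^esub> {f \<in> invariants W poly_alg. Poly_Mapping.lookup f 0 = 0}"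

definition diag_coinv :: "(complex^'n^'n) set \<Rightarrow> (complex^'n^'n, 'n::finite bipoly set) grep"
  where "diag_coinv W = quot_grep poly_alg (diag_ideal W)"

definition coinv :: "(complex^'n^'n) set \<Rightarrow> (complex^'n^'n, 'n::finite bipoly set) grep"
  where "coinv W = quot_grep x_alg (Idl\<^bsub>x_alg\<^esub> (\<Union>d\<in>{0<..}. invariants W x_alg \<inter> gr x_alg d))"

definition x_image ::
    "(complex^'n^'n) set \<Rightarrow> 'n::finite bipoly set set \<Rightarrow> (complex^'n^'n, 'n bipoly set set) grep"
  where "x_image W K = sub_grep (quot_grep (diag_coinv W) K)
    ((\<lambda>f. K +>\<^bsub>diag_coinv W\<^esub> (diag_ideal W +>\<^bsub>poly_alg\<^esub> f)) ` x_polys)"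

text \<open>\<open>det (1 - t\<^sup>k A)\<close> as a Laurent series in \<open>t\<close>.\<close>

definition det_one_minus :: "nat \<Rightarrow> complex^'n^'n \<Rightarrow> complex fls"
  where "det_one_minus k A = det (mat 1 - (\<chi> i j. fls_X ^ k * fls_const (A $ i $ j)))"

end

theory Submission
  imports Defs "HOL-Number_Theory.Cong"
begin

text \<open>Let \<open>v = \<Sum>\<^sub>\<pi> sgn(\<pi>) \<Prod>\<^sub>i x\<^sub>i\<^bsup>\<epsilon> + r \<pi>(i)\<^esup>\<close>, with \<open>\<epsilon> = 1\<close> if \<open>p < r\<close> and \<open>\<epsilon> = 0\<close> if \<open>p = r\<close>; it spans the
  line of vectors on which \<open>W\<close> acts by the character of \<open>\<Lambda>\<^sup>n V\<close> in the space \<open>A\<close> of polynomials whose exponents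
  are at most \<open>h\<close>. The space \<open>A\<close> is a representation of the rational Cherednik algebra in which the
  Dunkl operators send monomials to multiples of monomials, and it is generated by \<open>v\<close>. The
  associated graded of the filtration of \<open>A\<close> by total degree in the generators is a quotient of
  \<open>S(h\<^sup>* \<oplus> h)\<close> with kernel a \<open>W\<close>-stable graded ideal. As the line of \<open>v\<close> is the only one with its character, this
  ideal contains the invariants without constant term, so the quotient \<open>L\<close> is one of the diagonal
  coinvariant ring, and \<open>L \<otimes> \<Lambda>\<^sup>n V\<close> is \<open>A\<close> as a graded \<open>W\<close>-module because the exponents of \<open>V\<close> add up to the degree
  of \<open>v\<close>. The trace on \<open>A\<close> is a sum over the monomials fixed by a permutation, which is the quotient of determinants.
  To avoid quotients of filtrations, the associated graded is realized inside \<open>A\<close> by orthogonal projections.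
  Finally, the polynomials in the \<open>x\<^sub>i\<close> that annihilate \<open>v\<close> in \<open>A\<close> form the ideal \<open>J\<close>: modulo the elementary
  symmetric polynomials in the \<open>x\<^sub>i\<^sup>r\<close> one passes to normal forms, which are detected by their
  product with the Vandermonde polynomial in the \<open>x\<^sub>i\<^sup>r\<close>.\<close>

section \<open>Coordinates, traces and dimensions\<close>

text \<open>A Cherednik algebra enters because its parameters can be tuned until the polynomial
  representation gets a finite-dimensional quotient of known character. The operators used are those
  of G(r,1,n) with parameter zero at the reflections that permute coordinates. They act in one
  variable at a time, and everything rests on one function \<open>lam\<close> of a single exponent:
  it has to vanish at 0, which forces h + 1 not to be divisible by r; it vanishes at h + 1, which
  allows the truncation; and it is nonzero in between, which makes v a generator.

  The number \<open>eps\<close> comes from the determinant of w on V. That is the sign times the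
  product of the entries to the power h + 1 = r(n-1) + s + eps with s = r/p, and the s-th power of
  the product of the entries is 1.

  For p > 1 the ideal J contains (x_1 ... x_n)^s although the elementary symmetric polynomials only
  supply its p-th power. So the annihilator of v is found by multiplying with the missing power and
  cancelling it again, which needs exponents modulo rn. The exponents of V require all equivariant
  maps from V to the coinvariants; explicit monomials represent them, and these may share a
  degree.\<close>

definition supported :: "'i set \<Rightarrow> ('i \<Rightarrow> complex) set"
  where "supported I = {c. \<forall>i. i \<notin> I \<longrightarrow> c i = 0}"

lemma supportedD: "c \<in> supported I \<Longrightarrow> i \<notin> I \<Longrightarrow> c i = 0"
  by (simp add: supported_def)

text \<open>Coordinates indexed by an arbitrary finite set carry all the linear algebra: the laws of
  the additive monoid, and with them the finite sums in \<open>is_basis\<close>, follow from the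
  injectivity of \<open>\<phi>\<close>.\<close>

locale coordinatized =
  fixes M :: "(complex, 'a, 'm) module_scheme" and I :: "'i set" and \<phi> :: "'a \<Rightarrow> 'i \<Rightarrow> complex"
  assumes finite_index: "finite I"
    and bij: "bij_betw \<phi> (carrier M) (supported I)"
    and add_closed: "x \<in> carrier M \<Longrightarrow> y \<in> carrier M \<Longrightarrow> x \<oplus>\<^bsub>M\<^esub> y \<in> carrier M"
    and coord_add: "x \<in> carrier M \<Longrightarrow> y \<in> carrier M \<Longrightarrow> \<phi> (x \<oplus>\<^bsub>M\<^esub> y) = (\<lambda>i. \<phi> x i + \<phi> y i)"
    and smult_closed: "x \<in> carrier M \<Longrightarrow> c \<odot>\<^bsub>M\<^esub> x \<in> carrier M"
    and coord_smult: "x \<in> carrier M \<Longrightarrow> \<phi> (c \<odot>\<^bsub>M\<^esub> x) = (\<lambda>i. c * \<phi> x i)"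
    and zero_closed: "\<zero>\<^bsub>M\<^esub> \<in> carrier M"
    and coord_zero: "\<phi> \<zero>\<^bsub>M\<^esub> = (\<lambda>_. 0)"
begin

lemma coord_inj: "x \<in> carrier M \<Longrightarrow> y \<in> carrier M \<Longrightarrow> \<phi> x = \<phi> y \<Longrightarrow> x = y"
  using bij by (auto simp: bij_betw_def inj_on_def)

lemma coord_supported: "x \<in> carrier M \<Longrightarrow> \<phi> x \<in> supported I"
  using bij by (auto simp: bij_betw_def)

lemma coord_surj: assumes "c \<in> supported I" obtains x where "x \<in> carrier M" "\<phi> x = c"
  using bij assms by (auto simp: bij_betw_def elim!: equalityE)

lemma abelian_monoid: "abelian_monoid M"
  by (rule abelian_monoidI)
     (auto intro!: coord_inj simp: add_closed zero_closed coord_add coord_zero add.assoc add.commute)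

sublocale abelian_monoid M by (rule abelian_monoid)

definition unit :: "'i \<Rightarrow> 'a"
  where "unit i = inv_into (carrier M) \<phi> (\<lambda>j. of_bool (j = i))"

lemma unit:
  assumes "i \<in> I" shows unit_closed: "unit i \<in> carrier M" and coord_unit: "\<phi> (unit i) = (\<lambda>j. of_bool (j = i))"
proof -
  have "(\<lambda>j. of_bool (j = i)) \<in> \<phi> ` carrier M"
    using assms bij by (auto simp: bij_betw_def supported_def)
  then show "unit i \<in> carrier M" "\<phi> (unit i) = (\<lambda>j. of_bool (j = i))"
    unfolding unit_def by (auto intro: inv_into_into f_inv_into_f)
qed

lemma coord_finsum:
  assumes "finite A" "g \<in> A \<rightarrow> carrier M"
  shows "\<phi> (\<Oplus>\<^bsub>M\<^esub>a\<in>A. g a) = (\<lambda>i. \<Sum>a\<in>A. \<phi> (g a) i)"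
  using assms
proof (induction A rule: finite_induct)
  case (insert x F)
  then have "(\<Oplus>\<^bsub>M\<^esub>a\<in>F. g a) \<in> carrier M" by (intro finsum_closed) auto
  with insert show ?case by (simp add: coord_add Pi_iff)
qed (simp add: coord_zero)

lemma coord_combination:
  assumes "finite J" "b ` J \<subseteq> carrier M"
  shows "(\<Oplus>\<^bsub>M\<^esub>j\<in>J. c j \<odot>\<^bsub>M\<^esub> b j) \<in> carrier M"
    and "\<phi> (\<Oplus>\<^bsub>M\<^esub>j\<in>J. c j \<odot>\<^bsub>M\<^esub> b j) = (\<lambda>i. \<Sum>j\<in>J. c j * \<phi> (b j) i)"
proof -
  have g: "(\<lambda>j. c j \<odot>\<^bsub>M\<^esub> b j) \<in> J \<rightarrow> carrier M"
    using assms smult_closed by auto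
  then show "(\<Oplus>\<^bsub>M\<^esub>j\<in>J. c j \<odot>\<^bsub>M\<^esub> b j) \<in> carrier M" by (rule finsum_closed)
  show "\<phi> (\<Oplus>\<^bsub>M\<^esub>j\<in>J. c j \<odot>\<^bsub>M\<^esub> b j) = (\<lambda>i. \<Sum>j\<in>J. c j * \<phi> (b j) i)"
    unfolding coord_finsum[OF assms(1) g]
    using assms by (auto simp: coord_smult image_subset_iff intro!: ext sum.cong)
qed

lemma eq_combination_iff:
  assumes "finite J" "b ` J \<subseteq> carrier M" "v \<in> carrier M"
  shows "v = (\<Oplus>\<^bsub>M\<^esub>j\<in>J. c j \<odot>\<^bsub>M\<^esub> b j) \<longleftrightarrow> (\<forall>i. \<phi> v i = (\<Sum>j\<in>J. c j * \<phi> (b j) i))"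
proof
  assume "\<forall>i. \<phi> v i = (\<Sum>j\<in>J. c j * \<phi> (b j) i)"
  then show "v = (\<Oplus>\<^bsub>M\<^esub>j\<in>J. c j \<odot>\<^bsub>M\<^esub> b j)"
    by (intro coord_inj assms coord_combination) (simp add: coord_combination(2)[OF assms(1,2)] fun_eq_iff)
qed (simp add: coord_combination(2)[OF assms(1,2)])

lemma is_basis_iff:
  "is_basis M J b \<longleftrightarrow> finite J \<and> b ` J \<subseteq> carrier M \<and>
    (\<forall>v\<in>carrier M. \<exists>!c. c \<in> J \<rightarrow>\<^sub>E UNIV \<and> (\<forall>i. \<phi> v i = (\<Sum>j\<in>J. c j * \<phi> (b j) i)))"
  unfolding is_basis_def by (simp add: eq_combination_iff cong: conj_cong)

lemma coords_eq:
  assumes "is_basis M J b" "v \<in> carrier M" "c \<in> J \<rightarrow>\<^sub>E UNIV" "\<And>i. i \<in> I \<Longrightarrow> \<phi> v i = (\<Sum>j\<in>J. c j * \<phi> (b j) i)"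
  shows "coords M J b v = c"
proof -
  have bJ: "finite J" "b ` J \<subseteq> carrier M" using assms(1) by (auto simp: is_basis_def)
  have "\<phi> v i = (\<Sum>j\<in>J. c j * \<phi> (b j) i)" for i
  proof (cases "i \<in> I")
    case False
    then have "\<phi> v i = 0" "\<And>j. j \<in> J \<Longrightarrow> \<phi> (b j) i = 0"
      using bJ assms(2) by (auto intro!: supportedD[OF coord_supported])
    then show ?thesis by simp
  qed (use assms in auto)
  then have "v = (\<Oplus>\<^bsub>M\<^esub>j\<in>J. c j \<odot>\<^bsub>M\<^esub> b j)"
    using eq_combination_iff[OF bJ assms(2)] by blast
  then show ?thesis
    unfolding coords_def using assms(1-3) unfolding is_basis_def by (intro the1_equality) auto
qed

lemma unit_basis:
  assumes g: "bij_betw g J I"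
  shows "is_basis M J (\<lambda>j. unit (g j))"
    and "v \<in> carrier M \<Longrightarrow> coords M J (\<lambda>j. unit (g j)) v = (\<lambda>j\<in>J. \<phi> v (g j))"
proof -
  have J: "finite J" using g finite_index bij_betw_finite by blast
  have gI: "g j \<in> I" if "j \<in> J" for j using g that by (auto simp: bij_betw_def)
  have *: "(\<Sum>j\<in>J. c j * \<phi> (unit (g j)) (g k)) = c k" if "k \<in> J" for c k
  proof -
    have "(\<Sum>j\<in>J. c j * \<phi> (unit (g j)) (g k)) = (\<Sum>j\<in>J. if j = k then c j else 0)"
      using g that by (intro sum.cong) (auto simp: coord_unit gI bij_betw_def inj_on_def)
    then show ?thesis using J that by simp
  qed
  have **: "\<phi> v i = (\<Sum>j\<in>J. (\<lambda>j\<in>J. \<phi> v (g j)) j * \<phi> (unit (g j)) i)" if v: "v \<in> carrier M" for v i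
  proof (cases "i \<in> I")
    case True
    then obtain k where k: "k \<in> J" "i = g k" using g by (auto simp: bij_betw_def)
    show ?thesis unfolding k(2) by (subst *[OF k(1)]) (use k in auto)
  next
    case False
    then have "\<phi> v i = 0" using v by (auto intro!: supportedD[OF coord_supported])
    moreover have "\<phi> (unit (g j)) i = 0" if "j \<in> J" for j
      using False gI[OF that] by (auto simp: coord_unit[OF gI[OF that]])
    ultimately show ?thesis by simp
  qed
  show 1: "is_basis M J (\<lambda>j. unit (g j))"
    unfolding is_basis_iff
  proof (intro conjI ballI J)
    show "(\<lambda>j. unit (g j)) ` J \<subseteq> carrier M" using gI unit_closed by auto
    fix v assume v: "v \<in> carrier M"
    show "\<exists>!c. c \<in> J \<rightarrow>\<^sub>E UNIV \<and> (\<forall>i. \<phi> v i = (\<Sum>j\<in>J. c j * \<phi> (unit (g j)) i))"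
    proof (intro ex1I[of _ "\<lambda>j\<in>J. \<phi> v (g j)"] conjI allI)
      show "\<phi> v i = (\<Sum>j\<in>J. (\<lambda>j\<in>J. \<phi> v (g j)) j * \<phi> (unit (g j)) i)" for i using **[OF v] .
    next
      fix c assume c: "c \<in> J \<rightarrow>\<^sub>E UNIV \<and> (\<forall>i. \<phi> v i = (\<Sum>j\<in>J. c j * \<phi> (unit (g j)) i))"
      then have "\<phi> v (g k) = c k" if "k \<in> J" for k using *[OF that, of c] by metis
      with c show "c = (\<lambda>j\<in>J. \<phi> v (g j))"
        by (intro extensionalityI[of _ J]) (auto simp: PiE_def)
    qed auto
  qed
  show "coords M J (\<lambda>j. unit (g j)) v = (\<lambda>j\<in>J. \<phi> v (g j))" if v: "v \<in> carrier M"
    by (rule coords_eq[OF 1 v]) (simp, rule **[OF v])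
qed

text \<open>\<open>C\<close> is a two-sided inverse of the coordinate matrix of the basis. With both
  products at hand, dimension and trace become exchanges of double sums.\<close>

lemma basis_matrix:
  assumes b: "is_basis M J b"
  obtains C where "\<And>v j. v \<in> carrier M \<Longrightarrow> j \<in> J \<Longrightarrow> coords M J b v j = (\<Sum>i\<in>I. C j i * \<phi> v i)"
    "\<And>i i'. i \<in> I \<Longrightarrow> i' \<in> I \<Longrightarrow> (\<Sum>j\<in>J. \<phi> (b j) i * C j i') = of_bool (i = i')"
    "\<And>j j'. j \<in> J \<Longrightarrow> j' \<in> J \<Longrightarrow> (\<Sum>i\<in>I. C j i * \<phi> (b j') i) = of_bool (j = j')"
proof -
  define C where "C j i = coords M J b (unit i) j" for j i
  have bJ: "finite J" "b ` J \<subseteq> carrier M" using b by (auto simp: is_basis_def)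
  have BC: "(\<Sum>j\<in>J. \<phi> (b j) i * C j i') = of_bool (i = i')" if "i \<in> I" "i' \<in> I" for i i'
  proof -
    have "\<exists>!c. c \<in> J \<rightarrow>\<^sub>E UNIV \<and> unit i' = (\<Oplus>\<^bsub>M\<^esub>j\<in>J. c j \<odot>\<^bsub>M\<^esub> b j)"
      using b unit_closed[OF that(2)] by (auto simp: is_basis_def)
    from theI'[OF this]
    have "unit i' = (\<Oplus>\<^bsub>M\<^esub>j\<in>J. C j i' \<odot>\<^bsub>M\<^esub> b j)" unfolding C_def coords_def by auto
    then have "\<phi> (unit i') i = (\<Sum>j\<in>J. C j i' * \<phi> (b j) i)"
      using eq_combination_iff[OF bJ unit_closed[OF that(2)], of "\<lambda>j. C j i'"] by simp
    then show ?thesis using that by (simp add: coord_unit mult.commute)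
  qed
  have co: "coords M J b v = (\<lambda>j\<in>J. \<Sum>i\<in>I. C j i * \<phi> v i)" if v: "v \<in> carrier M" for v
  proof (rule coords_eq[OF b v])
    fix i assume i: "i \<in> I"
    have "(\<Sum>j\<in>J. (\<lambda>j\<in>J. \<Sum>i\<in>I. C j i * \<phi> v i) j * \<phi> (b j) i)
        = (\<Sum>j\<in>J. \<Sum>i'\<in>I. \<phi> v i' * (\<phi> (b j) i * C j i'))"
      by (intro sum.cong) (auto simp: sum_distrib_right sum_distrib_left mult_ac)
    also have "\<dots> = (\<Sum>i'\<in>I. \<phi> v i' * (\<Sum>j\<in>J. \<phi> (b j) i * C j i'))"
      by (subst sum.swap) (simp add: sum_distrib_left)
    also have "\<dots> = (\<Sum>i'\<in>I. if i' = i then \<phi> v i' else 0)"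
      by (intro sum.cong) (auto simp: BC i)
    also have "\<dots> = \<phi> v i" using i finite_index by simp
    finally show "\<phi> v i = (\<Sum>j\<in>J. (\<lambda>j\<in>J. \<Sum>i\<in>I. C j i * \<phi> v i) j * \<phi> (b j) i)" ..
  qed auto
  have CB: "(\<Sum>i\<in>I. C j i * \<phi> (b j') i) = of_bool (j = j')" if "j \<in> J" "j' \<in> J" for j j'
  proof -
    have "coords M J b (b j') = (\<lambda>k\<in>J. of_bool (k = j'))"
    proof (rule coords_eq[OF b])
      fix i
      have "(\<Sum>k\<in>J. (\<lambda>k\<in>J. of_bool (k = j')) k * \<phi> (b k) i) = (\<Sum>k\<in>J. if k = j' then \<phi> (b k) i else 0)"
        by (intro sum.cong) auto
      then show "\<phi> (b j') i = (\<Sum>k\<in>J. (\<lambda>k\<in>J. of_bool (k = j')) k * \<phi> (b k) i)"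
        using that bJ by simp
    qed (use that bJ in auto)
    moreover have "coords M J b (b j') j = (\<Sum>i\<in>I. C j i * \<phi> (b j') i)"
      using that bJ by (subst co) auto
    ultimately show ?thesis using that by simp
  qed
  show thesis by (rule that[of C]) (use co BC CB in auto)
qed

text \<open>Invariance of dimension by traces: with B the coordinate matrix of the basis, the trace
  of C B is d and the trace of B C is \<open>card I\<close>.\<close>

lemma vdim_eq: "vdim M = card I"
proof -
  obtain g where g: "bij_betw g {..<card I} I"
    using ex_bij_betw_nat_finite[OF finite_index] by (auto simp: lessThan_atLeast0)
  have ex: "is_basis M {..<card I} (\<lambda>j. unit (g j))" by (rule unit_basis[OF g])
  have un: "d = card I" if "is_basis M {..<d} b" for d :: nat and b
  proof -
    from basis_matrix[OF that] obtain C where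
      C: "\<And>i i'. i \<in> I \<Longrightarrow> i' \<in> I \<Longrightarrow> (\<Sum>j<d. \<phi> (b j) i * C j i') = of_bool (i = i')"
      "\<And>j j'. j \<in> {..<d} \<Longrightarrow> j' \<in> {..<d} \<Longrightarrow> (\<Sum>i\<in>I. C j i * \<phi> (b j') i) = of_bool (j = j')"
      by metis
    have "complex_of_nat d = (\<Sum>j<d. \<Sum>i\<in>I. C j i * \<phi> (b j) i)" using C(2) by simp
    also have "\<dots> = (\<Sum>i\<in>I. \<Sum>j<d. \<phi> (b j) i * C j i)" by (subst sum.swap) (simp add: mult.commute)
    also have "\<dots> = of_nat (card I)" using C(1) by simp
    finally show ?thesis by (simp only: of_nat_eq_iff)
  qed
  have "(THE d. \<exists>b. is_basis M {..<d} b) = card I"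
    by (rule the_equality) (use ex un in blast)+
  moreover have "\<exists>(d::nat) b. is_basis M {..<d} b" using ex by blast
  ultimately show ?thesis unfolding vdim_def by (simp only: if_True)
qed

text \<open>The basis inside \<open>endo_trace\<close> is chosen by \<open>SOME\<close>. Cyclicity
  of the trace, tr(C A B) = tr(A B C) with B C = 1, makes the choice irrelevant.\<close>

lemma endo_trace_eq:
  assumes T: "\<And>x. x \<in> carrier M \<Longrightarrow> T x \<in> carrier M"
    and A: "\<And>x i. x \<in> carrier M \<Longrightarrow> i \<in> I \<Longrightarrow> \<phi> (T x) i = (\<Sum>i'\<in>I. A i i' * \<phi> x i')"
  shows "endo_trace M T = (\<Sum>i\<in>I. A i i)"
proof -
  define b where "b = (SOME b. is_basis M {..<vdim M} b)"
  obtain g where g: "bij_betw g {..<card I} I"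
    using ex_bij_betw_nat_finite[OF finite_index] by (auto simp: lessThan_atLeast0)
  have b: "is_basis M {..<vdim M} b"
    unfolding b_def vdim_eq
    by (rule someI[of "is_basis M {..<card I}", OF unit_basis(1)[OF g]])
  have bc: "b k \<in> carrier M" if "k < vdim M" for k
    using b that unfolding is_basis_def by blast
  obtain C where
    C: "\<And>v j. v \<in> carrier M \<Longrightarrow> j \<in> {..<vdim M} \<Longrightarrow> coords M {..<vdim M} b v j = (\<Sum>i\<in>I. C j i * \<phi> v i)"
      "\<And>i i'. i \<in> I \<Longrightarrow> i' \<in> I \<Longrightarrow> (\<Sum>j<vdim M. \<phi> (b j) i * C j i') = of_bool (i = i')"
    by (rule basis_matrix[OF b]) blast
  have "endo_trace M T = (\<Sum>k<vdim M. coords M {..<vdim M} b (T (b k)) k)"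
    unfolding endo_trace_def b_def by (simp add: Let_def)
  also have "\<dots> = (\<Sum>k<vdim M. \<Sum>i\<in>I. C k i * (\<Sum>i'\<in>I. A i i' * \<phi> (b k) i'))"
    by (intro sum.cong refl) (subst C(1), auto intro!: T bc sum.cong A)
  also have "\<dots> = (\<Sum>i\<in>I. \<Sum>k<vdim M. \<Sum>i'\<in>I. A i i' * (\<phi> (b k) i' * C k i))"
    by (subst sum.swap) (simp add: sum_distrib_left mult_ac)
  also have "\<dots> = (\<Sum>i\<in>I. \<Sum>i'\<in>I. A i i' * (\<Sum>k<vdim M. \<phi> (b k) i' * C k i))"
    by (intro sum.cong refl, subst sum.swap) (simp add: sum_distrib_left)
  also have "\<dots> = (\<Sum>i\<in>I. \<Sum>i'\<in>I. if i' = i then A i i' else 0)"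
    by (intro sum.cong refl) (simp add: C(2) of_bool_def)
  also have "\<dots> = (\<Sum>i\<in>I. A i i)" using finite_index by simp
  finally show ?thesis .
qed

end

section \<open>Free vector spaces and their quotients\<close>

abbreviation scl :: "complex \<Rightarrow> ('x \<Rightarrow>\<^sub>0 complex) \<Rightarrow> ('x \<Rightarrow>\<^sub>0 complex)"
  where "scl c \<equiv> Poly_Mapping.map ((*) c)"

lemma lookup_scl [simp]: "Poly_Mapping.lookup (scl c f) x = c * Poly_Mapping.lookup f x"
  by (auto simp: map.rep_eq when_def)

lemma scl_add: "scl c (f + g) = scl c f + scl c g"
  by (intro poly_mapping_eqI) (simp add: lookup_add algebra_simps)

lemma scl_uminus: "scl (-1) f = - f"
  by (intro poly_mapping_eqI) simp

lemma scl_zero_right [simp]: "scl c 0 = 0"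
  by (intro poly_mapping_eqI) simp

definition lin_subspace :: "('x \<Rightarrow>\<^sub>0 complex) set \<Rightarrow> bool"
  where "lin_subspace S \<longleftrightarrow> 0 \<in> S \<and> (\<forall>x\<in>S. \<forall>y\<in>S. x + y \<in> S) \<and> (\<forall>c. \<forall>x\<in>S. scl c x \<in> S)"

lemma lin_subspaceD:
  assumes "lin_subspace S"
  shows "0 \<in> S" "x \<in> S \<Longrightarrow> y \<in> S \<Longrightarrow> x + y \<in> S" "x \<in> S \<Longrightarrow> scl c x \<in> S"
    "x \<in> S \<Longrightarrow> - x \<in> S" "x \<in> S \<Longrightarrow> y \<in> S \<Longrightarrow> x - y \<in> S"
    "(\<And>a. a \<in> A \<Longrightarrow> g a \<in> S) \<Longrightarrow> sum g A \<in> S"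
proof -
  show 1: "0 \<in> S" and 2: "x \<in> S \<Longrightarrow> y \<in> S \<Longrightarrow> x + y \<in> S" and 3: "x \<in> S \<Longrightarrow> scl c x \<in> S" for x y c
    using assms by (auto simp: lin_subspace_def)
  show 4: "x \<in> S \<Longrightarrow> - x \<in> S" for x using 3[of x "-1"] by (simp add: scl_uminus)
  show "x \<in> S \<Longrightarrow> y \<in> S \<Longrightarrow> x - y \<in> S" using 2[of x "- y"] 4[of y] by simp
  show "(\<And>a. a \<in> A \<Longrightarrow> g a \<in> S) \<Longrightarrow> sum g A \<in> S"
    by (induction A rule: infinite_finite_induct) (auto intro: 1 2)
qed

lemma sum_single_lookup: "(\<Sum>x\<in>Poly_Mapping.keys f. Poly_Mapping.single x (Poly_Mapping.lookup f x)) = f"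
  by (intro poly_mapping_eqI)
     (simp add: lookup_sum lookup_single when_def if_distrib in_keys_iff cong: if_cong)

lemma scl_single_one: "scl c (Poly_Mapping.single x 1) = Poly_Mapping.single x c"
  by (intro poly_mapping_eqI) (simp add: lookup_single when_def)

lemma scl_single: "scl c (Poly_Mapping.single x d) = Poly_Mapping.single x (c * d)"
  by (intro poly_mapping_eqI) (simp add: lookup_single when_def)

lemma keys_scl_subset: "Poly_Mapping.keys (scl c f) \<subseteq> Poly_Mapping.keys f"
  by (auto simp: in_keys_iff)

lemma lin_subspace_keys: "lin_subspace {f. Poly_Mapping.keys f \<subseteq> B}"
  unfolding lin_subspace_def by (auto dest!: subsetD[OF keys_scl_subset] subsetD[OF keys_add])

text \<open>Works as an induction over monomials: a linear property is phrased as membership in a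
  subspace, and only generators remain to be checked.\<close>

lemma lin_subspace_keys_in:
  assumes "lin_subspace S" "\<And>x. x \<in> Poly_Mapping.keys f \<Longrightarrow> gen x \<in> S"
  shows "f \<in> S"
proof -
  have "(\<Sum>x\<in>Poly_Mapping.keys f. Poly_Mapping.single x (Poly_Mapping.lookup f x)) \<in> S"
  proof (rule lin_subspaceD(6)[OF assms(1)])
    fix x assume "x \<in> Poly_Mapping.keys f"
    from lin_subspaceD(3)[OF assms(1) assms(2)[OF this], of "Poly_Mapping.lookup f x"]
    show "Poly_Mapping.single x (Poly_Mapping.lookup f x) \<in> S" by (simp only: scl_single_one)
  qed
  then show ?thesis by (simp only: sum_single_lookup)
qed

section \<open>Linear extension from a basis\<close>

definition lext :: "('x \<Rightarrow> 'k \<Rightarrow> complex) \<Rightarrow> ('x \<Rightarrow>\<^sub>0 complex) \<Rightarrow> 'k \<Rightarrow> complex"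
  where "lext g f k = (\<Sum>x\<in>Poly_Mapping.keys f. Poly_Mapping.lookup f x * g x k)"

lemma lext_superset:
  "finite A \<Longrightarrow> Poly_Mapping.keys f \<subseteq> A \<Longrightarrow> lext g f k = (\<Sum>x\<in>A. Poly_Mapping.lookup f x * g x k)"
  unfolding lext_def by (intro sum.mono_neutral_left) (auto simp: in_keys_iff)

lemma lext_add: "lext g (f + f') k = lext g f k + lext g f' k"
proof -
  let ?A = "Poly_Mapping.keys f \<union> Poly_Mapping.keys f'"
  have "lext g (f + f') k = (\<Sum>x\<in>?A. Poly_Mapping.lookup (f + f') x * g x k)"
    by (intro lext_superset) (auto dest: subsetD[OF keys_add])
  also have "\<dots> = lext g f k + lext g f' k"
    by (simp add: lext_superset[of ?A] lookup_add algebra_simps sum.distrib)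
  finally show ?thesis .
qed

lemma lext_scl: "lext g (scl c f) k = c * lext g f k"
  using lext_superset[OF finite_keys keys_scl_subset[of c f], of g k]
  by (simp add: lext_def sum_distrib_left mult_ac)

lemma lext_zero [simp]: "lext g 0 k = 0"
  by (simp add: lext_def)

lemma lext_uminus: "lext g (- f) k = - lext g f k"
  using lext_scl[of g "-1" f k] by (simp add: scl_uminus)

lemma lext_diff: "lext g (f - f') k = lext g f k - lext g f' k"
  using lext_add[of g f "- f'" k] by (simp add: lext_uminus)

lemma lext_sum: "lext g (sum F A) k = (\<Sum>a\<in>A. lext g (F a) k)"
  by (induction A rule: infinite_finite_induct) (auto simp: lext_add)

lemma lext_single [simp]: "lext g (Poly_Mapping.single x c) k = c * g x k"
  by (simp add: lext_def)

lemma lext_unique: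
  assumes "\<And>f f'. T (f + f') = T f + T f'" "\<And>c f. T (scl c f) = c * T f"
    and "\<And>x. x \<in> Poly_Mapping.keys f \<Longrightarrow> T (gen x) = g x k"
  shows "T f = lext g f k"
proof -
  have T0: "T 0 = 0" using assms(2)[of 0 0] by simp
  have "T (\<Sum>x\<in>A. Poly_Mapping.single x (Poly_Mapping.lookup f x))
      = (\<Sum>x\<in>A. Poly_Mapping.lookup f x * g x k)" if "finite A" "A \<subseteq> Poly_Mapping.keys f" for A
    using that
  proof (induction A rule: finite_induct)
    case (insert x F)
    have "T (Poly_Mapping.single x (Poly_Mapping.lookup f x)) = Poly_Mapping.lookup f x * g x k"
      using assms(2)[of "Poly_Mapping.lookup f x" "gen x"] assms(3)[of x] insert.prems
      by (simp add: scl_single_one)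
    then show ?case using insert by (simp add: assms(1))
  qed (simp add: T0)
  from this[of "Poly_Mapping.keys f"] show ?thesis by (simp add: sum_single_lookup lext_def)
qed

definition pext :: "('x \<Rightarrow> ('y \<Rightarrow>\<^sub>0 complex)) \<Rightarrow> ('x \<Rightarrow>\<^sub>0 complex) \<Rightarrow> ('y \<Rightarrow>\<^sub>0 complex)"
  where "pext b f = (\<Sum>x\<in>Poly_Mapping.keys f. scl (Poly_Mapping.lookup f x) (b x))"

lemma lookup_pext: "Poly_Mapping.lookup (pext b f) k = lext (\<lambda>x. Poly_Mapping.lookup (b x)) f k"
  by (simp add: pext_def lookup_sum lext_def)

lemma pext_add: "pext b (f + f') = pext b f + pext b f'"
  by (intro poly_mapping_eqI) (simp add: lookup_pext lookup_add lext_add)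

lemma pext_scl: "pext b (scl c f) = scl c (pext b f)"
  by (intro poly_mapping_eqI) (simp add: lookup_pext lext_scl)

lemma pext_diff: "pext b (f - f') = pext b f - pext b f'"
  by (intro poly_mapping_eqI) (simp add: lookup_pext lookup_minus lext_diff)

lemma pext_single [simp]: "pext b (Poly_Mapping.single x c) = scl c (b x)"
  by (intro poly_mapping_eqI) (simp add: lookup_pext)

lemma pext_zero [simp]: "pext b 0 = 0"
  by (simp add: pext_def)

lemma pext_sum: "pext b (sum F A) = (\<Sum>a\<in>A. pext b (F a))"
  by (induction A rule: infinite_finite_induct) (auto simp: pext_add)

text \<open>The space \<open>M\<close> is presented as the quotient of the subspace \<open>S\<close> of a free vector space by
  its subspace \<open>N\<close>.\<close>

locale presented =
  fixes M :: "('g, 'a, 'm) grep_scheme" and S :: "('x \<Rightarrow>\<^sub>0 complex) set" and \<pi> :: "('x \<Rightarrow>\<^sub>0 complex) \<Rightarrow> 'a"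
    and N :: "('x \<Rightarrow>\<^sub>0 complex) set" and \<alpha> :: "'g \<Rightarrow> ('x \<Rightarrow>\<^sub>0 complex) \<Rightarrow> ('x \<Rightarrow>\<^sub>0 complex)" and W :: "'g set"
  assumes subspace: "lin_subspace S" and kernel_subspace: "lin_subspace N" and kernel_subset: "N \<subseteq> S"
    and carrier: "carrier M = \<pi> ` S"
    and eq_iff: "x \<in> S \<Longrightarrow> y \<in> S \<Longrightarrow> \<pi> x = \<pi> y \<longleftrightarrow> x - y \<in> N"
    and add: "x \<in> S \<Longrightarrow> y \<in> S \<Longrightarrow> \<pi> x \<oplus>\<^bsub>M\<^esub> \<pi> y = \<pi> (x + y)"
    and zero: "\<zero>\<^bsub>M\<^esub> = \<pi> 0"
    and smult: "x \<in> S \<Longrightarrow> c \<odot>\<^bsub>M\<^esub> \<pi> x = \<pi> (scl c x)"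
    and act: "w \<in> W \<Longrightarrow> x \<in> S \<Longrightarrow> act M w (\<pi> x) = \<pi> (\<alpha> w x)"
    and act_closed: "w \<in> W \<Longrightarrow> x \<in> S \<Longrightarrow> \<alpha> w x \<in> S"
    and act_diff: "w \<in> W \<Longrightarrow> x \<in> S \<Longrightarrow> y \<in> S \<Longrightarrow> \<alpha> w (x - y) = \<alpha> w x - \<alpha> w y"
begin

lemma coset_eq:
  assumes "lin_subspace N'" "N' \<subseteq> S" "N \<subseteq> N'" "x \<in> S"
  shows "\<pi> ` N' +>\<^bsub>M\<^esub> \<pi> x = \<pi> ` {y \<in> S. y - x \<in> N'}"
proof -
  have "\<pi> ` N' +>\<^bsub>M\<^esub> \<pi> x = (\<lambda>n. \<pi> (n + x)) ` N'"
    unfolding a_r_coset_def' using assms by (auto simp: add subset_iff)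
  also have "\<dots> = \<pi> ` {y \<in> S. y - x \<in> N'}"
  proof -
    have "\<pi> y \<in> (\<lambda>n. \<pi> (n + x)) ` N'" if "y - x \<in> N'" for y
      by (rule image_eqI[OF _ that]) simp
    then show ?thesis
      using assms subspace by (auto intro!: imageI intro: lin_subspaceD(2)[OF subspace])
  qed
  finally show ?thesis .
qed

text \<open>Operations of \<open>quot_grep\<close> are unions over representatives, and
  compatibility with \<open>N'\<close> makes all members of such a union equal. The quotient is
  again presented by the same \<open>S\<close>, only with a larger kernel, so the quotient L of a
  quotient is handled by polynomials and not by cosets of cosets.\<close>

lemma presented_quot:
  assumes N': "lin_subspace N'" "N' \<subseteq> S" "N \<subseteq> N'"
    and stable: "\<And>w x. w \<in> W \<Longrightarrow> x \<in> N' \<Longrightarrow> \<alpha> w x \<in> N'"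
  shows "presented (quot_grep M (\<pi> ` N')) S (\<lambda>x. \<pi> ` N' +>\<^bsub>M\<^esub> \<pi> x) N' \<alpha> W"
proof -
  note sS = lin_subspaceD[OF subspace] and sN = lin_subspaceD[OF N'(1)]
  define q where "q x = \<pi> ` N' +>\<^bsub>M\<^esub> \<pi> x" for x
  have q: "q x = \<pi> ` {y \<in> S. y - x \<in> N'}" if "x \<in> S" for x
    using coset_eq[OF N' that] by (simp add: q_def)
  have mem: "z \<in> q x \<longleftrightarrow> (\<exists>y\<in>S. z = \<pi> y \<and> y - x \<in> N')" if "x \<in> S" for x z
    unfolding q[OF that] by auto
  have qeq: "q x = q y \<longleftrightarrow> x - y \<in> N'" if xy: "x \<in> S" "y \<in> S" for x y
  proof
    assume "q x = q y"
    moreover have "\<pi> x \<in> q x" using xy sN(1) by (auto simp: mem)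
    ultimately obtain z where "z \<in> S" "\<pi> x = \<pi> z" "z - y \<in> N'"
      using mem[OF xy(2), of "\<pi> x"] by auto
    then show "x - y \<in> N'" using eq_iff[of x z] xy N'(3) sN(2)[of "x - z" "z - y"] by auto
  next
    assume *: "x - y \<in> N'"
    have "z - x \<in> N' \<longleftrightarrow> z - y \<in> N'" for z
      using sN(2)[OF _ *, of "z - x"] sN(5)[OF _ *, of "z - y"] by auto
    then show "q x = q y" using xy by (auto simp: q)
  qed
  have N'q: "\<pi> ` N' = q 0" using N' by (auto simp: q[OF sS(1)])
  have ne: "q x \<noteq> {}" if "x \<in> S" for x using that sN(1) by (auto simp: q)
  \<comment> \<open>Cosets are nonempty, so a union of equal sets over a coset collapses to that
    set.\<close>
  have un: "(\<Union>z\<in>q x. q' z) = q y"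
    if "x \<in> S" "y \<in> S" "\<And>x'. x' \<in> S \<Longrightarrow> x' - x \<in> N' \<Longrightarrow> q' (\<pi> x') = q y" for x y q'
  proof -
    note xs = that(1)
    have "(\<Union>z\<in>q x. q' z) = (\<Union>z\<in>q x. q y)"
    proof (intro SUP_cong refl)
      fix z assume "z \<in> q x"
      then obtain x' where "x' \<in> S" "z = \<pi> x'" "x' - x \<in> N'" using mem xs by blast
      then show "q' z = q y" using that(3) by simp
    qed
    then show ?thesis using ne[OF that(1)] by simp
  qed
  show ?thesis unfolding q_def[symmetric]
  proof
    show "carrier (quot_grep M (\<pi> ` N')) = q ` S"
      unfolding quot_grep_def FactRing_def A_RCOSETS_def' carrier q_def by auto
    show "q x = q y \<longleftrightarrow> x - y \<in> N'" if "x \<in> S" "y \<in> S" for x y by (rule qeq[OF that])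
    show "q x \<oplus>\<^bsub>quot_grep M (\<pi> ` N')\<^esub> q y = q (x + y)" if xy: "x \<in> S" "y \<in> S" for x y
    proof -
      have "q x \<oplus>\<^bsub>quot_grep M (\<pi> ` N')\<^esub> q y = (\<Union>h\<in>q x. \<Union>k\<in>q y. {h \<oplus>\<^bsub>M\<^esub> k})"
        by (simp add: quot_grep_def FactRing_def set_add_def')
      also have "\<dots> = q (x + y)"
      proof (intro equalityI subsetI)
        fix z assume "z \<in> (\<Union>h\<in>q x. \<Union>k\<in>q y. {h \<oplus>\<^bsub>M\<^esub> k})"
        then obtain x' y' where xy': "x' \<in> S" "y' \<in> S" "x' - x \<in> N'" "y' - y \<in> N'" "z = \<pi> (x' + y')"
          using xy by (auto simp: mem add)
        then show "z \<in> q (x + y)"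
          using xy sS(2) sN(2)[OF xy'(3,4)] by (auto simp: mem add_diff_add intro!: bexI[of _ "x' + y'"])
      next
        fix z assume "z \<in> q (x + y)"
        then obtain u where u: "u \<in> S" "z = \<pi> u" "u - (x + y) \<in> N'" using xy sS(2) by (auto simp: mem)
        \<comment> \<open>A representative \<open>u\<close> of the coset of \<open>x + y\<close> is
          split as \<open>u - y\<close> plus \<open>y\<close>, one summand in each of the two
          cosets.\<close>
        have uy: "u - y \<in> S" using u xy sS(5) by auto
        have "u - y - x \<in> N'" using u(3) by (simp add: diff_diff_eq add.commute)
        then have "\<pi> (u - y) \<in> q x" using xy uy mem by blast
        moreover have "\<pi> y \<in> q y" using xy sN(1) by (auto simp: mem)
        moreover have "z = \<pi> (u - y) \<oplus>\<^bsub>M\<^esub> \<pi> y" using u uy xy by (simp add: add)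
        ultimately show "z \<in> (\<Union>h\<in>q x. \<Union>k\<in>q y. {h \<oplus>\<^bsub>M\<^esub> k})" by blast
      qed
      finally show ?thesis .
    qed
    show "\<zero>\<^bsub>quot_grep M (\<pi> ` N')\<^esub> = q 0" by (simp add: quot_grep_def FactRing_def N'q)
    show "c \<odot>\<^bsub>quot_grep M (\<pi> ` N')\<^esub> q x = q (scl c x)" if x: "x \<in> S" for c x
    proof -
      have "c \<odot>\<^bsub>quot_grep M (\<pi> ` N')\<^esub> q x = (\<Union>z\<in>q x. \<pi> ` N' +>\<^bsub>M\<^esub> (c \<odot>\<^bsub>M\<^esub> z))"
        by (simp add: quot_grep_def)
      also have "\<dots> = q (scl c x)"
      proof (rule un[OF x sS(3)[OF x]])
        fix x' assume x': "x' \<in> S" "x' - x \<in> N'"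
        have "scl c x' - scl c x = scl c (x' - x)"
          by (intro poly_mapping_eqI) (simp add: lookup_minus algebra_simps)
        then show "\<pi> ` N' +>\<^bsub>M\<^esub> (c \<odot>\<^bsub>M\<^esub> \<pi> x') = q (scl c x)"
          using x x' sS(3) sN(3) by (simp add: smult qeq flip: q_def)
      qed
      finally show ?thesis .
    qed
    show "act (quot_grep M (\<pi> ` N')) w (q x) = q (\<alpha> w x)" if w: "w \<in> W" and x: "x \<in> S" for w x
    proof -
      have "act (quot_grep M (\<pi> ` N')) w (q x) = (\<Union>z\<in>q x. \<pi> ` N' +>\<^bsub>M\<^esub> (act M w z))"
        by (simp add: quot_grep_def)
      also have "\<dots> = q (\<alpha> w x)"
      proof (rule un[OF x act_closed[OF w x]])
        fix x' assume x': "x' \<in> S" "x' - x \<in> N'"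
        have "\<alpha> w x' - \<alpha> w x \<in> N'" using stable[OF w x'(2)] act_diff[OF w x'(1) x] by simp
        then show "\<pi> ` N' +>\<^bsub>M\<^esub> (act M w (\<pi> x')) = q (\<alpha> w x)"
          using x x' w by (simp add: act act_closed qeq flip: q_def)
      qed
      finally show ?thesis .
    qed
  next
    show "lin_subspace S" "lin_subspace N'" "N' \<subseteq> S" by (rule subspace N')+
    show "\<alpha> w x \<in> S" if "w \<in> W" "x \<in> S" for w x using that by (rule act_closed)
    show "\<alpha> w (x - y) = \<alpha> w x - \<alpha> w y" if "w \<in> W" "x \<in> S" "y \<in> S" for w x y
      using that by (rule act_diff)
  qed
qed

definition lift_coord :: "(('x \<Rightarrow>\<^sub>0 complex) \<Rightarrow> 'i \<Rightarrow> complex) \<Rightarrow> 'a \<Rightarrow> 'i \<Rightarrow> complex"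
  where "lift_coord \<Psi> z = \<Psi> (SOME x. x \<in> S \<and> \<pi> x = z)"

text \<open>Two representatives of one element differ by a member of \<open>N\<close>, where
  \<open>\<Psi>\<close> vanishes, so the choice by \<open>SOME\<close> does not matter.\<close>

lemma lift_coord_eq:
  assumes "\<And>x y. \<Psi> (x - y) = (\<lambda>i. \<Psi> x i - \<Psi> y i)" and "N \<subseteq> {x \<in> S. \<forall>i. \<Psi> x i = 0}" and x: "x \<in> S"
  shows "lift_coord \<Psi> (\<pi> x) = \<Psi> x"
proof -
  define y where "y = (SOME y. y \<in> S \<and> \<pi> y = \<pi> x)"
  have y: "y \<in> S \<and> \<pi> y = \<pi> x" unfolding y_def by (rule someI[of _ x]) (use x in auto)
  then have "y - x \<in> N" using eq_iff x by blast
  then have "\<forall>i. \<Psi> (y - x) i = 0" using assms(2) by blast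
  then show ?thesis unfolding lift_coord_def y_def[symmetric] assms(1) by (simp add: fun_eq_iff)
qed

lemma coordinatized_part:
  fixes M' :: "(complex, 'a, 'l) module_scheme"
  assumes lin: "\<And>x y. \<Psi> (x + y) = (\<lambda>i. \<Psi> x i + \<Psi> y i)" "\<And>c x. \<Psi> (scl c x) = (\<lambda>i. c * \<Psi> x i)"
    and N: "N = {x \<in> S. \<forall>i. \<Psi> x i = 0}"
    and S': "lin_subspace S'" "S' \<subseteq> S" "\<Psi> ` S' = supported I" "finite I"
    and M': "carrier M' = \<pi> ` S'" "add M' = add M" "smult M' = smult M" "zero M' = zero M"
  shows "coordinatized M' I (lift_coord \<Psi>)"
proof -
  have um: "\<Psi> (- x) = (\<lambda>i. - \<Psi> x i)" for x using lin(2)[of "-1" x] by (simp add: scl_uminus)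
  have "\<Psi> (x - y) = (\<lambda>i. \<Psi> x i - \<Psi> y i)" for x y using lin(1)[of x "- y"] by (simp add: um)
  note diff = this
  have lc: "lift_coord \<Psi> (\<pi> x) = \<Psi> x" if "x \<in> S" for x
    by (rule lift_coord_eq[where \<Psi> = \<Psi>, OF diff _ that]) (use N in auto)
  note s = lin_subspaceD[OF S'(1)]
  have z: "\<Psi> 0 = (\<lambda>i. 0)" using lin(2)[of 0 0] by simp
  show ?thesis
  proof
    show "finite I" by fact
    show "bij_betw (lift_coord \<Psi>) (carrier M') (supported I)"
      unfolding bij_betw_def
    proof (intro conjI inj_onI)
      show "lift_coord \<Psi> ` carrier M' = supported I"
        using S'(2,3) by (auto simp: M' image_image lc subset_iff cong: image_cong_simp)
      fix a b assume "a \<in> carrier M'" "b \<in> carrier M'" and eq: "lift_coord \<Psi> a = lift_coord \<Psi> b"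
      then obtain x y where xy: "x \<in> S'" "y \<in> S'" "a = \<pi> x" "b = \<pi> y" by (auto simp: M')
      then have "\<Psi> x = \<Psi> y" using eq lc S'(2) by (metis subsetD)
      then have "x - y \<in> N" using s(5) xy S'(2) by (auto simp: N diff)
      then show "a = b" using eq_iff xy S'(2) by auto
    qed
    show "x \<oplus>\<^bsub>M'\<^esub> y \<in> carrier M'" "lift_coord \<Psi> (x \<oplus>\<^bsub>M'\<^esub> y) = (\<lambda>i. lift_coord \<Psi> x i + lift_coord \<Psi> y i)"
      if "x \<in> carrier M'" "y \<in> carrier M'" for x y
      using that S'(2) s(2) by (auto simp: M' add subset_iff lc lin lin_subspaceD[OF subspace])
    show "c \<odot>\<^bsub>M'\<^esub> x \<in> carrier M'" "lift_coord \<Psi> (c \<odot>\<^bsub>M'\<^esub> x) = (\<lambda>i. c * lift_coord \<Psi> x i)"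
      if "x \<in> carrier M'" for x c
      using that S'(2) s(3) by (auto simp: M' smult subset_iff lc lin lin_subspaceD[OF subspace])
    show "\<zero>\<^bsub>M'\<^esub> \<in> carrier M'" "lift_coord \<Psi> \<zero>\<^bsub>M'\<^esub> = (\<lambda>_. 0)"
      using s(1) S'(2) by (auto simp: M' zero lc z)
  qed
qed

end

lemma gr_quot_grep: "gr (quot_grep M N) d = (\<lambda>x. N +>\<^bsub>M\<^esub> x) ` gr M d"
  by (simp add: quot_grep_def)

section \<open>Presented algebras and images of ideals\<close>

locale presented_alg = presented M S \<pi> N \<alpha> W
  for M :: "('g, 'a, 'm) grep_scheme" and S :: "('x::comm_monoid_add \<Rightarrow>\<^sub>0 complex) set" and \<pi> N \<alpha> W +
  assumes one: "\<one>\<^bsub>M\<^esub> = \<pi> 1" and one_closed: "1 \<in> S"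
    and mult: "x \<in> S \<Longrightarrow> y \<in> S \<Longrightarrow> \<pi> x \<otimes>\<^bsub>M\<^esub> \<pi> y = \<pi> (x * y)"
    and mult_closed: "x \<in> S \<Longrightarrow> y \<in> S \<Longrightarrow> x * y \<in> S"
begin

lemma presented_alg_quot:
  assumes N': "lin_subspace N'" "N' \<subseteq> S" "N \<subseteq> N'"
    and stable: "\<And>w x. w \<in> W \<Longrightarrow> x \<in> N' \<Longrightarrow> \<alpha> w x \<in> N'"
    and ideal: "\<And>x y. x \<in> N' \<Longrightarrow> y \<in> S \<Longrightarrow> x * y \<in> N'"
  shows "presented_alg (quot_grep M (\<pi> ` N')) S (\<lambda>x. \<pi> ` N' +>\<^bsub>M\<^esub> \<pi> x) N' \<alpha> W"
proof -
  define q where "q x = \<pi> ` N' +>\<^bsub>M\<^esub> \<pi> x" for x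
  note sS = lin_subspaceD[OF subspace] and sN = lin_subspaceD[OF N'(1)]
  interpret Q: presented "quot_grep M (\<pi> ` N')" S q N' \<alpha> W
    using presented_quot[OF assms(1-4)] by (simp add: q_def[abs_def])
  have mem: "z \<in> q x \<longleftrightarrow> (\<exists>y\<in>S. z = \<pi> y \<and> y - x \<in> N')" if "x \<in> S" for x z
    unfolding q_def coset_eq[OF N' that] by auto
  have "q x \<otimes>\<^bsub>quot_grep M (\<pi> ` N')\<^esub> q y = q (x * y)" if xy: "x \<in> S" "y \<in> S" for x y
  proof -
    have "q x \<otimes>\<^bsub>quot_grep M (\<pi> ` N')\<^esub> q y = (\<Union>a\<in>q x. \<Union>b\<in>q y. \<pi> ` N' +>\<^bsub>M\<^esub> (a \<otimes>\<^bsub>M\<^esub> b))"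
      by (simp add: quot_grep_def FactRing_def rcoset_mult_def)
    also have "\<dots> = (\<Union>a\<in>q x. \<Union>b\<in>q y. q (x * y))"
    proof (intro SUP_cong refl)
      fix a b assume "a \<in> q x" "b \<in> q y"
      then obtain x' y' where *: "x' \<in> S" "y' \<in> S" "a = \<pi> x'" "b = \<pi> y'" "x' - x \<in> N'" "y' - y \<in> N'"
        using xy by (auto simp: mem)
      have "x' * y' - x * y = (x' - x) * y' + (y' - y) * x" by (simp add: algebra_simps)
      then have "x' * y' - x * y \<in> N'" using * xy sN(2) ideal by simp
      then show "\<pi> ` N' +>\<^bsub>M\<^esub> (a \<otimes>\<^bsub>M\<^esub> b) = q (x * y)"
        using * xy by (simp add: mult mult_closed Q.eq_iff flip: q_def)
    qed
    also have "\<dots> = q (x * y)"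
    proof -
      have "\<pi> x \<in> q x" "\<pi> y \<in> q y" using xy sN(1) by (auto simp: mem)
      then show ?thesis by blast
    qed
    finally show ?thesis .
  qed
  then show ?thesis unfolding q_def[symmetric]
    by unfold_locales (auto simp: quot_grep_def FactRing_def q_def one one_closed mult_closed)
qed

lemma ring: "ring M"
proof -
  note sS = lin_subspaceD[OF subspace]
  have closed: "x \<oplus>\<^bsub>M\<^esub> y \<in> carrier M" "x \<otimes>\<^bsub>M\<^esub> y \<in> carrier M"
    if "x \<in> carrier M" "y \<in> carrier M" for x y
    using that sS(2) mult_closed by (auto simp: carrier add mult)
  have units: "\<zero>\<^bsub>M\<^esub> \<in> carrier M" "\<one>\<^bsub>M\<^esub> \<in> carrier M"
    using sS(1) one_closed by (auto simp: carrier zero one)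
  have inverse: "\<exists>y\<in>carrier M. y \<oplus>\<^bsub>M\<^esub> x = \<zero>\<^bsub>M\<^esub>" if "x \<in> carrier M" for x
  proof -
    from that obtain y where y: "y \<in> S" "x = \<pi> y" by (auto simp: carrier)
    then have "\<pi> (- y) \<oplus>\<^bsub>M\<^esub> x = \<zero>\<^bsub>M\<^esub>" using sS(4) by (simp add: add zero)
    then show ?thesis using y sS(4) by (auto simp: carrier)
  qed
  show ?thesis
    by (intro ringI abelian_groupI monoidI closed units inverse)
       (auto simp: carrier add zero one mult one_closed mult_closed sS(1,2) algebra_simps)
qed

lemma ideal_image:
  assumes N': "lin_subspace N'" "N' \<subseteq> S" and ideal: "\<And>x y. x \<in> N' \<Longrightarrow> y \<in> S \<Longrightarrow> x * y \<in> N'"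
  shows "ideal (\<pi> ` N') M"
proof (rule idealI[OF ring])
  interpret R: ring M by (rule ring)
  note s = lin_subspaceD[OF N'(1)]
  show "subgroup (\<pi> ` N') (add_monoid M)"
  proof (rule R.add.subgroupI)
    fix a assume "a \<in> \<pi> ` N'"
    then obtain x where x: "x \<in> N'" "a = \<pi> x" by blast
    have xX: "x \<in> S" "- x \<in> S" using x N'(2) s(4) by auto
    have "\<pi> (- x) \<oplus>\<^bsub>M\<^esub> \<pi> x = \<zero>\<^bsub>M\<^esub>" using xX by (simp add: add zero)
    then have "\<ominus>\<^bsub>M\<^esub> \<pi> x = \<pi> (- x)"
      using xX by (intro R.minus_equality) (auto simp: carrier)
    then show "\<ominus>\<^bsub>M\<^esub> a \<in> \<pi> ` N'" using x s(4) by simp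
  next
    show "\<pi> ` N' \<subseteq> carrier M" using N'(2) by (auto simp: carrier)
    show "\<pi> ` N' \<noteq> {}" using s(1) by auto
    fix a b assume "a \<in> \<pi> ` N'" "b \<in> \<pi> ` N'"
    then obtain x y where "x \<in> N'" "y \<in> N'" "a = \<pi> x" "b = \<pi> y" by blast
    then show "a \<oplus>\<^bsub>M\<^esub> b \<in> \<pi> ` N'" using s(2)[of x y] N'(2) by (simp add: add subset_iff)
  qed
  fix a x assume "a \<in> \<pi> ` N'" "x \<in> carrier M"
  then obtain y z where *: "y \<in> N'" "z \<in> S" "a = \<pi> y" "x = \<pi> z" by (auto simp: carrier)
  have "y * z \<in> N'" "z * y \<in> N'" using ideal[OF *(1,2)] by (auto simp: mult.commute)
  then show "a \<otimes>\<^bsub>M\<^esub> x \<in> \<pi> ` N'" "x \<otimes>\<^bsub>M\<^esub> a \<in> \<pi> ` N'" using * N' by (auto simp: mult subset_iff)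
qed

end

section \<open>Monomials and the action of monomial matrices\<close>

abbreviation finv :: "('a \<Rightarrow> 'a) \<Rightarrow> 'a \<Rightarrow> 'a"
  where "finv \<equiv> inv_into UNIV"

type_synonym 'n bimon = "('n + 'n) \<Rightarrow>\<^sub>0 nat"

definition mon :: "('n::finite \<Rightarrow> nat) \<Rightarrow> ('n \<Rightarrow> nat) \<Rightarrow> 'n bimon"
  where "mon a b = Abs_poly_mapping (case_sum a b)"

abbreviation xe :: "'n bimon \<Rightarrow> 'n \<Rightarrow> nat" where "xe m i \<equiv> Poly_Mapping.lookup m (Inl i)"
abbreviation ye :: "'n bimon \<Rightarrow> 'n \<Rightarrow> nat" where "ye m i \<equiv> Poly_Mapping.lookup m (Inr i)"

lemma lookup_mon [simp]: "Poly_Mapping.lookup (mon a b) v = case_sum a b v"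
  by (simp add: mon_def)

lemma bimon_eqI: "(\<And>i. xe m i = xe m' i) \<Longrightarrow> (\<And>i. ye m i = ye m' i) \<Longrightarrow> m = m'"
  by (metis poly_mapping_eqI sumE)

lemma mon_xe_ye [simp]: "mon (xe m) (ye m) = m"
  by (rule bimon_eqI) simp_all

lemma mon_add: "mon a b + mon a' b' = mon (\<lambda>i. a i + a' i) (\<lambda>i. b i + b' i)"
  by (rule bimon_eqI) (simp_all add: lookup_add)

lemma mon_zero: "mon (\<lambda>_. 0) (\<lambda>_. 0) = 0"
  by (rule bimon_eqI) simp_all

definition tdeg :: "'n::finite bimon \<Rightarrow> nat"
  where "tdeg m = (\<Sum>i\<in>UNIV. xe m i) + (\<Sum>i\<in>UNIV. ye m i)"

lemma tdeg_add: "tdeg (m + m') = tdeg m + tdeg m'"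
  by (simp add: tdeg_def lookup_add sum.distrib)

lemma tdeg_eq_0_iff: "tdeg m = 0 \<longleftrightarrow> m = 0"
proof
  assume "tdeg m = 0"
  then show "m = 0" by (intro bimon_eqI) (simp_all add: tdeg_def)
qed (simp add: tdeg_def)

lemma Const_mult: "Const c * f = scl c f"
  by (simp add: Const_def mult_map_scale_conv_mult)

lemma scl_mult_left: "scl c f * g = scl c (f * g)"
  by (simp add: mult_map_scale_conv_mult mult.assoc)

lemma scl_mult_right: "f * scl c g = scl c (f * (g :: 'n bipoly))"
  by (simp add: mult_map_scale_conv_mult mult.left_commute)

lemma gen_mult: "gen m * gen m' = gen (m + m')"
  by (simp add: mult_single)

lemma Var_mult_gen: "Var v * gen m = gen (Poly_Mapping.single v 1 + m)"
  by (simp add: Var_def mult_single)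

lemma Var_power: "Var v ^ k = gen (Poly_Mapping.single v k)"
  by (induction k) (simp_all add: Var_def mult_single flip: single_add)

lemma single_Inl: "Poly_Mapping.single (Inl i) k = mon (\<lambda>j. if j = i then k else 0) (\<lambda>_. 0)"
  by (rule bimon_eqI) (simp_all add: lookup_single when_def)

lemma prod_gen: "(\<Prod>a\<in>A. Poly_Mapping.single (f a) (c a)) = Poly_Mapping.single (\<Sum>a\<in>A. f a) (\<Prod>a\<in>A. c a :: complex)"
  by (induction A rule: infinite_finite_induct) (simp_all add: mult_single)

text \<open>The entries are inverted so that \<open>w x\<^sub>i = \<eta>\<^sub>i x\<^bsub>\<sigma> i\<^esub>\<close>.\<close>

definition wmat :: "('n \<Rightarrow> 'n) \<Rightarrow> ('n \<Rightarrow> complex) \<Rightarrow> complex^'n^'n"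
  where "wmat \<sigma> \<eta> = (\<chi> i j. if i = \<sigma> j then inverse (\<eta> j) else 0)"

text \<open>The conditions of \<open>G_group\<close> are imposed on the inverted entries; they are
  stable under inversion.\<close>

definition G_data :: "nat \<Rightarrow> nat \<Rightarrow> ('n::finite \<Rightarrow> 'n) \<Rightarrow> ('n \<Rightarrow> complex) \<Rightarrow> bool"
  where "G_data r p \<sigma> \<eta> \<longleftrightarrow> \<sigma> permutes UNIV \<and> (\<forall>i. \<eta> i ^ r = 1) \<and> (\<Prod>i\<in>UNIV. \<eta> i) ^ (r div p) = 1"

lemma G_data_nonzero: "G_data r p \<sigma> \<eta> \<Longrightarrow> r > 0 \<Longrightarrow> \<eta> i \<noteq> 0"
  unfolding G_data_def by (metis power_0_left zero_neq_one not_gr_zero)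

lemma inverse_prod: "(\<Prod>j\<in>A. inverse (f j :: complex)) = inverse (\<Prod>j\<in>A. f j)"
  using prod_inversef[of f A] by (simp add: o_def)

lemma wmat_mem:
  fixes \<sigma> :: "'n::finite \<Rightarrow> 'n"
  assumes "G_data r p \<sigma> \<eta>" "r > 0"
  shows "wmat \<sigma> \<eta> \<in> G_group r p"
proof -
  have nz: "\<eta> i \<noteq> 0" for i using G_data_nonzero[OF assms] .
  have \<sigma>: "\<sigma> permutes UNIV" using assms by (simp add: G_data_def)
  have e: "wmat \<sigma> \<eta> $ i $ j \<noteq> 0 \<longleftrightarrow> i = \<sigma> j" for i j using nz by (simp add: wmat_def)
  have "monomial_matrix (wmat \<sigma> \<eta>)"
    unfolding monomial_matrix_def e using \<sigma> by (metis permutes_univ)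
  moreover have "\<forall>i j. wmat \<sigma> \<eta> $ i $ j \<noteq> 0 \<longrightarrow> (wmat \<sigma> \<eta> $ i $ j) ^ r = 1"
    unfolding e using assms by (simp add: wmat_def G_data_def power_inverse)
  moreover have "(\<Prod>(i, j)\<in>{(i, j). wmat \<sigma> \<eta> $ i $ j \<noteq> 0}. wmat \<sigma> \<eta> $ i $ j) = (\<Prod>j\<in>UNIV. inverse (\<eta> j))"
    unfolding e
    by (rule prod.reindex_bij_witness[of _ "\<lambda>j. (\<sigma> j, j)" snd]) (auto simp: wmat_def)
  ultimately show ?thesis
    using assms by (simp add: G_group_def G_data_def power_inverse inverse_prod)
qed

lemma G_groupE:
  fixes w :: "complex^'n::finite^'n"
  assumes "w \<in> G_group r p"
  obtains \<sigma> \<eta> where "G_data r p \<sigma> \<eta>" "w = wmat \<sigma> \<eta>"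
proof -
  have m: "\<forall>i. \<exists>!j. w $ i $ j \<noteq> 0" "\<forall>j. \<exists>!i. w $ i $ j \<noteq> 0"
    and pw: "\<And>i j. w $ i $ j \<noteq> 0 \<Longrightarrow> (w $ i $ j) ^ r = 1"
    and pr: "(\<Prod>(i, j)\<in>{(i, j). w $ i $ j \<noteq> 0}. w $ i $ j) ^ (r div p) = 1"
    using assms by (auto simp: G_group_def monomial_matrix_def)
  define \<sigma> where "\<sigma> j = (THE i. w $ i $ j \<noteq> 0)" for j
  have \<sigma>: "w $ i $ j \<noteq> 0 \<longleftrightarrow> i = \<sigma> j" for i j
  proof -
    have "w $ \<sigma> j $ j \<noteq> 0"
      unfolding \<sigma>_def by (rule theI'[of "\<lambda>i. w $ i $ j \<noteq> 0"]) (use m(2) in blast)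
    then show ?thesis using m(2) by blast
  qed
  have perm: "\<sigma> permutes UNIV" using m(1) unfolding permutes_univ \<sigma> by (simp add: eq_commute)
  define \<eta> where "\<eta> j = inverse (w $ \<sigma> j $ j)" for j
  have "w $ i $ j = wmat \<sigma> \<eta> $ i $ j" for i j
    using \<sigma>[of i j] by (cases "i = \<sigma> j") (auto simp: wmat_def \<eta>_def)
  then have "w = wmat \<sigma> \<eta>" by (simp add: vec_eq_iff)
  moreover have "\<eta> j ^ r = 1" for j using pw[of "\<sigma> j" j] \<sigma>[of "\<sigma> j" j] by (simp add: \<eta>_def power_inverse)
  moreover have "(\<Prod>(i, j)\<in>{(i, j). w $ i $ j \<noteq> 0}. w $ i $ j) = (\<Prod>j\<in>UNIV. inverse (\<eta> j))"
    unfolding \<sigma>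
    by (rule prod.reindex_bij_witness[of _ "\<lambda>j. (\<sigma> j, j)" snd]) (auto simp: \<eta>_def)
  ultimately show thesis
    using that[of \<sigma> \<eta>] pr perm by (simp add: G_data_def power_inverse inverse_prod)
qed

lemma matrix_inv_wmat:
  fixes \<sigma> :: "'n::finite \<Rightarrow> 'n"
  assumes \<sigma>: "\<sigma> permutes UNIV" and nz: "\<And>i. \<eta> i \<noteq> 0"
  shows "matrix_inv (wmat \<sigma> \<eta>) = (\<chi> i j. if j = \<sigma> i then \<eta> i else 0)" (is "_ = ?B")
proof -
  have inj: "\<sigma> i = \<sigma> j \<longleftrightarrow> i = j" for i j using permutes_inj[OF \<sigma>] by (auto simp: inj_def)
  have "(?B ** wmat \<sigma> \<eta>) $ i $ j = mat 1 $ i $ j" for i j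
  proof -
    have "(?B ** wmat \<sigma> \<eta>) $ i $ j = (\<Sum>k\<in>UNIV. if k = \<sigma> i then \<eta> i * (if k = \<sigma> j then inverse (\<eta> j) else 0) else 0)"
      unfolding matrix_matrix_mult_def wmat_def by (simp add: if_distrib[of "\<lambda>x. x * _"] cong: if_cong)
    then show ?thesis using nz by (simp add: mat_def inj)
  qed
  then have BA: "?B ** wmat \<sigma> \<eta> = mat 1" by (simp add: vec_eq_iff)
  then have AB: "wmat \<sigma> \<eta> ** ?B = mat 1" by (simp add: matrix_left_right_inverse)
  \<comment> \<open>\<open>matrix_inv\<close> is a choice, so it is first shown to be some inverse
    and then identified with \<open>?B\<close> by associativity.\<close>
  have "wmat \<sigma> \<eta> ** matrix_inv (wmat \<sigma> \<eta>) = mat 1 \<and> matrix_inv (wmat \<sigma> \<eta>) ** wmat \<sigma> \<eta> = mat 1"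
    unfolding matrix_inv_def by (rule someI[of _ ?B]) (use AB BA in blast)
  then have L: "matrix_inv (wmat \<sigma> \<eta>) ** wmat \<sigma> \<eta> = mat 1" ..
  have "matrix_inv (wmat \<sigma> \<eta>) = matrix_inv (wmat \<sigma> \<eta>) ** (wmat \<sigma> \<eta> ** ?B)" by (simp add: AB)
  also have "\<dots> = ?B" by (simp add: matrix_mul_assoc L)
  finally show ?thesis .
qed

text \<open>The scalar that a monomial acquires under \<open>wmat \<sigma> \<eta>\<close>. The
  y-part carries inverses because the spaces spanned by the x_i and by the y_i are
  contragredient.\<close>

definition pcoef :: "('n::finite \<Rightarrow> complex) \<Rightarrow> 'n bimon \<Rightarrow> complex"
  where "pcoef \<eta> m = (\<Prod>i\<in>UNIV. \<eta> i ^ xe m i * inverse (\<eta> i) ^ ye m i)"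

definition pperm :: "('n::finite \<Rightarrow> 'n) \<Rightarrow> 'n bimon \<Rightarrow> 'n bimon"
  where "pperm \<sigma> m = mon (\<lambda>i. xe m (finv \<sigma> i)) (\<lambda>i. ye m (finv \<sigma> i))"

definition pact :: "('n::finite \<Rightarrow> 'n) \<Rightarrow> ('n \<Rightarrow> complex) \<Rightarrow> 'n bipoly \<Rightarrow> 'n bipoly"
  where "pact \<sigma> \<eta> = pext (\<lambda>m. Poly_Mapping.single (pperm \<sigma> m) (pcoef \<eta> m))"

lemma pcoef_add: "pcoef \<eta> (m + m') = pcoef \<eta> m * pcoef \<eta> m'"
  by (simp add: pcoef_def lookup_add power_add mult_ac flip: prod.distrib)

lemma pperm_add: "pperm \<sigma> (m + m') = pperm \<sigma> m + pperm \<sigma> m'"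
  by (simp add: pperm_def mon_add lookup_add)

lemma pact_gen [simp]: "pact \<sigma> \<eta> (gen m) = Poly_Mapping.single (pperm \<sigma> m) (pcoef \<eta> m)"
  by (simp add: pact_def scl_single)

lemma pact_add: "pact \<sigma> \<eta> (f + g) = pact \<sigma> \<eta> f + pact \<sigma> \<eta> g"
  by (simp add: pact_def pext_add)

lemma pact_scl: "pact \<sigma> \<eta> (scl c f) = scl c (pact \<sigma> \<eta> f)"
  by (simp add: pact_def pext_scl)

lemma pact_diff: "pact \<sigma> \<eta> (f - g) = pact \<sigma> \<eta> f - pact \<sigma> \<eta> g"
  by (simp add: pact_def pext_diff)

lemma pact_zero [simp]: "pact \<sigma> \<eta> 0 = 0"
  by (simp add: pact_def)

lemma pact_sum: "pact \<sigma> \<eta> (sum f A) = (\<Sum>a\<in>A. pact \<sigma> \<eta> (f a))"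
  by (simp add: pact_def pext_sum)

lemma linear_eqI:
  assumes "\<And>f g. T (f + g) = T f + T g" "\<And>c f. T (scl c f) = scl c (T f)"
    and "\<And>f g. T' (f + g) = T' f + T' g" "\<And>c f. T' (scl c f) = scl c (T' f)"
    and "\<And>x. x \<in> Poly_Mapping.keys f \<Longrightarrow> T (gen x) = T' (gen x)"
  shows "T f = T' f"
proof -
  have T0: "T 0 = 0" using assms(2)[of 0 0] by (simp add: poly_mapping_eq_iff fun_eq_iff)
  have T'0: "T' 0 = 0" using assms(4)[of 0 0] by (simp add: poly_mapping_eq_iff fun_eq_iff)
  have "f \<in> {f. T f = T' f}"
    by (rule lin_subspace_keys_in) (simp_all add: lin_subspace_def T0 T'0 assms)
  then show ?thesis by simp
qed

lemma pact_single: "pact \<sigma> \<eta> (Poly_Mapping.single m c) = Poly_Mapping.single (pperm \<sigma> m) (c * pcoef \<eta> m)"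
  by (simp add: pact_def scl_single)

lemma pact_mult: "pact \<sigma> \<eta> (f * g) = pact \<sigma> \<eta> f * pact \<sigma> \<eta> g"
proof (rule linear_eqI[where T = "\<lambda>f. pact \<sigma> \<eta> (f * g)" and T' = "\<lambda>f. pact \<sigma> \<eta> f * pact \<sigma> \<eta> g"])
  fix m
  show "pact \<sigma> \<eta> (gen m * g) = pact \<sigma> \<eta> (gen m) * pact \<sigma> \<eta> g"
    by (rule linear_eqI[where T = "\<lambda>g. pact \<sigma> \<eta> (gen m * g)" and T' = "\<lambda>g. pact \<sigma> \<eta> (gen m) * pact \<sigma> \<eta> g"])
       (simp_all add: pact_add pact_scl scl_mult_right distrib_left gen_mult mult_single pperm_add pcoef_add)
qed (simp_all add: pact_add pact_scl scl_mult_left distrib_right)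

lemma subst_eq_pact:
  fixes \<sigma> :: "'n::finite \<Rightarrow> 'n"
  assumes \<sigma>: "\<sigma> permutes UNIV" and nz: "\<And>i. \<eta> i \<noteq> 0"
  shows "subst (var_act (wmat \<sigma> \<eta>)) f = pact \<sigma> \<eta> f"
proof -
  have inj: "\<sigma> i = \<sigma> j \<longleftrightarrow> i = j" for i j using permutes_inj[OF \<sigma>] by (auto simp: inj_def)
  have iff: "\<sigma> j = i \<longleftrightarrow> j = finv \<sigma> i" for i j using permutes_inverses[OF \<sigma>] by metis
  have "(\<Sum>j\<in>UNIV. Const (matrix_inv (wmat \<sigma> \<eta>) $ i $ j) * Var (Inl j)) =
      (\<Sum>j\<in>UNIV. if j = \<sigma> i then Poly_Mapping.single (Poly_Mapping.single (Inl (\<sigma> i)) 1) (\<eta> i) else 0)" for i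
    by (intro sum.cong) (auto simp: matrix_inv_wmat[OF \<sigma> nz] Const_def Var_def mult_single)
  then have l: "var_act (wmat \<sigma> \<eta>) (Inl i) = Poly_Mapping.single (Poly_Mapping.single (Inl (\<sigma> i)) 1) (\<eta> i)" for i
    by simp
  have "(\<Sum>j\<in>UNIV. Const (wmat \<sigma> \<eta> $ j $ i) * Var (Inr j)) =
      (\<Sum>j\<in>UNIV. if j = \<sigma> i then Poly_Mapping.single (Poly_Mapping.single (Inr (\<sigma> i)) 1) (inverse (\<eta> i)) else 0)" for i
    by (intro sum.cong) (auto simp: wmat_def Const_def Var_def mult_single)
  then have r: "var_act (wmat \<sigma> \<eta>) (Inr i) = Poly_Mapping.single (Poly_Mapping.single (Inr (\<sigma> i)) 1) (inverse (\<eta> i))" for i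
    by simp
  have pw: "Poly_Mapping.single (Poly_Mapping.single v 1) c ^ k = Poly_Mapping.single (Poly_Mapping.single v k) (c ^ k)"
    for v :: "'n + 'n" and c :: complex and k
    by (induction k) (simp_all add: mult_single flip: single_add)
  have "(\<Prod>v\<in>Poly_Mapping.keys m. var_act (wmat \<sigma> \<eta>) v ^ Poly_Mapping.lookup m v)
      = Poly_Mapping.single (pperm \<sigma> m) (pcoef \<eta> m)" for m
  proof -
    have "(\<Prod>v\<in>Poly_Mapping.keys m. var_act (wmat \<sigma> \<eta>) v ^ Poly_Mapping.lookup m v)
        = (\<Prod>v\<in>UNIV. var_act (wmat \<sigma> \<eta>) v ^ Poly_Mapping.lookup m v)"
      by (intro prod.mono_neutral_left) (auto simp: in_keys_iff)
    also have "\<dots> = (\<Prod>i\<in>UNIV. var_act (wmat \<sigma> \<eta>) (Inl i) ^ xe m i) * (\<Prod>i\<in>UNIV. var_act (wmat \<sigma> \<eta>) (Inr i) ^ ye m i)"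
      unfolding UNIV_Plus_UNIV[symmetric] by (subst prod.Plus) simp_all
    also have "\<dots> = Poly_Mapping.single ((\<Sum>i\<in>UNIV. Poly_Mapping.single (Inl (\<sigma> i)) (xe m i))
        + (\<Sum>i\<in>UNIV. Poly_Mapping.single (Inr (\<sigma> i)) (ye m i))) (pcoef \<eta> m)"
      unfolding l r pw prod_gen mult_single pcoef_def by (simp add: prod.distrib)
    also have "(\<Sum>i\<in>UNIV. Poly_Mapping.single (Inl (\<sigma> i)) (xe m i))
        + (\<Sum>i\<in>UNIV. Poly_Mapping.single (Inr (\<sigma> i)) (ye m i)) = pperm \<sigma> m"
      by (rule bimon_eqI)
         (simp_all add: lookup_add lookup_sum lookup_single when_def pperm_def iff cong: if_cong)
    finally show ?thesis .
  qed
  then show ?thesis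
    by (simp add: subst_def pact_def pext_def Const_mult)
qed

text \<open>The inner data describe the inverse matrix. Every polynomial is thereby an image under
  the group element, which lets \<open>perp_U\<close> test orthogonality against an arbitrary
  \<open>g\<close>.\<close>

lemma pact_inverse:
  fixes \<sigma> :: "'n::finite \<Rightarrow> 'n"
  assumes \<sigma>: "\<sigma> permutes UNIV" and nz: "\<And>i. \<eta> i \<noteq> 0"
  shows "pact \<sigma> \<eta> (pact (finv \<sigma>) (\<lambda>i. inverse (\<eta> (finv \<sigma> i))) f) = f"
proof (rule linear_eqI[where T' = "\<lambda>f. f"])
  fix m
  let ?m = "pperm (finv \<sigma>) m"
  note [simp] = permutes_inverses[OF \<sigma>] inv_inv_eq[OF permutes_bij[OF \<sigma>]]
  have "pcoef (\<lambda>i. inverse (\<eta> (finv \<sigma> i))) m = (\<Prod>i\<in>UNIV. inverse (\<eta> i) ^ xe m (\<sigma> i) * \<eta> i ^ ye m (\<sigma> i))"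
    unfolding pcoef_def by (subst prod.permute[OF \<sigma>]) (simp add: o_def)
  then have "pcoef (\<lambda>i. inverse (\<eta> (finv \<sigma> i))) m * pcoef \<eta> ?m = 1"
    using nz by (simp add: pcoef_def pperm_def field_simps flip: prod.distrib power_mult_distrib)
  moreover have "pperm \<sigma> ?m = m" by (rule bimon_eqI) (simp_all add: pperm_def)
  ultimately show "pact \<sigma> \<eta> (pact (finv \<sigma>) (\<lambda>i. inverse (\<eta> (finv \<sigma> i))) (gen m)) = gen m"
    by (simp add: pact_single)
qed (simp_all add: pact_add pact_scl)

lemma tdeg_pperm:
  fixes \<sigma> :: "'n::finite \<Rightarrow> 'n"
  assumes "\<sigma> permutes UNIV" shows "tdeg (pperm \<sigma> m) = tdeg m"
  unfolding tdeg_def pperm_def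
  using sum.permute[OF permutes_inv[OF assms], of "xe m"] sum.permute[OF permutes_inv[OF assms], of "ye m"]
  by (simp add: o_def)

section \<open>The polynomial algebra and its subalgebra in the x_i\<close>

lemma poly_alg_simps [simp]:
  "carrier poly_alg = UNIV" "\<zero>\<^bsub>poly_alg\<^esub> = 0" "\<one>\<^bsub>poly_alg\<^esub> = 1" "f \<oplus>\<^bsub>poly_alg\<^esub> g = f + g"
  "f \<otimes>\<^bsub>poly_alg\<^esub> g = f * g" "c \<odot>\<^bsub>poly_alg\<^esub> f = scl c f" "act poly_alg w = subst (var_act w)"
  by (simp_all add: poly_alg_def Const_mult)

lemma x_alg_simps [simp]:
  "carrier x_alg = x_polys" "\<zero>\<^bsub>x_alg\<^esub> = 0" "\<one>\<^bsub>x_alg\<^esub> = 1" "f \<oplus>\<^bsub>x_alg\<^esub> g = f + g"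
  "f \<otimes>\<^bsub>x_alg\<^esub> g = f * g" "c \<odot>\<^bsub>x_alg\<^esub> f = scl c f" "act x_alg w = subst (var_act w)"
  by (simp_all add: x_alg_def sub_grep_def poly_alg_def Const_mult)

lemma x_polys_iff: "f \<in> x_polys \<longleftrightarrow> (\<forall>m\<in>Poly_Mapping.keys f. \<forall>i. ye m i = 0)"
proof -
  have "Poly_Mapping.keys m \<subseteq> range Inl \<longleftrightarrow> (\<forall>i. ye m i = 0)" for m :: "'a bimon"
  proof
    assume "Poly_Mapping.keys m \<subseteq> range Inl"
    then have "Inr i \<notin> Poly_Mapping.keys m" for i by auto
    then show "\<forall>i. ye m i = 0" by (simp add: in_keys_iff)
  next
    assume *: "\<forall>i. ye m i = 0"
    show "Poly_Mapping.keys m \<subseteq> range Inl"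
    proof
      fix v assume "v \<in> Poly_Mapping.keys m"
      then show "v \<in> range Inl" using * by (cases v) (simp_all add: in_keys_iff)
    qed
  qed
  then show ?thesis by (simp add: x_polys_def)
qed

lemma x_polys_eq: "x_polys = {f. Poly_Mapping.keys f \<subseteq> {m. \<forall>i. ye m i = 0}}"
  by (auto simp: x_polys_iff subset_iff)

lemma x_polys_subspace: "lin_subspace x_polys"
  unfolding x_polys_eq by (rule lin_subspace_keys)

lemma x_polys_mult: "f \<in> x_polys \<Longrightarrow> g \<in> x_polys \<Longrightarrow> f * g \<in> x_polys"
  unfolding x_polys_iff by (auto simp: lookup_add dest!: subsetD[OF keys_mult])

lemma x_polys_gen: "gen (mon a (\<lambda>_. 0)) \<in> x_polys"
  by (simp add: x_polys_iff)

lemma x_polys_one: "(1 :: 'n::finite bipoly) \<in> x_polys"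
  using x_polys_gen[of "\<lambda>_ :: 'n. 0"] by (simp add: mon_zero)

lemma pact_x_polys: "f \<in> x_polys \<Longrightarrow> pact \<sigma> \<eta> f \<in> x_polys"
  unfolding pact_def pext_def
proof (rule lin_subspaceD(6)[OF x_polys_subspace])
  fix m assume "f \<in> x_polys" "m \<in> Poly_Mapping.keys f"
  then show "scl (Poly_Mapping.lookup f m) (Poly_Mapping.single (pperm \<sigma> m) (pcoef \<eta> m)) \<in> x_polys"
    by (simp add: scl_single x_polys_iff pperm_def)
qed

lemma zero_subspace: "lin_subspace {0}"
  by (simp add: lin_subspace_def)

lemma poly_alg_presented:
  assumes "r > 0"
  shows "presented_alg (poly_alg :: (complex^'n^'n, 'n::finite bipoly) grep) UNIV (\<lambda>f. f) {0} (\<lambda>w. subst (var_act w)) (G_group r p)"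
proof unfold_locales
  fix w :: "complex^'n^'n" and f g :: "'n bipoly" assume "w \<in> G_group r p"
  then obtain \<sigma> \<eta> where "G_data r p \<sigma> \<eta>" "w = wmat \<sigma> \<eta>" by (rule G_groupE)
  moreover from this have "subst (var_act w) f = pact \<sigma> \<eta> f" for f
    using G_data_nonzero[OF _ assms] subst_eq_pact by (metis G_data_def)
  ultimately show "subst (var_act w) (f - g) = subst (var_act w) f - subst (var_act w) g"
    by (simp add: pact_diff)
next
  show "lin_subspace (UNIV :: 'n bipoly set)" by (simp add: lin_subspace_def)
qed (simp_all only: poly_alg_simps zero_subspace image_ident UNIV_I subset_UNIV singleton_iff right_minus_eq)

lemma x_alg_presented:
  assumes "r > 0"
  shows "presented_alg (x_alg :: (complex^'n^'n, 'n::finite bipoly) grep) x_polys (\<lambda>f. f) {0} (\<lambda>w. subst (var_act w)) (G_group r p)"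
proof unfold_locales
  fix w :: "complex^'n^'n" and f g :: "'n bipoly" assume "w \<in> G_group r p"
  then obtain \<sigma> \<eta> where "G_data r p \<sigma> \<eta>" "w = wmat \<sigma> \<eta>" by (rule G_groupE)
  moreover from this have s: "subst (var_act w) f = pact \<sigma> \<eta> f" for f
    using G_data_nonzero[OF _ assms] subst_eq_pact by (metis G_data_def)
  ultimately show "subst (var_act w) (f - g) = subst (var_act w) f - subst (var_act w) g"
    by (simp add: pact_diff)
  show "f \<in> x_polys \<Longrightarrow> subst (var_act w) f \<in> x_polys" using pact_x_polys by (simp add: s)
qed (simp_all only: x_alg_simps x_polys_subspace x_polys_one x_polys_mult zero_subspace image_ident singleton_iff
  right_minus_eq insert_subset empty_subsetI lin_subspaceD(1)[OF x_polys_subspace])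

lemma ideal_subspace:
  assumes "ideal N poly_alg" shows "lin_subspace N" "\<And>f g. f \<in> N \<Longrightarrow> f * g \<in> N"
proof -
  interpret ideal N poly_alg by fact
  show 1: "\<And>f g. f \<in> N \<Longrightarrow> f * g \<in> N" using I_r_closed by simp
  have "scl c f \<in> N" if "f \<in> N" for c f
    using 1[OF that, of "Const c"] by (simp add: mult.commute[of f] Const_mult)
  then show "lin_subspace N"
    unfolding lin_subspace_def using additive_subgroup.zero_closed[OF additive_subgroup_axioms]
      additive_subgroup.a_closed[OF additive_subgroup_axioms] by simp
qed

lemma x_ideal_subspace:
  assumes "ideal N x_alg"
  shows "lin_subspace N" "N \<subseteq> x_polys" "\<And>f g. f \<in> N \<Longrightarrow> g \<in> x_polys \<Longrightarrow> f * g \<in> N"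
proof -
  interpret ideal N x_alg by fact
  show 1: "\<And>f g. f \<in> N \<Longrightarrow> g \<in> x_polys \<Longrightarrow> f * g \<in> N" using I_r_closed by simp
  have C: "Const c \<in> x_polys" for c :: complex by (simp add: Const_def x_polys_iff)
  have "scl c f \<in> N" if "f \<in> N" for c f
    using 1[OF that C, of c] by (simp add: mult.commute[of f] Const_mult)
  then show "lin_subspace N"
    unfolding lin_subspace_def using additive_subgroup.zero_closed[OF additive_subgroup_axioms]
      additive_subgroup.a_closed[OF additive_subgroup_axioms] by simp
  show "N \<subseteq> x_polys" using additive_subgroup.a_subset[OF additive_subgroup_axioms] by simp
qed

section \<open>A representation of the rational Cherednik algebra\<close>

lemma functional_eqI:
  assumes "\<And>f g. T (f + g) = T f + T g" "\<And>c f. T (scl c f) = c * T f"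
    and "\<And>f g. T' (f + g) = T' f + T' g" "\<And>c f. T' (scl c f) = c * T' f"
    and "\<And>x. x \<in> Poly_Mapping.keys f \<Longrightarrow> T (gen x) = T' (gen x)"
  shows "T f = (T' f :: complex)"
  using lext_unique[of T f "\<lambda>x k. T' (gen x)" "()"] lext_unique[of T' f "\<lambda>x k. T' (gen x)" "()"] assms by simp

text \<open>The numbering \<open>idx\<close> of the coordinates by 0, ..., n-1 serves twice: it
  supplies the exponents of the Vandermonde polynomial, and it orders the variables for normal forms
  and leading terms.\<close>

locale coinv_model =
  fixes r p :: nat and idx :: "'n::finite \<Rightarrow> nat"
  assumes r_gt_1: "r > 1" and p_pos: "p > 0" and p_dvd: "p dvd r"
    and idx: "bij_betw idx UNIV {..<CARD('n)}"
begin

definition s :: nat where "s = r div p"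
definition eps :: nat where "eps = (if p < r then 1 else 0)"
definition h :: nat where "h = (if p < r then r * (CARD('n) - 1) + r div p else r * (CARD('n) - 1))"

lemma idx_less: "idx i < CARD('n)" using idx by (auto simp: bij_betw_def)
lemma idx_inj: "idx i = idx j \<longleftrightarrow> i = j" using idx by (auto simp: bij_betw_def inj_on_def)

lemma s_mult_p: "s * p = r" using p_dvd by (simp add: s_def)

lemma s_pos: "s > 0"
proof (rule ccontr)
  assume "\<not> s > 0"
  then have "s * p = 0" by simp
  then show False using s_mult_p r_gt_1 by linarith
qed

lemma p_less_iff: "p < r \<longleftrightarrow> s > 1"
proof -
  have "p < s * p \<longleftrightarrow> 1 < s" using p_pos by simp
  then show ?thesis unfolding s_mult_p .
qed

lemma eps_less: "eps < s" using p_less_iff s_pos by (simp add: eps_def)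

lemma s_le: "s \<le> r"
proof -
  have "s * 1 \<le> s * p" using p_pos by (intro mult_le_mono2) linarith
  then show ?thesis using s_mult_p by linarith
qed

lemma eps_less_r: "eps < r" using eps_less s_le by linarith

text \<open>Unites the two cases in the definition of \<open>h\<close>: for p = r one has s = 1 and
  \<open>eps = 0\<close>.\<close>

lemma h_eq: "Suc h = r * (CARD('n) - 1) + s + eps"
proof (cases "p < r")
  case False
  then have "s = 1" using p_less_iff s_pos by linarith
  then show ?thesis using False by (simp add: h_def eps_def)
qed (simp add: h_def eps_def s_def)

lemma Suc_h_mod: "Suc h mod r = (s + eps) mod r"
  by (simp add: h_eq add.assoc)

text \<open>The residue of h + 1 is that of \<open>s + eps\<close>. For p = 1 this is r + 1; for p >
  1 one has \<open>s + eps < 2 s\<close>, which is at most r. The fact is what gives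
  \<open>lam 0 = 0\<close>.\<close>

lemma Suc_h_mod_nonzero: "Suc h mod r \<noteq> 0"
proof (cases "p = 1")
  case True
  then have "s * p = s" by (simp only: mult_1_right)
  then have "(s + eps) mod r = (r + 1) mod r"
    using s_mult_p True r_gt_1 unfolding eps_def by (simp only: if_True)
  then show ?thesis
    using r_gt_1 mod_less[of 1 r] unfolding Suc_h_mod by (simp only: mod_add_self1 one_neq_zero not_False_eq_True)
next
  case False
  then have "2 \<le> p" using p_pos by linarith
  then have "s * 2 \<le> s * p" by (rule mult_le_mono2)
  then have "s * 2 \<le> r" using s_mult_p by linarith
  then have "s + eps < r" using eps_less by linarith
  then show ?thesis using s_pos by (simp add: Suc_h_mod)
qed

text \<open>The Dunkl operator is the derivative minus (h+1)/x_i times the projector to exponents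
  congruent to h + 1 modulo r. A correction that depends on the residue only and vanishes at residue
  0 is the general shape of the contribution of the diagonal reflections in one coordinate.\<close>

definition lam :: "nat \<Rightarrow> complex"
  where "lam m = of_nat m - (if m mod r = Suc h mod r then of_nat (Suc h) else 0)"

lemma lam_0: "lam 0 = 0" using Suc_h_mod_nonzero by (simp add: lam_def)

lemma lam_Suc_h: "lam (Suc h) = 0" by (simp add: lam_def)

lemma lam_nonzero: "0 < m \<Longrightarrow> m \<le> h \<Longrightarrow> lam m \<noteq> 0"
proof -
  assume m: "0 < m" "m \<le> h"
  then have "of_nat m \<noteq> (of_nat (Suc h) :: complex)" unfolding of_nat_eq_iff by linarith
  with m show ?thesis unfolding lam_def by (simp del: of_nat_Suc)
qed

text \<open>The scalar with which the b-th power of a Dunkl operator takes x_i^(k+b) to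
  x_i^k.\<close>

definition Lf :: "nat \<Rightarrow> nat \<Rightarrow> complex" where "Lf k b = (\<Prod>j<b. lam (Suc k + j))"

lemma Lf_Suc: "Lf k (Suc b) = lam (Suc k) * Lf (Suc k) b"
  by (simp only: Lf_def prod.lessThan_Suc_shift) simp

text \<open>The coefficients of \<open>v = \<Sum>\<^sub>\<pi> sgn(\<pi>) \<Prod>\<^sub>i x\<^sub>i\<^bsup>\<epsilon> + r \<pi>(i)\<^esup>\<close>.\<close>

definition v :: "('n \<Rightarrow> nat) \<Rightarrow> complex"
  where "v k = (\<Sum>\<pi> | \<pi> permutes UNIV. of_int (sign \<pi>) * of_bool (\<forall>i. k i = eps + r * idx (\<pi> i)))"

lemma v_permute:
  assumes "\<sigma> permutes UNIV"
  shows "v (\<lambda>i. k (\<sigma> i)) = of_int (sign \<sigma>) * v k"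
proof -
  have "v (\<lambda>i. k (\<sigma> i)) = (\<Sum>\<pi> | \<pi> permutes UNIV. of_int (sign (\<pi> \<circ> \<sigma>)) * of_bool (\<forall>i. k (\<sigma> i) = eps + r * idx (\<pi> (\<sigma> i))))"
    unfolding v_def by (subst sum_permutations_compose_right[OF assms]) simp
  also have "\<dots> = (\<Sum>\<pi> | \<pi> permutes UNIV. of_int (sign \<sigma>) * (of_int (sign \<pi>) * of_bool (\<forall>i. k i = eps + r * idx (\<pi> i))))"
  proof (rule sum.cong)
    fix \<pi> :: "'n \<Rightarrow> 'n" assume "\<pi> \<in> {\<pi>. \<pi> permutes UNIV}"
    then have "permutation \<pi>" "permutation \<sigma>" using assms by (auto intro: permutes_imp_permutation[rotated])
    moreover have "(\<forall>i. k (\<sigma> i) = eps + r * idx (\<pi> (\<sigma> i))) \<longleftrightarrow> (\<forall>i. k i = eps + r * idx (\<pi> i))"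
      using permutes_surj[OF assms] by (metis surjD)
    ultimately show "of_int (sign (\<pi> \<circ> \<sigma>)) * of_bool (\<forall>i. k (\<sigma> i) = eps + r * idx (\<pi> (\<sigma> i)))
        = (of_int (sign \<sigma>) * (of_int (sign \<pi>) * of_bool (\<forall>i. k i = eps + r * idx (\<pi> i))) :: complex)"
      by (simp add: sign_compose)
  qed simp
  finally show ?thesis unfolding v_def[of k] sum_distrib_left .
qed

lemma v_nonzeroE:
  assumes "v k \<noteq> 0"
  obtains \<pi> where "\<pi> permutes UNIV" "\<And>i. k i = eps + r * idx (\<pi> i)"
proof -
  have "\<exists>\<pi>. \<pi> permutes UNIV \<and> (\<forall>i. k i = eps + r * idx (\<pi> i))"
  proof (rule ccontr)
    assume "\<not> ?thesis"
    then have "v k = 0" unfolding v_def by (intro sum.neutral) auto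
    with assms show False by simp
  qed
  then show thesis using that by blast
qed

text \<open>The degree of v. Since v is the image of 1, degree 0 of L corresponds to degree
  \<open>N\<close> of A, which is therefore the degree in which the top exterior power of V must
  sit.\<close>

definition N :: nat where "N = (\<Sum>i\<in>UNIV. eps + r * idx i)"

lemma v_degree: assumes "v k \<noteq> 0" shows "(\<Sum>i\<in>UNIV. k i) = N"
proof -
  from assms obtain \<pi> where \<pi>: "\<pi> permutes UNIV" "\<And>i. k i = eps + r * idx (\<pi> i)" by (rule v_nonzeroE) blast
  have "(\<Sum>i\<in>UNIV. k i) = (\<Sum>i\<in>UNIV. ((\<lambda>i. eps + r * idx i) \<circ> \<pi>) i)" by (simp add: \<pi>(2))
  also have "\<dots> = N" unfolding N_def by (rule sum.permute[OF \<pi>(1), symmetric])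
  finally show ?thesis .
qed

lemma v_base: "v (\<lambda>i. eps + r * idx i) = 1"
proof -
  have "v (\<lambda>i. eps + r * idx i) = (\<Sum>\<pi> :: 'n \<Rightarrow> 'n | \<pi> permutes UNIV. if \<pi> = id then 1 else 0)"
    unfolding v_def
  proof (rule sum.cong)
    fix \<pi> :: "'n \<Rightarrow> 'n" assume "\<pi> \<in> {\<pi>. \<pi> permutes UNIV}"
    have "eps + r * idx i = eps + r * idx (\<pi> i) \<longleftrightarrow> \<pi> i = i" for i
      using r_gt_1 idx_inj[of i "\<pi> i"] by auto
    then show "of_int (sign \<pi>) * of_bool (\<forall>i. eps + r * idx i = eps + r * idx (\<pi> i)) = (if \<pi> = id then 1 else 0 :: complex)"
      by (cases "\<pi> = id") (simp, auto simp: fun_eq_iff)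
  qed simp
  then show ?thesis by (simp add: permutes_id finite_permutations)
qed

definition box :: "('n \<Rightarrow> nat) set" where "box = {m. \<forall>i. m i \<le> h}"

lemma finite_box: "finite box"
proof -
  have "box = PiE UNIV (\<lambda>_. {..h})" by (auto simp: box_def PiE_def extensional_def)
  then show ?thesis by (simp add: finite_PiE)
qed

lemma base_le_h: "eps + r * idx i \<le> h"
proof -
  have "r * idx i \<le> r * (CARD('n) - 1)" using idx_less[of i] by (intro mult_le_mono2) linarith
  then show ?thesis using h_eq s_pos by linarith
qed

text \<open>The coefficients of \<open>x\<^sup>a Y\<^sup>b v\<close>, truncated to exponents at most \<open>h\<close>, where the Dunkl operator
  \<open>Y\<^sub>i\<close> maps \<open>x\<^sup>m\<close> to \<open>\<lambda>(m\<^sub>i) x\<^sup>m / x\<^sub>i\<close>.\<close>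

definition qq :: "('n \<Rightarrow> nat) \<Rightarrow> ('n \<Rightarrow> nat) \<Rightarrow> ('n \<Rightarrow> nat) \<Rightarrow> complex"
  where "qq a b m = (if \<forall>i. a i \<le> m i \<and> m i \<le> h
    then (\<Prod>i\<in>UNIV. Lf (m i - a i) (b i)) * v (\<lambda>i. m i - a i + b i) else 0)"

lemma qq_upd:
  "qq (a(i := x)) (b(i := y)) (m(i := z)) = (if (\<forall>j. j \<noteq> i \<longrightarrow> a j \<le> m j \<and> m j \<le> h) \<and> x \<le> z \<and> z \<le> h
    then (\<Prod>j\<in>UNIV - {i}. Lf (m j - a j) (b j)) * Lf (z - x) y * v ((\<lambda>j. m j - a j + b j)(i := z - x + y)) else 0)"
proof -
  have "(\<Prod>j\<in>UNIV. Lf ((m(i := z)) j - (a(i := x)) j) ((b(i := y)) j))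
      = Lf (z - x) y * (\<Prod>j\<in>UNIV - {i}. Lf ((m(i := z)) j - (a(i := x)) j) ((b(i := y)) j))"
    by (subst prod.remove[of _ i]) simp_all
  also have "(\<Prod>j\<in>UNIV - {i}. Lf ((m(i := z)) j - (a(i := x)) j) ((b(i := y)) j)) = (\<Prod>j\<in>UNIV - {i}. Lf (m j - a j) (b j))"
    by (rule prod.cong) auto
  finally have 1: "(\<Prod>j\<in>UNIV. Lf ((m(i := z)) j - (a(i := x)) j) ((b(i := y)) j))
      = Lf (z - x) y * (\<Prod>j\<in>UNIV - {i}. Lf (m j - a j) (b j))" .
  have 2: "(\<lambda>j. (m(i := z)) j - (a(i := x)) j + (b(i := y)) j) = (\<lambda>j. m j - a j + b j)(i := z - x + y)" by auto
  have 3: "(\<forall>j. (a(i := x)) j \<le> (m(i := z)) j \<and> (m(i := z)) j \<le> h) \<longleftrightarrow> (\<forall>j. j \<noteq> i \<longrightarrow> a j \<le> m j \<and> m j \<le> h) \<and> x \<le> z \<and> z \<le> h"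
    by auto
  show ?thesis unfolding qq_def 1 2 3 by (simp only: mult_ac)
qed

lemma qq_support: "m \<notin> box \<Longrightarrow> qq a b m = 0"
  by (auto simp: qq_def box_def)

lemma qq_degree:
  assumes "qq a b m \<noteq> 0" shows "(\<Sum>i\<in>UNIV. m i) + (\<Sum>i\<in>UNIV. b i) = N + (\<Sum>i\<in>UNIV. a i)"
proof -
  have le: "\<forall>i. a i \<le> m i" and "v (\<lambda>i. m i - a i + b i) \<noteq> 0"
    using assms by (auto simp: qq_def split: if_splits)
  then have "(\<Sum>i\<in>UNIV. m i - a i + b i) = N" by (intro v_degree)
  moreover have "(\<Sum>i\<in>UNIV. m i - a i + b i) + (\<Sum>i\<in>UNIV. a i) = (\<Sum>i\<in>UNIV. m i) + (\<Sum>i\<in>UNIV. b i)"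
    unfolding sum.distrib[symmetric]
  proof (rule sum.cong)
    show "m i - a i + b i + a i = m i + b i" for i using le[rule_format, of i] by linarith
  qed simp
  ultimately show ?thesis by simp
qed

definition Xop :: "'n \<Rightarrow> (('n \<Rightarrow> nat) \<Rightarrow> complex) \<Rightarrow> ('n \<Rightarrow> nat) \<Rightarrow> complex"
  where "Xop i u m = (if m \<in> box \<and> m i > 0 then u (m(i := m i - 1)) else 0)"

definition Yop :: "'n \<Rightarrow> (('n \<Rightarrow> nat) \<Rightarrow> complex) \<Rightarrow> ('n \<Rightarrow> nat) \<Rightarrow> complex"
  where "Yop i u m = (if m \<in> box then lam (Suc (m i)) * u (m(i := Suc (m i))) else 0)"

text \<open>The commutator of Y_i with x_i^a, evaluated on Y^b v. It depends on a and b alone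
  because all exponents of v are congruent to \<open>eps\<close> modulo r, so those of Y^b v at i
  are congruent to \<open>eps - b\<close>. The value 0 at a = 0 makes the truncated
  \<open>a i - 1\<close> in \<open>Y_qq\<close> harmless.\<close>

definition kap :: "nat \<Rightarrow> nat \<Rightarrow> complex"
  where "kap a b = (if a = 0 then 0 else of_nat a - of_nat (Suc h) *
    (of_bool ((eps + a) mod r = (Suc h + b) mod r) - of_bool (eps mod r = (Suc h + b) mod r)))"

lemma kap:
  assumes "k + b = eps + r * c" shows "lam (k + a) - lam k = kap a b"
proof -
  have *: "(k + a') mod r = Suc h mod r \<longleftrightarrow> (eps + a') mod r = (Suc h + b) mod r" for a'
  proof -
    have "(k + a') mod r = Suc h mod r \<longleftrightarrow> (k + a' + b) mod r = (Suc h + b) mod r"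
      unfolding nat_mod_eq_iff by (intro iff_exI) linarith
    also have "k + a' + b = eps + a' + r * c" using assms by simp
    finally show ?thesis by simp
  qed
  show ?thesis using *[of a] *[of 0] by (simp add: kap_def lam_def algebra_simps)
qed

lemma X_qq: "Xop i (qq a b) m = qq (a(i := Suc (a i))) b m"
proof (cases "m i")
  case 0
  then show ?thesis using qq_upd[of a i "Suc (a i)" b "b i" m "m i", unfolded fun_upd_triv] by (simp add: Xop_def)
next
  case (Suc k)
  have bx: "m \<in> box \<longleftrightarrow> (\<forall>j. j \<noteq> i \<longrightarrow> m j \<le> h) \<and> Suc k \<le> h"
  proof
    assume *: "(\<forall>j. j \<noteq> i \<longrightarrow> m j \<le> h) \<and> Suc k \<le> h"
    have "m j \<le> h" for j using * Suc by (cases "j = i") auto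
    then show "m \<in> box" by (simp add: box_def)
  qed (simp add: box_def flip: Suc)
  have "qq (a(i := Suc (a i))) b m = (if m \<in> box then qq a b (m(i := k)) else 0)"
    using qq_upd[of a i "Suc (a i)" b "b i" m "m i", unfolded fun_upd_triv] qq_upd[of a i "a i" b "b i" m k, unfolded fun_upd_triv] Suc
    by (auto simp: bx)
  then show ?thesis using Suc by (simp add: Xop_def)
qed

text \<open>Moving Y_i past x^a costs a term whose total degree in the generators is two lower than
  that of the main term. This is why the operators commute in the associated graded.\<close>

lemma Y_qq:
  "Yop i (qq a b) m = qq a (b(i := Suc (b i))) m + kap (a i) (b i) * qq (a(i := a i - 1)) b m"
proof (cases "m \<in> box \<and> (\<forall>j. j \<noteq> i \<longrightarrow> a j \<le> m j \<and> m j \<le> h)")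
  case False
  show ?thesis
  proof (cases "m \<in> box")
    case True
    with False have c: "(\<forall>j. j \<noteq> i \<longrightarrow> a j \<le> m j \<and> m j \<le> h) = False" by blast
    have "qq a b (m(i := Suc (m i))) = 0"
      using qq_upd[of a i "a i" b "b i" m "Suc (m i)", unfolded fun_upd_triv c] by simp
    moreover have "qq a (b(i := Suc (b i))) m = 0"
      using qq_upd[of a i "a i" b "Suc (b i)" m "m i", unfolded fun_upd_triv c] by simp
    moreover have "qq (a(i := a i - 1)) b m = 0"
      using qq_upd[of a i "a i - 1" b "b i" m "m i", unfolded fun_upd_triv c] by simp
    ultimately show ?thesis by (simp add: Yop_def)
  qed (simp add: Yop_def qq_support)
next
  case True
  define R where "R = (\<Prod>j\<in>UNIV - {i}. Lf (m j - a j) (b j))"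
  define f where "f x = v ((\<lambda>j. m j - a j + b j)(i := x))" for x
  have mh: "m i \<le> h" using True by (auto simp: box_def)
  have l: "Yop i (qq a b) m = lam (Suc (m i)) * (if a i \<le> Suc (m i) then R * Lf (Suc (m i) - a i) (b i) * f (Suc (m i) - a i + b i) else 0)"
  \<comment> \<open>At the exponent h the Dunkl operator would receive x_i^(h+1), which the
    truncation has discarded; \<open>lam (Suc h) = 0\<close> makes this consistent.\<close>
  proof (cases "m i = h")
    case True
    then show ?thesis using qq_upd[of a i "a i" b "b i" m "Suc (m i)", unfolded fun_upd_triv] by (simp add: Yop_def lam_Suc_h)
  next
    case False
    then show ?thesis using qq_upd[of a i "a i" b "b i" m "Suc (m i)", unfolded fun_upd_triv] True mh by (simp add: Yop_def R_def f_def)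
  qed
  have t1: "qq a (b(i := Suc (b i))) m = (if a i \<le> m i then R * Lf (m i - a i) (Suc (b i)) * f (m i - a i + Suc (b i)) else 0)"
    using qq_upd[of a i "a i" b "Suc (b i)" m "m i", unfolded fun_upd_triv] True mh by (simp add: R_def f_def)
  have t2: "qq (a(i := a i - 1)) b m = (if a i - 1 \<le> m i then R * Lf (m i - (a i - 1)) (b i) * f (m i - (a i - 1) + b i) else 0)"
    using qq_upd[of a i "a i - 1" b "b i" m "m i", unfolded fun_upd_triv] True mh by (simp add: R_def f_def)
  have fk: "lam (k + a') - lam k = kap a' (b i)" if "f (k + b i) \<noteq> 0" for k a'
  proof -
    from that obtain \<pi> where "\<And>j. ((\<lambda>j. m j - a j + b j)(i := k + b i)) j = eps + r * idx (\<pi> j)"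
      unfolding f_def by (rule v_nonzeroE) blast
    from this[of i] show ?thesis by (intro kap[of _ _ "idx (\<pi> i)"]) simp
  qed
  consider "Suc (m i) < a i" | "a i = Suc (m i)" | "a i \<le> m i" by linarith
  then show ?thesis
  proof cases
    case 1
    then show ?thesis unfolding l t1 t2 by simp
  next
    \<comment> \<open>Here Y_i would need the exponent -1 in Y^b v, so the main term is absent. The
      commutator term alone matches because \<open>lam 0 = 0\<close>.\<close>
    case 2
    have "lam (Suc (m i)) * f (b i) = kap (a i) (b i) * f (b i)"
      using fk[of 0 "a i"] 2 lam_0 by (cases "f (b i) = 0") simp_all
    with 2 show ?thesis unfolding l t1 t2 by auto
  next
    case 3
    define k where "k = m i - a i"
    have m: "m i = a i + k" using 3 by (simp add: k_def)
    have lhs: "Yop i (qq a b) m = lam (Suc k + a i) * (R * Lf (Suc k) (b i) * f (Suc k + b i))"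
      unfolding l m by (simp add: add.commute)
    have r1: "qq a (b(i := Suc (b i))) m = lam (Suc k) * (R * Lf (Suc k) (b i) * f (Suc k + b i))"
      unfolding t1 m by (simp add: Lf_Suc)
    have r2: "kap (a i) (b i) * qq (a(i := a i - 1)) b m = kap (a i) (b i) * (R * Lf (Suc k) (b i) * f (Suc k + b i))"
    proof (cases "a i = 0")
      case False
      then have "m i - (a i - 1) = Suc k" "a i - 1 \<le> m i" unfolding m by simp_all
      then show ?thesis unfolding t2 by simp
    qed (simp add: kap_def)
    show ?thesis
    proof (cases "f (Suc k + b i) = 0")
      case False
      from fk[OF this, of "a i"] have "lam (Suc k + a i) = lam (Suc k) + kap (a i) (b i)" by (simp add: algebra_simps)
      then show ?thesis unfolding lhs r1 r2 by (simp add: algebra_simps)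
    next
      case True
      then show ?thesis unfolding lhs r1 r2 by simp
    qed
  qed
qed

definition Uop :: "('n \<Rightarrow> 'n) \<Rightarrow> ('n \<Rightarrow> complex) \<Rightarrow> (('n \<Rightarrow> nat) \<Rightarrow> complex) \<Rightarrow> ('n \<Rightarrow> nat) \<Rightarrow> complex"
  where "Uop \<sigma> \<eta> u m = (\<Prod>i\<in>UNIV. \<eta> i ^ m (\<sigma> i)) * u (\<lambda>i. m (\<sigma> i))"

text \<open>The character of W on the line of v. It equals the determinant of w on V, see
  \<open>det_Vh\<close>.\<close>

definition chi :: "('n \<Rightarrow> 'n) \<Rightarrow> ('n \<Rightarrow> complex) \<Rightarrow> complex"
  where "chi \<sigma> \<eta> = of_int (sign \<sigma>) * (\<Prod>i\<in>UNIV. \<eta> i ^ eps)"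

lemma U_qq:
  assumes \<sigma>: "\<sigma> permutes UNIV" and \<eta>: "\<And>i. \<eta> i ^ r = 1"
  shows "Uop \<sigma> \<eta> (qq a b) m = chi \<sigma> \<eta> * (\<Prod>i\<in>UNIV. \<eta> i ^ a i * inverse (\<eta> i) ^ b i)
    * qq (\<lambda>i. a (finv \<sigma> i)) (\<lambda>i. b (finv \<sigma> i)) m"
proof -
  note [simp] = permutes_inverses[OF \<sigma>]
  have nz: "\<eta> i \<noteq> 0" for i using \<eta>[of i] r_gt_1 by (cases "\<eta> i = 0") (simp_all add: power_0_left)
  have all: "(\<forall>i. P (\<sigma> i)) \<longleftrightarrow> (\<forall>i. P i)" for P using permutes_surj[OF \<sigma>] by (metis surjD)
  have c: "(\<forall>i. a (finv \<sigma> i) \<le> m i \<and> m i \<le> h) \<longleftrightarrow> (\<forall>i. a i \<le> m (\<sigma> i) \<and> m (\<sigma> i) \<le> h)"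
    using all[of "\<lambda>i. a (finv \<sigma> i) \<le> m i \<and> m i \<le> h"] by simp
  show ?thesis
  proof (cases "\<forall>i. a i \<le> m (\<sigma> i) \<and> m (\<sigma> i) \<le> h")
    case False
    then show ?thesis using c by (simp only: Uop_def qq_def if_False mult_zero_right)
  next
    case True
    define k where "k j = m (\<sigma> j) - a j + b j" for j
    have "(\<lambda>i. m i - a (finv \<sigma> i) + b (finv \<sigma> i)) = (\<lambda>i. k (finv \<sigma> i))" by (simp add: k_def)
    then have vk: "v (\<lambda>i. m i - a (finv \<sigma> i) + b (finv \<sigma> i)) = of_int (sign \<sigma>) * v k"
      using v_permute[OF permutes_inv[OF \<sigma>], of k] sign_inverse[OF permutes_imp_permutation[OF _ \<sigma>]] by simp
    have L: "(\<Prod>i\<in>UNIV. Lf (m i - a (finv \<sigma> i)) (b (finv \<sigma> i))) = (\<Prod>i\<in>UNIV. Lf (m (\<sigma> i) - a i) (b i))"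
      by (subst prod.permute[OF \<sigma>]) (simp add: o_def)
    have q1: "qq a b (\<lambda>i. m (\<sigma> i)) = (\<Prod>i\<in>UNIV. Lf (m (\<sigma> i) - a i) (b i)) * v k"
      using True by (simp add: qq_def k_def[abs_def])
    have q2: "qq (\<lambda>i. a (finv \<sigma> i)) (\<lambda>i. b (finv \<sigma> i)) m = (\<Prod>i\<in>UNIV. Lf (m (\<sigma> i) - a i) (b i)) * (of_int (sign \<sigma>) * v k)"
      using True c unfolding qq_def L vk by simp
    show ?thesis
    proof (cases "v k = 0")
      case False
      then obtain \<pi> where \<pi>: "\<And>j. k j = eps + r * idx (\<pi> j)" by (rule v_nonzeroE) blast
      \<comment> \<open>Modulo r the exponent \<open>m (\<sigma> j)\<close> is
        \<open>eps + a j - b j\<close>, since \<open>k j\<close> is \<open>eps\<close> plus a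
        multiple of r and \<open>\<eta> j\<close> is an r-th root of unity.\<close>
      have "\<eta> j ^ m (\<sigma> j) = \<eta> j ^ eps * (\<eta> j ^ a j * inverse (\<eta> j) ^ b j)" for j
      proof -
        have "m (\<sigma> j) + b j = k j + a j" using True[rule_format, of j] by (simp add: k_def)
        then have "\<eta> j ^ m (\<sigma> j) * \<eta> j ^ b j = \<eta> j ^ k j * \<eta> j ^ a j" by (simp flip: power_add)
        moreover have "\<eta> j ^ k j = \<eta> j ^ eps" using \<eta>[of j] by (simp add: \<pi> power_add power_mult)
        ultimately show ?thesis using nz[of j] by (simp add: field_simps)
      qed
      then have "(\<Prod>i\<in>UNIV. \<eta> i ^ m (\<sigma> i)) = (\<Prod>i\<in>UNIV. \<eta> i ^ eps) * (\<Prod>i\<in>UNIV. \<eta> i ^ a i * inverse (\<eta> i) ^ b i)"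
        by (simp add: prod.distrib)
      moreover have "(of_int (sign \<sigma>) :: complex) * of_int (sign \<sigma>) = 1"
        by (simp flip: of_int_mult add: sign_idempotent)
      ultimately show ?thesis unfolding Uop_def q1 q2 chi_def by (simp add: mult_ac)
    qed (simp add: Uop_def q1 q2)
  qed
qed

text \<open>Polynomials act on v in normal order, all Dunkl operators before all multiplications by
  the x_i. This respects products with the x_i (\<open>X_Q\<close>), but products with the y_i only
  up to the terms in \<open>Y_Q\<close>.\<close>

definition Q :: "'n bipoly \<Rightarrow> ('n \<Rightarrow> nat) \<Rightarrow> complex"
  where "Q = lext (\<lambda>m. qq (xe m) (ye m))"

lemma Q_add: "Q (f + g) m = Q f m + Q g m" by (simp add: Q_def lext_add)
lemma Q_scl: "Q (scl c f) m = c * Q f m" by (simp add: Q_def lext_scl)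
lemma Q_diff: "Q (f - g) m = Q f m - Q g m" by (simp add: Q_def lext_diff)
lemma Q_zero [simp]: "Q 0 m = 0" by (simp add: Q_def)
lemma Q_sum: "Q (sum F A) m = (\<Sum>a\<in>A. Q (F a) m)" by (simp add: Q_def lext_sum)
lemma Q_single: "Q (Poly_Mapping.single x c) m = c * qq (xe x) (ye x) m" by (simp add: Q_def)

lemma Q_support: "m \<notin> box \<Longrightarrow> Q f m = 0"
  by (simp add: Q_def lext_def qq_support)

lemma Q_gen: "Q (gen x) = qq (xe x) (ye x)"
  by (rule ext) (simp add: Q_single)

lemma X_Q: "Xop i (Q f) m = Q (Var (Inl i) * f) m"
proof (rule functional_eqI[where T = "\<lambda>f. Xop i (Q f) m" and T' = "\<lambda>f. Q (Var (Inl i) * f) m"])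
  fix x
  have "qq ((xe x)(i := Suc (xe x i))) (ye x) = qq (xe (Poly_Mapping.single (Inl i) 1 + x)) (ye (Poly_Mapping.single (Inl i) 1 + x))"
    by (intro arg_cong2[where f = qq] ext) (simp_all add: lookup_add lookup_single when_def)
  then show "Xop i (Q (gen x)) m = Q (Var (Inl i) * gen x) m"
    by (simp only: Q_gen Var_mult_gen X_qq)
qed (simp_all add: Xop_def Q_add Q_scl distrib_left scl_mult_right)

text \<open>The commutator terms of Y_i as an operator on normally ordered polynomials. It does not
  raise the total degree, so it is invisible in the associated graded.\<close>

definition Kop :: "'n \<Rightarrow> 'n bipoly \<Rightarrow> 'n bipoly"
  where "Kop i = pext (\<lambda>x. Poly_Mapping.single (mon ((xe x)(i := xe x i - 1)) (ye x)) (kap (xe x i) (ye x i)))"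

lemma Y_Q: "Yop i (Q f) m = Q (Var (Inr i) * f) m + Q (Kop i f) m"
proof (rule functional_eqI[where T = "\<lambda>f. Yop i (Q f) m" and T' = "\<lambda>f. Q (Var (Inr i) * f) m + Q (Kop i f) m"])
  fix x
  have e: "qq (xe x) ((ye x)(i := Suc (ye x i))) = qq (xe (Poly_Mapping.single (Inr i) 1 + x)) (ye (Poly_Mapping.single (Inr i) 1 + x))"
    by (intro arg_cong2[where f = qq] ext) (simp_all add: lookup_add lookup_single when_def)
  have k: "Q (Kop i (gen x)) m = kap (xe x i) (ye x i) * qq ((xe x)(i := xe x i - 1)) (ye x) m"
    by (simp add: Kop_def scl_single Q_single del: fun_upd_apply)
  show "Yop i (Q (gen x)) m = Q (Var (Inr i) * gen x) m + Q (Kop i (gen x)) m"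
    unfolding k by (simp only: Q_gen Var_mult_gen Y_qq e)
qed (simp_all add: Yop_def Q_add Q_scl distrib_left scl_mult_right Kop_def pext_add pext_scl)

lemma U_Q:
  assumes \<sigma>: "\<sigma> permutes UNIV" and \<eta>: "\<And>i. \<eta> i ^ r = 1"
  shows "Uop \<sigma> \<eta> (Q f) m = chi \<sigma> \<eta> * Q (pact \<sigma> \<eta> f) m"
proof (rule functional_eqI[where T = "\<lambda>f. Uop \<sigma> \<eta> (Q f) m" and T' = "\<lambda>f. chi \<sigma> \<eta> * Q (pact \<sigma> \<eta> f) m"])
  fix x
  show "Uop \<sigma> \<eta> (Q (gen x)) m = chi \<sigma> \<eta> * Q (pact \<sigma> \<eta> (gen x)) m"
    unfolding Q_gen U_qq[OF \<sigma> \<eta>] pact_gen Q_single by (simp add: pperm_def pcoef_def)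
qed (simp_all add: Uop_def Q_add Q_scl pact_add pact_scl distrib_left)

text \<open>This says that v generates A. The product of Dunkl operators of multidegree
  \<open>eps + r * idx i\<close> brings v down to a constant, which is nonzero because only values
  of \<open>lam\<close> between 1 and h occur; multiplication by x^a then gives any monomial of the
  box.\<close>

lemma Q_surj:
  obtains c where "c \<noteq> 0" "\<And>a m. a \<in> box \<Longrightarrow> Q (gen (mon a (\<lambda>i. eps + r * idx i))) m = c * of_bool (m = a)"
proof
  let ?b = "\<lambda>i. eps + r * idx i"
  let ?c = "\<Prod>i\<in>UNIV. Lf 0 (?b i)"
  show "?c \<noteq> 0"
  proof -
    have "Lf 0 (?b i) \<noteq> 0" for i
    proof -
      have "lam (Suc 0 + j) \<noteq> 0" if "j < ?b i" for j
        using that base_le_h[of i] by (intro lam_nonzero) linarith+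
      then show ?thesis by (simp add: Lf_def)
    qed
    then show ?thesis by simp
  qed
  fix a m assume a: "a \<in> box"
  show "Q (gen (mon a ?b)) m = ?c * of_bool (m = a)"
  proof (cases "m = a")
    case True
    then show ?thesis using a by (simp add: Q_single qq_def box_def v_base)
  next
    case False
    \<comment> \<open>A contributing \<open>m\<close> dominates \<open>a\<close> in every coordinate
      and has the same total degree, so it is \<open>a\<close>.\<close>
    have "qq a ?b m = 0"
    proof (rule ccontr)
      assume *: "qq a ?b m \<noteq> 0"
      then have "(\<Sum>i\<in>UNIV. m i) = (\<Sum>i\<in>UNIV. a i)" using qq_degree[OF *] by (simp add: N_def)
      moreover have le: "\<And>i. a i \<le> m i" using * by (auto simp: qq_def split: if_splits)
      moreover obtain i where "m i \<noteq> a i" using False by (auto simp: fun_eq_iff)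
      then have "a i < m i" using le[of i] by linarith
      then have "(\<Sum>i\<in>UNIV. a i) < (\<Sum>i\<in>UNIV. m i)" using le by (intro sum_strict_mono_ex1) auto
      ultimately show False by linarith
    qed
    with False show ?thesis by (simp add: Q_single)
  qed
qed

end

section \<open>The associated graded module\<close>

definition restr :: "('x \<Rightarrow> bool) \<Rightarrow> ('x \<Rightarrow>\<^sub>0 complex) \<Rightarrow> ('x \<Rightarrow>\<^sub>0 complex)"
  where "restr P = pext (\<lambda>x. if P x then gen x else 0)"

lemma lookup_restr: "Poly_Mapping.lookup (restr P f) k = (if P k then Poly_Mapping.lookup f k else 0)"
  by (rule functional_eqI[where T = "\<lambda>f. Poly_Mapping.lookup (restr P f) k"])
     (simp_all add: restr_def pext_add pext_scl lookup_add lookup_single scl_single when_def)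

lemma keys_restr: "x \<in> Poly_Mapping.keys (restr P f) \<longleftrightarrow> P x \<and> x \<in> Poly_Mapping.keys f"
  by (simp add: in_keys_iff lookup_restr)

lemma sum_restr:
  assumes "finite D" "d ` Poly_Mapping.keys f \<subseteq> D"
  shows "(\<Sum>e\<in>D. restr (\<lambda>x. d x = e) f) = f"
proof (rule poly_mapping_eqI)
  fix x
  have "(\<Sum>e\<in>D. if d x = e then Poly_Mapping.lookup f x else 0) = Poly_Mapping.lookup f x"
    using assms by (cases "x \<in> Poly_Mapping.keys f") (auto simp: in_keys_iff)
  then show "Poly_Mapping.lookup (\<Sum>e\<in>D. restr (\<lambda>x. d x = e) f) x = Poly_Mapping.lookup f x"
    by (simp add: lookup_sum lookup_restr)
qed

lemma restr_add: "restr P (f + g) = restr P f + restr P g"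
  by (simp add: restr_def pext_add)

lemma restr_scl: "restr P (scl c f) = scl c (restr P f)"
  by (simp add: restr_def pext_scl)

lemma restr_gen: "restr P (gen x) = (if P x then gen x else 0)"
  by (rule poly_mapping_eqI) (simp add: lookup_restr lookup_single when_def)

text \<open>Gram-Schmidt by induction on \<open>F\<close>: \<open>z'\<close> is the part of the new
  vector orthogonal to the old ones, and subtracting its multiple \<open>t\<close> from
  \<open>u'\<close> preserves orthogonality to those.\<close>

lemma orthogonal_projection:
  fixes g :: "'x \<Rightarrow> 'k \<Rightarrow> complex" and u :: "'k \<Rightarrow> complex"
  assumes B: "finite B" and "finite F"
  shows "\<exists>c. \<forall>y\<in>F. (\<Sum>m\<in>B. (u m - (\<Sum>x\<in>F. c x * g x m)) * cnj (g y m)) = 0"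
  using assms(2)
proof (induction F arbitrary: u rule: finite_induct)
  case (insert z F)
  define ip where "ip u w = (\<Sum>m\<in>B. u m * cnj (w m))" for u w :: "'k \<Rightarrow> complex"
  have ip_diff: "ip (\<lambda>m. u m - t * u' m) w = ip u w - t * ip u' w" for u u' w t
    by (simp add: ip_def algebra_simps sum_subtractf sum_distrib_left)
  obtain d where d: "\<And>y. y \<in> F \<Longrightarrow> ip (\<lambda>m. g z m - (\<Sum>x\<in>F. d x * g x m)) (g y) = 0"
    using insert.IH[of "g z"] by (auto simp: ip_def)
  obtain c where c: "\<And>y. y \<in> F \<Longrightarrow> ip (\<lambda>m. u m - (\<Sum>x\<in>F. c x * g x m)) (g y) = 0"
    using insert.IH[of u] by (auto simp: ip_def)
  define z' where "z' m = g z m - (\<Sum>x\<in>F. d x * g x m)" for m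
  define u' where "u' m = u m - (\<Sum>x\<in>F. c x * g x m)" for m
  define t where "t = ip u' z' / ip z' z'"
  \<comment> \<open>The vectors may be dependent. If \<open>z'\<close> vanishes on \<open>B\<close>,
    division by zero sets \<open>t = 0\<close>, and the equation still holds since both products
    vanish.\<close>
  have t: "ip u' z' - t * ip z' z' = 0"
  proof (cases "ip z' z' = 0")
    case True
    have "(\<Sum>m\<in>B. (cmod (z' m))\<^sup>2) = 0"
    proof -
      have "complex_of_real (\<Sum>m\<in>B. (cmod (z' m))\<^sup>2) = ip z' z'"
        by (simp only: ip_def of_real_sum complex_norm_square)
      then show ?thesis using True by (simp only: of_real_eq_0_iff)
    qed
    then have "z' m = 0" if "m \<in> B" for m using B that by (simp add: sum_nonneg_eq_0_iff)
    then have "ip u' z' = 0" by (simp add: ip_def)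
    with True show ?thesis by simp
  qed (simp add: t_def)
  define c' where "c' x = (if x = z then t else c x - t * d x)" for x
  have u'': "u m - (\<Sum>x\<in>insert z F. c' x * g x m) = u' m - t * z' m" for m
  proof -
    have "(\<Sum>x\<in>F. c' x * g x m) = (\<Sum>x\<in>F. c x * g x m - t * (d x * g x m))"
      using insert.hyps by (intro sum.cong) (auto simp: c'_def algebra_simps)
    then show ?thesis
      using insert.hyps by (simp add: u'_def z'_def c'_def sum_subtractf sum_distrib_left algebra_simps)
  qed
  have F: "ip (\<lambda>m. u' m - t * z' m) (g y) = 0" if "y \<in> F" for y
    using c[OF that] d[OF that] by (simp add: ip_diff u'_def[abs_def] z'_def[abs_def])
  have "ip (\<lambda>m. u' m - t * z' m) (g z) = ip (\<lambda>m. u' m - t * z' m) (\<lambda>m. z' m + (\<Sum>x\<in>F. d x * g x m))"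
    by (simp add: z'_def)
  also have "\<dots> = ip (\<lambda>m. u' m - t * z' m) z' + (\<Sum>x\<in>F. cnj (d x) * ip (\<lambda>m. u' m - t * z' m) (g x))"
    unfolding ip_def
    by (simp add: distrib_left sum.distrib sum_distrib_left mult_ac) (rule sum.swap)
  also have "\<dots> = 0" using t F by (simp add: ip_diff)
  finally have "ip (\<lambda>m. u' m - t * z' m) (g z) = 0" .
  with F have "\<forall>y\<in>insert z F. (\<Sum>m\<in>B. (u m - (\<Sum>x\<in>insert z F. c' x * g x m)) * cnj (g y m)) = 0"
    unfolding u'' ip_def by blast
  then show ?case by blast
qed simp

context coinv_model
begin

section \<open>Orthogonal projections along the degree filtration\<close>

definition ip :: "(('n \<Rightarrow> nat) \<Rightarrow> complex) \<Rightarrow> (('n \<Rightarrow> nat) \<Rightarrow> complex) \<Rightarrow> complex"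
  where "ip u w = (\<Sum>m\<in>box. u m * cnj (w m))"

lemma ip_self_zero: "ip u u = 0 \<Longrightarrow> m \<in> box \<Longrightarrow> u m = 0"
proof -
  assume "ip u u = 0" and m: "m \<in> box"
  moreover have "complex_of_real (\<Sum>m\<in>box. (cmod (u m))\<^sup>2) = ip u u"
    by (simp only: ip_def of_real_sum complex_norm_square)
  ultimately have "(\<Sum>m\<in>box. (cmod (u m))\<^sup>2) = 0" by (simp only: of_real_eq_0_iff)
  then show "u m = 0" using finite_box m by (simp add: sum_nonneg_eq_0_iff)
qed

lemma ip_add_left: "ip (\<lambda>m. u m + u' m) w = ip u w + ip u' w"
  by (simp add: ip_def distrib_right sum.distrib)
lemma ip_diff_left: "ip (\<lambda>m. u m - u' m) w = ip u w - ip u' w"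
  by (simp add: ip_def left_diff_distrib sum_subtractf)
lemma ip_scl_left: "ip (\<lambda>m. c * u m) w = c * ip u w"
  by (simp add: ip_def sum_distrib_left mult_ac)
lemma ip_add_right: "ip w (\<lambda>m. u m + u' m) = ip w u + ip w u'"
  by (simp add: ip_def distrib_left sum.distrib)
lemma ip_scl_right: "ip w (\<lambda>m. c * u m) = cnj c * ip w u"
  by (simp add: ip_def sum_distrib_left mult_ac)
lemma ip_cnj: "ip u w = cnj (ip w u)"
  by (simp add: ip_def mult.commute)

text \<open>The strict bound makes \<open>Pd (tdeg x)\<close> the part of the filtration properly
  below the monomial \<open>x\<close>, and \<open>Pd 0\<close> the zero space.\<close>

definition Pd :: "nat \<Rightarrow> 'n bipoly set" where "Pd d = {f. Poly_Mapping.keys f \<subseteq> {x. tdeg x < d}}"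

lemma Pd_subspace: "lin_subspace (Pd d)" unfolding Pd_def by (rule lin_subspace_keys)

lemma Pd_mono: "d \<le> e \<Longrightarrow> f \<in> Pd d \<Longrightarrow> f \<in> Pd e"
  unfolding Pd_def by fastforce

lemma finite_tdeg: "finite {x :: 'n bimon. tdeg x < d}"
proof -
  have "{x :: 'n bimon. tdeg x < d} \<subseteq> (\<lambda>(a, b). mon a b) ` ((PiE UNIV (\<lambda>_. {..d})) \<times> (PiE UNIV (\<lambda>_. {..d})))"
  proof
    fix x :: "'n bimon" assume "x \<in> {x. tdeg x < d}"
    then have "xe x i \<le> d" "ye x i \<le> d" for i
      using member_le_sum[of i UNIV "xe x"] member_le_sum[of i UNIV "ye x"] by (auto simp: tdeg_def)
    then have "(xe x, ye x) \<in> PiE UNIV (\<lambda>_. {..d}) \<times> PiE UNIV (\<lambda>_. {..d})"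
      by (simp add: PiE_def Pi_def extensional_def)
    then show "x \<in> (\<lambda>(a, b). mon a b) ` ((PiE UNIV (\<lambda>_. {..d})) \<times> (PiE UNIV (\<lambda>_. {..d})))"
      by (rule rev_image_eqI) simp
  qed
  then show ?thesis by (rule finite_subset) (simp add: finite_PiE)
qed

definition is_perp :: "nat \<Rightarrow> (('n \<Rightarrow> nat) \<Rightarrow> complex) \<Rightarrow> (('n \<Rightarrow> nat) \<Rightarrow> complex) \<Rightarrow> bool"
  where "is_perp d u u' \<longleftrightarrow> (\<exists>f\<in>Pd d. \<forall>m. u' m = u m - Q f m) \<and> (\<forall>g\<in>Pd d. ip u' (Q g) = 0)"

lemma orthogonal_Pd:
  assumes "\<And>x. tdeg x < d \<Longrightarrow> ip u (Q (gen x)) = 0" "g \<in> Pd d" shows "ip u (Q g) = 0"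
proof -
  have Qa: "Q (f + g) = (\<lambda>m. Q f m + Q g m)" "Q (scl c f) = (\<lambda>m. c * Q f m)" for f g c
    by (auto simp: Q_add Q_scl)
  have "g \<in> {g. ip u (Q g) = 0}"
  proof (rule lin_subspace_keys_in)
    have "ip u (Q 0) = 0" by (simp add: ip_def)
    then show "lin_subspace {g. ip u (Q g) = 0}"
      by (simp add: lin_subspace_def Qa ip_add_right ip_scl_right)
  qed (use assms in \<open>auto simp: Pd_def\<close>)
  then show ?thesis by simp
qed

lemma perp_exists: "\<exists>u'. is_perp d u u'"
proof -
  let ?F = "{x :: 'n bimon. tdeg x < d}"
  obtain c where c: "\<forall>y\<in>?F. (\<Sum>m\<in>box. (u m - (\<Sum>x\<in>?F. c x * Q (gen x) m)) * cnj (Q (gen y) m)) = 0"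
    using orthogonal_projection[OF finite_box finite_tdeg[of d], where u = u and g = "\<lambda>x. Q (gen x)"] by blast
  define f where "f = (\<Sum>x\<in>?F. Poly_Mapping.single x (c x))"
  have f: "f \<in> Pd d"
    unfolding f_def by (rule lin_subspaceD(6)[OF Pd_subspace]) (simp add: Pd_def)
  have Qf: "Q f m = (\<Sum>x\<in>?F. c x * Q (gen x) m)" for m
    by (simp add: f_def Q_sum Q_single)
  have "ip (\<lambda>m. u m - Q f m) (Q (gen x)) = 0" if "tdeg x < d" for x
    using c that by (simp add: ip_def Qf)
  then have "\<forall>g\<in>Pd d. ip (\<lambda>m. u m - Q f m) (Q g) = 0" using orthogonal_Pd by blast
  then have "is_perp d u (\<lambda>m. u m - Q f m)" unfolding is_perp_def using f by blast
  then show ?thesis by blast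
qed

text \<open>The difference of two candidates lies in the image of \<open>Pd d\<close> and is
  orthogonal to that image. It is supported in the box, where the form is definite, so it is
  zero.\<close>

lemma perp_unique:
  assumes "is_perp d u u1" "is_perp d u u2" shows "u1 = u2"
proof
  fix m
  obtain f1 f2 where f: "f1 \<in> Pd d" "f2 \<in> Pd d" "\<And>m. u1 m = u m - Q f1 m" "\<And>m. u2 m = u m - Q f2 m"
    using assms unfolding is_perp_def by blast
  have e: "f2 - f1 \<in> Pd d" using f lin_subspaceD(5)[OF Pd_subspace] by blast
  have Qe: "Q (f2 - f1) = (\<lambda>m. u1 m - u2 m)" by (rule ext) (simp add: Q_diff f)
  have "ip u1 (Q (f2 - f1)) = 0" "ip u2 (Q (f2 - f1)) = 0" using assms e unfolding is_perp_def by blast+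
  then have "ip (Q (f2 - f1)) (Q (f2 - f1)) = 0" by (subst (1) Qe) (simp add: ip_diff_left)
  then have "Q (f2 - f1) m = 0" using ip_self_zero Q_support by blast
  then show "u1 m = u2 m" by (simp add: Qe)
qed

definition perp :: "nat \<Rightarrow> (('n \<Rightarrow> nat) \<Rightarrow> complex) \<Rightarrow> ('n \<Rightarrow> nat) \<Rightarrow> complex"
  where "perp d u = (THE u'. is_perp d u u')"

lemma perp_eqI: "is_perp d u u' \<Longrightarrow> perp d u = u'"
  unfolding perp_def by (rule the_equality) (auto intro: perp_unique)

lemma is_perp_perp: "is_perp d u (perp d u)"
  using perp_exists[of d u] perp_eqI by auto

lemma perpE:
  obtains f where "f \<in> Pd d" "\<And>m. perp d u m = u m - Q f m"
  using is_perp_perp[of d u] unfolding is_perp_def by blast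

lemma perp_ex: "\<exists>f\<in>Pd d. \<forall>m. perp d u m = u m - Q f m"
  using is_perp_perp[of d u] unfolding is_perp_def by blast

lemma perp_orth: "g \<in> Pd d \<Longrightarrow> ip (perp d u) (Q g) = 0"
  using is_perp_perp[of d u] unfolding is_perp_def by blast

lemma perp_add: "perp d (\<lambda>m. u m + u' m) = (\<lambda>m. perp d u m + perp d u' m)"
proof (rule perp_eqI)
  obtain f where f: "f \<in> Pd d" "\<And>m. perp d u m = u m - Q f m" using perp_ex by blast
  obtain f' where f': "f' \<in> Pd d" "\<And>m. perp d u' m = u' m - Q f' m" using perp_ex by blast
  have "\<forall>m. perp d u m + perp d u' m = u m + u' m - Q (f + f') m" by (simp add: f f' Q_add)
  moreover have "f + f' \<in> Pd d" using f f' lin_subspaceD(2)[OF Pd_subspace] by blast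
  moreover have o: "\<forall>g\<in>Pd d. ip (\<lambda>m. perp d u m + perp d u' m) (Q g) = 0"
    by (simp add: ip_add_left perp_orth)
  ultimately show "is_perp d (\<lambda>m. u m + u' m) (\<lambda>m. perp d u m + perp d u' m)"
    unfolding is_perp_def using o by blast
qed

lemma perp_scl: "perp d (\<lambda>m. c * u m) = (\<lambda>m. c * perp d u m)"
proof (rule perp_eqI)
  obtain f where f: "f \<in> Pd d" "\<And>m. perp d u m = u m - Q f m" using perp_ex by blast
  have "\<forall>m. c * perp d u m = c * u m - Q (scl c f) m" by (simp add: f Q_scl right_diff_distrib)
  moreover have "scl c f \<in> Pd d" using f lin_subspaceD(3)[OF Pd_subspace] by blast
  moreover have o: "\<forall>g\<in>Pd d. ip (\<lambda>m. c * perp d u m) (Q g) = 0"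
    by (simp add: ip_scl_left perp_orth)
  ultimately show "is_perp d (\<lambda>m. c * u m) (\<lambda>m. c * perp d u m)"
    unfolding is_perp_def using o by blast
qed

lemma perp_Q_support: "m \<notin> box \<Longrightarrow> perp d (Q f) m = 0"
  by (rule perpE[of d "Q f"]) (simp add: Q_support)

lemma perp_Q_zero_iff: "(\<forall>m. perp d (Q f) m = 0) \<longleftrightarrow> (\<exists>g\<in>Pd d. \<forall>m. Q f m = Q g m)"
proof
  assume *: "\<forall>m. perp d (Q f) m = 0"
  obtain g where "g \<in> Pd d" "\<And>m. perp d (Q f) m = Q f m - Q g m" using perp_ex by blast
  with * show "\<exists>g\<in>Pd d. \<forall>m. Q f m = Q g m" by auto
next
  assume "\<exists>g\<in>Pd d. \<forall>m. Q f m = Q g m"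
  then have "is_perp d (Q f) (\<lambda>_. 0)" unfolding is_perp_def by (auto simp: ip_def)
  then show "\<forall>m. perp d (Q f) m = 0" by (simp add: perp_eqI)
qed

text \<open>The symbol map: in degree d it is \<open>Q\<close> modulo the image of lower degrees,
  the quotient being realized as an orthogonal complement. Complements belonging to different
  degrees are orthogonal, so the whole associated graded fits inside A.\<close>

definition Psi :: "'n bipoly \<Rightarrow> ('n \<Rightarrow> nat) \<Rightarrow> complex"
  where "Psi = lext (\<lambda>x. perp (tdeg x) (Q (gen x)))"

lemma Psi_add: "Psi (f + g) m = Psi f m + Psi g m" by (simp add: Psi_def lext_add)
lemma Psi_scl: "Psi (scl c f) m = c * Psi f m" by (simp add: Psi_def lext_scl)
lemma Psi_diff: "Psi (f - g) m = Psi f m - Psi g m" by (simp add: Psi_def lext_diff)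
lemma Psi_zero [simp]: "Psi 0 m = 0" by (simp add: Psi_def)
lemma Psi_sum: "Psi (sum F A) m = (\<Sum>a\<in>A. Psi (F a) m)" by (simp add: Psi_def lext_sum)
lemma Psi_gen: "Psi (gen x) = perp (tdeg x) (Q (gen x))" by (rule ext) (simp add: Psi_def)

lemma Psi_support: "m \<notin> box \<Longrightarrow> Psi f m = 0"
  by (simp add: Psi_def lext_def perp_Q_support)

lemma perp_Q_add: "perp d (Q (f + g)) m = perp d (Q f) m + perp d (Q g) m"
  and perp_Q_scl: "perp d (Q (scl c f)) m = c * perp d (Q f) m"
proof -
  have "Q (f + g) = (\<lambda>m. Q f m + Q g m)" "Q (scl c f) = (\<lambda>m. c * Q f m)" by (auto simp: Q_add Q_scl)
  then show "perp d (Q (f + g)) m = perp d (Q f) m + perp d (Q g) m" "perp d (Q (scl c f)) m = c * perp d (Q f) m"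
    by (simp_all add: perp_add perp_scl)
qed

lemma Psi_homogeneous:
  assumes "\<And>x. x \<in> Poly_Mapping.keys f \<Longrightarrow> tdeg x = d" shows "Psi f m = perp d (Q f) m"
  by (rule functional_eqI[where T = "\<lambda>f. Psi f m" and T' = "\<lambda>f. perp d (Q f) m"])
     (simp_all add: Psi_add Psi_scl perp_Q_add perp_Q_scl Psi_gen assms)

abbreviation comp :: "nat \<Rightarrow> 'n bipoly \<Rightarrow> 'n bipoly" where "comp d \<equiv> restr (\<lambda>x. tdeg x = d)"

lemma Psi_comp: "Psi (comp d f) m = perp d (Q (comp d f)) m"
  by (rule Psi_homogeneous) (simp add: keys_restr)

lemma comp_Pd: "comp d f \<in> Pd (Suc d)"
  by (auto simp: Pd_def keys_restr)

text \<open>For d < e the symbol of the degree d component lies in the image of \<open>Pd e\<close>,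
  to which the symbol of the degree e component is orthogonal. Hence \<open>Psi f\<close> vanishes
  iff every component does, and a projection vanishes iff the vector comes from lower
  degree.\<close>

lemma Psi_zero_iff: "(\<forall>m. Psi f m = 0) \<longleftrightarrow> (\<forall>d. \<exists>g\<in>Pd d. \<forall>m. Q (comp d f) m = Q g m)"
proof -
  define D where "D = tdeg ` Poly_Mapping.keys f"
  have D: "finite D" "(\<Sum>d\<in>D. comp d f) = f" by (auto simp: D_def intro!: sum_restr)
  have PD: "Psi f m = (\<Sum>d\<in>D. Psi (comp d f) m)" for m by (subst D(2)[symmetric]) (simp only: Psi_sum)
  have orth: "ip (Psi (comp e f)) (Psi (comp d f)) = 0" if "d < e" for d e
  proof -
    obtain g where g: "g \<in> Pd d" "\<And>m. perp d (Q (comp d f)) m = Q (comp d f) m - Q g m" using perp_ex by blast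
    have "g \<in> Pd (Suc d)" using Pd_mono[OF _ g(1), of "Suc d"] by simp
    then have "comp d f - g \<in> Pd (Suc d)" using lin_subspaceD(5)[OF Pd_subspace comp_Pd] by blast
    then have "comp d f - g \<in> Pd e" using Pd_mono[of "Suc d" e] that by simp
    then have "ip (perp e (Q (comp e f))) (Q (comp d f - g)) = 0" by (rule perp_orth)
    moreover have "Psi (comp d f) = Q (comp d f - g)" by (rule ext) (simp add: Psi_comp g Q_diff)
    moreover have "Psi (comp e f) = perp e (Q (comp e f))" by (rule ext) (rule Psi_comp)
    ultimately show ?thesis by simp
  qed
  have orth': "ip (Psi (comp d f)) (Psi (comp e f)) = 0" if "d \<noteq> e" for d e
    using that orth[of d e] orth[of e d] ip_cnj[of "Psi (comp d f)" "Psi (comp e f)"] by (cases "d < e") auto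
  have "(\<forall>m. Psi f m = 0) \<longleftrightarrow> (\<forall>d m. Psi (comp d f) m = 0)"
  proof
    assume *: "\<forall>m. Psi f m = 0"
    show "\<forall>d m. Psi (comp d f) m = 0"
    proof (intro allI)
      fix d m
      show "Psi (comp d f) m = 0"
      proof (cases "d \<in> D")
        case True
        have "ip (Psi (comp d f)) (Psi f) = (\<Sum>e\<in>D. ip (Psi (comp d f)) (Psi (comp e f)))"
          unfolding ip_def PD by (simp add: sum_distrib_left) (rule sum.swap)
        also have "\<dots> = (\<Sum>e\<in>D. if e = d then ip (Psi (comp d f)) (Psi (comp d f)) else 0)"
          by (intro sum.cong) (auto simp: orth')
        also have "\<dots> = ip (Psi (comp d f)) (Psi (comp d f))" using D True by simp
        finally have "ip (Psi (comp d f)) (Psi (comp d f)) = 0" using * by (simp add: ip_def)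
        then show ?thesis using ip_self_zero Psi_support by blast
      next
        case False
        then have "comp d f = 0" by (intro poly_mapping_eqI) (auto simp: lookup_restr D_def in_keys_iff)
        then show ?thesis by simp
      qed
    qed
  qed (simp add: PD)
  then show ?thesis by (simp only: Psi_comp perp_Q_zero_iff)
qed

definition kernel :: "'n bipoly set" where "kernel = {f. \<forall>m. Psi f m = 0}"

lemma kernel_subspace: "lin_subspace kernel"
  by (simp add: lin_subspace_def kernel_def Psi_add Psi_scl)

lemma tdeg_single: "tdeg (Poly_Mapping.single z 1 :: 'n bimon) = 1"
  by (cases z) (simp_all add: tdeg_def lookup_single when_def)

lemma comp_Var_Suc: "comp (Suc d) (Var z * f) = Var z * comp d f"
  by (rule linear_eqI[where T = "\<lambda>f. comp (Suc d) (Var z * f)" and T' = "\<lambda>f. Var z * comp d f"])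
     (simp_all only: distrib_left restr_add scl_mult_right restr_scl Var_mult_gen restr_gen tdeg_add tdeg_single
        plus_1_eq_Suc nat.inject mult_zero_right if_distrib[of "\<lambda>x. Var z * x"])

lemma comp_Var_0: "comp 0 (Var z * f) = 0"
  by (rule linear_eqI[where T = "\<lambda>f. comp 0 (Var z * f)" and T' = "\<lambda>f. 0"])
     (simp_all only: distrib_left restr_add scl_mult_right restr_scl Var_mult_gen restr_gen tdeg_add tdeg_single
        plus_1_eq_Suc nat.distinct if_False add_0_left scl_zero_right)

lemma Var_Pd: assumes "g \<in> Pd d" shows "Var z * g \<in> Pd (Suc d)"
proof -
  have "g \<in> {g. Var z * g \<in> Pd (Suc d)}"
  proof (rule lin_subspace_keys_in)
    show "lin_subspace {g. Var z * g \<in> Pd (Suc d)}"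
      using lin_subspaceD(1-3)[OF Pd_subspace[of "Suc d"]]
      by (simp add: lin_subspace_def distrib_left scl_mult_right)
    fix x assume "x \<in> Poly_Mapping.keys g"
    then have "tdeg x < d" using assms by (auto simp: Pd_def)
    then show "gen x \<in> {g. Var z * g \<in> Pd (Suc d)}"
      unfolding mem_Collect_eq Var_mult_gen Pd_def by (simp add: tdeg_add tdeg_single[simplified])
  qed
  then show ?thesis by simp
qed

lemma K_Pd: assumes "g \<in> Pd d" shows "Kop i g \<in> Pd d"
  unfolding Kop_def pext_def
proof (rule lin_subspaceD(6)[OF Pd_subspace])
  fix x assume "x \<in> Poly_Mapping.keys g"
  then have "tdeg x < d" using assms by (auto simp: Pd_def)
  moreover have "tdeg (mon ((xe x)(i := xe x i - 1)) (ye x)) \<le> tdeg x"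
    unfolding tdeg_def by (simp add: sum_mono)
  ultimately show "scl (Poly_Mapping.lookup g x) (Poly_Mapping.single (mon ((xe x)(i := xe x i - 1)) (ye x)) (kap (xe x i) (ye x i))) \<in> Pd d"
    by (simp add: scl_single Pd_def)
qed

text \<open>If a component of \<open>f\<close> acts on v like something of lower degree, so does its
  product with a variable, because multiplication by x_i and application of Y_i can be applied to
  both sides in A.\<close>

lemma kernel_Var: assumes "f \<in> kernel" shows "Var z * f \<in> kernel"
proof -
  have "\<exists>g\<in>Pd d. \<forall>m. Q (comp d (Var z * f)) m = Q g m" for d
  proof (cases d)
    case 0
    then show ?thesis using lin_subspaceD(1)[OF Pd_subspace] by (intro bexI[of _ 0]) (simp_all add: comp_Var_0)
  next
    case (Suc e)
    obtain g where g: "g \<in> Pd e" "\<And>m. Q (comp e f) m = Q g m"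
      using assms Psi_zero_iff unfolding kernel_def by blast
    then have Qg: "Q (comp e f) = Q g" by auto
    show ?thesis
    proof (cases z)
      case (Inl i)
      have "Q (Var z * comp e f) m = Q (Var z * g) m" for m
        unfolding Inl X_Q[symmetric] Qg ..
      then show ?thesis using Var_Pd[OF g(1)] Suc by (auto simp: comp_Var_Suc)
    next
      case (Inr i)
      \<comment> \<open>Apply Y_i to the equal vectors \<open>Q (comp e f)\<close> and
        \<open>Q g\<close>, expand both sides by \<open>Y_Q\<close> and solve for the leading term;
        both corrections stay in degree at most e.\<close>
      let ?g = "Var z * g + Kop i g - Kop i (comp e f)"
      have "Q (Var z * comp e f) m = Q ?g m" for m
        using Y_Q[of i "comp e f" m] Y_Q[of i g m] unfolding Inr Qg by (simp add: Q_add Q_diff)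
      moreover have "?g \<in> Pd (Suc e)"
        using Var_Pd[OF g(1)] K_Pd[OF Pd_mono[OF _ g(1)], of "Suc e"] K_Pd[OF comp_Pd]
          lin_subspaceD(2,5)[OF Pd_subspace] by (meson le_SucI order_refl)
      ultimately show ?thesis using Suc by (auto simp: comp_Var_Suc)
    qed
  qed
  then show ?thesis using Psi_zero_iff unfolding kernel_def by blast
qed

lemma kernel_gen: "f \<in> kernel \<Longrightarrow> gen x * f \<in> kernel"
proof (induction "tdeg x" arbitrary: x)
  case 0
  then have "x = 0" using tdeg_eq_0_iff[of x] by simp
  with 0 show ?case by simp
next
  case (Suc k)
  have "x \<noteq> 0" using Suc.hyps(2) tdeg_eq_0_iff[of x] by auto
  then obtain z where z: "Poly_Mapping.lookup x z > 0"
    by (metis poly_mapping_eqI lookup_zero gr0I)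
  define y where "y = x - Poly_Mapping.single z 1"
  have xy: "x = Poly_Mapping.single z 1 + y"
    using z by (intro poly_mapping_eqI) (auto simp: y_def lookup_add lookup_minus lookup_single when_def)
  then have "tdeg x = tdeg (Poly_Mapping.single z 1) + tdeg y" by (simp only: tdeg_add)
  then have "k = tdeg y" using Suc.hyps(2) unfolding tdeg_single by simp
  then have "gen y * f \<in> kernel" using Suc by blast
  then have "Var z * (gen y * f) \<in> kernel" by (rule kernel_Var)
  then show ?case unfolding mult.assoc[symmetric] Var_mult_gen xy[symmetric] .
qed

lemma kernel_mult: assumes "f \<in> kernel" shows "f * g \<in> kernel"
proof -
  have "g \<in> {g. g * f \<in> kernel}"
    by (rule lin_subspace_keys_in)
       (use kernel_gen assms lin_subspaceD(1-3)[OF kernel_subspace] in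
        \<open>simp_all add: lin_subspace_def distrib_right scl_mult_left\<close>)
  then show ?thesis by (simp add: mult.commute)
qed

end

section \<open>Equivariance, grading and surjectivity of the symbol map\<close>

context coinv_model
begin

lemma chi_nonzero: "(\<And>i. \<eta> i ^ r = 1) \<Longrightarrow> chi \<sigma> \<eta> \<noteq> 0"
proof -
  assume \<eta>: "\<And>i. \<eta> i ^ r = 1"
  have "\<eta> i \<noteq> 0" for i using \<eta>[of i] r_gt_1 by (cases "\<eta> i = 0") (simp_all add: power_0_left)
  then show ?thesis by (simp add: chi_def sign_def)
qed

lemma ip_U:
  assumes \<sigma>: "\<sigma> permutes UNIV" and \<eta>: "\<And>i. \<eta> i ^ r = 1"
  shows "ip (Uop \<sigma> \<eta> u) (Uop \<sigma> \<eta> w) = ip u w"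
proof -
  have n: "\<eta> i * cnj (\<eta> i) = 1" for i
  proof -
    have "cmod (\<eta> i) ^ r = 1" using \<eta>[of i] by (metis norm_one norm_power)
    then have "cmod (\<eta> i) = 1" using power_eq_imp_eq_base[of "cmod (\<eta> i)" r 1] r_gt_1 by simp
    then show ?thesis using complex_norm_square[of "\<eta> i"] by simp
  qed
  have "(\<Prod>i\<in>UNIV. \<eta> i ^ m i) * cnj (\<Prod>i\<in>UNIV. \<eta> i ^ m i) = 1" for m :: "'n \<Rightarrow> nat"
    by (simp add: n flip: prod.distrib power_mult_distrib)
  then have e: "Uop \<sigma> \<eta> u m * cnj (Uop \<sigma> \<eta> w m) = u (\<lambda>i. m (\<sigma> i)) * cnj (w (\<lambda>i. m (\<sigma> i)))" for m
  proof -
    assume *: "\<And>m :: 'n \<Rightarrow> nat. (\<Prod>i\<in>UNIV. \<eta> i ^ m i) * cnj (\<Prod>i\<in>UNIV. \<eta> i ^ m i) = 1"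
    have "Uop \<sigma> \<eta> u m * cnj (Uop \<sigma> \<eta> w m) = ((\<Prod>i\<in>UNIV. \<eta> i ^ m (\<sigma> i)) * cnj (\<Prod>i\<in>UNIV. \<eta> i ^ m (\<sigma> i)))
        * (u (\<lambda>i. m (\<sigma> i)) * cnj (w (\<lambda>i. m (\<sigma> i))))"
      by (simp only: Uop_def complex_cnj_mult mult_ac)
    then show ?thesis by (simp only: *[of "\<lambda>i. m (\<sigma> i)"] mult_1_left)
  qed
  note [simp] = permutes_inverses[OF \<sigma>]
  show ?thesis unfolding ip_def e
    by (rule sum.reindex_bij_witness[of _ "\<lambda>m i. m (finv \<sigma> i)" "\<lambda>m i. m (\<sigma> i)"]) (auto simp: box_def)
qed

lemma pact_Pd: assumes "\<sigma> permutes UNIV" "f \<in> Pd d" shows "pact \<sigma> \<eta> f \<in> Pd d"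
  unfolding pact_def pext_def
proof (rule lin_subspaceD(6)[OF Pd_subspace])
  fix x assume "x \<in> Poly_Mapping.keys f"
  then have "tdeg (pperm \<sigma> x) < d" using assms by (auto simp: Pd_def tdeg_pperm)
  then show "scl (Poly_Mapping.lookup f x) (Poly_Mapping.single (pperm \<sigma> x) (pcoef \<eta> x)) \<in> Pd d"
    by (simp add: scl_single Pd_def)
qed

text \<open>The entries are roots of unity, so W acts unitarily; it also preserves the filtration.
  Hence it commutes with the projections.\<close>

lemma perp_U:
  assumes \<sigma>: "\<sigma> permutes UNIV" and \<eta>: "\<And>i. \<eta> i ^ r = 1"
  shows "perp d (Uop \<sigma> \<eta> u) = Uop \<sigma> \<eta> (perp d u)"
proof (rule perp_eqI)
  have nz: "\<eta> i \<noteq> 0" for i using \<eta>[of i] r_gt_1 by (cases "\<eta> i = 0") (simp_all add: power_0_left)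
  note c = chi_nonzero[of \<eta> \<sigma>, OF \<eta>]
  obtain f where f: "f \<in> Pd d" "\<And>m. perp d u m = u m - Q f m" using perp_ex by blast
  have "Uop \<sigma> \<eta> (perp d u) m = Uop \<sigma> \<eta> u m - Uop \<sigma> \<eta> (Q f) m" for m
    by (simp add: Uop_def f right_diff_distrib)
  then have "Uop \<sigma> \<eta> (perp d u) m = Uop \<sigma> \<eta> u m - Q (scl (chi \<sigma> \<eta>) (pact \<sigma> \<eta> f)) m" for m
    by (simp add: U_Q[OF \<sigma> \<eta>] Q_scl)
  moreover have "scl (chi \<sigma> \<eta>) (pact \<sigma> \<eta> f) \<in> Pd d"
    using pact_Pd[OF \<sigma> f(1)] lin_subspaceD(3)[OF Pd_subspace] by blast
  moreover have "ip (Uop \<sigma> \<eta> (perp d u)) (Q g) = 0" if g: "g \<in> Pd d" for g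
  proof -
    define g' where "g' = pact (finv \<sigma>) (\<lambda>i. inverse (\<eta> (finv \<sigma> i))) g"
    have g': "g' \<in> Pd d" unfolding g'_def by (rule pact_Pd[OF permutes_inv[OF \<sigma>] g])
    have "pact \<sigma> \<eta> g' = g" unfolding g'_def by (rule pact_inverse[OF \<sigma> nz])
    then have "Uop \<sigma> \<eta> (Q g') m = chi \<sigma> \<eta> * Q g m" for m by (simp add: U_Q[OF \<sigma> \<eta>])
    then have "Q g m = inverse (chi \<sigma> \<eta>) * Uop \<sigma> \<eta> (Q g') m" for m using c by simp
    then have Qg: "Q g = (\<lambda>m. inverse (chi \<sigma> \<eta>) * Uop \<sigma> \<eta> (Q g') m)" by blast
    show ?thesis unfolding Qg ip_scl_right ip_U[OF \<sigma> \<eta>] using perp_orth[OF g'] by simp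
  qed
  ultimately show "is_perp d (Uop \<sigma> \<eta> u) (Uop \<sigma> \<eta> (perp d u))" unfolding is_perp_def by blast
qed

lemma Psi_U:
  assumes \<sigma>: "\<sigma> permutes UNIV" and \<eta>: "\<And>i. \<eta> i ^ r = 1"
  shows "Uop \<sigma> \<eta> (Psi f) m = chi \<sigma> \<eta> * Psi (pact \<sigma> \<eta> f) m"
proof (rule functional_eqI[where T = "\<lambda>f. Uop \<sigma> \<eta> (Psi f) m" and T' = "\<lambda>f. chi \<sigma> \<eta> * Psi (pact \<sigma> \<eta> f) m"])
  fix x
  have "Uop \<sigma> \<eta> (Psi (gen x)) m = perp (tdeg x) (Uop \<sigma> \<eta> (Q (gen x))) m"
    by (simp only: Psi_gen perp_U[OF \<sigma> \<eta>])
  also have "Uop \<sigma> \<eta> (Q (gen x)) = (\<lambda>m. chi \<sigma> \<eta> * Q (pact \<sigma> \<eta> (gen x)) m)"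
    by (rule ext) (rule U_Q[OF \<sigma> \<eta>])
  also have "perp (tdeg x) \<dots> m = chi \<sigma> \<eta> * perp (tdeg x) (Q (pact \<sigma> \<eta> (gen x))) m"
    by (simp only: perp_scl)
  also have "perp (tdeg x) (Q (pact \<sigma> \<eta> (gen x))) m = Psi (pact \<sigma> \<eta> (gen x)) m"
    by (rule Psi_homogeneous[symmetric]) (simp add: tdeg_pperm[OF \<sigma>] split: if_splits)
  finally show "Uop \<sigma> \<eta> (Psi (gen x)) m = chi \<sigma> \<eta> * Psi (pact \<sigma> \<eta> (gen x)) m" .
qed (simp_all add: Uop_def Psi_add Psi_scl pact_add pact_scl distrib_left)

lemma kernel_pact:
  assumes "G_data r p \<sigma> \<eta>" "f \<in> kernel" shows "pact \<sigma> \<eta> f \<in> kernel"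
proof -
  have \<sigma>: "\<sigma> permutes UNIV" and \<eta>: "\<And>i. \<eta> i ^ r = 1" using assms by (auto simp: G_data_def)
  have "Uop \<sigma> \<eta> (Psi f) m = 0" for m using assms(2) by (simp add: Uop_def kernel_def)
  then have "chi \<sigma> \<eta> * Psi (pact \<sigma> \<eta> f) m = 0" for m by (simp add: Psi_U[OF \<sigma> \<eta>])
  then show ?thesis using chi_nonzero[of \<eta> \<sigma>, OF \<eta>] by (simp add: kernel_def)
qed

lemma mon_deg_eq: "mon_deg x = int (\<Sum>i\<in>UNIV. xe x i) - int (\<Sum>i\<in>UNIV. ye x i)"
  by (simp add: mon_deg_def)

text \<open>Cutting a vector down to one polynomial degree (\<open>E\<close>) is self-adjoint and
  maps the image of \<open>Pd d\<close> to itself. The cut-down symbol therefore satisfies the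
  characterization of the projection, and uniqueness identifies it with the symbol.\<close>

lemma Psi_gen_degree:
  assumes "Psi (gen x) m \<noteq> 0" shows "int (\<Sum>i\<in>UNIV. m i) = int N + mon_deg x"
proof -
  define e where "e = mon_deg x"
  define E where "E u m = (if int (\<Sum>i\<in>UNIV. m i) = int N + e then u m else 0)" for u :: "('n \<Rightarrow> nat) \<Rightarrow> complex" and m
  have deg: "int (\<Sum>i\<in>UNIV. m i) = int N + mon_deg y" if "Q (gen y) m \<noteq> 0" for y m
  proof -
    have "(\<Sum>i\<in>UNIV. m i) + (\<Sum>i\<in>UNIV. ye y i) = N + (\<Sum>i\<in>UNIV. xe y i)"
      using that by (intro qq_degree) (simp add: Q_single)
    then show ?thesis unfolding mon_deg_eq by linarith
  qed
  have EQ: "E (Q f) m = Q (restr (\<lambda>y. mon_deg y = e) f) m" for f m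
  proof (rule functional_eqI[where T = "\<lambda>f. E (Q f) m" and T' = "\<lambda>f. Q (restr (\<lambda>y. mon_deg y = e) f) m"])
    fix y
    show "E (Q (gen y)) m = Q (restr (\<lambda>y. mon_deg y = e) (gen y)) m"
    proof (cases "Q (gen y) m = 0")
      case False
      then show ?thesis using deg[OF False] by (simp add: restr_gen E_def)
    qed (simp add: restr_gen E_def)
  qed (simp_all add: E_def Q_add Q_scl restr_add restr_scl)
  have restr_Pd: "restr P f \<in> Pd d" if "f \<in> Pd d" for P f d
    using that by (auto simp: Pd_def keys_restr)
  have Esa: "ip (E u) w = ip u (E w)" for u w
    unfolding ip_def by (intro sum.cong) (auto simp: E_def)
  obtain f where f: "f \<in> Pd (tdeg x)" "\<And>m. Psi (gen x) m = Q (gen x) m - Q f m"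
    unfolding Psi_gen using perp_ex by blast
  have "E (Psi (gen x)) m = E (Q (gen x)) m - E (Q f) m" for m by (simp add: E_def f)
  then have "E (Psi (gen x)) m = Q (gen x) m - Q (restr (\<lambda>y. mon_deg y = e) f) m" for m
    unfolding EQ by (simp add: restr_gen e_def)
  moreover have "ip (E (Psi (gen x))) (Q g) = 0" if "g \<in> Pd (tdeg x)" for g
  proof -
    have "E (Q g) = Q (restr (\<lambda>y. mon_deg y = e) g)" by (rule ext) (rule EQ)
    then show ?thesis unfolding Esa Psi_gen using perp_orth[OF restr_Pd[OF that]] by simp
  qed
  ultimately have "is_perp (tdeg x) (Q (gen x)) (E (Psi (gen x)))"
    unfolding is_perp_def using restr_Pd[OF f(1)] by blast
  then have "Psi (gen x) = E (Psi (gen x))" unfolding Psi_gen by (rule perp_eqI)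
  then have "E (Psi (gen x)) m \<noteq> 0" using assms by simp
  then show ?thesis by (simp add: E_def e_def split: if_splits)
qed

lemma Psi_degree:
  assumes "\<And>x. x \<in> Poly_Mapping.keys f \<Longrightarrow> mon_deg x = e" "Psi f m \<noteq> 0"
  shows "int (\<Sum>i\<in>UNIV. m i) = int N + e"
proof -
  have "(\<Sum>x\<in>Poly_Mapping.keys f. Poly_Mapping.lookup f x * Psi (gen x) m) \<noteq> 0"
    using assms(2) by (simp add: Psi_def lext_def)
  then obtain x where "x \<in> Poly_Mapping.keys f" "Psi (gen x) m \<noteq> 0"
    by (metis (no_types, lifting) mult_zero_right sum.neutral)
  then show ?thesis using Psi_gen_degree assms(1) by blast
qed

text \<open>Triangularity: \<open>Q f\<close> minus the symbol of the top component of
  \<open>f\<close> is \<open>Q\<close> of something of lower degree, and induction applies.\<close>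

lemma Q_in_range_Psi: "f \<in> Pd d \<Longrightarrow> \<exists>f'. \<forall>m. Psi f' m = Q f m"
proof (induction d arbitrary: f)
  case 0
  then have "Poly_Mapping.keys f = {}" by (simp add: Pd_def)
  then have "f = 0" by simp
  then show ?case by (intro exI[of _ 0]) simp
next
  case (Suc d)
  obtain g where g: "g \<in> Pd d" "\<And>m. Psi (comp d f) m = Q (comp d f) m - Q g m"
    unfolding Psi_comp using perp_ex by blast
  have "f - comp d f \<in> Pd d"
    using Suc.prems by (auto simp: Pd_def in_keys_iff lookup_minus lookup_restr less_Suc_eq split: if_splits)
  then have "g + (f - comp d f) \<in> Pd d" using g lin_subspaceD(2)[OF Pd_subspace] by blast
  then obtain f' where f': "\<And>m. Psi f' m = Q (g + (f - comp d f)) m" using Suc.IH by blast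
  have "Psi (comp d f + f') m = Q f m" for m
    by (simp add: Psi_add g f' Q_add Q_diff)
  then show ?case by blast
qed

lemma Psi_surj:
  assumes "\<And>m. m \<notin> box \<Longrightarrow> u m = 0" shows "\<exists>f. \<forall>m. Psi f m = u m"
proof -
  obtain c where c: "c \<noteq> 0" "\<And>a m. a \<in> box \<Longrightarrow> Q (gen (mon a (\<lambda>i. eps + r * idx i))) m = c * of_bool (m = a)"
    using Q_surj by blast
  define f where "f = (\<Sum>a\<in>box. scl (u a / c) (gen (mon a (\<lambda>i. eps + r * idx i))))"
  have "Q f m = u m" for m
  proof -
    have "Q f m = (\<Sum>a\<in>box. if a = m then u a else 0)"
      unfolding f_def Q_sum Q_scl by (intro sum.cong) (auto simp: c)
    then show ?thesis using assms[of m] by (simp add: finite_box)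
  qed
  moreover have "f \<in> Pd (Suc (Max (insert 0 (tdeg ` Poly_Mapping.keys f))))"
    by (auto simp: Pd_def less_Suc_eq_le)
  then obtain f' where "\<forall>m. Psi f' m = Q f m" using Q_in_range_Psi by blast
  ultimately show ?thesis by auto
qed

lemma Psi_surj_graded:
  assumes "\<And>m. \<not> (m \<in> box \<and> int (\<Sum>i\<in>UNIV. m i) = int N + e) \<Longrightarrow> u m = 0"
  shows "\<exists>f. (\<forall>x\<in>Poly_Mapping.keys f. mon_deg x = e) \<and> (\<forall>m. Psi f m = u m)"
proof -
  obtain f where f: "\<And>m. Psi f m = u m" using Psi_surj[of u] assms by blast
  define f' where "f' = restr (\<lambda>x. mon_deg x = e) f"
  have "Psi f' m = u m" for m
  proof (cases "int (\<Sum>i\<in>UNIV. m i) = int N + e")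
    case True
    have "Psi f' m = Psi f m" unfolding f'_def
    proof (rule functional_eqI[where T = "\<lambda>f. Psi (restr (\<lambda>x. mon_deg x = e) f) m" and T' = "\<lambda>f. Psi f m"])
      fix x
      show "Psi (restr (\<lambda>x. mon_deg x = e) (gen x)) m = Psi (gen x) m"
      proof (cases "Psi (gen x) m = 0")
        case False
        then show ?thesis using Psi_gen_degree[OF False] True by (simp add: restr_gen)
      qed (simp add: restr_gen)
    qed (simp_all add: restr_add restr_scl Psi_add Psi_scl)
    then show ?thesis by (simp add: f)
  next
    case False
    then have "Psi f' m = 0" using Psi_degree[of f' e m] by (auto simp: f'_def keys_restr)
    then show ?thesis using assms False by simp
  qed
  then show ?thesis by (intro exI[of _ f']) (simp add: f'_def keys_restr)
qed

section \<open>Semi-invariants in A\<close>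

definition zeta :: complex where "zeta = exp (2 * of_real pi * \<i> / of_nat r)"

lemma zeta_power: "zeta ^ j = exp (2 * of_real pi * \<i> * of_nat j / of_nat r)"
  by (simp add: zeta_def mult_ac flip: exp_of_nat_mult)

lemma zeta_power_eq_iff: "zeta ^ j = zeta ^ k \<longleftrightarrow> j mod r = k mod r"
  unfolding zeta_power using r_gt_1 by (intro complex_root_unity_eq) simp

lemma zeta_root: "zeta ^ r = 1" "zeta \<noteq> 0"
  using zeta_power_eq_iff[of r 0] by (simp_all add: zeta_def)

text \<open>Diagonal matrices fix the residues of the exponents, transpositions make the exponents
  distinct, and the bound h then leaves only permutations of the exponents of v.\<close>

lemma semi_invariant_support:
  assumes u: "\<And>\<sigma> \<eta> m. G_data r p \<sigma> \<eta> \<Longrightarrow> Uop \<sigma> \<eta> u m = chi \<sigma> \<eta> * u m"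
    and m: "m \<in> box" "u m \<noteq> 0"
  obtains \<pi> where "\<pi> permutes UNIV" "\<And>i. m i = eps + r * idx (\<pi> i)"
proof -
  have diag: "(\<Prod>i\<in>UNIV. \<eta> i ^ m i) = (\<Prod>i\<in>UNIV. \<eta> i ^ eps)"
    if "\<And>i. \<eta> i ^ r = 1" "(\<Prod>i\<in>UNIV. \<eta> i) ^ (r div p) = 1" for \<eta> :: "'n \<Rightarrow> complex"
  proof -
    have "G_data r p id \<eta>" using that by (simp add: G_data_def permutes_id)
    from u[OF this, of m] show ?thesis using m(2) by (simp add: Uop_def chi_def)
  qed
  have mod_s: "m i mod s = eps mod s" for i
  proof -
    \<comment> \<open>A single nontrivial entry \<open>zeta ^ p\<close> is admissible, since its
      s-th power is \<open>zeta ^ r = 1\<close>.\<close>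
    define \<eta> where "\<eta> j = (if j = i then zeta ^ p else 1)" for j
    have pr: "(\<Prod>j\<in>UNIV. \<eta> j ^ k j) = zeta ^ (p * k i)" for k :: "'n \<Rightarrow> nat"
    proof -
      have "(\<Prod>j\<in>UNIV. \<eta> j ^ k j) = (\<Prod>j\<in>UNIV. if j = i then zeta ^ (p * k i) else 1)"
        by (intro prod.cong) (auto simp: \<eta>_def power_mult)
      then show ?thesis by simp
    qed
    have "zeta ^ (p * m i) = zeta ^ (p * eps)"
    proof -
      have "(zeta ^ p) ^ r = 1" by (metis mult.commute power_mult power_one zeta_root(1))
      then have "\<eta> j ^ r = 1" for j by (simp add: \<eta>_def)
      moreover have "(\<Prod>j\<in>UNIV. \<eta> j) ^ (r div p) = 1"
        using pr[of "\<lambda>_. 1"] by (simp add: mult.commute[of p] s_mult_p zeta_root flip: power_mult s_def)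
      ultimately show ?thesis using diag[of \<eta>] pr[of m] pr[of "\<lambda>_. eps"] by simp
    qed
    then have "(p * m i) mod (p * s) = (p * eps) mod (p * s)"
      unfolding zeta_power_eq_iff by (simp add: s_mult_p mult.commute[of p s])
    then show ?thesis using p_pos by (simp add: mod_mult_mult1)
  qed
  have mod_r: "m i mod r = m j mod r" for i j
  proof (cases "i = j")
    case False
    \<comment> \<open>Entries \<open>zeta\<close> and its inverse have product 1, so this diagonal
      matrix lies in W for every p.\<close>
    define \<eta> where "\<eta> l = (if l = i then zeta else if l = j then inverse zeta else 1)" for l
    have pr: "(\<Prod>l\<in>UNIV. \<eta> l ^ k l) = zeta ^ k i * inverse zeta ^ k j" for k :: "'n \<Rightarrow> nat"
    proof -
      have "(\<Prod>l\<in>UNIV. \<eta> l ^ k l) = (\<Prod>l\<in>UNIV. (if l = i then zeta ^ k i else 1) * (if l = j then inverse zeta ^ k j else 1))"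
        using False by (intro prod.cong) (auto simp: \<eta>_def)
      then show ?thesis by (simp add: prod.distrib)
    qed
    have "zeta ^ m i * inverse zeta ^ m j = 1"
      using diag[of \<eta>] pr[of m] pr[of "\<lambda>_. eps"] pr[of "\<lambda>_. 1"] zeta_root
      by (simp add: \<eta>_def power_inverse flip: power_mult_distrib)
    then have "zeta ^ m i = zeta ^ m j" using zeta_root(2) by (simp add: field_simps)
    then show ?thesis unfolding zeta_power_eq_iff .
  qed simp
  have inj: "m i \<noteq> m j" if "i \<noteq> j" for i j
  proof
    assume e: "m i = m j"
    let ?t = "Transposition.transpose i j"
    have t: "?t permutes UNIV" by (simp add: permutes_swap_id)
    have "G_data r p ?t (\<lambda>_. 1)" using t by (simp add: G_data_def)
    from u[OF this, of m] have "u (\<lambda>l. m (?t l)) = - u m"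
      using that by (simp add: Uop_def chi_def sign_swap_id)
    moreover have "(\<lambda>l. m (?t l)) = m" using e by (auto simp: Transposition.transpose_def)
    ultimately show False using m(2) by simp
  qed
  define k where "k i = m i div r" for i
  define c where "c = m undefined mod r"
  have mk: "m i = r * k i + c" for i using mod_r[of i undefined] mult_div_mod_eq[of r "m i"] by (simp add: k_def c_def)
  have kinj: "inj k"
  proof (rule injI)
    fix i j assume "k i = k j"
    then have "m i = m j" unfolding mk[of i] mk[of j] by simp
    then show "i = j" using inj by blast
  qed
  have cs: "c mod s = eps"
  proof -
    have "s dvd r" using s_mult_p by (metis dvd_triv_left)
    then have "c mod s = m undefined mod s" unfolding c_def by (rule mod_mod_cancel)
    then show ?thesis using mod_s[of undefined] eps_less by simp
  qed
  \<comment> \<open>The n distinct quotients cannot all lie below n - 1.\<close>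
  obtain i0 where i0: "CARD('n) - 1 \<le> k i0"
  proof (rule ccontr)
    assume nt: "\<not> thesis"
    have "k i < CARD('n) - 1" for i
    proof (rule ccontr)
      assume "\<not> k i < CARD('n) - 1"
      then have "CARD('n) - 1 \<le> k i" by simp
      then show False using nt that by blast
    qed
    then have "range k \<subseteq> {..<CARD('n) - 1}" by auto
    then have "card (range k) \<le> CARD('n) - 1" by (metis card_lessThan card_mono finite_lessThan)
    moreover have "card (range k) = CARD('n)" by (simp add: card_image kinj)
    moreover have "CARD('n) > 0" by simp
    ultimately show False by linarith
  qed
  have "r * (CARD('n) - 1) + c \<le> m i0" using i0 unfolding mk by simp
  moreover have "m i0 \<le> h" using m(1) by (simp add: box_def)
  \<comment> \<open>The large exponent at \<open>i0\<close> uses up almost all of h = r(n-1) + s +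
    eps - 1. Together with c congruent to \<open>eps\<close> modulo s this leaves only
    \<open>c = eps\<close>.\<close>
  ultimately have "c < s + eps" using h_eq by linarith
  then have c: "c = eps"
  proof (cases "c < s")
    case False
    then have "c = s + (c - s)" "c - s < s" using \<open>c < s + eps\<close> eps_less by linarith+
    then have "c mod s = c - s" by (metis mod_add_self1 mod_less)
    then show ?thesis using cs \<open>c < s + eps\<close> False by linarith
  qed (use cs in simp)
  have kless: "k i < CARD('n)" for i
  proof -
    have "m i < r * (CARD('n) - 1) + s + eps"
    proof -
      have "m i \<le> h" using m(1) by (simp add: box_def)
      then show ?thesis using h_eq by linarith
    qed
    then have "r * k i < r * (CARD('n) - 1) + s" unfolding mk c by linarith
    also have "\<dots> \<le> r * (CARD('n) - 1) + r" using s_le by simp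
    also have "\<dots> = r * Suc (CARD('n) - 1)" by (simp only: mult_Suc_right add.commute)
    also have "\<dots> = r * CARD('n)" by simp
    finally show ?thesis by simp
  qed
  define \<pi> where "\<pi> i = inv_into UNIV idx (k i)" for i
  have ip: "idx (\<pi> i) = k i" for i
    unfolding \<pi>_def using idx kless[of i] by (intro f_inv_into_f) (auto simp: bij_betw_def)
  have "inj \<pi>"
  proof (rule injI)
    fix i j assume "\<pi> i = \<pi> j"
    then have "k i = k j" using ip[of i] ip[of j] by simp
    then show "i = j" using kinj by (simp add: inj_eq)
  qed
  then have "bij \<pi>" by (simp add: bij_def finite_UNIV_inj_surj)
  then have "\<pi> permutes UNIV" by (intro bij_imp_permutes) auto
  moreover have "m i = eps + r * idx (\<pi> i)" for i by (simp add: ip mk[of i] c)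
  ultimately show thesis by (rule that)
qed

lemma v_box: "v k \<noteq> 0 \<Longrightarrow> k \<in> box"
  using base_le_h by (auto simp: box_def elim!: v_nonzeroE)

lemma Q_one: "Q 1 = v"
proof
  fix m
  have "Q 1 m = (if m \<in> box then v m else 0)"
    using Q_single[of 0 1 m] by (simp add: qq_def box_def Lf_def)
  then show "Q 1 m = v m" using v_box[of m] by auto
qed

text \<open>Multiplicity one of the character in A. The scalar is read off at the exponent vector
  where v has coefficient 1, and permutation matrices transport it to the others.\<close>

lemma semi_invariant_eq:
  assumes u: "\<And>\<sigma> \<eta> m. G_data r p \<sigma> \<eta> \<Longrightarrow> Uop \<sigma> \<eta> u m = chi \<sigma> \<eta> * u m"
    and sup: "\<And>m. m \<notin> box \<Longrightarrow> u m = 0"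
  shows "u = (\<lambda>m. u (\<lambda>i. eps + r * idx i) * v m)"
proof
  fix m
  let ?b = "\<lambda>i. eps + r * idx i"
  show "u m = u ?b * v m"
  proof (cases "\<exists>\<pi>. \<pi> permutes UNIV \<and> (\<forall>i. m i = eps + r * idx (\<pi> i))")
    case True
    then obtain \<pi> where \<pi>: "\<pi> permutes UNIV" "m = (\<lambda>i. ?b (\<pi> i))" by auto
    have "G_data r p \<pi> (\<lambda>_. 1)" using \<pi> by (simp add: G_data_def)
    from u[OF this, of ?b] have "u m = of_int (sign \<pi>) * u ?b" by (simp add: \<pi>(2) Uop_def chi_def)
    moreover have "v m = of_int (sign \<pi>)" unfolding \<pi>(2) v_permute[OF \<pi>(1), of ?b] v_base by simp
    ultimately show ?thesis by simp
  next
    case False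
    then have "u m = 0" using semi_invariant_support[of u m, OF u] sup by blast
    moreover have "v m = 0" using False v_nonzeroE by blast
    ultimately show ?thesis by simp
  qed
qed

lemma restr_single: "restr P (Poly_Mapping.single x c) = (if P x then Poly_Mapping.single x c else 0)"
  by (rule poly_mapping_eqI) (simp add: lookup_restr lookup_single when_def)

lemma pact_comp:
  fixes \<sigma> :: "'n \<Rightarrow> 'n"
  assumes "\<sigma> permutes UNIV" shows "pact \<sigma> \<eta> (comp d f) = comp d (pact \<sigma> \<eta> f)"
proof (rule linear_eqI[where T = "\<lambda>f. pact \<sigma> \<eta> (comp d f)" and T' = "\<lambda>f. comp d (pact \<sigma> \<eta> f)"])
  fix x show "pact \<sigma> \<eta> (comp d (gen x)) = comp d (pact \<sigma> \<eta> (gen x))"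
    using assms by (simp add: restr_single tdeg_pperm)
qed (simp_all only: restr_add restr_scl pact_add pact_scl)

text \<open>A component of degree d > 0 is again invariant, so its symbol is a multiple of v =
  \<open>Q 1\<close>. The symbol is also orthogonal to \<open>Q 1\<close>, since 1 has degree 0 < d,
  and so it vanishes.\<close>

lemma invariants_kernel:
  fixes f :: "'n bipoly"
  assumes inv: "\<And>\<sigma> \<eta>. G_data r p \<sigma> \<eta> \<Longrightarrow> pact \<sigma> \<eta> f = f" and f0: "Poly_Mapping.lookup f 0 = 0"
  shows "f \<in> kernel"
proof -
  have "Psi (comp d f) m = 0" for d m
  proof (cases d)
    case 0
    have "comp 0 f = 0" using f0 by (intro poly_mapping_eqI) (auto simp: lookup_restr tdeg_eq_0_iff)
    then show ?thesis using 0 by simp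
  next
    case (Suc e)
    define u where "u = Psi (comp d f)"
    have "u = (\<lambda>m. u (\<lambda>i. eps + r * idx i) * v m)"
    proof (rule semi_invariant_eq)
      fix \<sigma> :: "'n \<Rightarrow> 'n" and \<eta> m assume G: "G_data r p \<sigma> \<eta>"
      then have "pact \<sigma> \<eta> (comp d f) = comp d f" using inv[OF G] by (simp add: pact_comp G_data_def)
      then show "Uop \<sigma> \<eta> u m = chi \<sigma> \<eta> * u m"
        using G Psi_U[of \<sigma> \<eta> "comp d f" m] by (simp add: u_def G_data_def)
    qed (simp add: u_def Psi_support)
    then have uv: "u = (\<lambda>m. u (\<lambda>i. eps + r * idx i) * Q 1 m)" by (simp add: Q_one)
    have "1 \<in> Pd d" using Suc by (simp add: Pd_def tdeg_eq_0_iff[THEN iffD2])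
    then have "ip (perp d (Q (comp d f))) (Q 1) = 0" by (rule perp_orth)
    moreover have "u = perp d (Q (comp d f))" unfolding u_def by (rule ext) (rule Psi_comp)
    ultimately have o: "ip u (Q 1) = 0" by simp
    have "ip u (\<lambda>m. u (\<lambda>i. eps + r * idx i) * Q 1 m) = 0" unfolding ip_scl_right o by simp
    then have "ip u u = 0" using uv by simp
    then show ?thesis using ip_self_zero[of u m] Psi_support[of m] by (cases "m \<in> box") (simp_all add: u_def)
  qed
  moreover have "Psi f m = (\<Sum>d\<in>tdeg ` Poly_Mapping.keys f. Psi (comp d f) m)" for m
    unfolding Psi_sum[symmetric] by (subst sum_restr) simp_all
  ultimately show ?thesis by (simp add: kernel_def)
qed

text \<open>No projection takes place: x^a v is homogeneous of degree N + |a|, while monomials of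
  smaller total degree in the generators act on v with results of smaller polynomial degree.\<close>

lemma Psi_x_polys:
  assumes "f \<in> x_polys" shows "Psi f m = Q f m"
proof (rule functional_eqI[where T = "\<lambda>f. Psi f m" and T' = "\<lambda>f. Q f m"])
  fix x assume "x \<in> Poly_Mapping.keys f"
  then have y0: "ye x i = 0" for i using assms by (auto simp: x_polys_iff)
  have "ip (Q (gen x)) (Q (gen y)) = 0" if "tdeg y < tdeg x" for y
  proof -
    have "Q (gen x) m * cnj (Q (gen y) m) = 0" for m
    proof (rule ccontr)
      assume "Q (gen x) m * cnj (Q (gen y) m) \<noteq> 0"
      then have "qq (xe x) (ye x) m \<noteq> 0" "qq (xe y) (ye y) m \<noteq> 0" by (simp_all add: Q_single)
      then have "(\<Sum>i\<in>UNIV. m i) + (\<Sum>i\<in>UNIV. ye x i) = N + (\<Sum>i\<in>UNIV. xe x i)"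
        "(\<Sum>i\<in>UNIV. m i) + (\<Sum>i\<in>UNIV. ye y i) = N + (\<Sum>i\<in>UNIV. xe y i)" by (auto intro: qq_degree)
      then show False using that by (simp add: tdeg_def y0)
    qed
    then show ?thesis unfolding ip_def by (intro sum.neutral ballI)
  qed
  then have "\<forall>g\<in>Pd (tdeg x). ip (Q (gen x)) (Q g) = 0" using orthogonal_Pd by blast
  moreover have "\<forall>m. Q (gen x) m = Q (gen x) m - Q 0 m" by simp
  ultimately have "is_perp (tdeg x) (Q (gen x)) (Q (gen x))"
    unfolding is_perp_def using lin_subspaceD(1)[OF Pd_subspace] by blast
  then show "Psi (gen x) m = Q (gen x) m" unfolding Psi_gen by (simp add: perp_eqI)
qed (simp_all add: Psi_add Psi_scl Q_add Q_scl)

end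

section \<open>The annihilator of the lowest semi-invariant\<close>

definition xm :: "('n::finite \<Rightarrow> nat) \<Rightarrow> 'n bipoly" where "xm a = gen (mon a (\<lambda>_. 0))"

lemma xm_mult: "xm a * xm b = xm (\<lambda>i. a i + b i)"
  by (simp add: xm_def gen_mult mon_add)

lemma xm_zero: "xm (\<lambda>_. 0) = 1"
  by (simp add: xm_def mon_zero)

lemma xm_x_polys: "xm a \<in> x_polys"
  unfolding xm_def by (rule x_polys_gen)

lemma keys_xm: "Poly_Mapping.keys (xm a) = {mon a (\<lambda>_. 0)}"
  by (simp add: xm_def)

lemma x_polys_mono_eq: "x \<in> Poly_Mapping.keys f \<Longrightarrow> f \<in> x_polys \<Longrightarrow> gen x = xm (xe x)"
proof -
  assume "x \<in> Poly_Mapping.keys f" "f \<in> x_polys"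
  then have "x = mon (xe x) (\<lambda>_. 0)" by (intro bimon_eqI) (auto simp: x_polys_iff)
  then show "gen x = xm (xe x)" by (metis xm_def)
qed

lemma tdeg_mon: "tdeg (mon a (\<lambda>_. 0)) = (\<Sum>i\<in>UNIV. a i)"
  by (simp add: tdeg_def)

definition xideal :: "'n::finite bipoly set \<Rightarrow> bool"
  where "xideal A \<longleftrightarrow> lin_subspace A \<and> (\<forall>f\<in>A. \<forall>g\<in>x_polys. f * g \<in> A)"

lemma xidealD:
  assumes "xideal A" shows "lin_subspace A" "f \<in> A \<Longrightarrow> g \<in> x_polys \<Longrightarrow> f * g \<in> A"
    "f \<in> A \<Longrightarrow> g \<in> x_polys \<Longrightarrow> g * f \<in> A"
  using assms by (auto simp: xideal_def mult.commute)

lemma mod_subspace: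
  assumes "lin_subspace A" "lin_subspace G" shows "lin_subspace {f. \<exists>g\<in>G. f - g \<in> A}"
proof -
  note a = lin_subspaceD[OF assms(1)] and g = lin_subspaceD[OF assms(2)]
  have "\<exists>g\<in>G. 0 - g \<in> A" using a(1) g(1) by (intro bexI[of _ 0]) auto
  moreover have "\<exists>g\<in>G. x + y - g \<in> A" if h: "\<exists>g\<in>G. x - g \<in> A" "\<exists>g\<in>G. y - g \<in> A" for x y
  proof -
    obtain g1 g2 where *: "g1 \<in> G" "g2 \<in> G" "x - g1 \<in> A" "y - g2 \<in> A" using h by blast
    have "x + y - (g1 + g2) = (x - g1) + (y - g2)" by simp
    also have "\<dots> \<in> A" by (rule a(2)[OF *(3,4)])
    finally show ?thesis by (rule bexI[OF _ g(2)[OF *(1,2)]])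
  qed
  moreover have "\<exists>g\<in>G. scl c x - g \<in> A" if h: "\<exists>g\<in>G. x - g \<in> A" for x c
  proof -
    obtain g1 where *: "g1 \<in> G" "x - g1 \<in> A" using h by blast
    have "scl c x - scl c g1 = scl c (x - g1)" by (intro poly_mapping_eqI) (simp add: lookup_minus algebra_simps)
    also have "\<dots> \<in> A" by (rule a(3)[OF *(2)])
    finally show ?thesis by (rule bexI[OF _ g(3)[OF *(1)]])
  qed
  ultimately show ?thesis by (simp add: lin_subspace_def)
qed

section \<open>Normal forms modulo elementary symmetric polynomials\<close>

context coinv_model
begin

definition zexp :: "'n set \<Rightarrow> 'n \<Rightarrow> nat" where "zexp T i = (if i \<in> T then r else 0)"

text \<open>The elementary symmetric polynomial of degree k in the z_i = x_i^r with i in S. Proper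
  subsets S occur because the variables are eliminated one after another.\<close>

definition E :: "nat \<Rightarrow> 'n set \<Rightarrow> 'n bipoly"
  where "E k S = (\<Sum>T | T \<subseteq> S \<and> card T = k. xm (zexp T))"

lemma E_x_polys: "E k S \<in> x_polys"
  unfolding E_def by (rule lin_subspaceD(6)[OF x_polys_subspace]) (rule xm_x_polys)

lemma E_0: "E 0 S = 1"
proof -
  have "{T. T \<subseteq> S \<and> card T = 0} = {{}}" by (auto simp: card_eq_0_iff)
  moreover have "zexp {} = (\<lambda>_. 0)" by (simp add: zexp_def fun_eq_iff)
  ultimately show ?thesis by (simp add: E_def xm_zero)
qed

lemma E_big: "card S < k \<Longrightarrow> E k S = 0"
proof -
  assume *: "card S < k"
  have le: "card T \<le> card S" if "T \<subseteq> S" for T by (rule card_mono) (use that in auto)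
  have "\<not> (T \<subseteq> S \<and> card T = k)" for T using le[of T] * by auto
  then have "{T. T \<subseteq> S \<and> card T = k} = {}" by blast
  then show ?thesis by (simp only: E_def sum.empty)
qed

lemma E_insert:
  assumes "j \<notin> S" shows "E (Suc k) (insert j S) = E (Suc k) S + xm (zexp {j}) * E k S"
proof -
  have eq: "{T. T \<subseteq> insert j S \<and> card T = Suc k} = {T. T \<subseteq> S \<and> card T = Suc k} \<union> insert j ` {T. T \<subseteq> S \<and> card T = k}"
  proof (intro equalityI subsetI)
    fix T assume T: "T \<in> {T. T \<subseteq> insert j S \<and> card T = Suc k}"
    show "T \<in> {T. T \<subseteq> S \<and> card T = Suc k} \<union> insert j ` {T. T \<subseteq> S \<and> card T = k}"
    proof (cases "j \<in> T")
      case True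
      then have "T - {j} \<in> {T. T \<subseteq> S \<and> card T = k}" "T = insert j (T - {j})" using T by auto
      then show ?thesis by blast
    qed (use T in auto)
  next
    fix T assume "T \<in> {T. T \<subseteq> S \<and> card T = Suc k} \<union> insert j ` {T. T \<subseteq> S \<and> card T = k}"
    then consider "T \<subseteq> S" "card T = Suc k" | T' where "T = insert j T'" "T' \<subseteq> S" "card T' = k" by auto
    then show "T \<in> {T. T \<subseteq> insert j S \<and> card T = Suc k}"
    proof cases
      case 2
      then have "j \<notin> T'" using assms by blast
      then show ?thesis using 2 by auto
    qed auto
  qed
  have "{T. T \<subseteq> S \<and> card T = Suc k} \<inter> insert j ` {T. T \<subseteq> S \<and> card T = k} = {}" using assms by blast
  then have "E (Suc k) (insert j S) = E (Suc k) S + (\<Sum>T\<in>insert j ` {T. T \<subseteq> S \<and> card T = k}. xm (zexp T))"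
    unfolding E_def eq by (intro sum.union_disjoint) simp_all
  also have "(\<Sum>T\<in>insert j ` {T. T \<subseteq> S \<and> card T = k}. xm (zexp T)) = (\<Sum>T | T \<subseteq> S \<and> card T = k. xm (zexp (insert j T)))"
    using assms by (subst sum.reindex) (auto simp: inj_on_def)
  also have "\<dots> = (\<Sum>T | T \<subseteq> S \<and> card T = k. xm (zexp {j}) * xm (zexp T))"
  proof (rule sum.cong)
    fix T assume "T \<in> {T. T \<subseteq> S \<and> card T = k}"
    then have "j \<notin> T" using assms by auto
    then have "zexp (insert j T) = (\<lambda>i. zexp {j} i + zexp T i)" by (auto simp: zexp_def fun_eq_iff)
    then show "xm (zexp (insert j T)) = xm (zexp {j}) * xm (zexp T)" by (simp add: xm_mult)
  qed simp
  finally show ?thesis by (simp add: E_def sum_distrib_left)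
qed

definition zspan :: "(('n \<Rightarrow> nat) \<Rightarrow> bool) \<Rightarrow> 'n bipoly set"
  where "zspan P = {f. Poly_Mapping.keys f \<subseteq> {mon (\<lambda>i. r * b i) (\<lambda>_. 0) | b. P b}}"

lemma zspan_subspace: "lin_subspace (zspan P)" unfolding zspan_def by (rule lin_subspace_keys)

lemma zspan_mono: "(\<And>b. P b \<Longrightarrow> P' b) \<Longrightarrow> f \<in> zspan P \<Longrightarrow> f \<in> zspan P'"
  unfolding zspan_def by blast

lemma zspan_xm: "P b \<Longrightarrow> xm (\<lambda>i. r * b i) \<in> zspan P"
  unfolding zspan_def keys_xm mem_Collect_eq by blast

lemma zspan_mult:
  assumes "f \<in> zspan P" "\<And>b. P b \<Longrightarrow> P' (\<lambda>i. b i + of_bool (i = j))"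
  shows "xm (zexp {j}) * f \<in> zspan P'"
proof -
  have "f \<in> {f. xm (zexp {j}) * f \<in> zspan P'}"
  proof (rule lin_subspace_keys_in)
    show "lin_subspace {f. xm (zexp {j}) * f \<in> zspan P'}"
      using lin_subspaceD(1-3)[OF zspan_subspace[of P']] by (simp add: lin_subspace_def distrib_left scl_mult_right)
    fix x assume "x \<in> Poly_Mapping.keys f"
    then obtain b where b: "P b" "gen x = xm (\<lambda>i. r * b i)" using assms(1) by (auto simp: zspan_def xm_def)
    have "(\<lambda>i. zexp {j} i + r * b i) = (\<lambda>i. r * (b i + of_bool (i = j)))" by (auto simp: zexp_def)
    then show "gen x \<in> {f. xm (zexp {j}) * f \<in> zspan P'}"
      unfolding b mem_Collect_eq xm_mult using zspan_xm[of P', OF assms(2)[OF b(1)]] by simp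
  qed
  then show ?thesis by simp
qed

definition sums_to :: "nat \<Rightarrow> 'n set \<Rightarrow> ('n \<Rightarrow> nat) \<Rightarrow> bool"
  where "sums_to k U b \<longleftrightarrow> (\<Sum>i\<in>UNIV. b i) = k \<and> (\<forall>i. i \<notin> U \<longrightarrow> b i = 0)"

lemma sums_to_Suc: "sums_to k U b \<Longrightarrow> j \<in> U \<Longrightarrow> sums_to (Suc k) U (\<lambda>i. b i + of_bool (i = j))"
  by (auto simp: sums_to_def sum.distrib)

text \<open>By generating functions: the product of all 1 + z_i t is 1 modulo \<open>A\<close> up to
  order \<open>mm\<close>, so the product over the complement of U is the inverse of the product
  over U. Its coefficients are up to sign the complete symmetric polynomials in U. The induction
  moves one index at a time into U by \<open>E_insert\<close>.\<close>

lemma E_compl_mod: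
  assumes A: "xideal A" "\<And>k. 1 \<le> k \<Longrightarrow> k \<le> mm \<Longrightarrow> E k UNIV \<in> A" and "k \<le> mm"
  shows "\<exists>g\<in>zspan (sums_to k U). E k (- U) - g \<in> A"
  using \<open>k \<le> mm\<close>
proof (induction k arbitrary: U)
  case 0
  have "xm (\<lambda>i. r * (\<lambda>_. 0) i) \<in> zspan (sums_to 0 U)" by (rule zspan_xm) (simp add: sums_to_def)
  then show ?case using lin_subspaceD(1)[OF xidealD(1)[OF A(1)]]
    by (intro bexI[of _ 1]) (simp_all add: E_0 xm_zero)
next
  case (Suc k)
  note s = lin_subspaceD[OF xidealD(1)[OF A(1)]]
  have "finite U" by simp
  then show ?case
  proof (induction U rule: finite_induct)
    case empty
    show ?case using A(2)[of "Suc k"] Suc.prems lin_subspaceD(1)[OF zspan_subspace]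
      by (intro bexI[of _ 0]) simp_all
  next
    case (insert j U)
    obtain g1 where g1: "g1 \<in> zspan (sums_to (Suc k) U)" "E (Suc k) (- U) - g1 \<in> A" using insert.IH by blast
    obtain g2 where g2: "g2 \<in> zspan (sums_to k (insert j U))" "E k (- insert j U) - g2 \<in> A"
      using Suc.IH[of "insert j U"] Suc.prems by auto
    have "- U = insert j (- insert j U)" using insert.hyps by auto
    then have "E (Suc k) (- U) = E (Suc k) (- insert j U) + xm (zexp {j}) * E k (- insert j U)"
      using E_insert[of j "- insert j U" k] by simp
    then have "E (Suc k) (- insert j U) - (g1 - xm (zexp {j}) * g2)
        = (E (Suc k) (- U) - g1) - xm (zexp {j}) * (E k (- insert j U) - g2)" by (simp add: algebra_simps)
    also have "\<dots> \<in> A" using s(5) g1(2) xidealD(3)[OF A(1) g2(2) xm_x_polys] by blast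
    finally have "E (Suc k) (- insert j U) - (g1 - xm (zexp {j}) * g2) \<in> A" .
    moreover have "g1 \<in> zspan (sums_to (Suc k) (insert j U))"
      by (rule zspan_mono[OF _ g1(1)]) (auto simp: sums_to_def)
    moreover have "xm (zexp {j}) * g2 \<in> zspan (sums_to (Suc k) (insert j U))"
      by (rule zspan_mult[OF g2(1)]) (auto intro: sums_to_Suc)
    ultimately show ?case using lin_subspaceD(5)[OF zspan_subspace] by blast
  qed
qed

lemma card_idx_le: "card {l. idx l \<le> idx i} = Suc (idx i)"
proof -
  have "idx ` {l. idx l \<le> idx i} = {..idx i}"
  proof (intro equalityI subsetI)
    fix t assume t: "t \<in> {..idx i}"
    then have "t \<in> idx ` UNIV" using idx idx_less[of i] by (auto simp: bij_betw_def)
    then show "t \<in> idx ` {l. idx l \<le> idx i}" using t by auto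
  qed auto
  moreover have "inj_on idx {l. idx l \<le> idx i}" using idx by (auto simp: bij_betw_def inj_on_def)
  ultimately show ?thesis by (metis card_image card_atMost)
qed

definition reduced_part :: "nat \<Rightarrow> 'n \<Rightarrow> ('n \<Rightarrow> nat) \<Rightarrow> bool"
  where "reduced_part k i b \<longleftrightarrow> sums_to k {l. idx l \<le> idx i} b \<and> b i < k"

text \<open>Isolates z_i^k, which has coefficient (-1)^k in the signed complete symmetric polynomial
  of the variables numbered up to \<open>idx i\<close>; all other terms have a smaller power of
  z_i.\<close>

lemma pure_power_mod:
  assumes A: "xideal A" "\<And>k. 1 \<le> k \<Longrightarrow> k \<le> mm \<Longrightarrow> E k UNIV \<in> A" and "k \<le> mm"
  shows "\<exists>g\<in>zspan (reduced_part k i). E k (- {l. idx l \<le> idx i}) - scl ((-1) ^ k) (xm (\<lambda>l. r * (if l = i then k else 0))) - g \<in> A"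
  using \<open>k \<le> mm\<close>
proof (induction k)
  case 0
  have e: "E 0 S - scl ((-1) ^ 0) (xm (\<lambda>l. r * (if l = i then 0 else 0))) - 0 = 0" for S
    by (rule poly_mapping_eqI) (simp only: E_0 xm_zero if_cancel mult_0_right lookup_minus lookup_scl power_0
        mult_1_left diff_self lookup_zero diff_zero)
  show ?case
    by (rule bexI[of _ 0], unfold e) (rule lin_subspaceD(1)[OF xidealD(1)[OF A(1)]] lin_subspaceD(1)[OF zspan_subspace])+
next
  case (Suc k)
  note s = lin_subspaceD[OF xidealD(1)[OF A(1)]]
  let ?U = "{l. idx l \<le> idx i}" and ?pw = "\<lambda>k. xm (\<lambda>l. r * (if l = i then k else 0))"
  obtain g1 where g1: "g1 \<in> zspan (sums_to (Suc k) (?U - {i}))" "E (Suc k) (- (?U - {i})) - g1 \<in> A"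
    using E_compl_mod[OF A Suc.prems] by blast
  obtain g2 where g2: "g2 \<in> zspan (reduced_part k i)" "E k (- ?U) - scl ((-1) ^ k) (?pw k) - g2 \<in> A"
    using Suc by auto
  have "- (?U - {i}) = insert i (- ?U)" by auto
  then have "E (Suc k) (- (?U - {i})) = E (Suc k) (- ?U) + xm (zexp {i}) * E k (- ?U)"
    using E_insert[of i "- ?U" k] by simp
  moreover have "xm (zexp {i}) * ?pw k = ?pw (Suc k)"
    unfolding xm_mult by (intro arg_cong[where f = xm]) (auto simp: zexp_def)
  then have "scl ((-1) ^ Suc k) (?pw (Suc k)) = - (xm (zexp {i}) * scl ((-1) ^ k) (?pw k))"
    by (intro poly_mapping_eqI) (simp add: scl_mult_right)
  ultimately have "E (Suc k) (- ?U) - scl ((-1) ^ Suc k) (?pw (Suc k)) - (g1 - xm (zexp {i}) * g2)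
      = (E (Suc k) (- (?U - {i})) - g1) - xm (zexp {i}) * (E k (- ?U) - scl ((-1) ^ k) (?pw k) - g2)"
    by (simp add: algebra_simps)
  also have "\<dots> \<in> A" using s(5) g1(2) xidealD(3)[OF A(1) g2(2) xm_x_polys] by blast
  finally have "E (Suc k) (- ?U) - scl ((-1) ^ Suc k) (?pw (Suc k)) - (g1 - xm (zexp {i}) * g2) \<in> A" .
  moreover have "g1 \<in> zspan (reduced_part (Suc k) i)"
    by (rule zspan_mono[OF _ g1(1)]) (auto simp: sums_to_def reduced_part_def)
  moreover have "xm (zexp {i}) * g2 \<in> zspan (reduced_part (Suc k) i)"
    by (rule zspan_mult[OF g2(1)]) (auto intro: sums_to_Suc simp: reduced_part_def)
  ultimately show ?case using lin_subspaceD(5)[OF zspan_subspace] by blast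
qed

text \<open>Only n - idx i - 1 variables have a number above \<open>idx i\<close>, so their
  elementary symmetric polynomial of degree n - idx i is zero; this gives a monic relation for
  z_i.\<close>

lemma pure_power_reduce:
  assumes A: "xideal A" "\<And>k. 1 \<le> k \<Longrightarrow> k \<le> mm \<Longrightarrow> E k UNIV \<in> A" and "CARD('n) - idx i \<le> mm"
  shows "\<exists>g\<in>zspan (reduced_part (CARD('n) - idx i) i). xm (\<lambda>l. r * (if l = i then CARD('n) - idx i else 0)) - g \<in> A"
proof -
  let ?k = "CARD('n) - idx i" and ?U = "{l. idx l \<le> idx i}"
  have "card (- ?U) < ?k" using card_idx_le[of i] idx_less[of i] by (simp add: Compl_eq_Diff_UNIV card_Diff_subset)
  then have "E ?k (- ?U) = 0" by (rule E_big)
  then obtain g where g: "g \<in> zspan (reduced_part ?k i)" "0 - scl ((-1) ^ ?k) (xm (\<lambda>l. r * (if l = i then ?k else 0))) - g \<in> A"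
    using pure_power_mod[OF A assms(3), of i] by auto
  have e: "scl (- ((-1) ^ ?k)) (0 - scl ((-1) ^ ?k) (xm (\<lambda>l. r * (if l = i then ?k else 0))) - g)
      = xm (\<lambda>l. r * (if l = i then ?k else 0)) - scl (- ((-1) ^ ?k)) g"
    by (intro poly_mapping_eqI) (simp add: lookup_minus algebra_simps flip: power_mult_distrib mult.assoc)
  then show ?thesis
    using lin_subspaceD(3)[OF xidealD(1)[OF A(1)] g(2), of "- ((-1) ^ ?k)"] lin_subspaceD(3)[OF zspan_subspace g(1)]
    unfolding e by blast
qed

text \<open>For \<open>mm\<close> = n all exponents are bounded, as in the Artin basis. For
  \<open>mm\<close> = n - 1 the coordinate numbered 0 is free; this is the form used when E_n is
  left out of the ideal.\<close>

definition NF :: "nat \<Rightarrow> ('n \<Rightarrow> nat) \<Rightarrow> bool"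
  where "NF mm a \<longleftrightarrow> (\<forall>i. CARD('n) - idx i \<le> mm \<longrightarrow> a i < r * (CARD('n) - idx i))"

definition NFs :: "nat \<Rightarrow> nat \<Rightarrow> 'n bipoly set"
  where "NFs mm d = {f. Poly_Mapping.keys f \<subseteq> {mon a (\<lambda>_. 0) | a. NF mm a \<and> (\<Sum>i\<in>UNIV. a i) = d}}"

lemma NFs_subspace: "lin_subspace (NFs mm d)" unfolding NFs_def by (rule lin_subspace_keys)

text \<open>The monic relation for z_i trades a power of z_i for monomials of equal degree in
  variables of at most the same number, so the sum of \<open>idx i * a i\<close> drops.\<close>

lemma xm_reduce:
  assumes A: "xideal A" "\<And>k. 1 \<le> k \<Longrightarrow> k \<le> mm \<Longrightarrow> E k UNIV \<in> A"
  shows "\<exists>g\<in>NFs mm (\<Sum>i\<in>UNIV. a i). xm a - g \<in> A"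
proof (induction "\<Sum>i\<in>UNIV. idx i * a i" arbitrary: a rule: less_induct)
  case less
  let ?d = "\<Sum>i\<in>UNIV. a i"
  note s = lin_subspaceD[OF xidealD(1)[OF A(1)]]
  note sub = mod_subspace[OF xidealD(1)[OF A(1)] NFs_subspace[of mm ?d]]
  show ?case
  proof (cases "NF mm a")
    case True
    then have "xm a \<in> NFs mm ?d" unfolding NFs_def keys_xm mem_Collect_eq by blast
    then show ?thesis using s(1) by (intro bexI[of _ "xm a"]) simp_all
  next
    case False
    then obtain i where i: "CARD('n) - idx i \<le> mm" "r * (CARD('n) - idx i) \<le> a i"
      unfolding NF_def by (auto simp: not_less)
    define k where "k = CARD('n) - idx i"
    define a' where "a' l = (if l = i then a i - r * k else a l)" for l
    have aa: "a l = a' l + r * (if l = i then k else 0)" for l using i by (simp add: a'_def k_def)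
    obtain g where g: "g \<in> zspan (reduced_part k i)" "xm (\<lambda>l. r * (if l = i then k else 0)) - g \<in> A"
      using pure_power_reduce[OF A i(1)] unfolding k_def by blast
    have "xm a = xm a' * xm (\<lambda>l. r * (if l = i then k else 0))"
      unfolding xm_mult by (intro arg_cong[where f = xm] ext) (rule aa)
    then have "xm a - xm a' * g = xm a' * (xm (\<lambda>l. r * (if l = i then k else 0)) - g)" by (simp add: algebra_simps)
    also have "\<dots> \<in> A" by (rule xidealD(3)[OF A(1) g(2) xm_x_polys])
    finally have 1: "xm a - xm a' * g \<in> A" .
    have "g \<in> {g. xm a' * g \<in> {f. \<exists>g\<in>NFs mm ?d. f - g \<in> A}}"
    proof (rule lin_subspace_keys_in)
      show "lin_subspace {g. xm a' * g \<in> {f. \<exists>g\<in>NFs mm ?d. f - g \<in> A}}"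
        using lin_subspaceD(1-3)[OF sub] unfolding lin_subspace_def mem_Collect_eq
        by (simp only: distrib_left scl_mult_right mult_zero_right mem_Collect_eq) blast
      fix x assume "x \<in> Poly_Mapping.keys g"
      then obtain b where b: "reduced_part k i b" "gen x = xm (\<lambda>l. r * b l)" using g(1) by (auto simp: zspan_def xm_def)
      let ?a = "\<lambda>l. a' l + r * b l"
      have sb: "(\<Sum>l\<in>UNIV. b l) = k" "\<And>l. idx i < idx l \<Longrightarrow> b l = 0" "b i < k"
        using b(1) by (auto simp: reduced_part_def sums_to_def)
      have "(\<Sum>l\<in>UNIV. ?a l) = ?d"
        by (simp add: aa sum.distrib sb flip: sum_distrib_left)
      moreover have "(\<Sum>l\<in>UNIV. idx l * ?a l) < (\<Sum>l\<in>UNIV. idx l * a l)"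
      proof -
        \<comment> \<open>The drop is strict: b has total k but \<open>b i < k\<close>, so some part
          sits at another place, whose number must be smaller.\<close>
        have "\<exists>l. l \<noteq> i \<and> b l \<noteq> 0"
        proof (rule ccontr)
          assume "\<nexists>l. l \<noteq> i \<and> b l \<noteq> 0"
          then have "(\<Sum>l\<in>UNIV. b l) = (\<Sum>l\<in>UNIV. if l = i then b i else 0)" by (intro sum.cong) auto
          then show False using sb by simp
        qed
        then obtain l where l: "l \<noteq> i" "b l \<noteq> 0" by blast
        then have "idx l < idx i" using sb(2)[of l] idx_inj[of l i] by linarith
        then have "idx l * b l < idx i * b l" using l by simp
        moreover have "idx j * b j \<le> idx i * b j" for j
          using sb(2)[of j] by (cases "idx i < idx j") auto
        ultimately have "(\<Sum>l\<in>UNIV. idx l * b l) < (\<Sum>l\<in>UNIV. idx i * b l)"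
          by (intro sum_strict_mono_ex1) auto
        also have "\<dots> = idx i * k" by (simp add: sb flip: sum_distrib_left)
        finally have lt: "r * (\<Sum>l\<in>UNIV. idx l * b l) < r * (idx i * k)" using r_gt_1 by simp
        have "(\<Sum>l\<in>UNIV. idx l * (r * b l)) = r * (\<Sum>l\<in>UNIV. idx l * b l)"
          by (simp add: sum_distrib_left mult_ac)
        moreover have "(\<Sum>l\<in>UNIV. idx l * (r * (if l = i then k else 0))) = r * (idx i * k)"
          by (simp add: if_distrib mult_ac cong: if_cong)
        ultimately show ?thesis using lt by (simp add: aa distrib_left sum.distrib)
      qed
      ultimately have "\<exists>g\<in>NFs mm ?d. xm ?a - g \<in> A" using less[of ?a] by simp
      then show "gen x \<in> {g. xm a' * g \<in> {f. \<exists>g\<in>NFs mm ?d. f - g \<in> A}}" by (simp add: b(2) xm_mult)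
    qed
    then obtain g' where g': "g' \<in> NFs mm ?d" "xm a' * g - g' \<in> A" by blast
    have "xm a - g' = (xm a - xm a' * g) + (xm a' * g - g')" by simp
    then have "xm a - g' \<in> A" using s(2)[OF 1 g'(2)] by metis
    then show ?thesis using g'(1) by blast
  qed
qed

lemma x_polys_reduce:
  assumes A: "xideal A" "\<And>k. 1 \<le> k \<Longrightarrow> k \<le> mm \<Longrightarrow> E k UNIV \<in> A"
    and f: "f \<in> x_polys" "\<And>x. x \<in> Poly_Mapping.keys f \<Longrightarrow> tdeg x = d"
  shows "\<exists>g\<in>NFs mm d. f - g \<in> A"
proof -
  have "f \<in> {f. \<exists>g\<in>NFs mm d. f - g \<in> A}"
  proof (rule lin_subspace_keys_in[OF mod_subspace[OF xidealD(1)[OF A(1)] NFs_subspace]])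
    fix x assume x: "x \<in> Poly_Mapping.keys f"
    have "(\<Sum>i\<in>UNIV. xe x i) = d" using f x by (auto simp: x_polys_iff tdeg_def)
    then show "gen x \<in> {f. \<exists>g\<in>NFs mm d. f - g \<in> A}"
      unfolding x_polys_mono_eq[OF x f(1)] using xm_reduce[OF A, of mm "xe x"] by simp
  qed
  then show ?thesis by simp
qed

end

section \<open>Detection of normal forms by the Vandermonde polynomial\<close>

context coinv_model
begin

text \<open>The coefficients of \<open>f \<Prod>\<^sub>i\<^sub><\<^sub>j (x\<^sub>j\<^sup>r - x\<^sub>i\<^sup>r)\<close> with exponents taken modulo \<open>M\<close>; for \<open>M = 0\<close> these are
  the ordinary coefficients.\<close>

definition DD :: "int \<Rightarrow> 'n bipoly \<Rightarrow> ('n \<Rightarrow> int) \<Rightarrow> complex"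
  where "DD M = lext (\<lambda>x c. \<Sum>\<pi> | \<pi> permutes UNIV. of_int (sign \<pi>) *
    of_bool (\<forall>i. [c i = int (xe x i) + int (r * idx (\<pi> i))] (mod M)))"

lemma DD_add: "DD M (f + g) c = DD M f c + DD M g c" by (simp add: DD_def lext_add)
lemma DD_scl: "DD M (scl t f) c = t * DD M f c" by (simp add: DD_def lext_scl)
lemma DD_diff: "DD M (f - g) c = DD M f c - DD M g c" by (simp add: DD_def lext_diff)
lemma DD_zero: "DD M 0 c = 0" by (simp add: DD_def)
lemma DD_sum: "DD M (sum F A) c = (\<Sum>a\<in>A. DD M (F a) c)" by (simp add: DD_def lext_sum)

lemma DD_gen: "DD M (gen x) c = (\<Sum>\<pi> | \<pi> permutes UNIV. of_int (sign \<pi>) *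
    of_bool (\<forall>i. [c i = int (xe x i) + int (r * idx (\<pi> i))] (mod M)))"
  by (simp add: DD_def)

lemma DD_xm: "DD M (xm a) c = (\<Sum>\<pi> | \<pi> permutes UNIV. of_int (sign \<pi>) *
    of_bool (\<forall>i. [c i = int (a i) + int (r * idx (\<pi> i))] (mod M)))"
  by (simp add: xm_def DD_gen)

lemma DD_shift: "DD M (xm b * f) c = DD M f (\<lambda>i. c i - int (b i))"
proof (rule functional_eqI[where T = "\<lambda>f. DD M (xm b * f) c" and T' = "\<lambda>f. DD M f (\<lambda>i. c i - int (b i))"])
  fix x
  have "[c i = int (b i + xe x i) + k] (mod M) \<longleftrightarrow> [c i - int (b i) = int (xe x i) + k] (mod M)" for i k
    by (simp add: cong_iff_dvd_diff algebra_simps)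
  then show "DD M (xm b * gen x) c = DD M (gen x) (\<lambda>i. c i - int (b i))"
    by (simp add: xm_def gen_mult DD_gen lookup_add)
qed (simp_all add: DD_add DD_scl distrib_left scl_mult_right)

lemma sum_idx_bij:
  fixes \<rho> :: "'n \<Rightarrow> nat"
  assumes "inj \<rho>" "\<And>i. \<rho> i < CARD('n)" shows "(\<Sum>i\<in>UNIV. \<rho> i) = (\<Sum>i\<in>UNIV. idx i)"
proof -
  have "range \<rho> = {..<CARD('n)}"
    by (rule card_subset_eq) (use assms in \<open>auto simp: card_image\<close>)
  then have "(\<Sum>i\<in>UNIV. \<rho> i) = \<Sum>{..<CARD('n)}"
    using sum.reindex[OF assms(1), of "\<lambda>x. x"] by simp
  moreover have "(\<Sum>i\<in>UNIV. idx i) = \<Sum>{..<CARD('n)}"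
    using idx sum.reindex[of idx UNIV "\<lambda>x. x"] by (simp add: bij_betw_def)
  ultimately show ?thesis by simp
qed

text \<open>Multiplying the Vandermonde product by an elementary symmetric polynomial produces, below the
  cut-off, only exponent vectors with a repetition, and these cancel.\<close>

lemma DD_E:
  assumes k: "1 \<le> k" "k \<le> CARD('n)"
    and M: "M = 0 \<and> (\<forall>i. c i < int (r * CARD('n))) \<or> M = int (r * CARD('n)) \<and> k < CARD('n)"
  shows "DD M (xm a * E k UNIV) c = 0"
proof -
  let ?n = "CARD('n)"
  define val where "val T \<pi> i = of_bool (i \<in> T) + idx (\<pi> i)" for T and \<pi> :: "'n \<Rightarrow> 'n" and i
  define R where "R i x \<longleftrightarrow> [c i = int (a i) + int (r * x)] (mod M)" for i x
  have "DD M (xm a * E k UNIV) c = (\<Sum>T | T \<subseteq> UNIV \<and> card T = k. DD M (xm (\<lambda>i. a i + zexp T i)) c)"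
    by (simp add: E_def sum_distrib_left xm_mult DD_sum)
  also have "\<dots> = (\<Sum>T | card T = k. \<Sum>\<pi> | \<pi> permutes UNIV. of_int (sign \<pi>) * of_bool (\<forall>i. R i (val T \<pi> i)))"
  proof (rule sum.cong)
    fix T
    have "int (a i + zexp T i) + int (r * idx (\<pi> i)) = int (a i) + int (r * val T \<pi> i)" for \<pi> i
      by (simp add: zexp_def val_def algebra_simps)
    then show "DD M (xm (\<lambda>i. a i + zexp T i)) c = (\<Sum>\<pi> | \<pi> permutes UNIV. of_int (sign \<pi>) * of_bool (\<forall>i. R i (val T \<pi> i)))"
      by (simp only: DD_xm R_def)
  qed simp
  finally have S: "DD M (xm a * E k UNIV) c = (\<Sum>T | card T = k. \<Sum>\<pi> | \<pi> permutes UNIV. of_int (sign \<pi>) * of_bool (\<forall>i. R i (val T \<pi> i)))" .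
  show ?thesis
  proof (cases "\<exists>T \<pi>. card T = k \<and> \<pi> permutes UNIV \<and> (\<forall>i. R i (val T \<pi> i))")
    case False
    then show ?thesis unfolding S by (intro sum.neutral ballI) auto
  next
    case True
    then obtain T \<pi> where T: "card T = k" "\<pi> permutes UNIV" and R: "\<And>i. R i (val T \<pi> i)" by blast
    \<comment> \<open>The exponents of the z_i in one contributing term. Their sum exceeds that of a
      permutation of 0, ..., n-1 by k.\<close>
    define \<rho> where "\<rho> = val T \<pi>"
    have "(\<Sum>i\<in>UNIV. \<rho> i) = (\<Sum>i\<in>UNIV. of_bool (i \<in> T)) + (\<Sum>i\<in>UNIV. idx (\<pi> i))"
      by (simp add: \<rho>_def val_def sum.distrib)
    also have "(\<Sum>i\<in>UNIV. idx (\<pi> i)) = (\<Sum>i\<in>UNIV. idx i)"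
      using sum.permute[OF T(2), of idx] by (simp add: o_def)
    also have "(\<Sum>i\<in>UNIV. of_bool (i \<in> T) :: nat) = k" using T(1) by (simp add: of_bool_def sum.If_cases)
    finally have sum_rho: "(\<Sum>i\<in>UNIV. \<rho> i) = k + (\<Sum>i\<in>UNIV. idx i)" .
    \<comment> \<open>If \<open>\<rho>\<close> (or its residues modulo n) were injective it would be
      a permutation of 0, ..., n-1. For M = 0 the cut-off puts its values below n, and the sums
      differ by k > 0; for M = rn the sums would agree modulo n, although 0 < k < n.\<close>
    have "\<exists>i j. i \<noteq> j \<and> [int (r * \<rho> i) = int (r * \<rho> j)] (mod M)"
      using M
    proof
      assume M0: "M = 0 \<and> (\<forall>i. c i < int (r * CARD('n)))"
      have "\<rho> i < ?n" for i
      proof -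
        have "c i = int (a i) + int (r * \<rho> i)" using R[of i] M0 by (simp add: R_def \<rho>_def cong_def)
        moreover have "c i < int (r * ?n)" using M0 by blast
        moreover have "0 \<le> int (a i)" by simp
        ultimately have "int (r * \<rho> i) < int (r * ?n)" by linarith
        then have "r * \<rho> i < r * ?n" by (simp only: of_nat_less_iff)
        then show ?thesis by simp
      qed
      then have "\<not> inj \<rho>" using sum_idx_bij[of \<rho>] sum_rho k by auto
      then obtain i j where "i \<noteq> j" "\<rho> i = \<rho> j" by (auto simp: inj_def)
      then show ?thesis by (intro exI[of _ i] exI[of _ j]) simp
    next
      assume Mn: "M = int (r * CARD('n)) \<and> k < CARD('n)"
      have "\<not> inj (\<lambda>i. \<rho> i mod ?n)"
      proof
        assume "inj (\<lambda>i. \<rho> i mod ?n)"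
        then have "(\<Sum>i\<in>UNIV. \<rho> i mod ?n) = (\<Sum>i\<in>UNIV. idx i)" by (rule sum_idx_bij) simp
        then have "(k + (\<Sum>i\<in>UNIV. idx i)) mod ?n = (0 + (\<Sum>i\<in>UNIV. idx i)) mod ?n"
          using mod_sum_eq[of \<rho> ?n UNIV] sum_rho by simp
        then have "int ?n dvd int k" by (simp add: mod_eq_dvd_iff_nat flip: int_dvd_int_iff)
        then have "?n dvd k" by simp
        then show False using k Mn by (auto dest: dvd_imp_le)
      qed
      then obtain i j where ij: "i \<noteq> j" "\<rho> i mod ?n = \<rho> j mod ?n" by (auto simp: inj_def)
      have "(r * \<rho> i) mod (r * ?n) = (r * \<rho> j) mod (r * ?n)" using ij by (simp add: mod_mult_mult1)
      then have "[int (r * \<rho> i) = int (r * \<rho> j)] (mod M)" using Mn by (simp only: cong_def flip: of_nat_mod)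
      then show ?thesis using ij by blast
    qed
    then obtain i j where ij: "i \<noteq> j" "[int (r * \<rho> i) = int (r * \<rho> j)] (mod M)" by blast
    define \<tau> where "\<tau> = Transposition.transpose i j"
    have \<tau>: "\<tau> permutes UNIV" "\<tau> (\<tau> l) = l" "\<tau> i = j" "\<tau> j = i" "l \<noteq> i \<Longrightarrow> l \<noteq> j \<Longrightarrow> \<tau> l = l" for l
      by (simp_all add: \<tau>_def permutes_swap_id)
    \<comment> \<open>All contributing terms agree with \<open>\<rho>\<close> up to the congruence,
      so the one transposition \<open>\<tau>\<close> gives a sign-reversing involution on all of
      them.\<close>
    have Rl: "R l x \<longleftrightarrow> [int (r * \<rho> l) = int (r * x)] (mod M)" for l x
    proof -
      have "[c l = int (a l) + int (r * \<rho> l)] (mod M)" using R[of l] by (simp only: R_def \<rho>_def)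
      then have "R l x \<longleftrightarrow> [int (a l) + int (r * \<rho> l) = int (a l) + int (r * x)] (mod M)"
        unfolding R_def by (meson cong_sym cong_trans)
      then show ?thesis by (simp only: cong_add_lcancel)
    qed
    have Rij: "R i x \<longleftrightarrow> R j x" for x
      unfolding Rl using ij(2) by (meson cong_sym cong_trans)
    have R\<tau>: "R (\<tau> l) x \<longleftrightarrow> R l x" for l x
      using Rij \<tau>(3,4) \<tau>(5)[of l] by (cases "l = i"; cases "l = j") auto
    have mem: "l \<in> \<tau> ` T \<longleftrightarrow> \<tau> l \<in> T" for l T
      using \<tau>(2) by (metis image_iff)
    have inv: "(\<forall>l. R l (val (\<tau> ` T) (\<pi> \<circ> \<tau>) l)) \<longleftrightarrow> (\<forall>l. R l (val T \<pi> l))" for T \<pi>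
    proof -
      have "val (\<tau> ` T) (\<pi> \<circ> \<tau>) l = val T \<pi> (\<tau> l)" for l by (simp add: val_def mem)
      then have "(\<forall>l. R l (val (\<tau> ` T) (\<pi> \<circ> \<tau>) l)) \<longleftrightarrow> (\<forall>l. R (\<tau> l) (val T \<pi> (\<tau> l)))" by (simp add: R\<tau>)
      also have "\<dots> \<longleftrightarrow> (\<forall>l. R l (val T \<pi> l))" using \<tau>(2) by metis
      finally show ?thesis .
    qed
    define F where "F T \<pi> = (of_int (sign \<pi>) * of_bool (\<forall>i. R i (val T \<pi> i)) :: complex)" for T \<pi>
    have "(\<Sum>T | card T = k. \<Sum>\<pi> | \<pi> permutes UNIV. F T \<pi>) = (\<Sum>T | card T = k. \<Sum>\<pi> | \<pi> permutes UNIV. F (\<tau> ` T) (\<pi> \<circ> \<tau>))"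
    proof -
      have inj: "inj \<tau>" using \<tau>(1) by (rule permutes_inj)
      have "(\<Sum>T | card T = k. \<Sum>\<pi> | \<pi> permutes UNIV. F T \<pi>) = (\<Sum>T | card T = k. \<Sum>\<pi> | \<pi> permutes UNIV. F (\<tau> ` T) \<pi>)"
        by (rule sum.reindex_bij_witness[of _ "image \<tau>" "image \<tau>"])
           (auto simp: image_image \<tau>(2) card_image inj_on_subset[OF inj])
      also have "\<dots> = (\<Sum>T | card T = k. \<Sum>\<pi> | \<pi> permutes UNIV. F (\<tau> ` T) (\<pi> \<circ> \<tau>))"
        by (intro sum.cong refl sum_permutations_compose_right[OF \<tau>(1)])
      finally show ?thesis .
    qed
    also have "\<dots> = (\<Sum>T | card T = k. \<Sum>\<pi> | \<pi> permutes UNIV. - F T \<pi>)"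
    proof (intro sum.cong refl)
      fix T and \<pi> :: "'n \<Rightarrow> 'n" assume "\<pi> \<in> {\<pi>. \<pi> permutes UNIV}"
      then have "permutation \<pi>" "permutation \<tau>" using \<tau>(1) by (auto intro: permutes_imp_permutation[rotated])
      then have "sign (\<pi> \<circ> \<tau>) = - sign \<pi>" using ij(1) by (simp add: sign_compose \<tau>_def sign_swap_id)
      then show "F (\<tau> ` T) (\<pi> \<circ> \<tau>) = - F T \<pi>" unfolding F_def inv by simp
    qed
    also have "\<dots> = - (\<Sum>T | card T = k. \<Sum>\<pi> | \<pi> permutes UNIV. F T \<pi>)" by (simp add: sum_negf)
    finally have "(\<Sum>T | card T = k. \<Sum>\<pi> | \<pi> permutes UNIV. F T \<pi>) = 0"
      by (simp only: eq_neg_iff_add_eq_0) simp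
    then show ?thesis unfolding S F_def .
  qed
qed

lemma DD_E_mult:
  assumes "1 \<le> k" "k \<le> CARD('n)"
    and "M = 0 \<and> (\<forall>i. c i < int (r * CARD('n))) \<or> M = int (r * CARD('n)) \<and> k < CARD('n)"
    and f: "f \<in> x_polys"
  shows "DD M (E k UNIV * f) c = 0"
proof -
  have "f \<in> {f. DD M (E k UNIV * f) c = 0}"
  proof (rule lin_subspace_keys_in)
    show "lin_subspace {f. DD M (E k UNIV * f) c = 0}"
      by (simp add: lin_subspace_def distrib_left scl_mult_right DD_add DD_scl DD_zero)
    fix x assume x: "x \<in> Poly_Mapping.keys f"
    show "gen x \<in> {f. DD M (E k UNIV * f) c = 0}"
      unfolding x_polys_mono_eq[OF x f] mem_Collect_eq mult.commute[of "E k UNIV"] by (rule DD_E[OF assms(1-3)])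
  qed
  then show ?thesis by simp
qed

text \<open>Lexicographic order reading the highest number first, as required by the bounds in
  \<open>NF\<close>, which are tightest there.\<close>

definition lexless :: "('n \<Rightarrow> nat) \<Rightarrow> ('n \<Rightarrow> nat) \<Rightarrow> bool"
  where "lexless a b \<longleftrightarrow> (\<exists>i. a i < b i \<and> (\<forall>l. idx i < idx l \<longrightarrow> a l = b l))"

lemma lexless_asym: "lexless a b \<Longrightarrow> \<not> lexless b a"
proof
  assume "lexless a b" "lexless b a"
  then obtain i j where i: "a i < b i" "\<forall>l. idx i < idx l \<longrightarrow> a l = b l"
    and j: "b j < a j" "\<forall>l. idx j < idx l \<longrightarrow> b l = a l" unfolding lexless_def by blast
  consider "idx i < idx j" | "idx j < idx i" | "i = j" using idx_inj[of i j] by linarith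
  then show False
  proof cases
    case 1 then have "a j = b j" using i(2) by blast
    then show False using j(1) by simp
  next
    case 2 then have "b i = a i" using j(2) by blast
    then show False using i(1) by simp
  next
    case 3 then show False using i(1) j(1) by simp
  qed
qed

lemma lexless_trans: "lexless a b \<Longrightarrow> lexless b c \<Longrightarrow> lexless a c"
proof -
  assume "lexless a b" "lexless b c"
  then obtain i j where i: "a i < b i" "\<forall>l. idx i < idx l \<longrightarrow> a l = b l"
    and j: "b j < c j" "\<forall>l. idx j < idx l \<longrightarrow> b l = c l" unfolding lexless_def by blast
  consider "idx i < idx j" | "idx j < idx i" | "i = j" using idx_inj[of i j] by linarith
  then show "lexless a c"
  proof cases
    case 1
    then have "a j < c j" "\<forall>l. idx j < idx l \<longrightarrow> a l = c l" using i(2) j by auto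
    then show ?thesis unfolding lexless_def by blast
  next
    case 2
    then have "a i < c i" "\<forall>l. idx i < idx l \<longrightarrow> a l = c l" using j(2) i by auto
    then show ?thesis unfolding lexless_def by blast
  next
    case 3
    then have "a i < c i" "\<forall>l. idx i < idx l \<longrightarrow> a l = c l" using j i by auto
    then show ?thesis unfolding lexless_def by blast
  qed
qed

text \<open>Leading terms: \<open>a\<close> is a maximal exponent vector of \<open>g\<close>, and
  \<open>c\<close> is its sum with the diagonal term of the Vandermonde polynomial. No other pair of
  a monomial and a permutation reaches \<open>c\<close>, so the coefficient there is that of
  \<open>a\<close>.\<close>

lemma DD_independent:
  assumes g: "g \<in> NFs mm d" and mm: "CARD('n) - 1 \<le> mm"
    and M: "M = 0 \<and> CARD('n) \<le> mm \<or> M = int (r * CARD('n))"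
    and D: "\<And>c. (M = 0 \<Longrightarrow> \<forall>i. c i < int (r * CARD('n))) \<Longrightarrow> DD M g c = 0"
  shows "g = 0"
proof (rule ccontr)
  let ?n = "CARD('n)"
  assume "g \<noteq> 0"
  define K where "K = xe ` Poly_Mapping.keys g"
  have K: "finite K" "K \<noteq> {}" using \<open>g \<noteq> 0\<close> by (auto simp: K_def)
  have Kx: "x = mon (xe x) (\<lambda>_. 0) \<and> NF mm (xe x) \<and> (\<Sum>i\<in>UNIV. xe x i) = d" if xg: "x \<in> Poly_Mapping.keys g" for x
  proof -
    obtain a where "x = mon a (\<lambda>_. 0)" "NF mm a" "(\<Sum>i\<in>UNIV. a i) = d" using g xg unfolding NFs_def by blast
    moreover from this have "xe x = a" by auto
    ultimately show ?thesis by simp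
  qed
  obtain a where a: "a \<in> K" "\<And>b. b \<in> K \<Longrightarrow> b \<noteq> a \<Longrightarrow> \<not> lexless a b"
  proof -
    have "transp_on K lexless" by (rule transp_onI) (rule lexless_trans)
    moreover have "asymp_on K lexless" by (rule asymp_onI) (rule lexless_asym)
    ultimately have "\<exists>m\<in>K. \<forall>x\<in>K. x \<noteq> m \<longrightarrow> \<not> lexless m x"
      using Finite_Set.bex_max_element[of K lexless] K by blast
    then show thesis using that by blast
  qed
  then obtain x0 where x0: "x0 \<in> Poly_Mapping.keys g" "xe x0 = a" unfolding K_def by blast
  have a_NF: "NF mm a" using Kx[OF x0(1)] x0(2) by simp
  define c where "c i = int (a i) + int (r * idx i)" for i
  \<comment> \<open>Bounded coordinates stay below rn even after the shift, so for them a congruence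
    modulo rn is an equality.\<close>
  have bound: "b l + r * idx (\<pi> l) < r * ?n"
    if "NF mm b" "?n - idx l \<le> mm" "idx (\<pi> l) \<le> idx l" for b and \<pi> :: "'n \<Rightarrow> 'n" and l
  proof -
    have "b l < r * (?n - idx l)" using that by (simp add: NF_def)
    moreover have "r * idx (\<pi> l) \<le> r * idx l" using that by simp
    moreover have "r * (?n - idx l) + r * idx l = r * ?n"
      using idx_less[of l] by (simp flip: distrib_left)
    ultimately show ?thesis by linarith
  qed
  have eqI: "a l + r * idx l = b l + r * idx (\<pi> l)"
    if "[c l = int (b l) + int (r * idx (\<pi> l))] (mod M)" "NF mm b" "?n - idx l \<le> mm" "idx (\<pi> l) \<le> idx l"
    for b and \<pi> :: "'n \<Rightarrow> 'n" and l
  proof -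
    have 1: "a l + r * idx l < r * ?n" using bound[OF a_NF that(3), of id] by simp
    have 2: "b l + r * idx (\<pi> l) < r * ?n" by (rule bound[where \<pi> = \<pi>, OF that(2-4)])
    from M show ?thesis
    proof
      assume "M = 0 \<and> ?n \<le> mm"
      then have "int (a l + r * idx l) = int (b l + r * idx (\<pi> l))" using that(1) by (simp add: c_def cong_def)
      then show ?thesis by (simp only: of_nat_eq_iff)
    next
      assume "M = int (r * ?n)"
      then have "int ((a l + r * idx l) mod (r * ?n)) = int ((b l + r * idx (\<pi> l)) mod (r * ?n))"
        using that(1) by (simp only: c_def cong_def of_nat_mod of_nat_add)
      then have "(a l + r * idx l) mod (r * ?n) = (b l + r * idx (\<pi> l)) mod (r * ?n)" by (simp only: of_nat_eq_iff)
      then show ?thesis using 1 2 by simp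
    qed
  qed
  have mm_ge: "?n - idx l \<le> mm" if "idx l \<noteq> 0" for l using mm that by linarith
  have claim: "\<pi> = id \<and> xe x = a"
    if x: "x \<in> Poly_Mapping.keys g" and \<pi>: "\<pi> permutes UNIV"
      and c: "\<forall>i. [c i = int (xe x i) + int (r * idx (\<pi> i))] (mod M)" for x \<pi>
  proof -
    let ?b = "xe x"
    have b_NF: "NF mm ?b" "(\<Sum>i\<in>UNIV. ?b i) = d" using Kx[OF x] by auto
    have id: "\<pi> = id"
    proof (rule ccontr)
      assume "\<pi> \<noteq> id"
      then have "{l. \<pi> l \<noteq> l} \<noteq> {}" by (auto simp: fun_eq_iff)
      then have "\<exists>i\<in>{l. \<pi> l \<noteq> l}. \<forall>l\<in>{l. \<pi> l \<noteq> l}. idx l \<le> idx i"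
      proof -
        assume ne: "{l. \<pi> l \<noteq> l} \<noteq> {}"
        then have "Max (idx ` {l. \<pi> l \<noteq> l}) \<in> idx ` {l. \<pi> l \<noteq> l}" by (intro Max_in) simp_all
        then obtain i where i: "i \<in> {l. \<pi> l \<noteq> l}" "Max (idx ` {l. \<pi> l \<noteq> l}) = idx i" by blast
        have "idx l \<le> idx i" if "l \<in> {l. \<pi> l \<noteq> l}" for l
          unfolding i(2)[symmetric] by (rule Max_ge) (use that in simp_all)
        with i(1) show ?thesis by blast
      qed
      \<comment> \<open>At the highest place moved by \<open>\<pi>\<close> the number can only go
        down. To reach \<open>c\<close> all the same, \<open>?b\<close> must exceed \<open>a\<close>
        there while agreeing above, against the maximality of \<open>a\<close>.\<close>
      then obtain i where i: "\<pi> i \<noteq> i" "\<And>l. \<pi> l \<noteq> l \<Longrightarrow> idx l \<le> idx i" by blast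
      have fixed: "\<pi> l = l" if "idx i < idx l" for l using i(2)[of l] that by force
      have "idx (\<pi> i) \<le> idx i"
      proof (rule ccontr)
        assume "\<not> idx (\<pi> i) \<le> idx i"
        then have "\<pi> (\<pi> i) = \<pi> i" by (intro fixed) simp
        then show False using permutes_inj[OF \<pi>] i(1) by (simp add: inj_eq)
      qed
      then have lt: "idx (\<pi> i) < idx i" using i(1) idx_inj[of "\<pi> i" i] by linarith
      have "a i + r * idx i = ?b i + r * idx (\<pi> i)"
        by (rule eqI[of i ?b \<pi>]) (use c b_NF lt mm_ge[of i] in auto)
      moreover have "r * idx (\<pi> i) < r * idx i" using lt r_gt_1 by simp
      ultimately have "a i < ?b i" by linarith
      moreover have "a l = ?b l" if "idx i < idx l" for l
        using eqI[of l ?b \<pi>, OF c[rule_format, of l] b_NF(1) mm_ge[of l]] that fixed[OF that] by simp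
      ultimately have "lexless a ?b" unfolding lexless_def by blast
      moreover have "?b \<in> K" "?b \<noteq> a" using x \<open>a i < ?b i\<close> by (auto simp: K_def)
      ultimately show False using a(2) by blast
    qed
    have ne0: "a l = ?b l" if "idx l \<noteq> 0" for l
      using eqI[of l ?b \<pi>, OF c[rule_format, of l] b_NF(1) mm_ge[OF that]] by (simp add: id)
    have "a l = ?b l" for l
    \<comment> \<open>The place numbered 0 may be unbounded. Its coordinate is recovered from the
      common total degree d.\<close>
    proof (cases "idx l = 0")
      case True
      have rest: "(\<Sum>i\<in>UNIV - {l}. a i) = (\<Sum>i\<in>UNIV - {l}. ?b i)"
      proof (rule sum.cong)
        fix i assume "i \<in> UNIV - {l}"
        then have "idx i \<noteq> 0" using True idx_inj[of i l] by auto
        then show "a i = ?b i" by (rule ne0)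
      qed simp
      have "(\<Sum>i\<in>UNIV. a i) = d" using Kx[OF x0(1)] unfolding x0(2)[symmetric] by blast
      then have "(\<Sum>i\<in>UNIV. a i) = (\<Sum>i\<in>UNIV. ?b i)" using b_NF(2) by simp
      then show ?thesis using rest by (simp add: sum.remove[of UNIV l])
    qed (rule ne0)
    then show ?thesis using id by (simp add: fun_eq_iff)
  qed
  have "DD M g c = (\<Sum>x\<in>Poly_Mapping.keys g. Poly_Mapping.lookup g x * DD M (gen x) c)"
    by (simp add: DD_def lext_def)
  also have "\<dots> = (\<Sum>x\<in>Poly_Mapping.keys g. if x = x0 then Poly_Mapping.lookup g x0 else 0)"
  proof (rule sum.cong)
    fix x assume x: "x \<in> Poly_Mapping.keys g"
    show "Poly_Mapping.lookup g x * DD M (gen x) c = (if x = x0 then Poly_Mapping.lookup g x0 else 0)"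
    proof (cases "x = x0")
      case True
      have "DD M (gen x) c = (\<Sum>\<pi> :: 'n \<Rightarrow> 'n | \<pi> permutes UNIV. if \<pi> = id then 1 else 0)"
        unfolding DD_gen
      proof (rule sum.cong)
        fix \<pi> :: "'n \<Rightarrow> 'n" assume \<pi>: "\<pi> \<in> {\<pi>. \<pi> permutes UNIV}"
        show "of_int (sign \<pi>) * of_bool (\<forall>i. [c i = int (xe x i) + int (r * idx (\<pi> i))] (mod M)) = (if \<pi> = id then 1 else 0 :: complex)"
        proof (cases "\<pi> = id")
          case False
          then show ?thesis using claim[OF x] \<pi> by auto
        next
          case True
          have "xe x i = a i" for i using fun_cong[OF x0(2), of i] \<open>x = x0\<close> by simp
          then show ?thesis using True by (simp add: c_def)
        qed
      qed simp
      then show ?thesis using True by (simp add: permutes_id finite_permutations)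
    next
      case False
      have "\<not> (\<forall>i. [c i = int (xe x i) + int (r * idx (\<pi> i))] (mod M))" if "\<pi> permutes UNIV" for \<pi>
      proof
        assume "\<forall>i. [c i = int (xe x i) + int (r * idx (\<pi> i))] (mod M)"
        then have "xe x = a" using claim[OF x that] by blast
        then have "x = x0" using Kx[OF x] Kx[OF x0(1)] x0(2) by metis
        with False show False ..
      qed
      then have "DD M (gen x) c = 0" unfolding DD_gen by (intro sum.neutral) auto
      then show ?thesis using False by simp
    qed
  qed simp
  also have "\<dots> = Poly_Mapping.lookup g x0" using x0 by simp
  finally have "DD M g c \<noteq> 0" using x0(1) by (simp add: in_keys_iff)
  moreover have "DD M g c = 0"
  proof (rule D)
    assume "M = 0"
    then have "?n \<le> mm" using M r_gt_1 by auto
    then have "a i + r * idx i < r * ?n" for i using bound[OF a_NF, of i id] by simp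
    then show "\<forall>i. c i < int (r * ?n)" unfolding c_def of_nat_add[symmetric] of_nat_less_iff by blast
  qed
  ultimately show False by simp
qed

text \<open>v is the Vandermonde polynomial in the x_i^r times (x_1 ... x_n)^eps, which explains the
  shift by \<open>eps\<close>.\<close>

lemma Q_DD:
  assumes "f \<in> x_polys" "m \<in> box" shows "Q f m = DD 0 f (\<lambda>i. int (m i) - int eps)"
proof (rule functional_eqI[where T = "\<lambda>f. Q f m" and T' = "\<lambda>f. DD 0 f (\<lambda>i. int (m i) - int eps)"])
  fix x assume "x \<in> Poly_Mapping.keys f"
  then have y0: "ye x = (\<lambda>_. 0)" using assms(1) by (auto simp: x_polys_iff)
  have mh: "m i \<le> h" for i using assms(2) by (simp add: box_def)
  have iff: "[int (m i) - int eps = int (xe x i) + int (r * idx (\<pi> i))] (mod 0)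
      \<longleftrightarrow> xe x i \<le> m i \<and> m i - xe x i = eps + r * idx (\<pi> i)" for i and \<pi> :: "'n \<Rightarrow> 'n"
    unfolding cong_0 by (simp only: of_nat_add[symmetric] diff_eq_eq of_nat_eq_iff) linarith
  show "Q (gen x) m = DD 0 (gen x) (\<lambda>i. int (m i) - int eps)"
  proof (cases "\<forall>i. xe x i \<le> m i")
    case True
    then show ?thesis unfolding Q_gen DD_gen iff qq_def y0 v_def by (simp add: mh Lf_def)
  next
    case False
    then show ?thesis unfolding Q_gen DD_gen iff qq_def by (auto intro!: sum.neutral)
  qed
qed (simp_all add: Q_add Q_scl DD_add DD_scl)

end

section \<open>The coinvariant ideal as an annihilator\<close>

lemma restr_mult_homogeneous:
  assumes f: "\<And>x. x \<in> Poly_Mapping.keys f \<Longrightarrow> tdeg x = e"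
  shows "restr (\<lambda>x. tdeg x = d) (f * g) = f * (if e \<le> d then restr (\<lambda>x. tdeg x = d - e) g else 0)"
proof (rule linear_eqI[where T = "\<lambda>f. restr (\<lambda>x. tdeg x = d) (f * g)"
      and T' = "\<lambda>f. f * (if e \<le> d then restr (\<lambda>x. tdeg x = d - e) g else 0)"])
  fix x assume "x \<in> Poly_Mapping.keys f"
  then have x: "tdeg x = e" by (rule f)
  show "restr (\<lambda>x. tdeg x = d) (gen x * g) = gen x * (if e \<le> d then restr (\<lambda>x. tdeg x = d - e) g else 0)"
  proof (rule linear_eqI[where T = "\<lambda>g. restr (\<lambda>x. tdeg x = d) (gen x * g)"
        and T' = "\<lambda>g. gen x * (if e \<le> d then restr (\<lambda>x. tdeg x = d - e) g else 0)"])
    fix y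
    have "tdeg (x + y) = d \<longleftrightarrow> e \<le> d \<and> tdeg y = d - e" unfolding tdeg_add x by linarith
    then show "restr (\<lambda>x. tdeg x = d) (gen x * gen y) = gen x * (if e \<le> d then restr (\<lambda>x. tdeg x = d - e) (gen y) else 0)"
      by (simp add: gen_mult restr_gen)
  qed (simp_all add: distrib_left scl_mult_right restr_add restr_scl)
qed (simp_all add: distrib_right scl_mult_left restr_add restr_scl)

lemma restr_x_polys: "f \<in> x_polys \<Longrightarrow> restr P f \<in> x_polys"
  by (auto simp: x_polys_iff keys_restr)

context coinv_model
begin

definition J :: "'n bipoly set"
  where "J = Idl\<^bsub>x_alg :: (complex^'n^'n, 'n bipoly) grep\<^esub>
    (\<Union>d\<in>{0<..}. invariants (G_group r p) (x_alg :: (complex^'n^'n, 'n bipoly) grep) \<inter> gr (x_alg :: (complex^'n^'n, 'n bipoly) grep) d)"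

lemma x_alg_ring: "ring (x_alg :: (complex^'n^'n, 'n bipoly) grep)"
  using presented_alg.ring[OF x_alg_presented[of r]] r_gt_1 by simp

lemma gr_x_alg: "gr (x_alg :: (complex^'n^'n, 'n bipoly) grep) d = {f \<in> x_polys. \<forall>x\<in>Poly_Mapping.keys f. mon_deg x = d}"
  by (auto simp: x_alg_def sub_grep_def poly_alg_def)

lemma act_pact:
  assumes "G_data r p \<sigma> \<eta>" shows "subst (var_act (wmat \<sigma> \<eta>)) f = pact \<sigma> \<eta> f"
  using assms G_data_nonzero[OF assms] r_gt_1 by (intro subst_eq_pact) (auto simp: G_data_def)

lemma x_invariants:
  fixes f :: "'n bipoly"
  shows "f \<in> invariants (G_group r p) x_alg \<longleftrightarrow> f \<in> x_polys \<and> (\<forall>\<sigma> \<eta>. G_data r p \<sigma> \<eta> \<longrightarrow> pact \<sigma> \<eta> f = f)"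
proof
  assume f: "f \<in> invariants (G_group r p) x_alg"
  have "pact \<sigma> \<eta> f = f" if "G_data r p \<sigma> \<eta>" for \<sigma> \<eta>
    using f wmat_mem[OF that] r_gt_1 act_pact[OF that, of f] by (simp add: invariants_def)
  then show "f \<in> x_polys \<and> (\<forall>\<sigma> \<eta>. G_data r p \<sigma> \<eta> \<longrightarrow> pact \<sigma> \<eta> f = f)" using f by (simp add: invariants_def)
next
  assume f: "f \<in> x_polys \<and> (\<forall>\<sigma> \<eta>. G_data r p \<sigma> \<eta> \<longrightarrow> pact \<sigma> \<eta> f = f)"
  have "subst (var_act w) f = f" if w: "w \<in> G_group r p" for w :: "complex^'n^'n"
  proof -
    obtain \<sigma> \<eta> where G: "G_data r p \<sigma> \<eta>" "w = wmat \<sigma> \<eta>" using w by (rule G_groupE)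
    then show ?thesis using f act_pact[OF G(1), of f] by simp
  qed
  then show "f \<in> invariants (G_group r p) x_alg" using f by (simp add: invariants_def)
qed

lemma J_gens: "(\<Union>d\<in>{0<..}. invariants (G_group r p) (x_alg :: (complex^'n^'n, 'n bipoly) grep) \<inter> gr (x_alg :: (complex^'n^'n, 'n bipoly) grep) d) \<subseteq> x_polys"
  by (auto simp: invariants_def)

lemma J_ideal: "ideal J (x_alg :: (complex^'n^'n, 'n bipoly) grep)"
  unfolding J_def using J_gens by (intro ring.genideal_ideal[OF x_alg_ring]) simp

lemma J_xideal: "xideal J" "J \<subseteq> x_polys"
  using x_ideal_subspace[OF J_ideal] by (auto simp: xideal_def)

lemma invariant_in_J:
  assumes "f \<in> x_polys" "\<And>\<sigma> \<eta>. G_data r p \<sigma> \<eta> \<Longrightarrow> pact \<sigma> \<eta> f = f"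
    and "\<And>x. x \<in> Poly_Mapping.keys f \<Longrightarrow> mon_deg x = d" "d > 0"
  shows "f \<in> J"
proof -
  have "f \<in> invariants (G_group r p) x_alg \<inter> gr x_alg d" using assms x_invariants gr_x_alg by blast
  then show ?thesis unfolding J_def genideal_def using assms(4) by blast
qed

lemma mon_deg_mon: "mon_deg (mon a (\<lambda>_. 0)) = int (\<Sum>i\<in>UNIV. a i)"
  by (simp add: mon_deg_eq)

lemma keys_sum_subset: "Poly_Mapping.keys (sum f A) \<subseteq> (\<Union>a\<in>A. Poly_Mapping.keys (f a))"
proof (induction A rule: infinite_finite_induct)
  case (insert x F)
  then show ?case using keys_add[of "f x" "sum f F"] by auto
qed auto

lemma sum_zexp: "(\<Sum>i\<in>UNIV. zexp T i) = r * card T"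
  by (simp add: zexp_def sum.If_cases)

lemma keys_E: "x \<in> Poly_Mapping.keys (E k S) \<Longrightarrow> \<exists>T. card T = k \<and> x = mon (zexp T) (\<lambda>_. 0)"
  using keys_sum_subset[of "\<lambda>T. xm (zexp T)" "{T. T \<subseteq> S \<and> card T = k}"] by (auto simp: E_def keys_xm)

lemma pact_xm: "pact \<sigma> \<eta> (xm a) = scl (\<Prod>i\<in>UNIV. \<eta> i ^ a i) (xm (\<lambda>i. a (finv \<sigma> i)))"
  by (simp add: xm_def pperm_def pcoef_def scl_single)

lemma E_in_J: assumes "1 \<le> k" shows "E k UNIV \<in> J"
proof (rule invariant_in_J[where d = "int (r * k)"])
  fix \<sigma> :: "'n \<Rightarrow> 'n" and \<eta> assume G: "G_data r p \<sigma> \<eta>"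
  then have \<sigma>: "\<sigma> permutes UNIV" and \<eta>: "\<And>i. \<eta> i ^ r = 1" by (auto simp: G_data_def)
  note [simp] = permutes_inverses[OF \<sigma>]
  have 1: "pact \<sigma> \<eta> (xm (zexp T)) = xm (zexp (\<sigma> ` T))" for T
  proof -
    have "(\<Prod>i\<in>UNIV. \<eta> i ^ zexp T i) = 1" by (intro prod.neutral) (simp add: zexp_def \<eta>)
    moreover have "finv \<sigma> i \<in> T \<longleftrightarrow> i \<in> \<sigma> ` T" for i by (metis image_iff permutes_inverses[OF \<sigma>])
    then have "(\<lambda>i. zexp T (finv \<sigma> i)) = zexp (\<sigma> ` T)" by (intro ext) (simp add: zexp_def)
    moreover have "scl 1 f = f" for f :: "'n bipoly" by (rule poly_mapping_eqI) (simp only: lookup_scl mult_1_left)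
    ultimately show ?thesis unfolding pact_xm by simp
  qed
  have inj: "inj \<sigma>" by (rule permutes_inj[OF \<sigma>])
  have "pact \<sigma> \<eta> (E k UNIV) = (\<Sum>T | card T = k. xm (zexp (\<sigma> ` T)))" by (simp add: E_def pact_sum 1)
  also have "\<dots> = (\<Sum>T | card T = k. xm (zexp T))"
    by (rule sum.reindex_bij_witness[of _ "image (finv \<sigma>)" "image \<sigma>"])
       (auto simp: image_image card_image inj_on_subset[OF inj] inj_on_subset[OF permutes_inj[OF permutes_inv[OF \<sigma>]]])
  finally show "pact \<sigma> \<eta> (E k UNIV) = E k UNIV" by (simp add: E_def)
next
  fix x assume "x \<in> Poly_Mapping.keys (E k UNIV)"
  then show "mon_deg x = int (r * k)" using keys_E[of x k UNIV] by (auto simp: mon_deg_mon sum_zexp simp del: of_nat_sum)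
qed (use assms r_gt_1 E_x_polys in auto)

lemma q_in_J: "xm (\<lambda>_. s) \<in> J"
proof (rule invariant_in_J[where d = "int (CARD('n) * s)"])
  fix \<sigma> :: "'n \<Rightarrow> 'n" and \<eta> assume G: "G_data r p \<sigma> \<eta>"
  have "(\<Prod>i\<in>UNIV. \<eta> i ^ s) = 1" using G by (simp add: prod_power_distrib G_data_def s_def)
  moreover have "scl 1 f = f" for f :: "'n bipoly" by (rule poly_mapping_eqI) (simp only: lookup_scl mult_1_left)
  ultimately show "pact \<sigma> \<eta> (xm (\<lambda>_. s)) = xm (\<lambda>_. s)" unfolding pact_xm by simp
qed (use s_pos xm_x_polys in \<open>auto simp: keys_xm mon_deg_mon\<close>)

text \<open>The polynomials in the x_i that lie in \<open>kernel\<close> form an ideal, and by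
  \<open>invariants_kernel\<close> it contains the generators of \<open>J\<close>; on such
  polynomials the symbol is \<open>Q\<close>.\<close>

lemma J_annihilates: assumes "f \<in> J" shows "Q f m = 0"
proof -
  define A where "A = x_polys \<inter> kernel"
  have A: "lin_subspace A"
    using lin_subspaceD(1-3)[OF x_polys_subspace] lin_subspaceD(1-3)[OF kernel_subspace] by (auto simp: A_def lin_subspace_def)
  have "ideal ((\<lambda>f. f) ` A) (x_alg :: (complex^'n^'n, 'n bipoly) grep)"
    by (rule presented_alg.ideal_image[OF x_alg_presented[of r]])
       (use r_gt_1 A kernel_mult x_polys_mult in \<open>auto simp: A_def\<close>)
  then have "ideal A (x_alg :: (complex^'n^'n, 'n bipoly) grep)" by simp
  moreover have "(\<Union>d\<in>{0<..}. invariants (G_group r p) x_alg \<inter> gr x_alg d) \<subseteq> A"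
  proof
    fix f assume "f \<in> (\<Union>d\<in>{0<..}. invariants (G_group r p) (x_alg :: (complex^'n^'n, 'n bipoly) grep) \<inter> gr x_alg d)"
    then obtain d where d: "d > 0" "f \<in> invariants (G_group r p) x_alg" "\<forall>x\<in>Poly_Mapping.keys f. mon_deg x = d"
      by (auto simp: gr_x_alg)
    have "0 \<notin> Poly_Mapping.keys f" using d(1,3) by (auto simp: mon_deg_eq)
    then have "Poly_Mapping.lookup f 0 = 0" by (simp add: in_keys_iff)
    then show "f \<in> A" using d(2) x_invariants invariants_kernel by (auto simp: A_def)
  qed
  ultimately have "J \<subseteq> A" unfolding J_def by (rule ring.genideal_minimal[OF x_alg_ring])
  then have "f \<in> x_polys" "f \<in> kernel" using assms by (auto simp: A_def)
  then show ?thesis using Psi_x_polys[of f m] by (simp add: kernel_def)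
qed

text \<open>The ideal of E_1, ..., E_k with its coefficients exposed, so that the last generator can
  be split off and homogeneous components can be taken termwise.\<close>

definition Jz :: "nat \<Rightarrow> 'n bipoly set"
  where "Jz k = {f. \<exists>g. (\<forall>l. g l \<in> x_polys) \<and> f = (\<Sum>l\<in>{1..k}. E l UNIV * g l)}"

lemma Jz_xideal: "xideal (Jz k)"
proof -
  note s = lin_subspaceD[OF x_polys_subspace]
  have "0 \<in> Jz k" unfolding Jz_def mem_Collect_eq by (rule exI[of _ "\<lambda>_. 0"]) (simp add: s(1))
  moreover have "f + f' \<in> Jz k" if h: "f \<in> Jz k" "f' \<in> Jz k" for f f'
  proof -
    obtain g g' where g: "\<forall>l. g l \<in> x_polys" "f = (\<Sum>l\<in>{1..k}. E l UNIV * g l)"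
      and g': "\<forall>l. g' l \<in> x_polys" "f' = (\<Sum>l\<in>{1..k}. E l UNIV * g' l)" using h unfolding Jz_def by blast
    show ?thesis unfolding Jz_def mem_Collect_eq
      by (rule exI[of _ "\<lambda>l. g l + g' l"]) (simp add: g g' s(2) distrib_left sum.distrib)
  qed
  moreover have "scl c f \<in> Jz k" if h: "f \<in> Jz k" for f c
  proof -
    obtain g where g: "\<forall>l. g l \<in> x_polys" "f = (\<Sum>l\<in>{1..k}. E l UNIV * g l)" using h unfolding Jz_def by blast
    have "scl c f = (\<Sum>l\<in>{1..k}. E l UNIV * scl c (g l))"
      unfolding g(2) Const_mult[symmetric] by (simp add: sum_distrib_left mult.left_commute)
    then show ?thesis unfolding Jz_def mem_Collect_eq by (intro exI[of _ "\<lambda>l. scl c (g l)"]) (simp add: g s(3))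
  qed
  moreover have "f * f' \<in> Jz k" if h: "f \<in> Jz k" "f' \<in> x_polys" for f f'
  proof -
    obtain g where g: "\<forall>l. g l \<in> x_polys" "f = (\<Sum>l\<in>{1..k}. E l UNIV * g l)" using h unfolding Jz_def by blast
    have "f * f' = (\<Sum>l\<in>{1..k}. E l UNIV * (g l * f'))" by (simp add: g(2) sum_distrib_right mult.assoc)
    then show ?thesis unfolding Jz_def mem_Collect_eq by (intro exI[of _ "\<lambda>l. g l * f'"]) (simp add: g x_polys_mult h)
  qed
  ultimately show ?thesis by (simp add: xideal_def lin_subspace_def)
qed

lemma E_in_Jz: assumes "1 \<le> l" "l \<le> k" shows "E l UNIV \<in> Jz k"
proof -
  have "E l UNIV = (\<Sum>l'\<in>{1..k}. if l' = l then E l UNIV else 0)" using assms by simp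
  also have "\<dots> = (\<Sum>l'\<in>{1..k}. E l' UNIV * (if l' = l then 1 else 0))" by (intro sum.cong) auto
  finally show ?thesis unfolding Jz_def mem_Collect_eq
    by (intro exI[of _ "\<lambda>l'. if l' = l then 1 else 0"]) (simp add: x_polys_one lin_subspaceD(1)[OF x_polys_subspace])
qed

lemma tdeg_keys_E: "x \<in> Poly_Mapping.keys (E k UNIV) \<Longrightarrow> tdeg x = r * k"
  using keys_E[of x k UNIV] by (auto simp: tdeg_mon sum_zexp)

lemma Jz_comp: assumes "f \<in> Jz k" shows "comp d f \<in> Jz k"
proof -
  obtain g where g: "\<forall>l. g l \<in> x_polys" "f = (\<Sum>l\<in>{1..k}. E l UNIV * g l)" using assms unfolding Jz_def by blast
  have rs: "restr P (sum F A) = (\<Sum>a\<in>A. restr P (F a))" for P and F :: "nat \<Rightarrow> 'n bipoly" and A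
    by (simp add: restr_def pext_sum)
  have "comp d f = (\<Sum>l\<in>{1..k}. E l UNIV * (if r * l \<le> d then comp (d - r * l) (g l) else 0))"
    unfolding g(2) rs by (intro sum.cong refl restr_mult_homogeneous tdeg_keys_E)
  then show ?thesis unfolding Jz_def mem_Collect_eq
    by (intro exI[of _ "\<lambda>l. if r * l \<le> d then comp (d - r * l) (g l) else 0"])
       (simp add: g restr_x_polys lin_subspaceD(1)[OF x_polys_subspace])
qed

lemma Jz_DD:
  assumes "f \<in> Jz k" "k \<le> CARD('n)" "M = 0 \<and> (\<forall>i. c i < int (r * CARD('n))) \<or> M = int (r * CARD('n)) \<and> k < CARD('n)"
  shows "DD M f c = 0"
proof -
  obtain g where g: "\<forall>l. g l \<in> x_polys" "f = (\<Sum>l\<in>{1..k}. E l UNIV * g l)" using assms(1) unfolding Jz_def by blast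
  show ?thesis unfolding g(2) DD_sum
    by (intro sum.neutral ballI DD_E_mult) (use assms(2,3) g(1) in auto)
qed

lemma Jz_subset_J: "Jz k \<subseteq> J"
proof
  fix f assume "f \<in> Jz k"
  then obtain g where g: "\<forall>l. g l \<in> x_polys" "f = (\<Sum>l\<in>{1..k}. E l UNIV * g l)" unfolding Jz_def by blast
  show "f \<in> J" unfolding g(2)
    by (rule lin_subspaceD(6)[OF xidealD(1)[OF J_xideal(1)]])
       (use E_in_J g(1) xidealD(2)[OF J_xideal(1)] in auto)
qed

text \<open>f v = 0 says that f times the Vandermonde polynomial lies in the ideal of the
  x_i^(r(n-1)+s). Multiplying by (x_1 ... x_n)^(r-s) raises the cut-off to rn, where normal forms
  are detected, so the product lies in the ideal of E_1, ..., E_n. As E_n = (x_1 ... x_n)^r contains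
  the extra factor, it can be cancelled modulo E_1, ..., E_(n-1), where exponents modulo rn make
  multiplication by a monomial invertible.\<close>

lemma homogeneous_annihilator:
  assumes f: "f \<in> x_polys" "\<And>x. x \<in> Poly_Mapping.keys f \<Longrightarrow> tdeg x = d" and ann: "\<And>m. Q f m = 0"
  shows "f \<in> J"
proof -
  let ?n = "CARD('n)"
  have rn: "r * ?n = r * (?n - 1) + r"
  proof -
    have "?n = Suc (?n - 1)" by simp
    then have "r * ?n = r * Suc (?n - 1)" by simp
    then show ?thesis by (simp only: mult_Suc_right add.commute)
  qed
  \<comment> \<open>Coefficients of f times the Vandermonde polynomial: for nonnegative exponents
    they are coefficients of f v shifted by \<open>eps\<close>, and negative exponents do not
    occur.\<close>
  have D0: "DD 0 f c = 0" if c: "\<And>i. c i < int (r * (?n - 1) + s)" for c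
  proof (cases "\<forall>i. 0 \<le> c i")
    case True
    define m where "m i = nat (c i) + eps" for i
    have "m \<in> box"
    proof -
      have "m i \<le> h" for i
      proof -
        have "nat (c i) < r * (?n - 1) + s" using c[of i] True by (simp add: nat_less_iff)
        then show ?thesis using h_eq by (simp add: m_def)
      qed
      then show ?thesis by (simp add: box_def)
    qed
    then have "DD 0 f (\<lambda>i. int (m i) - int eps) = 0" using Q_DD[OF f(1)] ann by metis
    moreover have "(\<lambda>i. int (m i) - int eps) = c" using True by (simp add: m_def fun_eq_iff)
    ultimately show ?thesis by simp
  next
    case False
    then obtain i where i: "c i < 0" by (auto simp: not_le)
    have "\<not> [c i = int (xe x i) + int (r * idx (\<pi> i))] (mod 0)" for x :: "'n bimon" and \<pi> :: "'n \<Rightarrow> 'n"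
      unfolding cong_0 using i by linarith
    then have "DD 0 (gen x) c = 0" for x unfolding DD_gen by (intro sum.neutral) auto
    then show ?thesis by (simp add: DD_def lext_def)
  qed
  \<comment> \<open>s(p - 1) is r - s, the gap between the cut-offs r(n-1) + s and rn.\<close>
  define b where "b = (\<lambda>_ :: 'n. s * (p - 1))"
  have bs: "s * (p - 1) + s = r" using p_pos s_mult_p by (cases p) auto
  have F0: "DD 0 (xm b * f) c = 0" if c: "\<And>i. c i < int (r * ?n)" for c
    unfolding DD_shift
  proof (rule D0)
    fix i
    have "c i < int (r * (?n - 1) + (s * (p - 1) + s))" using c[of i] rn bs by simp
    then show "c i - int (b i) < int (r * (?n - 1) + s)" unfolding b_def by simp
  qed
  define d' where "d' = ?n * (s * (p - 1)) + d"
  have F: "xm b * f \<in> x_polys" using f(1) xm_x_polys x_polys_mult by blast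
  have hom_mult: "tdeg x = (\<Sum>i\<in>UNIV. b i) + e" if h: "x \<in> Poly_Mapping.keys (xm b * g)" "\<And>y. y \<in> Poly_Mapping.keys g \<Longrightarrow> tdeg y = e" for x b e and g :: "'n bipoly"
    using subsetD[OF keys_mult h(1)] h(2) by (auto simp: keys_xm tdeg_add tdeg_mon)
  have Fd: "tdeg x = d'" if "x \<in> Poly_Mapping.keys (xm b * f)" for x
    using hom_mult[OF that f(2)] by (simp add: b_def d'_def)
  obtain g where g: "g \<in> NFs ?n d'" "xm b * f - g \<in> Jz ?n"
    using x_polys_reduce[OF Jz_xideal E_in_Jz F Fd] by blast
  have "g = 0"
  proof (rule DD_independent[OF g(1)])
    fix c :: "'n \<Rightarrow> int" assume "(0::int) = 0 \<Longrightarrow> \<forall>i. c i < int (r * ?n)"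
    then have c: "\<forall>i. c i < int (r * ?n)" by simp
    have "DD 0 (xm b * f - g) c = 0" by (rule Jz_DD[OF g(2)]) (use c in auto)
    then show "DD 0 g c = 0" using F0 c by (simp add: DD_diff)
  qed auto
  then have "xm b * f \<in> Jz ?n" using g(2) by simp
  then obtain gg where gg: "\<forall>l. gg l \<in> x_polys" "xm b * f = (\<Sum>l\<in>{1..?n}. E l UNIV * gg l)" unfolding Jz_def by blast
  define a where "a = (\<Sum>l\<in>{1..?n - 1}. E l UNIV * gg l)"
  have a: "a \<in> Jz (?n - 1)" unfolding a_def Jz_def using gg(1) by blast
  have "{1..?n} = insert ?n {1..?n - 1}" "?n \<notin> {1..?n - 1}"
  proof -
    have "0 < ?n" by simp
    then have "\<not> ?n \<le> ?n - 1" by linarith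
    then show "?n \<notin> {1..?n - 1}" by simp
  qed auto
  then have split: "xm b * f = E ?n UNIV * gg ?n + a"
    unfolding gg(2) a_def by (simp only: sum.insert finite_atLeastAtMost not_False_eq_True)
  have "card T = ?n \<longleftrightarrow> T = UNIV" for T :: "'n set" using card_eq_UNIV_imp_eq_UNIV[of T] by auto
  moreover have "zexp UNIV = (\<lambda>_. r)" by (rule ext) (simp add: zexp_def)
  ultimately have En: "E ?n UNIV = xm (\<lambda>_. r)" by (simp add: E_def)
  \<comment> \<open>The cofactor of E_n is cut down to a single degree, so that the remainder
    \<open>G\<close> is homogeneous. Normal forms for \<open>mm\<close> = n - 1 require
    this.\<close>
  define g' where "g' = (if r * ?n \<le> d' then comp (d' - r * ?n) (gg ?n) else 0)"
  have g': "g' \<in> x_polys" by (simp add: g'_def gg(1) restr_x_polys lin_subspaceD(1)[OF x_polys_subspace])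
  have "xm b * f = comp d' (xm b * f)"
    by (rule poly_mapping_eqI) (use Fd in \<open>auto simp: lookup_restr in_keys_iff\<close>)
  also have "\<dots> = comp d' (E ?n UNIV * gg ?n) + comp d' a" unfolding split restr_add ..
  also have "comp d' (E ?n UNIV * gg ?n) = E ?n UNIV * g'"
    unfolding g'_def by (rule restr_mult_homogeneous) (rule tdeg_keys_E)
  also have "E ?n UNIV = xm b * xm (\<lambda>_. s)" unfolding En xm_mult b_def by (simp only: bs)
  finally have split': "xm b * (f - xm (\<lambda>_. s) * g') = comp d' a" by (simp add: algebra_simps)
  define G where "G = f - xm (\<lambda>_. s) * g'"
  have G: "G \<in> x_polys" unfolding G_def
    using f(1) g' xm_x_polys x_polys_mult lin_subspaceD(5)[OF x_polys_subspace] by blast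
  have Gd: "tdeg x = d" if x: "x \<in> Poly_Mapping.keys G" for x
  proof -
    have g'd: "tdeg y = d' - r * ?n \<and> r * ?n \<le> d'" if "y \<in> Poly_Mapping.keys g'" for y
      using that by (auto simp: g'_def keys_restr split: if_splits)
    have "x \<in> Poly_Mapping.keys f \<or> x \<in> Poly_Mapping.keys (xm (\<lambda>_. s) * g')"
      using x by (auto simp: G_def in_keys_iff lookup_minus)
    then show ?thesis
    proof
      assume x: "x \<in> Poly_Mapping.keys (xm (\<lambda>_. s) * g')"
      then obtain y where "y \<in> Poly_Mapping.keys g'" using keys_mult[of "xm (\<lambda>_. s)" g'] by blast
      then have le: "r * ?n \<le> d'" using g'd by blast
      have "tdeg x = ?n * s + (d' - r * ?n)"
      proof -
        have "tdeg x = (\<Sum>i\<in>(UNIV :: 'n set). s) + (d' - r * ?n)" by (rule hom_mult[OF x]) (use g'd in blast)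
        then show ?thesis by simp
      qed
      moreover have "r * ?n = ?n * (s * (p - 1)) + ?n * s"
      proof -
        have "r * ?n = ?n * (s * (p - 1) + s)" unfolding bs by (rule mult.commute)
        then show ?thesis by (simp only: distrib_left)
      qed
      ultimately show ?thesis using le unfolding d'_def by linarith
    qed (rule f(2))
  qed
  \<comment> \<open>Modulo rn the shift by \<open>b\<close> in \<open>DD_shift\<close> can be
    undone, so the vanishing for x^b G at all exponent vectors is the vanishing for G.\<close>
  have DG: "DD (int (r * ?n)) G c = 0" for c
  proof -
    have "DD (int (r * ?n)) (comp d' a) (\<lambda>i. c i + int (b i)) = 0"
      by (rule Jz_DD[OF Jz_comp[OF a]]) auto
    then show ?thesis unfolding split'[symmetric] G_def[symmetric] DD_shift by simp
  qed
  obtain g2 where g2: "g2 \<in> NFs (?n - 1) d" "G - g2 \<in> Jz (?n - 1)"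
    using x_polys_reduce[OF Jz_xideal E_in_Jz G Gd] by blast
  have "g2 = 0"
  proof (rule DD_independent[OF g2(1), of "int (r * ?n)"])
    fix c :: "'n \<Rightarrow> int"
    have "DD (int (r * ?n)) (G - g2) c = 0" by (rule Jz_DD[OF g2(2)]) auto
    then show "DD (int (r * ?n)) g2 c = 0" using DG by (simp add: DD_diff)
  qed auto
  then have "G \<in> J" using g2(2) Jz_subset_J by auto
  moreover have "xm (\<lambda>_. s) * g' \<in> J" using q_in_J g' xidealD(2)[OF J_xideal(1)] by blast
  ultimately have "G + xm (\<lambda>_. s) * g' \<in> J" using lin_subspaceD(2)[OF xidealD(1)[OF J_xideal(1)]] by blast
  then show ?thesis by (simp add: G_def)
qed

text \<open>Reduces to homogeneous polynomials: on polynomials in the x_i the map \<open>Q\<close>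
  raises the degree by exactly \<open>N\<close>, so each component is annihilated
  separately.\<close>

theorem annihilator_eq_J:
  assumes f: "f \<in> x_polys" shows "(\<forall>m. Q f m = 0) \<longleftrightarrow> f \<in> J"
proof
  assume ann: "\<forall>m. Q f m = 0"
  have "comp d f \<in> J" for d
  proof (rule homogeneous_annihilator[where d = d])
    show "comp d f \<in> x_polys" using f by (rule restr_x_polys)
    fix m
    have "Q (comp d f) m = (if (\<Sum>i\<in>UNIV. m i) = N + d then Q f m else 0)"
    proof (rule functional_eqI[where T = "\<lambda>f. Q (comp d f) m" and T' = "\<lambda>f. if (\<Sum>i\<in>UNIV. m i) = N + d then Q f m else 0"])
      fix x assume "x \<in> Poly_Mapping.keys f"
      then have y0: "ye x i = 0" for i using f by (auto simp: x_polys_iff)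
      show "Q (comp d (gen x)) m = (if (\<Sum>i\<in>UNIV. m i) = N + d then Q (gen x) m else 0)"
      proof (cases "Q (gen x) m = 0")
        case True
        then show ?thesis by (simp add: restr_gen)
      next
        case False
        then have "(\<Sum>i\<in>UNIV. m i) + (\<Sum>i\<in>UNIV. ye x i) = N + (\<Sum>i\<in>UNIV. xe x i)"
          by (intro qq_degree) (simp add: Q_gen)
        then have "(\<Sum>i\<in>UNIV. m i) = N + tdeg x" by (simp add: tdeg_def y0)
        then show ?thesis by (simp add: restr_gen)
      qed
    qed (simp_all add: restr_add restr_scl Q_add Q_scl)
    then show "Q (comp d f) m = 0" using ann by simp
  qed (simp add: keys_restr)
  then have "(\<Sum>d\<in>tdeg ` Poly_Mapping.keys f. comp d f) \<in> J"
    by (intro lin_subspaceD(6)[OF xidealD(1)[OF J_xideal(1)]])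
  then show "f \<in> J" by (simp add: sum_restr)
qed (use J_annihilates in auto)

end

section \<open>The determinant identity\<close>

definition bmat :: "('n \<Rightarrow> 'n) \<Rightarrow> ('n \<Rightarrow> 'c) \<Rightarrow> 'c::zero^'n^'n"
  where "bmat \<sigma> b = (\<chi> i j. if i = \<sigma> j then b j else 0)"

text \<open>The diagonal part of a monomial operator on polynomials with exponents at most h: only
  monomials fixed by the permutation count. The weights lie in a general commutative ring so that
  they can carry the grading variable.\<close>

definition fixsum :: "nat \<Rightarrow> ('n::finite \<Rightarrow> 'n) \<Rightarrow> ('n \<Rightarrow> 'c) \<Rightarrow> 'c::comm_ring_1"
  where "fixsum h \<sigma> b = (\<Sum>m | (\<forall>i. m i \<le> h) \<and> (\<forall>i. m (\<sigma> i) = m i). \<Prod>i\<in>UNIV. b i ^ m i)"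

lemma finite_bounded: "finite {m :: 'n::finite \<Rightarrow> nat. (\<forall>i. m i \<le> h) \<and> P m}"
proof -
  have "{m :: 'n \<Rightarrow> nat. (\<forall>i. m i \<le> h) \<and> P m} \<subseteq> PiE UNIV (\<lambda>_. {..h})" by (auto simp: PiE_def extensional_def)
  then show ?thesis by (rule finite_subset) (simp add: finite_PiE)
qed

lemma det_bmat:
  fixes \<sigma> :: "'n::finite \<Rightarrow> 'n" and b :: "'n \<Rightarrow> 'c::comm_ring_1"
  assumes \<sigma>: "\<sigma> permutes UNIV"
  shows "det (bmat \<sigma> b) = of_int (sign \<sigma>) * (\<Prod>i\<in>UNIV. b i)"
proof -
  have "det (bmat \<sigma> b) = (\<Sum>\<pi> | \<pi> permutes UNIV. if \<pi> = finv \<sigma> then of_int (sign \<sigma>) * (\<Prod>i\<in>UNIV. b i) else 0)"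
    unfolding det_def
  proof (rule sum.cong)
    fix \<pi> :: "'n \<Rightarrow> 'n" assume "\<pi> \<in> {\<pi>. \<pi> permutes UNIV}"
    then have \<pi>: "\<pi> permutes UNIV" by simp
    show "of_int (sign \<pi>) * (\<Prod>i\<in>UNIV. bmat \<sigma> b $ i $ \<pi> i) = (if \<pi> = finv \<sigma> then of_int (sign \<sigma>) * (\<Prod>i\<in>UNIV. b i) else 0)"
    proof (cases "\<forall>i. i = \<sigma> (\<pi> i)")
      case True
      have "finv \<sigma> i = \<pi> i" for i
        using arg_cong[OF True[rule_format, of i], of "finv \<sigma>"] permutes_inverses(2)[OF \<sigma>, of "\<pi> i"] by (rule trans)
      then have "\<pi> = finv \<sigma>" by (intro ext) simp
      moreover have "(\<Prod>i\<in>UNIV. bmat \<sigma> b $ i $ \<pi> i) = (\<Prod>i\<in>UNIV. b (\<pi> i))"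
        using True by (intro prod.cong) (auto simp: bmat_def)
      moreover have "\<dots> = (\<Prod>i\<in>UNIV. b i)" using prod.permute[OF \<pi>, of b] by (simp add: o_def)
      moreover have "sign (finv \<sigma>) = sign \<sigma>" by (rule sign_inverse[OF permutes_imp_permutation[OF finite \<sigma>]])
      ultimately show ?thesis by simp
    next
      case False
      then obtain i where "i \<noteq> \<sigma> (\<pi> i)" by blast
      then have "bmat \<sigma> b $ i $ \<pi> i = 0" by (simp add: bmat_def)
      then have "(\<Prod>i\<in>UNIV. bmat \<sigma> b $ i $ \<pi> i) = 0" by (intro prod_zero) auto
      moreover have "\<pi> \<noteq> finv \<sigma>" using False permutes_inverses(1)[OF \<sigma>] by auto
      ultimately show ?thesis by simp
    qed
  qed simp
  also have "\<dots> = of_int (sign \<sigma>) * (\<Prod>i\<in>UNIV. b i)" by (simp add: permutes_inv[OF \<sigma>] finite_permutations)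
  finally show ?thesis .
qed

text \<open>Takes \<open>i\<close> out of its cycle: b_j times column i is added to column j, then
  b_i times row i to row \<open>\<sigma> i\<close>. Afterwards \<open>i\<close> is a fixed point of
  weight 0 and its weight has moved to \<open>j\<close>. The transposes turn both operations into
  row operations.\<close>

lemma det_contract:
  fixes \<sigma> :: "'n::finite \<Rightarrow> 'n" and b :: "'n \<Rightarrow> 'c::comm_ring_1"
  assumes \<sigma>: "\<sigma> permutes UNIV" and ij: "\<sigma> j = i" "i \<noteq> j"
  shows "det (mat 1 - bmat \<sigma> b) = det (mat 1 - bmat (\<sigma>(j := \<sigma> i, i := i)) (b(j := b j * b i, i := 0)))"
proof -
  have inj: "\<sigma> k = \<sigma> l \<longleftrightarrow> k = l" for k l using permutes_inj[OF \<sigma>] by (auto simp: inj_def)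
  have \<sigma>i: "\<sigma> i \<noteq> i" using ij inj[of i j] by metis
  let ?A = "mat 1 - bmat \<sigma> b"
  define B where "B = (\<chi> k. if k = j then row j (transpose ?A) + b j *s row i (transpose ?A) else row k (transpose ?A))"
  have dB: "det B = det ?A" unfolding B_def using det_row_operation[of j i "transpose ?A" "b j"] ij by simp
  define C where "C = (\<chi> k. if k = \<sigma> i then row (\<sigma> i) (transpose B) + b i *s row i (transpose B) else row k (transpose B))"
  have dC: "det C = det B" unfolding C_def using det_row_operation[of "\<sigma> i" i "transpose B" "b i"] \<sigma>i by simp
  have Bk: "B $ k $ l = (if k = j then ?A $ l $ j + b j * ?A $ l $ i else ?A $ l $ k)" for k l
    by (simp add: B_def row_def transpose_def)
  have Ck: "C $ k $ l = (if k = \<sigma> i then B $ l $ \<sigma> i + b i * B $ l $ i else B $ l $ k)" for k l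
    by (simp add: C_def row_def transpose_def)
  have A: "?A $ k $ l = of_bool (k = l) - (if k = \<sigma> l then b l else 0)" for k l
    by (simp add: mat_def bmat_def)
  let ?\<sigma> = "\<sigma>(j := \<sigma> i, i := i)" and ?b = "b(j := b j * b i, i := 0)"
  have "C $ k $ l = (mat 1 - bmat ?\<sigma> ?b) $ k $ l" for k l
  proof -
    have R: "(mat 1 - bmat ?\<sigma> ?b) $ k $ l = of_bool (k = l) - (if k = ?\<sigma> l then ?b l else 0)"
      by (simp add: mat_def bmat_def)
    have ne: "\<sigma> l \<noteq> i" if "l \<noteq> j" for l using ij inj[of l j] that by metis
    have ne': "\<sigma> l \<noteq> \<sigma> i" if "l \<noteq> i" for l using inj that by blast
    consider "l = j" | "l = i" | "l \<noteq> i" "l \<noteq> j" by blast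
    then show ?thesis
    proof cases
      case 1
      then show ?thesis unfolding R Ck Bk A using ij \<sigma>i by (auto simp: algebra_simps)
    next
      case 2
      then show ?thesis unfolding R Ck Bk A using ij \<sigma>i by (auto simp: algebra_simps)
    next
      case 3
      then show ?thesis unfolding R Ck Bk A using ij \<sigma>i ne[of l] ne'[of l] by (auto simp: algebra_simps)
    qed
  qed
  then have "C = mat 1 - bmat ?\<sigma> ?b" by (simp add: vec_eq_iff)
  then show ?thesis using dB dC by simp
qed

text \<open>After the contraction only \<open>m i = 0\<close> contributes, as the weight at
  \<open>i\<close> is 0. Before it \<open>m i = m j\<close> is forced by invariance, so the value at
  \<open>i\<close> can be forgotten and restored.\<close>

lemma fixsum_contract:
  fixes \<sigma> :: "'n::finite \<Rightarrow> 'n" and b :: "'n \<Rightarrow> 'c::comm_ring_1"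
  assumes \<sigma>: "\<sigma> permutes UNIV" and ij: "\<sigma> j = i" "i \<noteq> j"
  shows "fixsum h \<sigma> b = fixsum h (\<sigma>(j := \<sigma> i, i := i)) (b(j := b j * b i, i := 0))"
proof -
  let ?\<sigma> = "\<sigma>(j := \<sigma> i, i := i)" and ?b = "b(j := b j * b i, i := 0)"
  let ?M = "{m :: 'n \<Rightarrow> nat. (\<forall>i. m i \<le> h) \<and> (\<forall>l. m (\<sigma> l) = m l)}"
    and ?M' = "{m :: 'n \<Rightarrow> nat. (\<forall>i. m i \<le> h) \<and> (\<forall>l. m (?\<sigma> l) = m l)}"
  have inj: "\<sigma> k = \<sigma> l \<longleftrightarrow> k = l" for k l using permutes_inj[OF \<sigma>] by (auto simp: inj_def)
  have \<sigma>i: "\<sigma> i \<noteq> i" using ij inj[of i j] by metis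
  have "fixsum h ?\<sigma> ?b = (\<Sum>m | m \<in> ?M' \<and> m i = 0. \<Prod>l\<in>UNIV. ?b l ^ m l)"
    unfolding fixsum_def
  proof (rule sum.mono_neutral_right)
    show "\<forall>m\<in>?M' - {m. m \<in> ?M' \<and> m i = 0}. (\<Prod>l\<in>UNIV. ?b l ^ m l) = 0"
    proof
      fix m assume "m \<in> ?M' - {m. m \<in> ?M' \<and> m i = 0}"
      then have "?b i ^ m i = 0" by (auto simp: power_0_left)
      then show "(\<Prod>l\<in>UNIV. ?b l ^ m l) = 0" by (intro prod_zero) auto
    qed
  qed (auto intro: finite_bounded)
  also have "\<dots> = (\<Sum>m\<in>?M. \<Prod>l\<in>UNIV. b l ^ m l)"
  proof (rule sum.reindex_bij_witness[of _ "\<lambda>m. m(i := 0)" "\<lambda>m. m(i := m j)"])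
    fix m assume m: "m \<in> {m. m \<in> ?M' \<and> m i = 0}"
    then show "(m(i := m j))(i := 0) = m" by auto
    have e: "m (?\<sigma> l) = m l" for l using m by blast
    have "(m(i := m j)) (\<sigma> l) = (m(i := m j)) l" for l
    proof -
      consider "l = j" | "l = i" | "l \<noteq> i" "l \<noteq> j" by blast
      then show ?thesis
      proof cases
        case 1 then show ?thesis using ij by simp
      next
        case 2 then show ?thesis using e[of j] ij \<sigma>i by simp
      next
        case 3
        then have "\<sigma> l \<noteq> i" using ij inj[of l j] by metis
        then show ?thesis using e[of l] 3 by simp
      qed
    qed
    moreover have "(m(i := m j)) l \<le> h" for l using m by auto
    ultimately show "m(i := m j) \<in> ?M" by blast
    have "(\<Prod>l\<in>UNIV. b l ^ (m(i := m j)) l) = b i ^ m j * (b j ^ m j * (\<Prod>l\<in>UNIV - {i} - {j}. b l ^ m l))"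
      using ij by (simp add: prod.remove[of UNIV i] prod.remove[of "UNIV - {i}" j])
    also have "\<dots> = (\<Prod>l\<in>UNIV. ?b l ^ m l)"
      using ij m by (simp add: prod.remove[of UNIV i] prod.remove[of "UNIV - {i}" j] power_mult_distrib mult_ac)
    finally show "(\<Prod>l\<in>UNIV. b l ^ (m(i := m j)) l) = (\<Prod>l\<in>UNIV. ?b l ^ m l)" .
  next
    fix m assume m: "m \<in> ?M"
    have e: "m (\<sigma> l) = m l" for l using m by blast
    have mj: "m i = m j" using e[of j] ij by simp
    then show "(m(i := 0))(i := (m(i := 0)) j) = m" using ij by auto
    have "(m(i := 0)) (?\<sigma> l) = (m(i := 0)) l" for l
    proof -
      consider "l = j" | "l = i" | "l \<noteq> i" "l \<noteq> j" by blast
      then show ?thesis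
      proof cases
        case 1 then show ?thesis using ij \<sigma>i e[of i] mj by simp
      next
        case 2 then show ?thesis by simp
      next
        case 3
        then have "\<sigma> l \<noteq> i" using ij inj[of l j] by metis
        then show ?thesis using e[of l] 3 by simp
      qed
    qed
    moreover have "(m(i := 0)) l \<le> h" for l using m by auto
    ultimately show "m(i := 0) \<in> {m. m \<in> ?M' \<and> m i = 0}" by simp
  qed
  finally show ?thesis unfolding fixsum_def ..
qed

text \<open>Contracting cycles reduces to the identity permutation, where both sides are products
  over the coordinates of a geometric series.\<close>

lemma fixsum_det:
  fixes \<sigma> :: "'n::finite \<Rightarrow> 'n" and b :: "'n \<Rightarrow> 'c::comm_ring_1"
  assumes "\<sigma> permutes UNIV"
  shows "fixsum h \<sigma> b * det (mat 1 - bmat \<sigma> b) = det (mat 1 - bmat \<sigma> (\<lambda>i. b i ^ Suc h))"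
  using assms
proof (induction "card {i. \<sigma> i \<noteq> i}" arbitrary: \<sigma> b rule: less_induct)
  case less
  show ?case
  proof (cases "\<forall>i. \<sigma> i = i")
    case True
    have D: "det (mat 1 - bmat \<sigma> c) = (\<Prod>i\<in>UNIV. 1 - c i)" for c :: "'n \<Rightarrow> 'c"
      using True by (subst det_diagonal) (auto simp: mat_def bmat_def)
    have "fixsum h \<sigma> b = (\<Sum>m\<in>PiE UNIV (\<lambda>_. {..h}). \<Prod>i\<in>UNIV. b i ^ m i)"
      unfolding fixsum_def using True by (intro sum.cong) (auto simp: PiE_def extensional_def)
    also have "\<dots> = (\<Prod>i\<in>UNIV. \<Sum>k\<le>h. b i ^ k)" by (subst prod_sum_PiE) auto
    finally have "fixsum h \<sigma> b * det (mat 1 - bmat \<sigma> b) = (\<Prod>i\<in>UNIV. (\<Sum>k\<le>h. b i ^ k) * (1 - b i))"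
      by (simp add: D prod.distrib)
    also have "\<dots> = (\<Prod>i\<in>UNIV. 1 - b i ^ Suc h)"
    proof (rule prod.cong)
      fix i show "(\<Sum>k\<le>h. b i ^ k) * (1 - b i) = 1 - b i ^ Suc h"
        using sum_gp_basic[of "b i" h] by (simp add: mult.commute)
    qed simp
    finally show ?thesis by (simp only: D)
  next
    case False
    then obtain i where i: "\<sigma> i \<noteq> i" by blast
    note perm = \<open>\<sigma> permutes UNIV\<close>
    define j where "j = finv \<sigma> i"
    have ij: "\<sigma> j = i" unfolding j_def by (rule permutes_inverses(1)[OF perm])
    then have ne: "i \<noteq> j" using i by metis
    let ?\<sigma> = "\<sigma>(j := \<sigma> i, i := i)"
    have inj: "\<sigma> k = \<sigma> l \<longleftrightarrow> k = l" for k l using permutes_inj[OF perm] by (auto simp: inj_def)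
    have "inj ?\<sigma>"
    proof (rule injI)
      fix k l assume e: "?\<sigma> k = ?\<sigma> l"
      have "\<sigma> x \<noteq> i" if "x \<noteq> j" for x using ij inj[of x j] that by metis
      then show "k = l" using e ne i i[symmetric] by (auto simp: inj split: if_splits)
    qed
    then have "bij ?\<sigma>" using finite_UNIV_inj_surj[OF finite, of ?\<sigma>] by (simp only: bij_def simp_thms)
    then have perm': "?\<sigma> permutes UNIV" by (intro bij_imp_permutes) simp_all
    have "{l. ?\<sigma> l \<noteq> l} \<subseteq> {l. \<sigma> l \<noteq> l} - {i}" using ij ne by auto
    then have "card {l. ?\<sigma> l \<noteq> l} \<le> card ({l. \<sigma> l \<noteq> l} - {i})" by (intro card_mono) auto
    also have "\<dots> < card {l. \<sigma> l \<noteq> l}" by (intro card_Diff1_less) (use i in auto)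
    finally have lt: "card {l. ?\<sigma> l \<noteq> l} < card {l. \<sigma> l \<noteq> l}" .
    \<comment> \<open>Taking powers commutes with the contraction; the weight 0 stays 0 because h +
      1 is positive.\<close>
    have pw: "(\<lambda>l. (b(j := b j * b i, i := 0)) l ^ Suc h) = (\<lambda>l. b l ^ Suc h)(j := b j ^ Suc h * b i ^ Suc h, i := 0)"
      by (auto simp: power_mult_distrib mult_ac)
    show ?thesis
      unfolding fixsum_contract[OF perm ij ne] det_contract[OF perm ij ne] less.hyps[OF lt perm'] pw ..
  qed
qed

section \<open>Linear spans in free vector spaces\<close>

lemma lin_span_eq:
  assumes M: "carrier M = S" "add M = (+)" "zero M = 0" "smult M = scl" and S: "lin_subspace S"
  shows "lin_span M R = \<Inter>{H. lin_subspace H \<and> H \<subseteq> S \<and> R \<subseteq> H}"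
proof -
  have inv: "m_inv (add_monoid M) x = - x" if "x \<in> S" for x
    unfolding m_inv_def using that lin_subspaceD(4)[OF S that] M
    by (intro the_equality) (auto simp: eq_neg_iff_add_eq_0 add.commute)
  have "submodule H complex_field M \<longleftrightarrow> lin_subspace H \<and> H \<subseteq> S" for H
  proof
    assume "submodule H complex_field M"
    then interpret submodule H complex_field M .
    have "x + y \<in> H" if "x \<in> H" "y \<in> H" for x y using m_closed[OF that] M by simp
    moreover have "scl c x \<in> H" if "x \<in> H" for c x
      using smult_closed[of c x] that M by (simp add: ring_of_type_algebra_def)
    ultimately show "lin_subspace H \<and> H \<subseteq> S" using one_closed subset M by (simp add: lin_subspace_def)
  next
    assume H: "lin_subspace H \<and> H \<subseteq> S"
    then have sH: "lin_subspace H" by simp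
    show "submodule H complex_field M"
    proof (intro submodule.intro subgroup.intro submodule_axioms.intro)
      show "inv\<^bsub>add_monoid M\<^esub> x \<in> H" if "x \<in> H" for x using inv[of x] H that lin_subspaceD(4)[OF sH that] by auto
    qed (use H lin_subspaceD(1-3)[OF sH] M in auto)
  qed
  then show ?thesis unfolding lin_span_def by (simp add: conj_assoc)
qed

lemma lin_span_props:
  assumes M: "carrier M = S" "add M = (+)" "zero M = 0" "smult M = scl" and S: "lin_subspace S" and R: "R \<subseteq> S"
  shows "lin_subspace (lin_span M R)" "lin_span M R \<subseteq> S" "R \<subseteq> lin_span M R"
    "\<And>H. lin_subspace H \<Longrightarrow> H \<subseteq> S \<Longrightarrow> R \<subseteq> H \<Longrightarrow> lin_span M R \<subseteq> H"
proof -
  note e = lin_span_eq[OF M S, of R]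
  show "lin_span M R \<subseteq> S" unfolding e using S R by blast
  show "R \<subseteq> lin_span M R" unfolding e by blast
  show "lin_span M R \<subseteq> H" if "lin_subspace H" "H \<subseteq> S" "R \<subseteq> H" for H unfolding e using that by blast
  show "lin_subspace (lin_span M R)" unfolding e lin_subspace_def by blast
qed

section \<open>Tensor products and top exterior powers in coordinates\<close>

lemma free_grep_presented:
  assumes "\<And>g x. g \<in> W \<Longrightarrow> x \<in> B \<Longrightarrow> \<alpha> g x \<in> B"
  shows "presented (free_grep B \<alpha> D) {f. Poly_Mapping.keys f \<subseteq> B} (\<lambda>f. f) {0} (\<lambda>g. pext (\<lambda>x. gen (\<alpha> g x))) W"
proof
  show "lin_subspace {f. Poly_Mapping.keys f \<subseteq> B}" by (rule lin_subspace_keys)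
  show "pext (\<lambda>x. gen (\<alpha> w x)) f \<in> {f. Poly_Mapping.keys f \<subseteq> B}"
    if w: "w \<in> W" and f: "f \<in> {f. Poly_Mapping.keys f \<subseteq> B}" for w f
    unfolding pext_def
  proof (rule lin_subspaceD(6)[OF lin_subspace_keys])
    fix x assume "x \<in> Poly_Mapping.keys f"
    then have "\<alpha> w x \<in> B" using f assms[OF w] by auto
    then show "scl (Poly_Mapping.lookup f x) (gen (\<alpha> w x)) \<in> {f. Poly_Mapping.keys f \<subseteq> B}"
      by (simp add: scl_single)
  qed
  show "act (free_grep B \<alpha> D) w f = pext (\<lambda>x. gen (\<alpha> w x)) f" for w f
    by (simp add: free_grep_def pext_def scl_single)
qed (simp_all add: free_grep_def zero_subspace pext_diff)

lemma free_grep_simps: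
  "carrier (free_grep B \<alpha> D) = {f. Poly_Mapping.keys f \<subseteq> B}" "add (free_grep B \<alpha> D) = (+)"
  "zero (free_grep B \<alpha> D) = 0" "smult (free_grep B \<alpha> D) = scl" "gr (free_grep B \<alpha> D) d = {f. Poly_Mapping.keys f \<subseteq> D d}"
  by (simp_all add: free_grep_def)

lemmas free_span = lin_span_props[OF free_grep_simps(1-4) lin_subspace_keys]

context coordinatized
begin

lemma coordinate_induct:
  assumes add: "\<And>x y. x \<in> carrier M \<Longrightarrow> y \<in> carrier M \<Longrightarrow> P x \<Longrightarrow> P y \<Longrightarrow> P (x \<oplus>\<^bsub>M\<^esub> y)"
    and smult: "\<And>c x. x \<in> carrier M \<Longrightarrow> P x \<Longrightarrow> P (c \<odot>\<^bsub>M\<^esub> x)"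
    and unit: "\<And>i. i \<in> I \<Longrightarrow> P (unit i)" and zero: "P \<zero>\<^bsub>M\<^esub>" and x: "x \<in> carrier M"
  shows "P x"
proof -
  have ub: "unit ` I \<subseteq> carrier M" using unit_closed by auto
  have "P (\<Oplus>\<^bsub>M\<^esub>i\<in>J. \<phi> x i \<odot>\<^bsub>M\<^esub> unit i)" if "finite J" "J \<subseteq> I" for J
    using that
  proof (induction J rule: finite_induct)
    case (insert j J)
    have g: "(\<lambda>i. \<phi> x i \<odot>\<^bsub>M\<^esub> unit i) \<in> J \<rightarrow> carrier M" "\<phi> x j \<odot>\<^bsub>M\<^esub> unit j \<in> carrier M"
      using insert.prems unit_closed smult_closed by auto
    then show ?case using insert by (simp add: add smult unit unit_closed finsum_closed)
  qed (simp add: zero)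
  then have "P (\<Oplus>\<^bsub>M\<^esub>i\<in>I. \<phi> x i \<odot>\<^bsub>M\<^esub> unit i)" using finite_index by simp
  moreover have "x = (\<Oplus>\<^bsub>M\<^esub>i\<in>I. \<phi> x i \<odot>\<^bsub>M\<^esub> unit i)"
    unfolding eq_combination_iff[OF finite_index ub x]
  proof
    fix i
    have "(\<Sum>j\<in>I. \<phi> x j * \<phi> (unit j) i) = (\<Sum>j\<in>I. if j = i then \<phi> x i else 0)"
      by (intro sum.cong) (auto simp: coord_unit)
    also have "\<dots> = \<phi> x i" using finite_index supportedD[OF coord_supported[OF x], of i] by auto
    finally show "\<phi> x i = (\<Sum>j\<in>I. \<phi> x j * \<phi> (unit j) i)" ..
  qed
  ultimately show ?thesis by simp
qed

end

section \<open>Top exterior powers\<close>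

lemma ext_relationsE:
  fixes V :: "('g, 'a, 'm) rep_scheme"
  assumes "f \<in> ext_relations k V"
  obtains (1) us vs a a' where "f = gen (us @ (a \<oplus>\<^bsub>V\<^esub> a') # vs) - gen (us @ a # vs) - gen (us @ a' # vs)"
      "set us \<union> set vs \<union> {a, a'} \<subseteq> carrier V" "Suc (length us + length vs) = k"
  | (2) us vs a c where "f = gen (us @ (c \<odot>\<^bsub>V\<^esub> a) # vs) - Poly_Mapping.single (us @ a # vs) c"
      "set us \<union> set vs \<union> {a} \<subseteq> carrier V" "Suc (length us + length vs) = k"
  | (3) vs where "f = gen vs" "set vs \<subseteq> carrier V" "length vs = k" "\<not> distinct vs"
  using assms unfolding ext_relations_def
proof (elim UnE CollectE exE conjE)
  fix us vs a a'
  assume "f = gen (us @ (a \<oplus>\<^bsub>V\<^esub> a') # vs) - gen (us @ a # vs) - gen (us @ a' # vs)"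
    "set us \<union> set vs \<union> {a, a'} \<subseteq> carrier V" "Suc (length us + length vs) = k"
  then show thesis by (rule 1)
next
  fix us vs a c
  assume "f = gen (us @ (c \<odot>\<^bsub>V\<^esub> a) # vs) - Poly_Mapping.single (us @ a # vs) c"
    "set us \<union> set vs \<union> {a} \<subseteq> carrier V" "Suc (length us + length vs) = k"
  then show thesis by (rule 2)
next
  fix vs assume "f = gen vs" "set vs \<subseteq> carrier V" "length vs = k" "\<not> distinct vs"
  then show thesis by (rule 3)
qed

locale ext_space = coordinatized V "UNIV :: 'n::finite set" \<phi>
  for V :: "('g, 'a, 'm) rep_scheme" and \<phi> :: "'a \<Rightarrow> 'n::finite \<Rightarrow> complex" +
  fixes idx :: "'n::finite \<Rightarrow> nat" and W :: "'g set" and mat_of :: "'g \<Rightarrow> complex^'n^'n" and e :: int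
  assumes idx: "bij_betw idx UNIV {..<CARD('n)}"
    and act_closed: "w \<in> W \<Longrightarrow> x \<in> carrier V \<Longrightarrow> act V w x \<in> carrier V"
    and act_coord: "w \<in> W \<Longrightarrow> x \<in> carrier V \<Longrightarrow> \<phi> (act V w x) i = (\<Sum>j\<in>UNIV. mat_of w $ i $ j * \<phi> x j)"
begin

definition Bl :: "'a list set" where "Bl = {vs. set vs \<subseteq> carrier V \<and> length vs = CARD('n)}"

definition Fr :: "('g, 'a list \<Rightarrow>\<^sub>0 complex) grep"
  where "Fr = free_grep Bl (\<lambda>g. map (act V g)) (\<lambda>d. if d = e then Bl else {})"

definition Rl :: "('a list \<Rightarrow>\<^sub>0 complex) set" where "Rl = lin_span Fr (ext_relations CARD('n) V)"

lemma relations_subset: "ext_relations CARD('n) V \<subseteq> {f. Poly_Mapping.keys f \<subseteq> Bl}"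
proof
  fix f assume "f \<in> ext_relations CARD('n) V"
  then show "f \<in> {f. Poly_Mapping.keys f \<subseteq> Bl}"
  proof (cases rule: ext_relationsE)
    case (1 us vs a a')
    have "us @ b # vs \<in> Bl" if "b \<in> carrier V" for b
      using 1 that by (simp add: Bl_def)
    then have "gen (us @ b # vs) \<in> {f. Poly_Mapping.keys f \<subseteq> Bl}" if "b \<in> carrier V" for b
      using that by simp
    then show ?thesis unfolding 1(1)
      by (intro lin_subspaceD(5)[OF lin_subspace_keys]) (use 1(2) add_closed in blast)+
  next
    case (2 us vs a c)
    have "us @ b # vs \<in> Bl" if "b \<in> carrier V" for b
      using 2 that by (simp add: Bl_def)
    then have "Poly_Mapping.single (us @ b # vs) t \<in> {f. Poly_Mapping.keys f \<subseteq> Bl}" if "b \<in> carrier V" for b t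
      using that by simp
    then show ?thesis unfolding 2(1)
      by (intro lin_subspaceD(5)[OF lin_subspace_keys]) (use 2(2) smult_closed in blast)+
  next
    case (3 vs)
    then show ?thesis by (simp add: Bl_def)
  qed
qed

lemmas Rl_props = free_span[OF relations_subset, where \<alpha> = "\<lambda>g. map (act V g)" and D = "\<lambda>d. if d = e then Bl else {}", folded Fr_def Rl_def]

text \<open>Rows and columns must share the index type for \<open>det\<close>, so \<open>idx\<close>
  translates row indices into positions of the list.\<close>

definition Mx :: "'a list \<Rightarrow> complex^'n^'n" where "Mx vs = (\<chi> i j. \<phi> (vs ! idx i) j)"

definition Psi_e :: "('a list \<Rightarrow>\<^sub>0 complex) \<Rightarrow> unit \<Rightarrow> complex" where "Psi_e = lext (\<lambda>vs _. det (Mx vs))"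

lemma idx_less: "idx i < CARD('n)" using idx by (auto simp: bij_betw_def)
lemma idx_inj: "idx i = idx j \<longleftrightarrow> i = j" using idx by (auto simp: bij_betw_def inj_on_def)
lemma idx_surj: assumes "k < CARD('n)" obtains i where "idx i = k"
proof -
  have "k \<in> idx ` UNIV" using assms idx by (auto simp: bij_betw_def)
  then show thesis using that by blast
qed

definition other_rows :: "'a list \<Rightarrow> 'a list \<Rightarrow> 'n \<Rightarrow> complex^'n"
  where "other_rows us vs i = (\<chi> j. \<phi> (if idx i < length us then us ! idx i else vs ! (idx i - Suc (length us))) j)"

definition vrow :: "'a \<Rightarrow> complex^'n" where "vrow a = (\<chi> j. \<phi> a j)"

lemma Mx_split:
  assumes "idx i0 = length us"
  shows "Mx (us @ a # vs) = (\<chi> i. if i = i0 then (\<lambda>_. vrow a) i else other_rows us vs i)"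
proof -
  have "(us @ a # vs) ! idx i = (if i = i0 then a else if idx i < length us then us ! idx i else vs ! (idx i - Suc (length us)))" for i
    using assms idx_inj[of i i0] by (auto simp: nth_append nth_Cons')
  then show ?thesis by (simp add: Mx_def vec_eq_iff other_rows_def vrow_def)
qed

lemma relations_kernel:
  assumes "f \<in> ext_relations CARD('n) V" shows "Psi_e f i = 0"
proof -
  from assms show ?thesis
  proof (cases rule: ext_relationsE)
    case (1 us vs a a')
    then obtain i0 where i0: "idx i0 = length us" using idx_surj[of "length us"] by auto
    have v: "vrow (a \<oplus>\<^bsub>V\<^esub> a') = vrow a + vrow a'" using 1 by (simp add: vrow_def vec_eq_iff coord_add)
    then have "det (Mx (us @ (a \<oplus>\<^bsub>V\<^esub> a') # vs)) = det (Mx (us @ a # vs)) + det (Mx (us @ a' # vs))"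
      unfolding Mx_split[OF i0] v
      using det_row_add[where k = i0 and a = "\<lambda>_. vrow a" and b = "\<lambda>_. vrow a'" and c = "other_rows us vs"] by simp
    then show ?thesis by (simp add: 1(1) Psi_e_def lext_diff)
  next
    case (2 us vs a c)
    then obtain i0 where i0: "idx i0 = length us" using idx_surj[of "length us"] by auto
    have v: "vrow (c \<odot>\<^bsub>V\<^esub> a) = c *s vrow a" using 2 by (simp add: vrow_def vec_eq_iff coord_smult)
    then have "det (Mx (us @ (c \<odot>\<^bsub>V\<^esub> a) # vs)) = c * det (Mx (us @ a # vs))"
      unfolding Mx_split[OF i0] v
      using det_row_mul[where k = i0 and c = c and a = "\<lambda>_. vrow a" and b = "other_rows us vs"] by simp
    then show ?thesis by (simp add: 2(1) Psi_e_def lext_diff)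
  next
    case (3 vs)
    then obtain k l where kl: "k < CARD('n)" "l < CARD('n)" "k \<noteq> l" "vs ! k = vs ! l"
      by (auto simp: distinct_conv_nth)
    obtain i where i: "idx i = k" by (rule idx_surj[OF kl(1)])
    obtain j where j: "idx j = l" by (rule idx_surj[OF kl(2)])
    then have "i \<noteq> j" "row i (Mx vs) = row j (Mx vs)" using kl i j by (auto simp: row_def Mx_def)
    then have "det (Mx vs) = 0" by (rule det_identical_rows)
    then show ?thesis by (simp add: 3(1) Psi_e_def)
  qed
qed

lemma upd_closed: "vs \<in> Bl \<Longrightarrow> a \<in> carrier V \<Longrightarrow> vs[k := a] \<in> Bl"
  by (auto simp: Bl_def dest!: subsetD[OF set_update_subset_insert])

lemma split_upd:
  assumes "vs \<in> Bl" "k < CARD('n)"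
  shows "vs[k := a] = take k vs @ a # drop (Suc k) vs" "set (take k vs) \<union> set (drop (Suc k) vs) \<subseteq> carrier V"
    "Suc (length (take k vs) + length (drop (Suc k) vs)) = CARD('n)"
  using assms set_take_subset[of k vs] set_drop_subset[of "Suc k" vs] by (auto simp: Bl_def upd_conv_take_nth_drop)

lemma rel_add:
  assumes "vs \<in> Bl" "k < CARD('n)" "a \<in> carrier V" "a' \<in> carrier V"
  shows "gen (vs[k := a \<oplus>\<^bsub>V\<^esub> a']) - gen (vs[k := a]) - gen (vs[k := a']) \<in> Rl"
proof -
  have "gen (vs[k := a \<oplus>\<^bsub>V\<^esub> a']) - gen (vs[k := a]) - gen (vs[k := a']) \<in> ext_relations CARD('n) V"
    unfolding split_upd(1)[OF assms(1,2)] ext_relations_def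
    by (rule UnI1, rule UnI1, intro CollectI exI conjI, rule refl) (use split_upd(2,3)[OF assms(1,2)] assms(3,4) in auto)
  then show ?thesis by (rule subsetD[OF Rl_props(3)])
qed

lemma rel_smult:
  assumes "vs \<in> Bl" "k < CARD('n)" "a \<in> carrier V"
  shows "gen (vs[k := c \<odot>\<^bsub>V\<^esub> a]) - Poly_Mapping.single (vs[k := a]) c \<in> Rl"
proof -
  have "gen (vs[k := c \<odot>\<^bsub>V\<^esub> a]) - Poly_Mapping.single (vs[k := a]) c \<in> ext_relations CARD('n) V"
    unfolding split_upd(1)[OF assms(1,2)] ext_relations_def
    by (rule UnI1, rule UnI2, intro CollectI exI conjI, rule refl) (use split_upd(2,3)[OF assms(1,2)] assms(3) in auto)
  then show ?thesis by (rule subsetD[OF Rl_props(3)])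
qed

lemma rel_alt: "vs \<in> Bl \<Longrightarrow> \<not> distinct vs \<Longrightarrow> gen vs \<in> Rl"
proof -
  assume "vs \<in> Bl" "\<not> distinct vs"
  then have "gen vs \<in> ext_relations CARD('n) V"
    unfolding ext_relations_def Bl_def by (intro UnI2 CollectI exI conjI) auto
  then show "gen vs \<in> Rl" by (rule subsetD[OF Rl_props(3)])
qed

text \<open>Only lists with a repetition are declared zero; antisymmetry follows by expanding the
  repeated entry x + y in both places.\<close>

lemma rel_swap:
  assumes vs: "vs \<in> Bl" and k: "k < CARD('n)" "m < CARD('n)" "k \<noteq> m"
  shows "gen vs + gen (vs[k := vs ! m, m := vs ! k]) \<in> Rl"
proof -
  define F where "F a b = gen (vs[k := a, m := b])" for a b
  define x y where "x = vs ! k" and "y = vs ! m"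
  have len: "length vs = CARD('n)" using vs by (simp add: Bl_def)
  have c: "x \<in> carrier V" "y \<in> carrier V" using vs k by (auto simp: Bl_def x_def y_def)
  let ?z = "x \<oplus>\<^bsub>V\<^esub> y"
  have z: "?z \<in> carrier V" using c add_closed by blast
  have alt: "F a a \<in> Rl" if "a \<in> carrier V" for a
  proof -
    have "vs[k := a, m := a] ! k = vs[k := a, m := a] ! m" using k len by simp
    then have "\<not> distinct (vs[k := a, m := a])"
      using nth_eq_iff_index_eq[of "vs[k := a, m := a]" k m] k len by auto
    then show ?thesis unfolding F_def using upd_closed[OF upd_closed[OF vs that] that] by (intro rel_alt)
  qed
  have 1: "F a ?z - F a x - F a y \<in> Rl" if "a \<in> carrier V" for a
    unfolding F_def by (rule rel_add[OF upd_closed[OF vs that] k(2) c])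
  have 2: "F ?z a - F x a - F y a \<in> Rl" if "a \<in> carrier V" for a
    unfolding F_def list_update_swap[OF k(3)] by (rule rel_add[OF upd_closed[OF vs that] k(1) c])
  note s = lin_subspaceD[OF Rl_props(1)]
  have "(F ?z ?z - F x x - F y y) - (F ?z ?z - F x ?z - F y ?z) - (F x ?z - F x x - F x y) - (F y ?z - F y x - F y y) \<in> Rl"
    by (rule s(5)[OF s(5)[OF s(5)[OF s(5)[OF s(5)[OF alt[OF z] alt[OF c(1)]] alt[OF c(2)]] 2[OF z]] 1[OF c(1)]] 1[OF c(2)]])
  moreover have "(F ?z ?z - F x x - F y y) - (F ?z ?z - F x ?z - F y ?z) - (F x ?z - F x x - F x y) - (F y ?z - F y x - F y y)
      = F x y + F y x" by (simp add: algebra_simps)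
  moreover have "F x y = gen vs" by (simp add: F_def x_def y_def)
  ultimately show ?thesis by (simp add: F_def x_def y_def)
qed

definition is0 :: "'n list" where "is0 = map (inv_into UNIV idx) [0..<CARD('n)]"

lemma is0_nth: "k < CARD('n) \<Longrightarrow> idx (is0 ! k) = k"
  using idx by (auto simp: is0_def bij_betw_def intro!: f_inv_into_f)

lemma is0_idx: "is0 ! idx i = i"
  using is0_nth[OF idx_less[of i]] by (simp add: idx_inj)

definition Zl :: "('a list \<Rightarrow>\<^sub>0 complex) set"
  where "Zl = {f. \<exists>g\<in>{f. Poly_Mapping.keys f \<subseteq> {map unit is0}}. f - g \<in> Rl}"

lemma Zl_subspace: "lin_subspace Zl"
  unfolding Zl_def by (rule mod_subspace[OF Rl_props(1) lin_subspace_keys])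

lemma Rl_Zl: "f \<in> Rl \<Longrightarrow> f \<in> Zl"
  unfolding Zl_def by (intro CollectI bexI[of _ 0]) simp_all

lemma unit_list: "length js = CARD('n) \<Longrightarrow> map unit js \<in> Bl"
  by (auto simp: Bl_def unit_closed)

text \<open>Selection sort with \<open>rel_swap\<close>: \<open>j\<close> counts the trailing
  positions not yet known to be in order, and each step puts the right vector in front of
  them.\<close>

lemma permuted_basis:
  assumes "j \<le> CARD('n)" "length js = CARD('n)" "distinct js" "\<And>l. l < CARD('n) - j \<Longrightarrow> js ! l = is0 ! l"
  shows "gen (map unit js) \<in> Zl"
  using assms
proof (induction j arbitrary: js)
  case 0
  then have "js = is0" by (intro nth_equalityI) (auto simp: is0_def)
  then have "gen (map unit js) \<in> {f. Poly_Mapping.keys f \<subseteq> {map unit is0}}" by simp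
  moreover have "gen (map unit js) - gen (map unit js) \<in> Rl" using lin_subspaceD(1)[OF Rl_props(1)] by simp
  ultimately show ?case unfolding Zl_def by blast
next
  case (Suc j)
  define k where "k = CARD('n) - Suc j"
  have k: "k < CARD('n)" "CARD('n) - j = Suc k" using Suc.prems(1) by (auto simp: k_def)
  have "card (set js) = CARD('n)" using Suc.prems by (simp add: distinct_card)
  then have "set js = UNIV" by (rule card_eq_UNIV_imp_eq_UNIV[OF finite])
  then have "is0 ! k \<in> set js" by simp
  then obtain m where m: "m < CARD('n)" "js ! m = is0 ! k"
    using Suc.prems(2) unfolding in_set_conv_nth by auto
  have "\<not> m < k"
  proof
    assume "m < k"
    then have "is0 ! m = is0 ! k" using Suc.prems(4)[of m] m by (simp add: k_def)
    then have "idx (is0 ! m) = idx (is0 ! k)" by (rule arg_cong)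
    then have "m = k" unfolding is0_nth[OF m(1)] is0_nth[OF k(1)] .
    then show False using \<open>m < k\<close> by simp
  qed
  define js' where "js' = js[k := js ! m, m := js ! k]"
  have "js' ! l = is0 ! l" if "l < CARD('n) - j" for l
  proof (cases "l = k")
    case True
    then show ?thesis using m k Suc.prems(2) by (cases "m = k") (simp_all add: js'_def)
  next
    case False
    then have "l < k" "l \<noteq> m" using that k(2) \<open>\<not> m < k\<close> by auto
    then show ?thesis using Suc.prems(4)[of l] by (simp add: js'_def k_def)
  qed
  moreover have "length js' = CARD('n)" using Suc.prems(2) by (simp add: js'_def)
  moreover have "distinct js'" unfolding js'_def
    by (subst distinct_swap) (use Suc.prems(2,3) m(1) k(1) in simp_all)
  ultimately have Z': "gen (map unit js') \<in> Zl" using Suc.IH[of js'] Suc.prems(1) by simp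
  show ?case
  proof (cases "m = k")
    case True
    then show ?thesis using Z' by (simp add: js'_def)
  next
    case False
    have "map unit js' = (map unit js)[k := map unit js ! m, m := map unit js ! k]"
      using m k Suc.prems(2) by (simp add: js'_def map_update)
    then have "gen (map unit js) + gen (map unit js') \<in> Rl"
      using rel_swap[OF unit_list[OF Suc.prems(2)] k(1) m(1)] False by simp
    then have "gen (map unit js) + gen (map unit js') - gen (map unit js') \<in> Zl"
      by (rule lin_subspaceD(5)[OF Zl_subspace Rl_Zl Z'])
    then show ?thesis by simp
  qed
qed

text \<open>The first \<open>j\<close> entries are arbitrary and the others are basis vectors.
  Multilinearity expands the last arbitrary entry, which lowers \<open>j\<close>.\<close>

lemma gen_Zl_aux:
  assumes "j \<le> CARD('n)" "vs \<in> Bl" "\<And>l. l < CARD('n) \<Longrightarrow> j \<le> l \<Longrightarrow> vs ! l \<in> range unit"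
  shows "gen vs \<in> Zl"
  using assms
proof (induction j arbitrary: vs)
  case 0
  have len: "length vs = CARD('n)" using 0 by (simp add: Bl_def)
  have "\<forall>y\<in>set vs. \<exists>x. y = unit x"
  proof
    fix y assume "y \<in> set vs"
    then obtain l where "l < length vs" "y = vs ! l" by (auto simp: in_set_conv_nth)
    then have "y \<in> range unit" using 0(3)[of l] len by simp
    then show "\<exists>x. y = unit x" by blast
  qed
  then obtain js where js: "vs = map unit js" unfolding ex_map_conv[symmetric] by blast
  show ?case
  proof (cases "distinct js")
    case True
    then show ?thesis unfolding js by (intro permuted_basis[of "CARD('n)"]) (use js len in auto)
  next
    case False
    then have "\<not> distinct vs" unfolding js by (simp add: distinct_map)
    then show ?thesis using rel_alt[OF 0(2)] Rl_Zl by blast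
  qed
next
  case (Suc j)
  have j: "j < CARD('n)" using Suc.prems(1) by simp
  have len: "length vs = CARD('n)" using Suc.prems(2) by (simp add: Bl_def)
  note s = lin_subspaceD[OF Zl_subspace]
  have "vs ! j \<in> carrier V" using Suc.prems(2) j by (auto simp: Bl_def)
  then have "gen (vs[j := vs ! j]) \<in> Zl"
  proof (rule coordinate_induct[rotated -1])
    fix x y assume h: "x \<in> carrier V" "y \<in> carrier V" "gen (vs[j := x]) \<in> Zl" "gen (vs[j := y]) \<in> Zl"
    have "(gen (vs[j := x \<oplus>\<^bsub>V\<^esub> y]) - gen (vs[j := x]) - gen (vs[j := y])) + gen (vs[j := x]) + gen (vs[j := y]) \<in> Zl"
      by (rule s(2)[OF s(2)[OF Rl_Zl[OF rel_add[OF Suc.prems(2) j h(1,2)]] h(3)] h(4)])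
    then show "gen (vs[j := x \<oplus>\<^bsub>V\<^esub> y]) \<in> Zl" by simp
  next
    fix c x assume h: "x \<in> carrier V" "gen (vs[j := x]) \<in> Zl"
    have "(gen (vs[j := c \<odot>\<^bsub>V\<^esub> x]) - Poly_Mapping.single (vs[j := x]) c) + scl c (gen (vs[j := x])) \<in> Zl"
      by (rule s(2)[OF Rl_Zl[OF rel_smult[OF Suc.prems(2) j h(1)]] s(3)[OF h(2)]])
    then show "gen (vs[j := c \<odot>\<^bsub>V\<^esub> x]) \<in> Zl" by (simp add: scl_single)
  next
    fix i :: 'n
    show "gen (vs[j := unit i]) \<in> Zl"
    proof (rule Suc.IH)
      show "vs[j := unit i] \<in> Bl" using Suc.prems(2) by (intro upd_closed unit_closed) simp_all
      fix l assume "l < CARD('n)" "j \<le> l"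
      then show "vs[j := unit i] ! l \<in> range unit"
        using Suc.prems(3)[of l] len by (cases "l = j") auto
    qed (use j in simp)
  next
    \<comment> \<open>The scalar relation with scalar 0 makes a list containing the zero vector a
      relation.\<close>
    have "0 \<odot>\<^bsub>V\<^esub> \<zero>\<^bsub>V\<^esub> = \<zero>\<^bsub>V\<^esub>"
      by (rule coord_inj) (simp_all add: smult_closed zero_closed coord_smult coord_zero)
    then have "gen (vs[j := \<zero>\<^bsub>V\<^esub>]) \<in> Rl"
      using rel_smult[OF Suc.prems(2) j zero_closed, of 0] by simp
    then show "gen (vs[j := \<zero>\<^bsub>V\<^esub>]) \<in> Zl" by (rule Rl_Zl)
  qed
  then show ?case by (simp only: list_update_id)
qed

lemma Psi_e_basis: "Psi_e (gen (map unit is0)) i = 1"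
proof -
  have "Mx (map unit is0) = mat 1"
  proof -
    have len: "length is0 = CARD('n)" by (simp add: is0_def)
    have "map unit is0 ! idx i = unit (is0 ! idx i)" for i by (rule nth_map) (simp only: len idx_less)
    then have u: "map unit is0 ! idx i = unit i" for i by (simp only: is0_idx)
    show ?thesis unfolding Mx_def u mat_def vec_eq_iff by (simp add: coord_unit)
  qed
  then show ?thesis by (simp add: Psi_e_def)
qed

text \<open>The relations are killed by the determinant, and modulo them everything is a multiple of
  the list of all basis vectors, whose determinant is 1. Hence they exhaust the kernel and the top
  exterior power is a line.\<close>

lemma Rl_eq: "Rl = {f \<in> {f. Poly_Mapping.keys f \<subseteq> Bl}. \<forall>i. Psi_e f i = 0}"
proof (intro equalityI subsetI)
  have "Rl \<subseteq> {f \<in> {f. Poly_Mapping.keys f \<subseteq> Bl}. \<forall>i. Psi_e f i = 0}"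
  proof (rule Rl_props(4))
    show "lin_subspace {f \<in> {f. Poly_Mapping.keys f \<subseteq> Bl}. \<forall>i. Psi_e f i = 0}"
      using lin_subspaceD(1-3)[OF lin_subspace_keys[of Bl]] by (simp add: lin_subspace_def Psi_e_def lext_add lext_scl)
    show "ext_relations CARD('n) V \<subseteq> {f \<in> {f. Poly_Mapping.keys f \<subseteq> Bl}. \<forall>i. Psi_e f i = 0}"
      using relations_kernel relations_subset by blast
  qed blast
  then show "f \<in> {f \<in> {f. Poly_Mapping.keys f \<subseteq> Bl}. \<forall>i. Psi_e f i = 0}" if "f \<in> Rl" for f using that by blast
  fix f assume f: "f \<in> {f \<in> {f. Poly_Mapping.keys f \<subseteq> Bl}. \<forall>i. Psi_e f i = 0}"
  have "f \<in> Zl"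
    by (rule lin_subspace_keys_in[OF Zl_subspace]) (use f gen_Zl_aux[of "CARD('n)"] in auto)
  then obtain g where g: "Poly_Mapping.keys g \<subseteq> {map unit is0}" "f - g \<in> Rl" unfolding Zl_def by blast
  have "Psi_e (f - g) () = 0" using g(2) \<open>Rl \<subseteq> _\<close> by blast
  then have "Psi_e g () = 0" using f by (simp add: Psi_e_def lext_diff)
  moreover have "Psi_e g () = Poly_Mapping.lookup g (map unit is0) * Psi_e (gen (map unit is0)) ()"
    unfolding Psi_e_def by (subst lext_superset[OF _ g(1)]) simp_all
  ultimately have "Poly_Mapping.lookup g (map unit is0) = 0" by (simp add: Psi_e_basis)
  then have "g = 0" using g(1) by (intro poly_mapping_eqI) (auto simp: in_keys_iff subset_iff)
  then show "f \<in> Rl" using g(2) by simp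
qed

lemma det_act:
  assumes "w \<in> W" "vs \<in> Bl" shows "det (Mx (map (act V w) vs)) = det (mat_of w) * det (Mx vs)"
proof -
  have "Mx (map (act V w) vs) $ i $ l = (Mx vs ** Finite_Cartesian_Product.transpose (mat_of w)) $ i $ l" for i l
  proof -
    have v: "vs ! idx i \<in> carrier V" "idx i < length vs" using assms(2) idx_less[of i] by (auto simp: Bl_def)
    have "Mx (map (act V w) vs) $ i $ l = \<phi> (act V w (vs ! idx i)) l" by (simp only: Mx_def vec_lambda_beta nth_map[OF v(2)])
    also have "\<dots> = (\<Sum>k\<in>UNIV. \<phi> (vs ! idx i) k * mat_of w $ l $ k)"
      unfolding act_coord[OF assms(1) v(1)] by (intro sum.cong refl mult.commute)
    finally show ?thesis by (simp only: Mx_def matrix_matrix_mult_def Finite_Cartesian_Product.transpose_def vec_lambda_beta)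
  qed
  then have "Mx (map (act V w) vs) = Mx vs ** Finite_Cartesian_Product.transpose (mat_of w)" by (simp add: vec_eq_iff)
  then show ?thesis by (simp add: det_mul det_transpose)
qed

abbreviation "alpha_e \<equiv> \<lambda>w. pext (\<lambda>vs. gen (map (act V w) vs))"

lemma Psi_e_act:
  assumes "w \<in> W" "Poly_Mapping.keys f \<subseteq> Bl" shows "Psi_e (alpha_e w f) i = det (mat_of w) * Psi_e f i"
proof (rule functional_eqI[where T = "\<lambda>f. Psi_e (alpha_e w f) i" and T' = "\<lambda>f. det (mat_of w) * Psi_e f i"])
  fix vs assume "vs \<in> Poly_Mapping.keys f"
  then have "vs \<in> Bl" using assms(2) by blast
  then show "Psi_e (alpha_e w (gen vs)) i = det (mat_of w) * Psi_e (gen vs) i"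
    unfolding pext_single scl_single Psi_e_def lext_single by (simp add: det_act[OF assms(1)])
qed (simp_all add: Psi_e_def lext_add lext_scl pext_add pext_scl distrib_left)

definition E :: "('g, ('a list \<Rightarrow>\<^sub>0 complex) set) grep" where "E = quot_grep Fr Rl"

definition pi_e :: "('a list \<Rightarrow>\<^sub>0 complex) \<Rightarrow> ('a list \<Rightarrow>\<^sub>0 complex) set"
  where "pi_e f = (\<lambda>f. f) ` Rl +>\<^bsub>Fr\<^esub> f"

sublocale free: presented Fr "{f. Poly_Mapping.keys f \<subseteq> Bl}" "\<lambda>f. f" "{0}" alpha_e W
  unfolding Fr_def by (rule free_grep_presented) (auto simp: Bl_def act_closed)

lemma ext_power_eq: "ext_power CARD('n) e V = E"
  unfolding ext_power_def Let_def E_def Fr_def Rl_def Bl_def ..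

lemma ext_presented: "presented E {f. Poly_Mapping.keys f \<subseteq> Bl} pi_e Rl alpha_e W"
proof -
  have st: "alpha_e w f \<in> Rl" if "w \<in> W" "f \<in> Rl" for w f
  proof -
    have "Poly_Mapping.keys f \<subseteq> Bl" "\<forall>i. Psi_e f i = 0" using that(2) Rl_eq by auto
    then show ?thesis using Rl_eq free.act_closed[OF that(1), of f] Psi_e_act[OF that(1)] by auto
  qed
  have E: "E = quot_grep Fr ((\<lambda>f. f) ` Rl)" unfolding E_def by (simp only: image_ident)
  show ?thesis unfolding E pi_e_def[abs_def]
  proof (rule free.presented_quot)
    show "lin_subspace Rl" by (rule Rl_props(1))
    show "Rl \<subseteq> {f. Poly_Mapping.keys f \<subseteq> Bl}" by (rule Rl_props(2))
    show "{0} \<subseteq> Rl" using lin_subspaceD(1)[OF Rl_props(1)] by simp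
  qed (rule st)
qed

sublocale ext: presented E "{f. Poly_Mapping.keys f \<subseteq> Bl}" pi_e Rl alpha_e W
  by (rule ext_presented)

definition phi_e where "phi_e = ext.lift_coord Psi_e"

lemma phi_e_pi: "Poly_Mapping.keys f \<subseteq> Bl \<Longrightarrow> phi_e (pi_e f) = Psi_e f"
  unfolding phi_e_def
  by (rule ext.lift_coord_eq) (use Rl_eq in \<open>auto simp: Psi_e_def lext_diff\<close>)

lemma ext_coordinatized: "coordinatized E {()} phi_e"
  unfolding phi_e_def
proof (rule ext.coordinatized_part[where S' = "{f. Poly_Mapping.keys f \<subseteq> Bl}"])
  show "Psi_e ` {f. Poly_Mapping.keys f \<subseteq> Bl} = supported {()}"
  proof (intro equalityI subsetI)
    fix c :: "unit \<Rightarrow> complex"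
    have "Psi_e (scl (c ()) (gen (map unit is0))) u = c u" for u
    proof -
      have "Psi_e (scl (c ()) (gen (map unit is0))) u = c () * Psi_e (gen (map unit is0)) u"
        unfolding Psi_e_def lext_scl ..
      then show ?thesis by (cases u) (simp only: Psi_e_basis mult_1_right)
    qed
    then have "Psi_e (scl (c ()) (gen (map unit is0))) = c" by (rule ext)
    moreover have "scl (c ()) (gen (map unit is0)) \<in> {f. Poly_Mapping.keys f \<subseteq> Bl}"
      using unit_list[of is0] by (simp add: scl_single is0_def)
    ultimately show "c \<in> Psi_e ` {f. Poly_Mapping.keys f \<subseteq> Bl}" by (metis imageI)
  qed (auto simp: supported_def)
qed (use ext.carrier ext.subspace Rl_eq in \<open>auto simp: Psi_e_def lext_add lext_scl\<close>)

lemma ext_gr: "gr E d = (if d = e then carrier E else {\<zero>\<^bsub>E\<^esub>})"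
proof -
  have "gr E d = pi_e ` gr Fr d" by (simp add: E_def pi_e_def gr_quot_grep)
  also have "gr Fr d = (if d = e then {f. Poly_Mapping.keys f \<subseteq> Bl} else {0})"
    by (auto simp: Fr_def free_grep_simps)
  finally show ?thesis by (simp add: ext.carrier ext.zero)
qed

lemma ext_act:
  assumes w: "w \<in> W" and b: "b \<in> carrier E"
  shows "act E w b \<in> carrier E" "phi_e (act E w b) i = det (mat_of w) * phi_e b i"
proof -
  obtain f where f: "Poly_Mapping.keys f \<subseteq> Bl" "b = pi_e f" using b by (auto simp: ext.carrier)
  have a: "act E w b = pi_e (alpha_e w f)" using ext.act[OF w, of f] f by simp
  have k: "Poly_Mapping.keys (alpha_e w f) \<subseteq> Bl" using ext.act_closed[OF w, of f] f by simp
  show "act E w b \<in> carrier E" unfolding a ext.carrier using k by blast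
  show "phi_e (act E w b) i = det (mat_of w) * phi_e b i"
    unfolding a phi_e_pi[OF k] unfolding f(2) phi_e_pi[OF f(1)] by (rule Psi_e_act[OF w f(1)])
qed

end

text \<open>The second factor is a line, so the tensor product inherits the coordinates of the first
  factor, with matrices multiplied by \<open>\<rho>\<close> and degrees shifted by e.
  \<open>K d\<close> indexes the coordinates of degree d.\<close>

locale tensor_line = A: coordinatized A I \<phi>A + B: coordinatized B "{()}" \<phi>B
  for A :: "('g, 'a, 'm) grep_scheme" and I :: "'i set" and \<phi>A :: "'a \<Rightarrow> 'i \<Rightarrow> complex"
    and B :: "('g, 'b, 'k) grep_scheme" and \<phi>B :: "'b \<Rightarrow> unit \<Rightarrow> complex" +
  fixes W :: "'g set" and RA :: "'g \<Rightarrow> 'i \<Rightarrow> 'i \<Rightarrow> complex" and \<rho> :: "'g \<Rightarrow> complex" and e :: int and K :: "int \<Rightarrow> 'i set"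
  assumes actA: "w \<in> W \<Longrightarrow> a \<in> carrier A \<Longrightarrow> act A w a \<in> carrier A"
    and actB: "w \<in> W \<Longrightarrow> b \<in> carrier B \<Longrightarrow> act B w b \<in> carrier B"
    and coordA: "w \<in> W \<Longrightarrow> a \<in> carrier A \<Longrightarrow> \<phi>A (act A w a) i = (\<Sum>j\<in>I. RA w i j * \<phi>A a j)"
    and coordB: "w \<in> W \<Longrightarrow> b \<in> carrier B \<Longrightarrow> \<phi>B (act B w b) () = \<rho> w * \<phi>B b ()"
    and grA: "gr A d = {a \<in> carrier A. \<phi>A a \<in> supported (K d)}" and K: "K d \<subseteq> I"
    and graded_act: "w \<in> W \<Longrightarrow> i \<in> K d \<Longrightarrow> j \<in> I \<Longrightarrow> j \<notin> K d \<Longrightarrow> RA w j i = 0"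
    and grB: "gr B d = (if d = e then carrier B else {\<zero>\<^bsub>B\<^esub>})"
begin

definition AB where "AB = carrier A \<times> carrier B"
definition Fr where "Fr = free_grep AB (\<lambda>g. map_prod (act A g) (act B g)) (\<lambda>d. \<Union>j. gr A j \<times> gr B (d - j))"
definition Rt where "Rt = lin_span Fr (tensor_relations A B)"
definition Psi_t :: "('a \<times> 'b \<Rightarrow>\<^sub>0 complex) \<Rightarrow> 'i \<Rightarrow> complex" where "Psi_t = lext (\<lambda>ab i. \<phi>A (fst ab) i * \<phi>B (snd ab) ())"

lemma tensor_relationsE:
  assumes "f \<in> tensor_relations A B"
  obtains (1) a a' b where "f = gen (a \<oplus>\<^bsub>A\<^esub> a', b) - gen (a, b) - gen (a', b)" "a \<in> carrier A" "a' \<in> carrier A" "b \<in> carrier B"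
  | (2) a b b' where "f = gen (a, b \<oplus>\<^bsub>B\<^esub> b') - gen (a, b) - gen (a, b')" "a \<in> carrier A" "b \<in> carrier B" "b' \<in> carrier B"
  | (3) c a b where "f = gen (c \<odot>\<^bsub>A\<^esub> a, b) - Poly_Mapping.single (a, b) c" "a \<in> carrier A" "b \<in> carrier B"
  | (4) c a b where "f = gen (a, c \<odot>\<^bsub>B\<^esub> b) - Poly_Mapping.single (a, b) c" "a \<in> carrier A" "b \<in> carrier B"
  using assms unfolding tensor_relations_def
  by (elim UnE CollectE exE conjE) (rule 1 2 3 4; assumption)+

lemma gen_AB: "a \<in> carrier A \<Longrightarrow> b \<in> carrier B \<Longrightarrow> Poly_Mapping.single (a, b) c \<in> {f. Poly_Mapping.keys f \<subseteq> AB}"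
  by (simp add: AB_def)

lemma Psi_t_single: "Psi_t (Poly_Mapping.single (a, b) c) i = c * (\<phi>A a i * \<phi>B b ())"
  by (simp add: Psi_t_def)

lemma Psi_t_lin: "Psi_t (f + g) i = Psi_t f i + Psi_t g i" "Psi_t (f - g) i = Psi_t f i - Psi_t g i" "Psi_t (scl c f) i = c * Psi_t f i"
  by (simp_all add: Psi_t_def lext_add lext_diff lext_scl)

lemma relations_props:
  assumes "f \<in> tensor_relations A B" shows "f \<in> {f. Poly_Mapping.keys f \<subseteq> AB}" "Psi_t f i = 0"
proof -
  note d = lin_subspaceD(5)[OF lin_subspace_keys]
  show "f \<in> {f. Poly_Mapping.keys f \<subseteq> AB}"
    using assms by (cases rule: tensor_relationsE)
      (simp only:, intro d gen_AB; assumption?, (rule A.add_closed B.add_closed A.smult_closed B.smult_closed; assumption)?)+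
  show "Psi_t f i = 0"
    using assms
  proof (cases rule: tensor_relationsE)
    case (1 a a' b)
    show ?thesis unfolding 1(1) Psi_t_lin Psi_t_single using 1 by (simp add: A.coord_add algebra_simps)
  next
    case (2 a b b')
    show ?thesis unfolding 2(1) Psi_t_lin Psi_t_single using 2 by (simp add: B.coord_add algebra_simps)
  next
    case (3 c a b)
    show ?thesis unfolding 3(1) Psi_t_lin Psi_t_single using 3 by (simp add: A.coord_smult algebra_simps)
  next
    case (4 c a b)
    show ?thesis unfolding 4(1) Psi_t_lin Psi_t_single using 4 by (simp add: B.coord_smult algebra_simps)
  qed
qed

lemma relations_subset: "tensor_relations A B \<subseteq> {f. Poly_Mapping.keys f \<subseteq> AB}"
  using relations_props(1) by blast

lemmas Rt_props = free_span[OF relations_subset, where \<alpha> = "\<lambda>g. map_prod (act A g) (act B g)"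
  and D = "\<lambda>d. \<Union>j. gr A j \<times> gr B (d - j)", folded Fr_def Rt_def]

lemma rel_in:
  shows "a \<in> carrier A \<Longrightarrow> a' \<in> carrier A \<Longrightarrow> b \<in> carrier B \<Longrightarrow> gen (a \<oplus>\<^bsub>A\<^esub> a', b) - gen (a, b) - gen (a', b) \<in> Rt"
    and "a \<in> carrier A \<Longrightarrow> b \<in> carrier B \<Longrightarrow> gen (c \<odot>\<^bsub>A\<^esub> a, b) - Poly_Mapping.single (a, b) c \<in> Rt"
    and "a \<in> carrier A \<Longrightarrow> b \<in> carrier B \<Longrightarrow> gen (a, c \<odot>\<^bsub>B\<^esub> b) - Poly_Mapping.single (a, b) c \<in> Rt"
proof -
  assume h: "a \<in> carrier A" "a' \<in> carrier A" "b \<in> carrier B"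
  show "gen (a \<oplus>\<^bsub>A\<^esub> a', b) - gen (a, b) - gen (a', b) \<in> Rt"
    by (rule subsetD[OF Rt_props(3)], unfold tensor_relations_def, rule UnI1, rule UnI1, rule UnI1, intro CollectI exI conjI, rule refl) (use h in auto)
next
  assume h: "a \<in> carrier A" "b \<in> carrier B"
  show "gen (c \<odot>\<^bsub>A\<^esub> a, b) - Poly_Mapping.single (a, b) c \<in> Rt"
    by (rule subsetD[OF Rt_props(3)], unfold tensor_relations_def, rule UnI1, rule UnI2, intro CollectI exI conjI, rule refl) (use h in auto)
  show "gen (a, c \<odot>\<^bsub>B\<^esub> b) - Poly_Mapping.single (a, b) c \<in> Rt"
    by (rule subsetD[OF Rt_props(3)], unfold tensor_relations_def, rule UnI2, intro CollectI exI conjI, rule refl) (use h in auto)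
qed

abbreviation "b0 \<equiv> B.unit ()"

lemma b0: "b0 \<in> carrier B" "\<phi>B b0 () = 1"
  using B.unit_closed[of "()"] B.coord_unit[of "()"] by simp_all

definition Zt where "Zt = {f. \<exists>g\<in>{f. \<exists>a\<in>carrier A. f = gen (a, b0)}. f - g \<in> Rt}"

lemma Zt_eqv: assumes "f \<in> Zt" "f' - f \<in> Rt" shows "f' \<in> Zt"
proof -
  obtain a where a: "a \<in> carrier A" "f - gen (a, b0) \<in> Rt" using assms(1) unfolding Zt_def by blast
  have "(f' - f) + (f - gen (a, b0)) \<in> Rt" using assms(2) a(2) lin_subspaceD(2)[OF Rt_props(1)] by blast
  then show ?thesis using a(1) unfolding Zt_def by auto
qed

lemma gen_Zt: "a \<in> carrier A \<Longrightarrow> gen (a, b0) \<in> Zt"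
  using lin_subspaceD(1)[OF Rt_props(1)] unfolding Zt_def by (intro CollectI bexI[of _ "gen (a, b0)"]) auto

lemma Zt_subspace: "lin_subspace Zt"
  unfolding lin_subspace_def
proof (intro conjI ballI allI)
  note s = lin_subspaceD[OF Rt_props(1)]
  have "0 \<odot>\<^bsub>A\<^esub> \<zero>\<^bsub>A\<^esub> = \<zero>\<^bsub>A\<^esub>"
    by (rule A.coord_inj) (simp_all add: A.smult_closed A.zero_closed A.coord_smult A.coord_zero)
  then have "gen (\<zero>\<^bsub>A\<^esub>, b0) \<in> Rt" using rel_in(2)[OF A.zero_closed b0(1), of 0] by simp
  then have "0 - gen (\<zero>\<^bsub>A\<^esub>, b0) \<in> Rt" using s(1,5) by blast
  then show "0 \<in> Zt" by (rule Zt_eqv[OF gen_Zt[OF A.zero_closed]])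
  fix x assume "x \<in> Zt"
  then obtain a where a: "a \<in> carrier A" "x - gen (a, b0) \<in> Rt" unfolding Zt_def by blast
  {
    fix c
    have "scl c (x - gen (a, b0)) - (gen (c \<odot>\<^bsub>A\<^esub> a, b0) - Poly_Mapping.single (a, b0) c) \<in> Rt"
      by (rule s(5)[OF s(3)[OF a(2)] rel_in(2)[OF a(1) b0(1)]])
    moreover have "scl c (x - gen (a, b0)) - (gen (c \<odot>\<^bsub>A\<^esub> a, b0) - Poly_Mapping.single (a, b0) c) = scl c x - gen (c \<odot>\<^bsub>A\<^esub> a, b0)"
      by (rule poly_mapping_eqI) (simp add: lookup_add lookup_minus lookup_single when_def algebra_simps)
    ultimately have "scl c x - gen (c \<odot>\<^bsub>A\<^esub> a, b0) \<in> Rt" by simp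
    then show "scl c x \<in> Zt" by (rule Zt_eqv[OF gen_Zt[OF A.smult_closed[OF a(1)]]])
  }
  fix y assume "y \<in> Zt"
  then obtain a' where a': "a' \<in> carrier A" "y - gen (a', b0) \<in> Rt" unfolding Zt_def by blast
  have "(x - gen (a, b0)) + (y - gen (a', b0)) - (gen (a \<oplus>\<^bsub>A\<^esub> a', b0) - gen (a, b0) - gen (a', b0)) \<in> Rt"
    by (rule s(5)[OF s(2)[OF a(2) a'(2)] rel_in(1)[OF a(1) a'(1) b0(1)]])
  then have "x + y - gen (a \<oplus>\<^bsub>A\<^esub> a', b0) \<in> Rt" by (simp add: algebra_simps)
  then show "x + y \<in> Zt" by (rule Zt_eqv[OF gen_Zt[OF A.add_closed[OF a(1) a'(1)]]])
qed

text \<open>Modulo the relations every element is a pure tensor of some \<open>a\<close> with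
  \<open>b0\<close>, and the coordinates of that tensor are those of \<open>a\<close>. Vanishing
  coordinates force \<open>a\<close> to be zero.\<close>

lemma Rt_eq: "Rt = {f \<in> {f. Poly_Mapping.keys f \<subseteq> AB}. \<forall>i. Psi_t f i = 0}" (is "_ = ?K")
proof (intro equalityI subsetI)
  have sub: "Rt \<subseteq> ?K"
  proof (rule Rt_props(4))
    show "lin_subspace ?K"
      using lin_subspaceD(1-3)[OF lin_subspace_keys[of AB]] by (simp add: lin_subspace_def Psi_t_lin) (simp add: Psi_t_def)
    show "tensor_relations A B \<subseteq> ?K" using relations_props by blast
  qed blast
  then show "f \<in> ?K" if h: "f \<in> Rt" for f using h by blast
  fix f assume f: "f \<in> ?K"
  have "f \<in> Zt"
  proof (rule lin_subspace_keys_in[OF Zt_subspace])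
    fix x assume "x \<in> Poly_Mapping.keys f"
    then obtain a b where ab: "x = (a, b)" "a \<in> carrier A" "b \<in> carrier B" using f by (auto simp: AB_def)
    let ?c = "\<phi>B b ()"
    have b: "b = ?c \<odot>\<^bsub>B\<^esub> b0"
      by (rule B.coord_inj) (simp_all add: ab b0 B.smult_closed B.coord_smult fun_eq_iff)
    have "gen (a, ?c \<odot>\<^bsub>B\<^esub> b0) - Poly_Mapping.single (a, b0) ?c \<in> Rt" by (intro rel_in(3) ab b0)
    then have "gen x - Poly_Mapping.single (a, b0) ?c \<in> Rt" unfolding ab(1) using b by simp
    moreover have "scl ?c (gen (a, b0)) \<in> Zt" by (intro lin_subspaceD(3)[OF Zt_subspace] gen_Zt ab)
    ultimately show "gen x \<in> Zt" using Zt_eqv[of "Poly_Mapping.single (a, b0) ?c"] by (simp add: scl_single)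
  qed
  then obtain a where a: "a \<in> carrier A" "f - gen (a, b0) \<in> Rt" unfolding Zt_def by blast
  have "Psi_t (f - gen (a, b0)) i = 0" for i using a(2) sub by blast
  then have "\<phi>A a i = 0" for i using f by (simp add: Psi_t_lin Psi_t_single b0)
  then have "a = \<zero>\<^bsub>A\<^esub>" by (intro A.coord_inj) (simp_all add: a A.zero_closed A.coord_zero fun_eq_iff)
  moreover have "0 \<odot>\<^bsub>A\<^esub> \<zero>\<^bsub>A\<^esub> = \<zero>\<^bsub>A\<^esub>"
    by (rule A.coord_inj) (simp_all add: A.smult_closed A.zero_closed A.coord_smult A.coord_zero)
  ultimately have "gen (a, b0) \<in> Rt" using rel_in(2)[OF A.zero_closed b0(1), of 0] by simp
  then have "f - gen (a, b0) + gen (a, b0) \<in> Rt" using a(2) lin_subspaceD(2)[OF Rt_props(1)] by blast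
  then show "f \<in> Rt" by simp
qed

abbreviation "alpha_t \<equiv> \<lambda>w. pext (\<lambda>x. gen (map_prod (act A w) (act B w) x))"

lemma Psi_t_act:
  assumes w: "w \<in> W" and f: "Poly_Mapping.keys f \<subseteq> AB" shows "Psi_t (alpha_t w f) i = (\<Sum>j\<in>I. \<rho> w * RA w i j * Psi_t f j)"
proof (rule functional_eqI[where T = "\<lambda>f. Psi_t (alpha_t w f) i" and T' = "\<lambda>f. \<Sum>j\<in>I. \<rho> w * RA w i j * Psi_t f j"])
  fix x assume "x \<in> Poly_Mapping.keys f"
  then obtain a b where ab: "x = (a, b)" "a \<in> carrier A" "b \<in> carrier B" using f by (auto simp: AB_def)
  have "Psi_t (alpha_t w (gen x)) i = \<phi>A (act A w a) i * \<phi>B (act B w b) ()"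
    unfolding ab(1) pext_single map_prod_simp scl_single Psi_t_single by simp
  also have "\<dots> = (\<Sum>j\<in>I. \<rho> w * RA w i j * (1 * (\<phi>A a j * \<phi>B b ())))"
    unfolding coordA[OF w ab(2)] coordB[OF w ab(3)] sum_distrib_right by (intro sum.cong) simp_all
  finally show "Psi_t (alpha_t w (gen x)) i = (\<Sum>j\<in>I. \<rho> w * RA w i j * Psi_t (gen x) j)" unfolding ab(1) Psi_t_single .
qed (simp_all add: Psi_t_lin pext_add pext_scl distrib_left sum.distrib sum_distrib_left ac_simps)

sublocale free: presented Fr "{f. Poly_Mapping.keys f \<subseteq> AB}" "\<lambda>f. f" "{0}" alpha_t W
  unfolding Fr_def by (rule free_grep_presented) (auto simp: AB_def actA actB)

definition pi_t where "pi_t f = (\<lambda>f. f) ` Rt +>\<^bsub>Fr\<^esub> f"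

lemma tensor_presented: "presented (tensor A B) {f. Poly_Mapping.keys f \<subseteq> AB} pi_t Rt alpha_t W"
proof -
  have st: "alpha_t w f \<in> Rt" if h: "w \<in> W" "f \<in> Rt" for w f
  proof -
    have f: "Poly_Mapping.keys f \<subseteq> AB" "\<forall>i. Psi_t f i = 0" using h(2) Rt_eq by auto
    have "Psi_t (alpha_t w f) i = 0" for i unfolding Psi_t_act[OF h(1) f(1)] using f(2) by simp
    moreover have "alpha_t w f \<in> {f. Poly_Mapping.keys f \<subseteq> AB}" using free.act_closed[OF h(1)] f(1) by blast
    ultimately show ?thesis unfolding Rt_eq by blast
  qed
  have E: "tensor A B = quot_grep Fr ((\<lambda>f. f) ` Rt)"
    unfolding tensor_def Let_def Fr_def Rt_def AB_def by (simp only: image_ident)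
  show ?thesis unfolding E pi_t_def[abs_def]
  proof (rule free.presented_quot)
    show "lin_subspace Rt" by (rule Rt_props(1))
    show "Rt \<subseteq> {f. Poly_Mapping.keys f \<subseteq> AB}" by (rule Rt_props(2))
    show "{0} \<subseteq> Rt" using lin_subspaceD(1)[OF Rt_props(1)] by simp
  qed (rule st)
qed

sublocale tens: presented "tensor A B" "{f. Poly_Mapping.keys f \<subseteq> AB}" pi_t Rt alpha_t W
  by (rule tensor_presented)

definition GD where "GD d = (\<Union>j. gr A j \<times> gr B (d - j))"

lemma GD_subset: "GD d \<subseteq> AB"
  unfolding GD_def AB_def grA grB using B.zero_closed by (auto split: if_splits)

lemma gr_tensor: "gr (tensor A B) d = pi_t ` {f. Poly_Mapping.keys f \<subseteq> GD d}"
  unfolding tensor_def Let_def gr_quot_grep free_grep_simps pi_t_def Fr_def Rt_def AB_def GD_def by (simp only: image_ident)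

lemma Psi_t_gr: "Psi_t ` {f. Poly_Mapping.keys f \<subseteq> GD d} = supported (K (d - e))"
proof (intro equalityI subsetI)
  fix c assume "c \<in> Psi_t ` {f. Poly_Mapping.keys f \<subseteq> GD d}"
  then obtain f where f: "Poly_Mapping.keys f \<subseteq> GD d" "c = Psi_t f" by blast
  show "c \<in> supported (K (d - e))" unfolding supported_def
  proof (intro CollectI allI impI)
    fix i assume i: "i \<notin> K (d - e)"
    have "\<phi>A (fst x) i * \<phi>B (snd x) () = 0" if x: "x \<in> Poly_Mapping.keys f" for x
    proof -
      obtain j where j: "fst x \<in> gr A j" "snd x \<in> gr B (d - j)" using f(1) x unfolding GD_def by auto
      show ?thesis
      proof (cases "d - j = e")
        case True
        then have "j = d - e" by simp
        then show ?thesis using j(1) i unfolding grA by (auto dest: supportedD)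
      next
        case False
        then show ?thesis using j(2) unfolding grB by (simp add: B.coord_zero)
      qed
    qed
    then show "c i = 0" unfolding f(2) Psi_t_def lext_def by (intro sum.neutral) simp
  qed
next
  fix c assume c: "c \<in> supported (K (d - e))"
  then have "c \<in> supported I" using K[of "d - e"] by (auto simp: supported_def)
  then obtain a where a: "a \<in> carrier A" "\<phi>A a = c" by (rule A.coord_surj)
  have "a \<in> gr A (d - e)" "b0 \<in> gr B (d - (d - e))" unfolding grA grB using a c b0 by simp_all
  then have "gen (a, b0) \<in> {f. Poly_Mapping.keys f \<subseteq> GD d}" unfolding GD_def by auto
  moreover have "Psi_t (gen (a, b0)) = c" by (rule ext) (simp add: Psi_t_single a b0)
  ultimately show "c \<in> Psi_t ` {f. Poly_Mapping.keys f \<subseteq> GD d}" by (metis imageI)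
qed

theorem tensor_trace:
  assumes w: "w \<in> W"
  shows "endo_trace (piece (tensor A B) d) (act (tensor A B) w) = \<rho> w * (\<Sum>i\<in>K (d - e). RA w i i)"
proof -
  have fK: "finite (K (d - e))" using K A.finite_index by (rule finite_subset)
  have P: "coordinatized (piece (tensor A B) d) (K (d - e)) (tens.lift_coord Psi_t)"
    by (rule tens.coordinatized_part[where S' = "{f. Poly_Mapping.keys f \<subseteq> GD d}"])
      (use Rt_eq GD_subset[of d] Psi_t_gr fK gr_tensor in \<open>auto simp: Psi_t_lin piece_def lin_subspace_keys\<close>)
  interpret P: coordinatized "piece (tensor A B) d" "K (d - e)" "tens.lift_coord Psi_t" by (rule P)
  have lc: "tens.lift_coord Psi_t (pi_t f) = Psi_t f" if "Poly_Mapping.keys f \<subseteq> AB" for f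
    by (rule tens.lift_coord_eq) (use Rt_eq that in \<open>auto simp: Psi_t_lin\<close>)
  have C: "carrier (piece (tensor A B) d) = pi_t ` {f. Poly_Mapping.keys f \<subseteq> GD d}" by (simp add: piece_def gr_tensor)
  have act: "act (tensor A B) w x \<in> carrier (piece (tensor A B) d) \<and>
      (\<forall>i. tens.lift_coord Psi_t (act (tensor A B) w x) i = (\<Sum>j\<in>K (d - e). \<rho> w * RA w i j * tens.lift_coord Psi_t x j))"
    if x: "x \<in> carrier (piece (tensor A B) d)" for x
  proof -
    obtain f where f: "Poly_Mapping.keys f \<subseteq> GD d" "x = pi_t f" using x unfolding C by blast
    have fA: "Poly_Mapping.keys f \<subseteq> AB" using f(1) GD_subset by blast
    have sup: "Psi_t f \<in> supported (K (d - e))" using f(1) Psi_t_gr by blast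
    have k: "Poly_Mapping.keys (alpha_t w f) \<subseteq> AB" using tens.act_closed[OF w, of f] fA by simp
    have act: "act (tensor A B) w x = pi_t (alpha_t w f)" unfolding f(2) using tens.act[OF w, of f] fA by simp
    have val: "Psi_t (alpha_t w f) i = (\<Sum>j\<in>K (d - e). \<rho> w * RA w i j * Psi_t f j)" for i
      unfolding Psi_t_act[OF w fA]
      by (rule sum.mono_neutral_right) (use A.finite_index K supportedD[OF sup] in auto)
    have Isup: "Psi_t (alpha_t w f) i = 0" if "i \<notin> I" for i
    proof -
      have "Psi_t f' i = 0" if "Poly_Mapping.keys f' \<subseteq> AB" for f'
        unfolding Psi_t_def lext_def using that \<open>i \<notin> I\<close>
        by (intro sum.neutral) (auto simp: AB_def dest!: A.coord_supported supportedD)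
      then show ?thesis using k by blast
    qed
    have "Psi_t (alpha_t w f) \<in> supported (K (d - e))"
      unfolding supported_def
    proof (intro CollectI allI impI)
      fix i assume i: "i \<notin> K (d - e)"
      show "Psi_t (alpha_t w f) i = 0"
      proof (cases "i \<in> I")
        case True
        then show ?thesis unfolding val using graded_act[OF w _ True i] by (intro sum.neutral) simp
      qed (rule Isup)
    qed
    \<comment> \<open>The image has the right coordinates, but the graded piece asks for a
      representative built from homogeneous pairs; \<open>g\<close> is one, and it differs from the
      image by a relation.\<close>
    then obtain g where g: "Poly_Mapping.keys g \<subseteq> GD d" "Psi_t (alpha_t w f) = Psi_t g" using Psi_t_gr by blast
    have gA: "Poly_Mapping.keys g \<subseteq> AB" using g(1) GD_subset by blast
    have "alpha_t w f - g \<in> Rt" unfolding Rt_eq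
      using lin_subspaceD(5)[OF lin_subspace_keys[of AB]] k gA g(2) by (simp add: Psi_t_lin)
    then have "pi_t (alpha_t w f) = pi_t g" using tens.eq_iff k gA by simp
    then have "act (tensor A B) w x \<in> carrier (piece (tensor A B) d)" unfolding act C using g(1) by blast
    then show ?thesis unfolding act unfolding f(2) lc[OF k] lc[OF fA] using val by simp
  qed
  have "endo_trace (piece (tensor A B) d) (act (tensor A B) w) = (\<Sum>i\<in>K (d - e). \<rho> w * RA w i i)"
  proof (rule P.endo_trace_eq[where A = "\<lambda>i j. \<rho> w * RA w i j"])
    show "act (tensor A B) w x \<in> carrier (piece (tensor A B) d)" if h: "x \<in> carrier (piece (tensor A B) d)" for x
      by (rule conjunct1[OF act[OF h]])
    show "tens.lift_coord Psi_t (act (tensor A B) w x) i = (\<Sum>j\<in>K (d - e). \<rho> w * RA w i j * tens.lift_coord Psi_t x j)"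
      if h: "x \<in> carrier (piece (tensor A B) d)" for x i
      by (rule spec[OF conjunct2[OF act[OF h]]])
  qed
  then show ?thesis by (simp add: sum_distrib_left)
qed

end

section \<open>Semi-invariants modulo the coinvariant ideal\<close>

lemma sum_distinguished:
  "(\<Sum>l\<in>(UNIV :: 'n::finite set). if l = j then x else y) = x + (CARD('n) - 1) * (y :: nat)"
proof -
  have "(\<Sum>l\<in>UNIV - {j}. if l = j then x else y) = (\<Sum>l\<in>UNIV - {j}. y)" by (intro sum.cong) auto
  then show ?thesis by (subst sum.remove[of UNIV j]) (simp_all add: card_Diff_singleton)
qed

lemma prod_one_point:
  "(\<Prod>i\<in>(UNIV :: 'n::finite set). ((\<lambda>_. 1)(l := x)) i ^ a i) = (x :: complex) ^ a l"
  by (subst prod.mono_neutral_right[of UNIV "{l}"]) auto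

lemma prod_two_points:
  assumes "l \<noteq> j"
  shows "(\<Prod>i\<in>(UNIV :: 'n::finite set). ((\<lambda>_. 1)(l := x, j := y)) i ^ a i) = (x :: complex) ^ a l * y ^ a j"
  using assms by (subst prod.mono_neutral_right[of UNIV "{l, j}"]) auto

lemma sum_const_scl: "(\<Sum>x\<in>A. f) = scl (of_nat (card A)) f"
proof (rule poly_mapping_eqI)
  fix k
  have "Poly_Mapping.lookup (\<Sum>x\<in>A. f) k = (\<Sum>x\<in>A. Poly_Mapping.lookup f k)" by (rule lookup_sum)
  then show "Poly_Mapping.lookup (\<Sum>x\<in>A. f) k = Poly_Mapping.lookup (scl (of_nat (card A)) f) k" by simp
qed

lemma scl_scl: "scl c (scl d f) = scl (c * d) f"
  by (rule poly_mapping_eqI) (simp add: mult.assoc)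

lemma scl_left_add: "scl (c + d) f = scl c f + scl d f"
  by (rule poly_mapping_eqI) (simp add: lookup_add distrib_right)

lemma scl_one: "scl 1 f = f"
  by (rule poly_mapping_eqI) simp

lemma scl_zero_left: "scl 0 f = 0"
  by (rule poly_mapping_eqI) simp

lemma scl_sum: "scl c (sum f A) = (\<Sum>a\<in>A. scl c (f a))"
  by (rule poly_mapping_eqI) (simp add: lookup_sum sum_distrib_left)

lemma scl_cancel:
  assumes S: "lin_subspace S" and c: "c \<noteq> 0" and f: "scl c f \<in> S" shows "f \<in> S"
proof -
  have "scl (inverse c) (scl c f) \<in> S" by (rule lin_subspaceD(3)[OF S f])
  then show ?thesis using c by (simp add: scl_scl scl_one)
qed

lemma line_subspace: "lin_subspace (range (\<lambda>c. scl c f))"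
  unfolding lin_subspace_def
proof (intro conjI ballI allI)
  show "0 \<in> range (\<lambda>c. scl c f)" using scl_zero_left[of f] by (metis rangeI)
qed (auto simp: scl_scl scl_left_add[symmetric])

context coinv_model
begin

text \<open>Monomials on which W acts as on x_j^(h+1) in V: the powers x_j^(s+eps+kr) with k < n -
  1, and x_j^eps times all other x_l^(r-s). The next power in the series would be x_j^(h+1) itself,
  which lies in J; the last monomial takes its place.\<close>

definition gex :: "nat \<Rightarrow> 'n \<Rightarrow> 'n \<Rightarrow> nat"
  where "gex k j l = (if k < CARD('n) - 1 then (if l = j then s + eps + k * r else 0)
    else (if l = j then eps else r - s))"

definition exd :: "nat \<Rightarrow> nat"
  where "exd k = (if k < CARD('n) - 1 then s + eps + k * r else eps + (CARD('n) - 1) * (r - s))"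

definition GG :: "nat \<Rightarrow> 'n \<Rightarrow> 'n bipoly" where "GG k j = xm (gex k j)"

lemma sum_gex: "(\<Sum>l\<in>UNIV. gex k j l) = exd k"
  unfolding gex_def exd_def by (cases "k < CARD('n) - 1") (simp_all only: sum_distinguished if_True if_False mult_0_right add_0_right)

text \<open>The degrees of the candidate maps add up to the degree of v, so the exterior power
  placed in the sum of the exponents matches A.\<close>

lemma sum_exd: "(\<Sum>k<CARD('n). exd k) = N"
proof -
  obtain m where m: "CARD('n) = Suc m" using not0_implies_Suc[of "CARD('n)"] by auto
  have "N = (\<Sum>j<CARD('n). eps + r * j)"
    unfolding N_def by (rule sum.reindex_bij_betw[OF idx])
  also have "\<dots> = (m * eps + (\<Sum>k<m. k * r)) + (eps + r * m)"
    unfolding m by (simp add: sum.distrib mult.commute)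
  finally have N: "N = (m * eps + (\<Sum>k<m. k * r)) + (eps + r * m)" .
  have "(\<Sum>k<CARD('n). exd k) = (\<Sum>k<m. s + eps + k * r) + (eps + m * (r - s))"
    unfolding m by (simp add: exd_def m)
  also have "(\<Sum>k<m. s + eps + k * r) = m * s + m * eps + (\<Sum>k<m. k * r)"
    by (simp add: sum.distrib distrib_left)
  finally have E: "(\<Sum>k<CARD('n). exd k) = m * s + m * eps + (\<Sum>k<m. k * r) + (eps + m * (r - s))" .
  have "m * (r - s) + m * s = m * ((r - s) + s)" by (simp only: distrib_left)
  also have "\<dots> = r * m" using s_le by simp
  finally show ?thesis unfolding N E by linarith
qed

lemma r_minus_s: "r - s = s * (p - 1)"
  unfolding diff_mult_distrib2 s_mult_p by (simp only: mult_1_right)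

lemma twice_s_le: assumes "s \<noteq> r" shows "s * 2 \<le> r"
proof -
  have "p \<noteq> 1"
  proof
    assume "p = 1"
    then have "s * p = s" by (simp only: mult_1_right)
    then show False using s_mult_p assms by (simp only:)
  qed
  then have "s * 2 \<le> s * p" using p_pos by (intro mult_le_mono2) linarith
  then show ?thesis unfolding s_mult_p .
qed

lemma GG_pact:
  assumes G: "G_data r p \<sigma> \<eta>" shows "pact \<sigma> \<eta> (GG k j) = scl (\<eta> j ^ (s + eps)) (GG k (\<sigma> j))"
proof -
  have \<sigma>: "\<sigma> permutes UNIV" and \<eta>: "\<And>i. \<eta> i ^ r = 1" and det: "(\<Prod>i\<in>UNIV. \<eta> i) ^ s = 1"
    using G by (auto simp: G_data_def s_def)
  have "finv \<sigma> i = j \<longleftrightarrow> i = \<sigma> j" for i using permutes_inv_eq[OF \<sigma>, of i j] by auto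
  then have perm: "(\<lambda>i. gex k j (finv \<sigma> i)) = gex k (\<sigma> j)" by (simp add: gex_def fun_eq_iff)
  have "(\<Prod>i\<in>UNIV. \<eta> i ^ gex k j i) = \<eta> j ^ (s + eps)"
  proof (cases "k < CARD('n) - 1")
    case True
    have "(\<Prod>i\<in>UNIV. \<eta> i ^ gex k j i) = (\<Prod>i\<in>{j}. \<eta> i ^ gex k j i)"
      by (rule prod.mono_neutral_right) (use True in \<open>auto simp: gex_def\<close>)
    also have "\<dots> = \<eta> j ^ (s + eps) * (\<eta> j ^ r) ^ k"
      using True by (simp add: gex_def power_add power_mult[symmetric] mult.commute)
    finally show ?thesis by (simp add: \<eta>)
  next
    case False
    \<comment> \<open>r - s is a multiple of s, so the product of all entries to this power is 1.
      Hence the entries other than \<open>\<eta> j\<close> contribute the inverse of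
      \<open>\<eta> j ^ (r - s)\<close>, which is \<open>\<eta> j ^ s\<close>.\<close>
    have "(\<Prod>i\<in>UNIV. \<eta> i) ^ (r - s) = 1" unfolding r_minus_s power_mult det by simp
    then have "(\<Prod>i\<in>UNIV. \<eta> i ^ (r - s)) = 1" by (simp add: prod_power_distrib)
    then have a: "\<eta> j ^ (r - s) * (\<Prod>i\<in>UNIV - {j}. \<eta> i ^ (r - s)) = 1"
      by (subst (asm) prod.remove[of UNIV j]) simp_all
    have b: "\<eta> j ^ s * \<eta> j ^ (r - s) = 1" using \<eta>[of j] s_le by (simp add: power_add[symmetric])
    have "(\<Prod>i\<in>UNIV - {j}. \<eta> i ^ (r - s)) = (\<eta> j ^ s * \<eta> j ^ (r - s)) * (\<Prod>i\<in>UNIV - {j}. \<eta> i ^ (r - s))"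
      by (simp add: b)
    also have "\<dots> = \<eta> j ^ s" using a by (simp add: mult.assoc)
    finally have c: "(\<Prod>i\<in>UNIV - {j}. \<eta> i ^ (r - s)) = \<eta> j ^ s" .
    have "(\<Prod>i\<in>UNIV. \<eta> i ^ gex k j i) = \<eta> j ^ eps * (\<Prod>i\<in>UNIV - {j}. \<eta> i ^ gex k j i)"
      using False by (subst prod.remove[of UNIV j]) (simp_all add: gex_def)
    also have "(\<Prod>i\<in>UNIV - {j}. \<eta> i ^ gex k j i) = (\<Prod>i\<in>UNIV - {j}. \<eta> i ^ (r - s))"
      using False by (intro prod.cong) (auto simp: gex_def)
    finally show ?thesis by (simp add: c power_add mult.commute)
  qed
  then show ?thesis unfolding GG_def pact_xm perm by simp
qed

lemma GG_x_polys: "GG k j \<in> x_polys" unfolding GG_def by (rule xm_x_polys)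

lemma GG_degree: "x \<in> Poly_Mapping.keys (GG k j) \<Longrightarrow> mon_deg x = int (exd k)"
  by (simp add: GG_def keys_xm mon_deg_mon sum_gex)

lemma J_subspace: "lin_subspace J" by (rule xidealD(1)[OF J_xideal(1)])

lemma J_I: "f \<in> x_polys \<Longrightarrow> (\<And>m. Q f m = 0) \<Longrightarrow> f \<in> J"
  using annihilator_eq_J by blast

lemma J_pact: assumes "G_data r p \<sigma> \<eta>" "f \<in> J" shows "pact \<sigma> \<eta> f \<in> J"
proof (rule J_I)
  have fx: "f \<in> x_polys" using assms(2) J_xideal(2) by blast
  then show "pact \<sigma> \<eta> f \<in> x_polys" by (rule pact_x_polys)
  have \<sigma>: "\<sigma> permutes UNIV" and \<eta>: "\<And>i. \<eta> i ^ r = 1" using assms(1) by (auto simp: G_data_def)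
  fix m
  have "Q f m = 0" for m using J_annihilates[OF assms(2)] .
  then have "Uop \<sigma> \<eta> (Q f) m = 0" unfolding Uop_def by simp
  then have "chi \<sigma> \<eta> * Q (pact \<sigma> \<eta> f) m = 0" using U_Q[OF \<sigma> \<eta>, where f = f and m = m] by simp
  then show "Q (pact \<sigma> \<eta> f) m = 0" using chi_nonzero[OF \<eta>] by simp
qed

lemma Q_xm: "Q (xm a) m = qq a (\<lambda>_. 0) m"
  unfolding xm_def Q_gen by simp

lemma xm_in_J_big: assumes "Suc h \<le> a i" shows "xm a \<in> J"
proof (rule J_I[OF xm_x_polys])
  fix m
  have "\<not> (a i \<le> m i \<and> m i \<le> h)" using assms by linarith
  then show "Q (xm a) m = 0" unfolding Q_xm qq_def by auto
qed

lemma xm_in_J_q: assumes "\<And>i. s \<le> a i" shows "xm a \<in> J"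
proof -
  have "xm a = xm (\<lambda>_. s) * xm (\<lambda>i. a i - s)" unfolding xm_mult using assms by simp
  then show ?thesis using xidealD(2)[OF J_xideal(1) q_in_J xm_x_polys] by simp
qed

section \<open>Averages over the stabilizer of an index\<close>

definition stab :: "'n \<Rightarrow> ('n \<Rightarrow> 'n) set" where "stab j = {\<pi>. \<pi> permutes UNIV \<and> \<pi> j = j}"

definition TT :: "'n \<Rightarrow> ('n \<Rightarrow> nat) \<Rightarrow> 'n bipoly" where "TT j b = (\<Sum>\<pi>\<in>stab j. xm (\<lambda>i. r * b (\<pi> i)))"

definition zj :: "'n \<Rightarrow> nat \<Rightarrow> 'n bipoly" where "zj j k = xm (\<lambda>i. if i = j then k else 0)"

lemma zj_mult: "zj j k * zj j l = zj j (k + l)"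
  unfolding zj_def xm_mult by (rule arg_cong[where f = xm]) auto

lemma finite_stab: "finite (stab j)"
  unfolding stab_def by (rule finite_subset[OF _ finite_permutations[of UNIV]]) auto

lemma card_stab: "card (stab j) > 0"
proof -
  have "id \<in> stab j" by (simp add: stab_def permutes_id)
  then show ?thesis unfolding card_gt_0_iff using finite_stab by blast
qed

lemma G_data_perm: "\<pi> permutes UNIV \<Longrightarrow> G_data r p \<pi> (\<lambda>_. 1)"
  by (simp add: G_data_def)

lemma symmetric_in_J:
  assumes "(\<Sum>i\<in>UNIV. b i) > 0"
  shows "(\<Sum>\<pi> | \<pi> permutes (UNIV :: 'n set). xm (\<lambda>i. r * b (\<pi> i))) \<in> J"
proof (rule invariant_in_J[where d = "int (r * (\<Sum>i\<in>UNIV. b i))"])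
  show "(\<Sum>\<pi> | \<pi> permutes (UNIV :: 'n set). xm (\<lambda>i. r * b (\<pi> i))) \<in> x_polys"
    by (rule lin_subspaceD(6)[OF x_polys_subspace xm_x_polys])
  fix \<sigma> :: "'n \<Rightarrow> 'n" and \<eta> assume G: "G_data r p \<sigma> \<eta>"
  have \<sigma>: "\<sigma> permutes UNIV" and \<eta>: "\<And>i. \<eta> i ^ r = 1" using G by (auto simp: G_data_def)
  have "pact \<sigma> \<eta> (xm (\<lambda>i. r * b (\<pi> i))) = xm (\<lambda>i. r * b ((\<pi> \<circ> finv \<sigma>) i))" for \<pi>
    unfolding pact_xm by (simp add: power_mult \<eta> scl_one)
  then have "pact \<sigma> \<eta> (\<Sum>\<pi> | \<pi> permutes (UNIV :: 'n set). xm (\<lambda>i. r * b (\<pi> i)))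
      = (\<Sum>\<pi> | \<pi> permutes UNIV. xm (\<lambda>i. r * b ((\<pi> \<circ> finv \<sigma>) i)))" by (simp only: pact_sum)
  also have "\<dots> = (\<Sum>\<pi> | \<pi> permutes UNIV. xm (\<lambda>i. r * b (\<pi> i)))"
    by (rule sum_permutations_compose_right[OF permutes_inv[OF \<sigma>], symmetric])
  finally show "pact \<sigma> \<eta> (\<Sum>\<pi> | \<pi> permutes (UNIV :: 'n set). xm (\<lambda>i. r * b (\<pi> i)))
      = (\<Sum>\<pi> | \<pi> permutes UNIV. xm (\<lambda>i. r * b (\<pi> i)))" .
next
  fix x assume "x \<in> Poly_Mapping.keys (\<Sum>\<pi> | \<pi> permutes (UNIV :: 'n set). xm (\<lambda>i. r * b (\<pi> i)))"
  then obtain \<pi> :: "'n \<Rightarrow> 'n" where \<pi>: "\<pi> permutes UNIV" "x \<in> Poly_Mapping.keys (xm (\<lambda>i. r * b (\<pi> i)))"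
    using keys_sum_subset by fast
  have "(\<Sum>i\<in>UNIV. b (\<pi> i)) = (\<Sum>i\<in>UNIV. b i)"
    using sum.permute[OF \<pi>(1), of b] by (simp add: comp_def)
  then show "mon_deg x = int (r * (\<Sum>i\<in>UNIV. b i))"
    using \<pi>(2) by (simp add: keys_xm mon_deg_mon sum_distrib_left[symmetric])
next
  have "0 < r * (\<Sum>i\<in>UNIV. b i)" using assms r_gt_1 by (intro mult_pos_pos) linarith+
  then show "0 < int (r * (\<Sum>i\<in>UNIV. b i))" by (simp only: of_nat_0_less_iff)
qed

text \<open>Permutations are grouped by the image \<open>l\<close> of \<open>j\<close>. Composition
  with the transposition of \<open>j\<close> and \<open>l\<close> brings each group into the
  stabilizer, and the exponent \<open>b l\<close> at \<open>j\<close> factors out.\<close>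

lemma symmetric_split:
  assumes "b j = 0"
  shows "(\<Sum>\<pi> | \<pi> permutes (UNIV :: 'n set). xm (\<lambda>i. r * b (\<pi> i)))
    = (\<Sum>l\<in>UNIV. zj j (r * b l) * TT j ((b \<circ> Transposition.transpose j l)(j := 0)))"
proof -
  let ?P = "{\<pi>. \<pi> permutes (UNIV :: 'n set)}"
  have "(\<Sum>\<pi>\<in>{\<pi> \<in> ?P. \<pi> j = l}. xm (\<lambda>i. r * b (\<pi> i))) = zj j (r * b l) * TT j ((b \<circ> Transposition.transpose j l)(j := 0))" for l
  proof -
    let ?t = "Transposition.transpose j l"
    have t: "?t permutes UNIV" by (rule permutes_swap_id) simp_all
    have "(\<Sum>\<pi>\<in>{\<pi> \<in> ?P. \<pi> j = l}. xm (\<lambda>i. r * b (\<pi> i))) = (\<Sum>\<pi>\<in>stab j. xm (\<lambda>i. r * b ((?t \<circ> \<pi>) i)))"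
    proof (rule sum.reindex_bij_witness[where i = "\<lambda>\<pi>. ?t \<circ> \<pi>" and j = "\<lambda>\<pi>. ?t \<circ> \<pi>"])
      fix \<pi> assume "\<pi> \<in> {\<pi> \<in> ?P. \<pi> j = l}"
      then show "?t \<circ> \<pi> \<in> stab j" using permutes_compose[OF _ t, of \<pi>] by (simp add: stab_def)
    next
      fix \<pi> assume "\<pi> \<in> stab j"
      then show "?t \<circ> \<pi> \<in> {\<pi> \<in> ?P. \<pi> j = l}" using permutes_compose[OF _ t, of \<pi>] by (simp add: stab_def)
    qed (simp_all add: fun_eq_iff)
    also have "\<dots> = (\<Sum>\<pi>\<in>stab j. zj j (r * b l) * xm (\<lambda>i. r * ((b \<circ> ?t)(j := 0)) (\<pi> i)))"
    proof (rule sum.cong[OF refl])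
      fix \<pi> assume "\<pi> \<in> stab j"
      then have \<pi>: "\<pi> j = j" "inj \<pi>" by (auto simp: stab_def permutes_inj)
      have "\<pi> i = j \<longleftrightarrow> i = j" for i using inj_eq[OF \<pi>(2), of i j] \<pi>(1) by simp
      then show "xm (\<lambda>i. r * b ((?t \<circ> \<pi>) i)) = zj j (r * b l) * xm (\<lambda>i. r * ((b \<circ> ?t)(j := 0)) (\<pi> i))"
        unfolding zj_def xm_mult by (intro arg_cong[where f = xm]) (auto simp: fun_eq_iff \<pi>(1))
    qed
    finally show ?thesis unfolding TT_def sum_distrib_left .
  qed
  moreover have "(\<Sum>l\<in>UNIV. \<Sum>\<pi>\<in>{\<pi> \<in> ?P. \<pi> j = l}. xm (\<lambda>i. r * b (\<pi> i))) = (\<Sum>\<pi>\<in>?P. xm (\<lambda>i. r * b (\<pi> i)))"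
    by (rule sum.group) (simp_all add: finite_permutations)
  ultimately show ?thesis by simp
qed

text \<open>Symmetrizing over all indices gives an element of the ideal; splitting it according to the exponent
  at the index \<open>j\<close> expresses a symmetric sum by symmetric sums with fewer parts.\<close>

lemma TT_mod_J: "b j = 0 \<Longrightarrow> \<exists>c. TT j b - scl c (zj j (r * (\<Sum>i\<in>UNIV. b i))) \<in> J"
proof (induction "card {l. b l \<noteq> 0}" arbitrary: b rule: less_induct)
  case less
  define M where "M = zj j (r * (\<Sum>i\<in>UNIV. b i))"
  show ?case
  proof (cases "(\<Sum>i\<in>UNIV. b i) = 0")
    case True
    then have "b = (\<lambda>_. 0)" by (simp add: fun_eq_iff)
    then have "TT j b = scl (of_nat (card (stab j))) (zj j (r * (\<Sum>i\<in>UNIV. b i)))"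
      by (simp add: TT_def zj_def sum_const_scl del: sum_constant)
    then show ?thesis using lin_subspaceD(1)[OF J_subspace] by (intro exI[of _ "of_nat (card (stab j))"]) simp
  next
    case False
    define Z where "Z = {f. \<exists>g\<in>range (\<lambda>c. scl c M). f - g \<in> J}"
    have Z: "lin_subspace Z" unfolding Z_def by (rule mod_subspace[OF J_subspace line_subspace])
    have JZ: "f \<in> Z" if h: "f \<in> J" for f
    proof -
      have "f - scl 0 M \<in> J" using h by (simp add: scl_zero_left)
      then show ?thesis unfolding Z_def by blast
    qed
    \<comment> \<open>If \<open>b l = 0\<close> this term is \<open>TT j b\<close> itself; otherwise
      the part \<open>b l\<close> has moved to the index \<open>j\<close>, leaving one part fewer
      for the induction.\<close>
    define tm where "tm l = zj j (r * b l) * TT j ((b \<circ> Transposition.transpose j l)(j := 0))" for l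
    have tm_Z: "tm l \<in> Z" if l: "b l \<noteq> 0" for l
    proof -
      let ?b = "(b \<circ> Transposition.transpose j l)(j := 0)"
      have lj: "l \<noteq> j" using l less.prems by auto
      have b: "?b = b(l := 0)"
        using lj less.prems by (auto simp: fun_eq_iff Transposition.transpose_def)
      have "{i. (b(l := 0)) i \<noteq> 0} \<subset> {i. b i \<noteq> 0}" using l by auto
      then have "card {i. ?b i \<noteq> 0} < card {i. b i \<noteq> 0}" unfolding b by (intro psubset_card_mono) simp_all
      moreover have "?b j = 0" by simp
      ultimately obtain c where c: "TT j ?b - scl c (zj j (r * (\<Sum>i\<in>UNIV. ?b i))) \<in> J" using less.hyps by blast
      have sb: "(\<Sum>i\<in>UNIV. b i) = b l + (\<Sum>i\<in>UNIV. ?b i)"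
        unfolding b by (subst (1 2) sum.remove[of UNIV l]) simp_all
      have "zj j (r * b l) * (TT j ?b - scl c (zj j (r * (\<Sum>i\<in>UNIV. ?b i)))) \<in> J"
        by (rule xidealD(3)[OF J_xideal(1) c]) (simp add: zj_def xm_x_polys)
      then have "tm l - scl c M \<in> J"
        unfolding tm_def M_def sb by (simp only: right_diff_distrib scl_mult_right zj_mult distrib_left)
      then show ?thesis unfolding Z_def by blast
    qed
    have tm_0: "tm l = TT j b" if l: "b l = 0" for l
    proof -
      have "(b \<circ> Transposition.transpose j l)(j := 0) = b"
        using l less.prems by (auto simp: fun_eq_iff Transposition.transpose_def)
      moreover have "zj j (r * b l) = 1" using l by (simp add: zj_def xm_zero)
      ultimately show ?thesis unfolding tm_def by simp
    qed
    have "(\<Sum>l\<in>UNIV. tm l) \<in> Z"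
      unfolding tm_def symmetric_split[where b = b, OF less.prems, symmetric]
      by (rule JZ[OF symmetric_in_J[OF neq0_conv[THEN iffD1, OF False]]])
    moreover have "(\<Sum>l | b l \<noteq> 0. tm l) \<in> Z" by (rule lin_subspaceD(6)[OF Z]) (use tm_Z in simp)
    moreover have "(\<Sum>l\<in>UNIV. tm l) = (\<Sum>l | b l = 0. tm l) + (\<Sum>l | b l \<noteq> 0. tm l)"
      by (subst sum.union_disjoint[symmetric]) (auto intro!: sum.cong)
    ultimately have "(\<Sum>l | b l = 0. tm l) \<in> Z" using lin_subspaceD(5)[OF Z] by fastforce
    moreover have "(\<Sum>l | b l = 0. tm l) = (\<Sum>l | b l = 0. TT j b)" by (rule sum.cong) (use tm_0 in auto)
    ultimately have "scl (of_nat (card {l. b l = 0})) (TT j b) \<in> Z" by (simp only: sum_const_scl)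
    \<comment> \<open>\<open>b j = 0\<close> guarantees that \<open>TT j b\<close> occurs at least
      once, so its multiplicity can be divided out.\<close>
    moreover have "card {l. b l = 0} \<noteq> 0" using less.prems by (auto simp: card_eq_0_iff)
    ultimately have "TT j b \<in> Z" using scl_cancel[OF Z] by (metis of_nat_eq_0_iff)
    then show ?thesis unfolding Z_def M_def by blast
  qed
qed

text \<open>The diagonal matrices of W act on x^a by the same weight as on x_j^(h+1).\<close>

definition adm :: "'n \<Rightarrow> ('n \<Rightarrow> nat) \<Rightarrow> bool"
  where "adm j a \<longleftrightarrow> (\<forall>\<eta>. G_data r p id \<eta> \<longrightarrow> (\<Prod>i\<in>UNIV. \<eta> i ^ a i) = \<eta> j ^ (s + eps))"

lemma adm_residues:
  assumes a: "adm j a"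
  shows "l \<noteq> j \<Longrightarrow> a j mod r = (a l + s + eps) mod r" "l \<noteq> j \<Longrightarrow> s dvd a l" "a j mod s = eps"
proof -
  have id: "id permutes (UNIV :: 'n set)" by (rule permutes_id)
  show "a j mod r = (a l + s + eps) mod r" if l: "l \<noteq> j"
  proof -
    \<comment> \<open>\<open>zeta ^ (r - 1)\<close> is the inverse of \<open>zeta\<close>, so the
      two entries have product 1.\<close>
    let ?\<eta> = "(\<lambda>_. 1)(l := zeta ^ (r - 1), j := zeta) :: 'n \<Rightarrow> complex"
    have zr: "zeta ^ (r - 1) * zeta = 1"
      using zeta_root(1) r_gt_1 by (simp flip: power_Suc2)
    have "(zeta ^ (r - 1)) ^ r = 1" by (metis zeta_root(1) power_commutes power_mult mult.commute power_one)
    then have "\<forall>i. ?\<eta> i ^ r = 1" using zeta_root(1) by simp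
    moreover have "(\<Prod>i\<in>UNIV. ?\<eta> i) = 1" using prod_two_points[OF l, of "zeta ^ (r - 1)" zeta "\<lambda>_. 1"] zr by simp
    ultimately have "G_data r p id ?\<eta>" using id by (simp add: G_data_def)
    then have "(\<Prod>i\<in>UNIV. ?\<eta> i ^ a i) = ?\<eta> j ^ (s + eps)" using a unfolding adm_def by blast
    then have "(zeta ^ (r - 1)) ^ a l * zeta ^ a j = zeta ^ (s + eps)" unfolding prod_two_points[OF l] by simp
    then have "zeta ^ ((r - 1) * a l + a j) = zeta ^ (s + eps)" by (simp add: power_add power_mult)
    then have "((r - 1) * a l + a j) mod r = (s + eps) mod r" unfolding zeta_power_eq_iff .
    then have "(((r - 1) * a l + a j) + a l) mod r = ((s + eps) + a l) mod r" by (rule mod_add_cong[OF _ refl])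
    moreover have "((r - 1) * a l + a j) + a l = a j + r * a l"
    proof -
      have "(r - 1) * a l + a l = (r - 1 + 1) * a l" by (simp only: distrib_right mult_1_left)
      also have "\<dots> = r * a l" using r_gt_1 by simp
      finally show ?thesis by linarith
    qed
    ultimately show ?thesis by (simp add: ac_simps)
  qed
  have single: "(p * a l) mod r = (if l = j then p * (s + eps) else 0) mod r" for l
  proof -
    \<comment> \<open>One entry \<open>zeta ^ p\<close> alone is allowed, because its s-th power is
      1; it detects exponents modulo s.\<close>
    let ?\<eta> = "(\<lambda>_. 1)(l := zeta ^ p) :: 'n \<Rightarrow> complex"
    have "(zeta ^ p) ^ r = 1" by (metis zeta_root(1) power_mult mult.commute power_one)
    then have "\<forall>i. ?\<eta> i ^ r = 1" by simp
    moreover have "(\<Prod>i\<in>UNIV. ?\<eta> i) ^ (r div p) = 1"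
      using prod_one_point[of l "zeta ^ p" "\<lambda>_. 1"] zeta_root(1) s_mult_p
      by (simp add: s_def power_mult[symmetric] mult.commute)
    ultimately have "G_data r p id ?\<eta>" using id by (simp add: G_data_def)
    then have "(\<Prod>i\<in>UNIV. ?\<eta> i ^ a i) = ?\<eta> j ^ (s + eps)" using a unfolding adm_def by blast
    then have "(zeta ^ p) ^ a l = (if l = j then (zeta ^ p) ^ (s + eps) else 1)" unfolding prod_one_point by auto
    then have "zeta ^ (p * a l) = zeta ^ (if l = j then p * (s + eps) else 0)" by (simp add: power_mult split: if_splits)
    then show ?thesis unfolding zeta_power_eq_iff .
  qed
  have ps: "p * s = r" using s_mult_p by (simp only: mult.commute)
  show "s dvd a l" if "l \<noteq> j"
  proof -
    have "r dvd p * a l" using single[of l] that by (simp add: mod_eq_0_iff_dvd)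
    then have "p * s dvd p * a l" unfolding ps .
    then show ?thesis using p_pos by simp
  qed
  have "(p * a j) mod (p * s) = (p * (s + eps)) mod (p * s)" unfolding ps using single[of j] by simp
  then have "p * (a j mod s) = p * ((s + eps) mod s)" unfolding mod_mult_mult1 .
  then show "a j mod s = eps" using p_pos eps_less by simp
qed

text \<open>The exponents away from \<open>j\<close> share one residue modulo r and are multiples of
  s. If that residue is nonzero they are all at least s, so the small exponent is the one at
  \<open>j\<close>; it is then \<open>eps\<close>, and the common residue is -s. Monomials without
  an exponent below s are excluded here since they lie in J.\<close>

lemma adm_cases:
  assumes a: "adm j a" and small: "a i0 < s"
  shows "(a j = eps \<and> s < r \<and> (\<forall>l. l \<noteq> j \<longrightarrow> a l mod r = r - s)) \<or>
    ((\<forall>l. l \<noteq> j \<longrightarrow> a l mod r = 0) \<and> a j mod r = (s + eps) mod r)"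
proof (cases "\<exists>l. l \<noteq> j \<and> a l mod r = 0")
  case True
  then obtain l where l: "l \<noteq> j" "a l mod r = 0" by (elim exE conjE)
  have aj: "a j mod r = (s + eps) mod r"
  proof -
    have "a j mod r = (a l + (s + eps)) mod r" using adm_residues(1)[OF a l(1)] by (simp only: add.assoc)
    also have "\<dots> = (a l mod r + (s + eps)) mod r" by (simp only: mod_add_left_eq)
    finally show ?thesis unfolding l(2) add_0 .
  qed
  have "a k mod r = 0" if k: "k \<noteq> j" for k
  proof -
    have "(a k + (s + eps)) mod r = a j mod r" using adm_residues(1)[OF a k] by (simp only: add.assoc)
    then have "(a k + (s + eps)) mod r = (0 + (s + eps)) mod r" unfolding aj add_0 .
    then have "[a k + (s + eps) = 0 + (s + eps)] (mod r)" unfolding cong_def .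
    then have "[a k = 0] (mod r)" unfolding cong_add_rcancel_nat .
    then show ?thesis unfolding cong_def mod_0 .
  qed
  then have all: "\<forall>l. l \<noteq> j \<longrightarrow> a l mod r = 0" by (intro allI impI)
  show ?thesis by (rule disjI2, rule conjI[OF all aj])
next
  case False
  have nz: "a l mod r \<noteq> 0" if l: "l \<noteq> j" for l
  proof
    assume "a l mod r = 0"
    then have "\<exists>l. l \<noteq> j \<and> a l mod r = 0" using l by (intro exI[of _ l] conjI)
    with False show False by (rule notE)
  qed
  have ge: "s \<le> a l" if l: "l \<noteq> j" for l
  proof -
    have "a l \<noteq> 0"
    proof
      assume "a l = 0"
      then show False using nz[OF l] by (simp only: mod_0)
    qed
    then show ?thesis using adm_residues(2)[OF a l] by (intro dvd_imp_le) simp_all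
  qed
  have "i0 = j"
  proof (rule ccontr)
    assume "i0 \<noteq> j"
    then show False using ge[of i0] small by linarith
  qed
  then have "a j < s" using small by (simp only:)
  then have aj: "a j = eps" using adm_residues(3)[OF a] by (simp only: mod_less)
  have res: "a l mod r = r - s" if l: "l \<noteq> j" for l
  proof -
    have "(a l + s + eps) mod r = (0 + eps) mod r" using adm_residues(1)[OF a l] unfolding aj add_0 by (rule sym)
    then have "[(a l + s) + eps = 0 + eps] (mod r)" unfolding cong_def .
    then have "[a l + s = 0] (mod r)" unfolding cong_add_rcancel_nat .
    then have "(a l + s) mod r = 0" unfolding cong_def mod_0 .
    then have "(a l mod r + s) mod r = 0" by (simp only: mod_add_left_eq)
    then have d: "r dvd a l mod r + s" by (simp only: mod_eq_0_iff_dvd)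
    have "0 < a l mod r + s" "a l mod r + s < r + r"
      using nz[OF l] mod_less_divisor[of r "a l"] r_gt_1 s_le by linarith+
    moreover obtain q where q: "a l mod r + s = r * q" using d by (rule dvdE)
    ultimately have "0 < r * q" "r * q < r * 2" by linarith+
    then have "q = 1" by simp
    then have "a l mod r + s = r" using q by (simp only: mult_1_right)
    then show ?thesis by linarith
  qed
  show ?thesis
  proof (cases "s < r")
    case True
    show ?thesis by (rule disjI1, intro conjI allI impI aj True res)
  next
    case f: False
    then have sr: "s = r" using s_le by linarith
    have "a l mod r = 0" if l: "l \<noteq> j" for l using res[OF l] unfolding sr by (simp only: diff_self_eq_0)
    then have all: "\<forall>l. l \<noteq> j \<longrightarrow> a l mod r = 0" by (intro allI impI)
    have "a j mod r = (s + eps) mod r" unfolding aj sr by simp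
    then show ?thesis by (intro disjI2 conjI all)
  qed
qed

definition gg :: "(nat \<Rightarrow> complex) \<Rightarrow> 'n \<Rightarrow> 'n bipoly"
  where "gg c j = (\<Sum>k<CARD('n). scl (c k) (GG k j))"

definition Kd :: "nat \<Rightarrow> nat set" where "Kd d = {k. k < CARD('n) \<and> exd k = d}"

text \<open>The possible images of x_j^(h+1) in degree d: combinations of the candidate monomials of
  that degree, modulo J.\<close>

definition YY :: "'n \<Rightarrow> nat \<Rightarrow> 'n bipoly set"
  where "YY j d = {f. \<exists>g\<in>(\<lambda>c. gg c j) ` supported (Kd d). f - g \<in> J}"

lemma gg_add: "gg (\<lambda>k. c k + c' k) j = gg c j + gg c' j"
  unfolding gg_def scl_left_add sum.distrib ..

lemma gg_scl: "gg (\<lambda>k. t * c k) j = scl t (gg c j)"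
  unfolding gg_def scl_sum scl_scl ..

lemma gg_zero: "gg (\<lambda>_. 0) j = 0"
  unfolding gg_def scl_zero_left by simp

lemma gg_diff: "gg (\<lambda>k. c k - c' k) j = gg c j - gg c' j"
proof -
  have "gg (\<lambda>k. c k - c' k) j + gg c' j = gg c j" unfolding gg_add[symmetric] by simp
  then show ?thesis by (simp add: algebra_simps)
qed

lemma gg_x_polys: "gg c j \<in> x_polys"
  unfolding gg_def by (intro lin_subspaceD(6)[OF x_polys_subspace] lin_subspaceD(3)[OF x_polys_subspace] GG_x_polys)

lemma gg_pact: "G_data r p \<sigma> \<eta> \<Longrightarrow> pact \<sigma> \<eta> (gg c j) = scl (\<eta> j ^ (s + eps)) (gg c (\<sigma> j))"
  unfolding gg_def by (simp add: pact_sum pact_scl GG_pact scl_sum scl_scl mult.commute)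

lemma YY_subspace: "lin_subspace (YY j d)"
  unfolding YY_def
proof (rule mod_subspace[OF J_subspace])
  show "lin_subspace ((\<lambda>c. gg c j) ` supported (Kd d))"
    unfolding lin_subspace_def
  proof (intro conjI ballI allI)
    show "0 \<in> (\<lambda>c. gg c j) ` supported (Kd d)"
      by (rule image_eqI[of _ _ "\<lambda>_. 0"]) (simp_all add: gg_zero supported_def)
    fix x assume "x \<in> (\<lambda>c. gg c j) ` supported (Kd d)"
    then obtain c where c: "c \<in> supported (Kd d)" "x = gg c j" by blast
    show "scl t x \<in> (\<lambda>c. gg c j) ` supported (Kd d)" for t
      by (rule image_eqI[of _ _ "\<lambda>k. t * c k"]) (use c in \<open>simp_all add: gg_scl supported_def\<close>)
    fix y assume "y \<in> (\<lambda>c. gg c j) ` supported (Kd d)"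
    then obtain c' where c': "c' \<in> supported (Kd d)" "y = gg c' j" by blast
    show "x + y \<in> (\<lambda>c. gg c j) ` supported (Kd d)"
      by (rule image_eqI[of _ _ "\<lambda>k. c k + c' k"]) (use c c' in \<open>simp_all add: gg_add supported_def\<close>)
  qed
qed

lemma J_YY: assumes "f \<in> J" shows "f \<in> YY j d"
proof -
  have "f - gg (\<lambda>_. 0) j \<in> J" using assms by (simp add: gg_zero)
  moreover have "(\<lambda>_. 0) \<in> supported (Kd d)" by (simp add: supported_def)
  ultimately show ?thesis unfolding YY_def by blast
qed

lemma GG_YY: assumes "k < CARD('n)" "exd k = d" shows "GG k j \<in> YY j d"
proof -
  let ?c = "\<lambda>l. of_bool (l = k)"
  have "gg ?c j = (\<Sum>l\<in>{k}. scl (?c l) (GG l j))"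
    unfolding gg_def by (rule sum.mono_neutral_right) (use assms in \<open>auto simp: scl_zero_left\<close>)
  then have "GG k j - gg ?c j \<in> J" using lin_subspaceD(1)[OF J_subspace] by (simp add: scl_one)
  moreover have "?c \<in> supported (Kd d)" using assms by (auto simp: supported_def Kd_def)
  ultimately show ?thesis unfolding YY_def by blast
qed

lemma YY_mod: assumes "f - g \<in> J" "g \<in> YY j d" shows "f \<in> YY j d"
proof -
  have "f - g + g \<in> YY j d" by (rule lin_subspaceD(2)[OF YY_subspace J_YY[OF assms(1)] assms(2)])
  then show ?thesis by simp
qed

lemma n_pos: "0 < CARD('n)" by simp

text \<open>Exponents above h give elements of J, and those from \<open>s + eps\<close> to h are
  candidate powers. Smaller ones of the right residue exist only for s = r, where
  \<open>e = eps\<close> and the power is the last candidate.\<close>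

lemma zj_YY:
  assumes e: "e mod r = (s + eps) mod r" shows "zj j e \<in> YY j e"
proof -
  consider (big) "Suc h \<le> e" | (mid) "e < Suc h" "s + eps \<le> e" | (low) "e < s + eps" by linarith
  then show ?thesis
  proof cases
    case big
    then show ?thesis unfolding zj_def by (intro J_YY xm_in_J_big[of _ j]) simp
  next
    case mid
    then have "r dvd e - (s + eps)" using e by (simp add: mod_eq_dvd_iff_nat)
    then obtain k where k: "e - (s + eps) = r * k" by (rule dvdE)
    then have ek: "e = s + eps + k * r" using mid(2) by (simp add: mult.commute)
    then have "r * k < r * (CARD('n) - 1)" using mid(1) unfolding h_eq by (simp add: mult.commute)
    then have kn: "k < CARD('n) - 1" by simp
    then have "zj j e = GG k j" unfolding zj_def GG_def by (intro arg_cong[where f = xm]) (simp add: fun_eq_iff gex_def ek)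
    moreover have "exd k = e" using kn by (simp add: exd_def ek)
    moreover have "k < CARD('n)" using kn by linarith
    ultimately show ?thesis using GG_YY by simp
  next
    case low
    have "(s + eps) mod r = e mod r" using e by simp
    then have "r dvd (s + eps) - e" using low by (simp add: mod_eq_dvd_iff_nat)
    then obtain t where t: "s + eps - e = r * t" by (rule dvdE)
    have "t \<noteq> 0" by (rule notI) (use t low in simp)
    then have "r \<le> s + eps - e" unfolding t by simp
    then have rl: "r + e \<le> s + eps" using low by linarith
    have sr: "s = r"
    proof (rule ccontr)
      assume "s \<noteq> r"
      then show False using rl eps_less twice_s_le by linarith
    qed
    then have "s + eps - e < r * 2" using eps_less by linarith
    then have "t = 1" using t \<open>t \<noteq> 0\<close> by (cases t) auto
    then have ee: "e = eps" using t sr low by simp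
    have "zj j e = GG (CARD('n) - 1) j" unfolding zj_def GG_def by (intro arg_cong[where f = xm]) (simp add: fun_eq_iff gex_def ee sr)
    moreover have "exd (CARD('n) - 1) = e" by (simp add: exd_def ee sr)
    moreover have "CARD('n) - 1 < CARD('n)" using n_pos by linarith
    ultimately show ?thesis using GG_YY by simp
  qed
qed

lemma stab_iff: assumes "\<pi> \<in> stab j" shows "\<pi> i = j \<longleftrightarrow> i = j"
  using assms inj_eq[of \<pi> i j] by (auto simp: stab_def permutes_inj)

text \<open>In both cases of \<open>adm_cases\<close> the average is a fixed monomial times a
  symmetric sum in the z_l, and \<open>TT_mod_J\<close> replaces the latter by a multiple of a power
  of z_j.\<close>

lemma average_YY:
  assumes a: "adm j a" shows "(\<Sum>\<pi>\<in>stab j. xm (\<lambda>i. a (\<pi> i))) \<in> YY j (\<Sum>i\<in>UNIV. a i)"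
proof (cases "\<forall>i. s \<le> a i")
  case True
  then show ?thesis by (intro J_YY lin_subspaceD(6)[OF J_subspace] xm_in_J_q) blast
next
  case False
  then obtain i0 where "a i0 < s" by (auto simp: not_le)
  from adm_cases[OF a this] show ?thesis
  proof (elim disjE conjE)
    assume l0: "\<forall>l. l \<noteq> j \<longrightarrow> a l mod r = 0" and aj: "a j mod r = (s + eps) mod r"
    define b where "b l = (if l = j then 0 else a l div r)" for l
    have al: "a l = r * b l" if "l \<noteq> j" for l using l0 that by (auto simp: b_def)
    have avg: "(\<Sum>\<pi>\<in>stab j. xm (\<lambda>i. a (\<pi> i))) = zj j (a j) * TT j b"
      unfolding TT_def sum_distrib_left
    proof (rule sum.cong[OF refl])
      fix \<pi> assume \<pi>: "\<pi> \<in> stab j"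
      show "xm (\<lambda>i. a (\<pi> i)) = zj j (a j) * xm (\<lambda>i. r * b (\<pi> i))"
        unfolding zj_def xm_mult
      proof (intro arg_cong[where f = xm] ext)
        show "a (\<pi> i) = (if i = j then a j else 0) + r * b (\<pi> i)" for i
          using stab_iff[OF \<pi>, of i] al[of "\<pi> i"] by (cases "i = j") (simp_all add: b_def)
      qed
    qed
    have "(\<Sum>i\<in>UNIV. a i) = (\<Sum>i\<in>UNIV. (if i = j then a j else 0) + r * b i)"
      using al by (intro sum.cong) (auto simp: b_def)
    also have "\<dots> = a j + r * (\<Sum>i\<in>UNIV. b i)" by (simp add: sum.distrib sum_distrib_left)
    finally have sa: "(\<Sum>i\<in>UNIV. a i) = a j + r * (\<Sum>i\<in>UNIV. b i)" .
    obtain c where c: "TT j b - scl c (zj j (r * (\<Sum>i\<in>UNIV. b i))) \<in> J" using TT_mod_J[of b j] by (auto simp: b_def)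
    have "zj j (a j) * (TT j b - scl c (zj j (r * (\<Sum>i\<in>UNIV. b i)))) \<in> J"
      by (rule xidealD(3)[OF J_xideal(1) c]) (simp add: zj_def xm_x_polys)
    then have "zj j (a j) * TT j b - scl c (zj j (\<Sum>i\<in>UNIV. a i)) \<in> J"
      unfolding sa by (simp only: right_diff_distrib scl_mult_right zj_mult)
    moreover have "scl c (zj j (\<Sum>i\<in>UNIV. a i)) \<in> YY j (\<Sum>i\<in>UNIV. a i)"
      by (intro lin_subspaceD(3)[OF YY_subspace] zj_YY) (simp add: sa aj)
    ultimately show ?thesis unfolding avg by (rule YY_mod)
  next
    assume aj: "a j = eps" and sr: "s < r" and l0: "\<forall>l. l \<noteq> j \<longrightarrow> a l mod r = r - s"
    let ?k = "CARD('n) - 1"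
    define b where "b l = (if l = j then 0 else a l div r)" for l
    have al: "a l = r - s + r * b l" if "l \<noteq> j" for l
      using l0 that mult_div_mod_eq[of r "a l"] by (simp add: b_def)
    have avg: "(\<Sum>\<pi>\<in>stab j. xm (\<lambda>i. a (\<pi> i))) = GG ?k j * TT j b"
      unfolding TT_def sum_distrib_left
    proof (rule sum.cong[OF refl])
      fix \<pi> assume \<pi>: "\<pi> \<in> stab j"
      show "xm (\<lambda>i. a (\<pi> i)) = GG ?k j * xm (\<lambda>i. r * b (\<pi> i))"
        unfolding GG_def xm_mult
      proof (intro arg_cong[where f = xm] ext)
        show "a (\<pi> i) = gex ?k j i + r * b (\<pi> i)" for i
          using stab_iff[OF \<pi>, of i] al[of "\<pi> i"] by (cases "i = j") (simp_all add: b_def gex_def aj)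
      qed
    qed
    have "(\<Sum>i\<in>UNIV. a i) = (\<Sum>i\<in>UNIV. gex ?k j i + r * b i)"
      using al aj by (intro sum.cong) (auto simp: b_def gex_def)
    also have "\<dots> = exd ?k + r * (\<Sum>i\<in>UNIV. b i)" by (simp add: sum.distrib sum_distrib_left sum_gex)
    finally have sa: "(\<Sum>i\<in>UNIV. a i) = exd ?k + r * (\<Sum>i\<in>UNIV. b i)" .
    obtain c where c: "TT j b - scl c (zj j (r * (\<Sum>i\<in>UNIV. b i))) \<in> J" using TT_mod_J[of b j] by (auto simp: b_def)
    have "GG ?k j * (TT j b - scl c (zj j (r * (\<Sum>i\<in>UNIV. b i)))) \<in> J"
      by (rule xidealD(3)[OF J_xideal(1) c GG_x_polys])
    then have m: "GG ?k j * TT j b - scl c (GG ?k j * zj j (r * (\<Sum>i\<in>UNIV. b i))) \<in> J"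
      by (simp only: right_diff_distrib scl_mult_right)
    have "GG ?k j * zj j (r * (\<Sum>i\<in>UNIV. b i)) \<in> YY j (\<Sum>i\<in>UNIV. a i)"
    proof (cases "(\<Sum>i\<in>UNIV. b i) = 0")
      case True
      have "zj j (r * (\<Sum>i\<in>UNIV. b i)) = 1" unfolding True zj_def mult_0_right if_cancel by (rule xm_zero)
      moreover have "GG ?k j \<in> YY j (\<Sum>i\<in>UNIV. a i)" by (rule GG_YY) (use n_pos True sa in simp_all)
      ultimately show ?thesis by simp
    next
      case False
      \<comment> \<open>With a positive power of z_j every exponent is at least s: at
        \<open>j\<close> because of the factor x_j^r, elsewhere because r - s is at least s. So the
        product lies in J.\<close>
      have "s * 2 \<le> r" using sr by (intro twice_s_le) simp
      then have rs: "s \<le> r - s" by linarith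
      have "r * 1 \<le> r * (\<Sum>i\<in>UNIV. b i)" using False by (intro mult_le_mono2) linarith
      then have "s \<le> r * (\<Sum>i\<in>UNIV. b i)" using sr by linarith
      then show ?thesis unfolding GG_def zj_def xm_mult
        by (intro J_YY xm_in_J_q) (use rs in \<open>auto simp: gex_def\<close>)
    qed
    then have "scl c (GG ?k j * zj j (r * (\<Sum>i\<in>UNIV. b i))) \<in> YY j (\<Sum>i\<in>UNIV. a i)"
      by (rule lin_subspaceD(3)[OF YY_subspace])
    then show ?thesis unfolding avg by (rule YY_mod[OF m])
  qed
qed

lemma inv_stab: assumes "\<pi> \<in> stab j" shows "finv \<pi> permutes UNIV" "finv \<pi> j = j" "finv (finv \<pi>) = \<pi>"
  using assms permutes_inv[of \<pi> UNIV] permutes_inv_inv[of \<pi> UNIV] permutes_inv_eq[of \<pi> UNIV j j] by (auto simp: stab_def)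

text \<open>Semi-invariance is given only modulo J. The monomials of wrong weight are discarded
  first, which changes \<open>g\<close> by an element of J; the rest agrees modulo J with its
  average over the stabilizer of \<open>j\<close>.\<close>

lemma semi_invariant_YY:
  assumes g: "g \<in> x_polys" "\<And>x. x \<in> Poly_Mapping.keys g \<Longrightarrow> tdeg x = d"
    and inv: "\<And>\<sigma> \<eta>. G_data r p \<sigma> \<eta> \<Longrightarrow> \<sigma> j = j \<Longrightarrow> pact \<sigma> \<eta> g - scl (\<eta> j ^ (s + eps)) g \<in> J"
  shows "g \<in> YY j d"
proof -
  note sJ = lin_subspaceD[OF J_subspace]
  define g' where "g' = restr (\<lambda>x. adm j (xe x)) g"
  have g'x: "g' \<in> x_polys" unfolding g'_def by (rule restr_x_polys[OF g(1)])
  have exps: "(\<Prod>i\<in>UNIV. \<eta> i ^ m i) = (\<Prod>i\<in>UNIV. \<eta> i ^ eps) * (\<Prod>i\<in>UNIV. \<eta> i ^ xe x i)"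
    if x: "x \<in> Poly_Mapping.keys g" "Q (gen x) m \<noteq> 0" and G: "G_data r p id \<eta>" for x m \<eta>
  proof -
    have "ye x = (\<lambda>_. 0)" using g(1) x(1) by (auto simp: x_polys_iff)
    then have q: "qq (xe x) (\<lambda>_. 0) m \<noteq> 0" using x(2) by (simp add: Q_gen)
    then have le: "\<forall>i. xe x i \<le> m i" and vn: "v (\<lambda>i. m i - xe x i + 0) \<noteq> 0"
      by (auto simp: qq_def split: if_splits)
    obtain \<pi> where \<pi>: "\<pi> permutes UNIV" "\<And>i. m i - xe x i + 0 = eps + r * idx (\<pi> i)" using v_nonzeroE[OF vn] by blast
    have "\<eta> i ^ m i = \<eta> i ^ eps * \<eta> i ^ xe x i" for i
    proof -
      have "m i = eps + r * idx (\<pi> i) + xe x i" using \<pi>(2)[of i] le[rule_format, of i] by linarith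
      moreover have "\<eta> i ^ (r * idx (\<pi> i)) = 1" using G by (simp add: power_mult G_data_def)
      ultimately show ?thesis by (simp add: power_add)
    qed
    then show ?thesis by (simp add: prod.distrib)
  qed
  have Qinv: "(\<Prod>i\<in>UNIV. \<eta> i ^ m i) * Q g m = (\<Prod>i\<in>UNIV. \<eta> i ^ eps) * \<eta> j ^ (s + eps) * Q g m"
    if G: "G_data r p id \<eta>" for \<eta> m
  proof -
    have \<sigma>: "id permutes (UNIV :: 'n set)" and \<eta>: "\<And>i. \<eta> i ^ r = 1" using G by (auto simp: G_data_def)
    have "Q (pact id \<eta> g - scl (\<eta> j ^ (s + eps)) g) m = 0" using inv[OF G] by (intro J_annihilates) simp
    then have "Q (pact id \<eta> g) m = \<eta> j ^ (s + eps) * Q g m" by (simp add: Q_diff Q_scl)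
    then show ?thesis using U_Q[OF \<sigma> \<eta>, where f = g and m = m] by (simp add: Uop_def chi_def sign_id)
  qed
  \<comment> \<open>At exponents \<open>m\<close> of the right weight the discarded monomials do not
    contribute. At the other \<open>m\<close> semi-invariance forces \<open>Q g m = 0\<close>, and
    the retained monomials do not contribute.\<close>
  have "Q g' m = Q g m" for m
  proof (cases "\<forall>\<eta>. G_data r p id \<eta> \<longrightarrow> (\<Prod>i\<in>UNIV. \<eta> i ^ m i) = (\<Prod>i\<in>UNIV. \<eta> i ^ eps) * \<eta> j ^ (s + eps)")
    case True
    show ?thesis unfolding g'_def
    proof (rule functional_eqI[where T = "\<lambda>f. Q (restr (\<lambda>x. adm j (xe x)) f) m" and T' = "\<lambda>f. Q f m"])
      fix x assume x: "x \<in> Poly_Mapping.keys g"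
      show "Q (restr (\<lambda>x. adm j (xe x)) (gen x)) m = Q (gen x) m"
      proof (cases "Q (gen x) m = 0")
        case False
        have "(\<Prod>i\<in>UNIV. \<eta> i ^ xe x i) = \<eta> j ^ (s + eps)" if G: "G_data r p id \<eta>" for \<eta>
        proof -
          have "(\<Prod>i\<in>UNIV. \<eta> i ^ eps) \<noteq> 0" using G_data_nonzero[OF G] r_gt_1 by simp
          moreover have "(\<Prod>i\<in>UNIV. \<eta> i ^ eps) * (\<Prod>i\<in>UNIV. \<eta> i ^ xe x i) = (\<Prod>i\<in>UNIV. \<eta> i ^ eps) * \<eta> j ^ (s + eps)"
            by (rule trans[OF exps[OF x False G, symmetric] True[rule_format, OF G]])
          ultimately show ?thesis using mult_left_cancel by blast
        qed
        then have "adm j (xe x)" unfolding adm_def by blast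
        then show ?thesis by (simp add: restr_gen)
      qed (simp add: restr_gen)
    qed (simp_all add: restr_add restr_scl Q_add Q_scl)
  next
    case False
    then obtain \<eta> where G: "G_data r p id \<eta>" and ne: "(\<Prod>i\<in>UNIV. \<eta> i ^ m i) \<noteq> (\<Prod>i\<in>UNIV. \<eta> i ^ eps) * \<eta> j ^ (s + eps)" by blast
    have Qg: "Q g m = 0" using Qinv[OF G, of m] ne by simp
    have "Q g' m = 0" unfolding g'_def
    proof (rule functional_eqI[where T = "\<lambda>f. Q (restr (\<lambda>x. adm j (xe x)) f) m" and T' = "\<lambda>f. 0"])
      fix x assume x: "x \<in> Poly_Mapping.keys g"
      show "Q (restr (\<lambda>x. adm j (xe x)) (gen x)) m = 0"
      proof (cases "adm j (xe x) \<and> Q (gen x) m \<noteq> 0")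
        case True
        then have "(\<Prod>i\<in>UNIV. \<eta> i ^ xe x i) = \<eta> j ^ (s + eps)" using G unfolding adm_def by blast
        then show ?thesis using exps[OF x _ G, of m] True ne by simp
      qed (auto simp: restr_gen)
    qed (simp_all add: restr_add restr_scl Q_add Q_scl)
    then show ?thesis using Qg by simp
  qed
  then have gg': "g - g' \<in> J"
    using lin_subspaceD(5)[OF x_polys_subspace g(1) g'x] by (intro J_I) (simp_all add: Q_diff)
  have near: "pact (finv \<pi>) (\<lambda>_. 1) g' - g' \<in> J" if \<pi>: "\<pi> \<in> stab j" for \<pi>
  proof -
    have G: "G_data r p (finv \<pi>) (\<lambda>_. 1)" by (rule G_data_perm[OF inv_stab(1)[OF \<pi>]])
    have 1: "pact (finv \<pi>) (\<lambda>_. 1) g - g \<in> J" using inv[OF G inv_stab(2)[OF \<pi>]] by (simp add: scl_one)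
    have "(pact (finv \<pi>) (\<lambda>_. 1) g - g) - pact (finv \<pi>) (\<lambda>_. 1) (g - g') + (g - g') \<in> J"
      by (rule sJ(2)[OF sJ(5)[OF 1 J_pact[OF G gg']] gg'])
    then show ?thesis by (simp add: pact_diff)
  qed
  \<comment> \<open>Each translate of \<open>g'\<close> equals \<open>g'\<close> modulo J, so the
    sum of the translates is \<open>g'\<close> times the order of the stabilizer.\<close>
  have "(\<Sum>\<pi>\<in>stab j. g' - pact (finv \<pi>) (\<lambda>_. 1) g') \<in> J"
  proof (rule sJ(6))
    fix \<pi> assume "\<pi> \<in> stab j"
    from sJ(4)[OF near[OF this]] show "g' - pact (finv \<pi>) (\<lambda>_. 1) g' \<in> J" by simp
  qed
  then have "scl (of_nat (card (stab j))) g' - (\<Sum>\<pi>\<in>stab j. pact (finv \<pi>) (\<lambda>_. 1) g') \<in> J"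
    unfolding sum_subtractf sum_const_scl .
  moreover have "(\<Sum>\<pi>\<in>stab j. pact (finv \<pi>) (\<lambda>_. 1) g') \<in> YY j d"
  proof -
    let ?Z = "{f. (\<Sum>\<pi>\<in>stab j. pact (finv \<pi>) (\<lambda>_. 1) f) \<in> YY j d}"
    have Z: "lin_subspace ?Z"
      unfolding lin_subspace_def
      by (auto simp: pact_add pact_scl sum.distrib scl_sum[symmetric] intro: lin_subspaceD(1-3)[OF YY_subspace])
    have "g' \<in> ?Z"
    proof (rule lin_subspace_keys_in[OF Z])
      fix x assume "x \<in> Poly_Mapping.keys g'"
      then have x: "adm j (xe x)" "x \<in> Poly_Mapping.keys g" by (auto simp: g'_def keys_restr)
      have gx: "gen x = xm (xe x)" by (rule x_polys_mono_eq[OF x(2) g(1)])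
      have "ye x i = 0" for i using g(1) x(2) by (auto simp: x_polys_iff)
      then have dx: "(\<Sum>i\<in>UNIV. xe x i) = d" using g(2)[OF x(2)] by (simp add: tdeg_def)
      have "pact (finv \<pi>) (\<lambda>_. 1) (gen x) = xm (\<lambda>i. xe x (\<pi> i))" if "\<pi> \<in> stab j" for \<pi>
        unfolding gx pact_xm inv_stab(3)[OF that] by (simp add: scl_one)
      then have "(\<Sum>\<pi>\<in>stab j. pact (finv \<pi>) (\<lambda>_. 1) (gen x)) = (\<Sum>\<pi>\<in>stab j. xm (\<lambda>i. xe x (\<pi> i)))"
        by (rule sum.cong[OF refl])
      then show "gen x \<in> ?Z" using average_YY[OF x(1)] unfolding dx by simp
    qed
    then show ?thesis by simp
  qed
  ultimately have "scl (of_nat (card (stab j))) g' \<in> YY j d" by (rule YY_mod)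
  moreover have "of_nat (card (stab j)) \<noteq> (0::complex)" using card_stab[of j] unfolding of_nat_eq_0_iff by linarith
  ultimately have "g' \<in> YY j d" using scl_cancel[OF YY_subspace] by blast
  then show ?thesis by (rule YY_mod[OF gg'])
qed

text \<open>For each k a monomial of A is exhibited to which only the k-th candidate contributes
  after multiplication with v. The degrees \<open>exd\<close> are distinct for k < n - 1, so the
  only possible collision is with the last candidate, and residues modulo r settle it.\<close>

lemma gg_independent:
  assumes c: "c \<in> supported (Kd d)" and g: "gg c j \<in> J" shows "c = (\<lambda>_. 0)"
proof -
  let ?n = "CARD('n)"
  have Q0: "(\<Sum>k<?n. c k * qq (gex k j) (\<lambda>_. 0) m) = 0" for m
    using J_annihilates[OF g, of m] unfolding gg_def GG_def Q_sum Q_scl Q_xm .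
  obtain i0 where i0: "idx i0 = 0" using idx n_pos by (metis bij_betw_iff_bijections lessThan_iff)
  obtain i1 where i1: "idx i1 = ?n - 1" using idx n_pos by (metis bij_betw_iff_bijections diff_less lessThan_iff zero_less_one)
  define base where "base \<pi> i = eps + r * idx (\<pi> i)" for \<pi> :: "'n \<Rightarrow> 'n" and i
  have qbase: "qq (gex k j) (\<lambda>_. 0) (\<lambda>i. gex k j i + base \<pi> i) \<noteq> 0"
    if \<pi>: "\<pi> permutes UNIV" and le: "\<And>i. gex k j i + base \<pi> i \<le> h" for k \<pi>
  proof -
    have "v (base \<pi>) = of_int (sign \<pi>) * v (\<lambda>i. eps + r * idx i)"
      using v_permute[OF \<pi>, of "\<lambda>i. eps + r * idx i"] by (simp add: base_def[abs_def])
    then have "v (base \<pi>) \<noteq> 0" by (simp add: v_base sign_def)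
    moreover have "Lf t 0 = 1" for t by (simp add: Lf_def)
    ultimately show ?thesis using le by (simp add: qq_def)
  qed
  have resid: "m i mod r = (gex k j i + eps) mod r" if q: "qq (gex k j) (\<lambda>_. 0) m \<noteq> 0" for k m i
  proof -
    have le: "\<forall>i. gex k j i \<le> m i" and vn: "v (\<lambda>i. m i - gex k j i + 0) \<noteq> 0"
      using q by (auto simp: qq_def split: if_splits)
    obtain \<pi> where \<pi>: "\<pi> permutes UNIV" "\<And>i. m i - gex k j i + 0 = eps + r * idx (\<pi> i)" using v_nonzeroE[OF vn] by blast
    have "m i = gex k j i + eps + r * idx (\<pi> i)" using \<pi>(2)[of i] le[rule_format, of i] by linarith
    then show ?thesis by simp
  qed
  have exd_inj: "k = k'" if "k < ?n - 1" "k' < ?n - 1" "exd k = exd k'" for k k'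
    using that r_gt_1 by (simp add: exd_def)
  \<comment> \<open>Chosen to keep the product within the bound h: the power of x_j is multiplied
    with a term of v that is smallest at \<open>j\<close>, the last candidate with a term that is
    largest at \<open>j\<close> and hence smaller elsewhere.\<close>
  define wit where "wit k = (if k < ?n - 1 then Transposition.transpose j i0 else Transposition.transpose j i1)" for k
  have wit: "wit k permutes UNIV" "wit k j = (if k < ?n - 1 then i0 else i1)" for k
    unfolding wit_def by (auto intro: permutes_swap_id)
  have inj: "idx (wit k i) \<noteq> idx (wit k j)" if "i \<noteq> j" for k i
    using that permutes_inj[OF wit(1)] by (simp add: idx_inj inj_eq)
  have le: "gex k j i + base (wit k) i \<le> h" for k i
  proof (cases "k < ?n - 1")
    case True
    show ?thesis
    proof (cases "i = j")
      case i: True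
      have "k * r + r \<le> (?n - 1) * r" using True by (metis Suc_leI add.commute mult_Suc mult_le_mono1)
      then have "k * r + r \<le> r * (?n - 1)" by (simp add: mult.commute)
      then have "s + eps + k * r + eps \<le> h" using h_eq eps_less_r by linarith
      then show ?thesis using i True wit(2)[of k] by (simp add: gex_def base_def i0)
    next
      case False
      then show ?thesis using True base_le_h[of "wit k i"] by (simp add: gex_def base_def)
    qed
  next
    case False
    show ?thesis
    proof (cases "i = j")
      case i: True
      have "eps + (eps + r * (?n - 1)) \<le> h" using h_eq eps_less by linarith
      then show ?thesis using i False wit(2)[of k] by (simp add: gex_def base_def i1)
    next
      case i: False
      have "idx (wit k i) < ?n - 1" using inj[OF i, of k] idx_less[of "wit k i"] False wit(2)[of k] i1 by auto
      then have "r * Suc (idx (wit k i)) \<le> r * (?n - 1)" by (intro mult_le_mono2) simp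
      then have "r - s + (eps + r * idx (wit k i)) \<le> h" using h_eq s_le s_pos by simp
      then show ?thesis using i False by (simp add: gex_def base_def)
    qed
  qed
  have main: "c k = 0" if k: "k \<in> Kd d" and other: "\<And>k'. k' \<in> Kd d \<Longrightarrow> k' \<noteq> k \<Longrightarrow> c k' * qq (gex k' j) (\<lambda>_. 0) (\<lambda>i. gex k j i + base (wit k) i) = 0" for k
  proof -
    have "(\<Sum>l<?n. c l * qq (gex l j) (\<lambda>_. 0) (\<lambda>i. gex k j i + base (wit k) i))
        = (\<Sum>l\<in>{k}. c l * qq (gex l j) (\<lambda>_. 0) (\<lambda>i. gex k j i + base (wit k) i))"
      by (rule sum.mono_neutral_right) (use k other supportedD[OF c] in \<open>auto simp: Kd_def\<close>)
    then show ?thesis using Q0 qbase[OF wit(1) le, of k] by simp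
  qed
  have last: "k = ?n - 1" if k: "k \<in> Kd d" "\<not> k < ?n - 1" for k
  proof -
    have "k < ?n" using k(1) by (simp add: Kd_def)
    then show ?thesis using k(2) by linarith
  qed
  have "c k = 0" if k: "k \<in> Kd d" for k
  proof (rule main[OF k])
    fix k' assume k': "k' \<in> Kd d" "k' \<noteq> k"
    have "qq (gex k' j) (\<lambda>_. 0) (\<lambda>i. gex k j i + base (wit k) i) = 0"
    proof (rule ccontr)
      assume q: "qq (gex k' j) (\<lambda>_. 0) (\<lambda>i. gex k j i + base (wit k) i) \<noteq> 0"
      have ex: "exd k = exd k'" using k k' by (simp add: Kd_def)
      have mixed: "(k < ?n - 1) \<noteq> (k' < ?n - 1)"
        using exd_inj[of k k'] last[OF k] last[OF k'(1)] ex k'(2) by metis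
      then have "1 < ?n" by linarith
      then have "card ({j} :: 'n set) < card (UNIV :: 'n set)" by simp
      then obtain l where l: "l \<noteq> j" by (metis UNIV_eq_I less_irrefl singletonI)
      have "(gex k j l + base (wit k) l) mod r = (gex k' j l + eps) mod r" by (rule resid[OF q])
      then have "(gex k j l + eps) mod r = (gex k' j l + eps) mod r" by (simp add: base_def add.assoc[symmetric])
      then have "[gex k j l = gex k' j l] (mod r)" using cong_add_rcancel_nat[of "gex k j l" eps "gex k' j l" r] by (simp add: cong_def)
      \<comment> \<open>Away from \<open>j\<close> the candidates have exponent 0 or r - s, so a
        collision would need s = r. Then the last candidate has degree \<open>eps\<close>, below the
        degrees of all the others.\<close>
      then have "(r - s) mod r = 0" using mixed l by (auto simp: gex_def cong_def split: if_splits)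
      moreover have "r - s < r" using s_pos r_gt_1 by linarith
      ultimately have "s = r" using s_le by simp
      then have small: "exd (?n - 1) = eps" by (simp add: exd_def)
      have "r \<le> exd k''" if "k'' < ?n - 1" for k'' using that \<open>s = r\<close> by (simp add: exd_def)
      then show False using mixed ex small last[OF k] last[OF k'(1)] eps_less_r by (metis not_le)
    qed
    then show "c k' * qq (gex k' j) (\<lambda>_. 0) (\<lambda>i. gex k j i + base (wit k) i) = 0" by simp
  qed
  then show ?thesis using supportedD[OF c] by (intro ext) blast
qed

end

section \<open>The exponents\<close>

text \<open>Coordinates obtained from a linear parametrization, the form in which the space of
  equivariant maps is described.\<close>

lemma coordinatized_inverse:
  fixes M :: "(complex, 'a, 'm) module_scheme" and \<Theta> :: "('i \<Rightarrow> complex) \<Rightarrow> 'a"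
  assumes I: "finite I" and bij: "bij_betw \<Theta> (supported I) (carrier M)"
    and add: "\<And>c c'. c \<in> supported I \<Longrightarrow> c' \<in> supported I \<Longrightarrow> \<Theta> c \<oplus>\<^bsub>M\<^esub> \<Theta> c' = \<Theta> (\<lambda>i. c i + c' i)"
    and smult: "\<And>t c. c \<in> supported I \<Longrightarrow> t \<odot>\<^bsub>M\<^esub> \<Theta> c = \<Theta> (\<lambda>i. t * c i)"
    and zero: "\<zero>\<^bsub>M\<^esub> = \<Theta> (\<lambda>_. 0)"
  shows "coordinatized M I (inv_into (supported I) \<Theta>)"
proof -
  have l: "inv_into (supported I) \<Theta> (\<Theta> c) = c" if "c \<in> supported I" for c
    using bij that by (auto simp: bij_betw_def)
  have m: "\<Theta> c \<in> carrier M" if "c \<in> supported I" for c using bij that by (auto simp: bij_betw_def)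
  have ex: "\<exists>c\<in>supported I. x = \<Theta> c" if "x \<in> carrier M" for x using bij that by (auto simp: bij_betw_def)
  have sa: "(\<lambda>i. c i + c' i) \<in> supported I" if "c \<in> supported I" "c' \<in> supported I" for c c'
    using that by (simp add: supported_def)
  have ss: "(\<lambda>i. t * c i) \<in> supported I" if "c \<in> supported I" for c t using that by (simp add: supported_def)
  have sz: "(\<lambda>_. 0) \<in> supported I" by (simp add: supported_def)
  show ?thesis
  proof
    show "finite I" by (rule I)
    show "bij_betw (inv_into (supported I) \<Theta>) (carrier M) (supported I)" by (rule bij_betw_inv_into[OF bij])
    show "\<zero>\<^bsub>M\<^esub> \<in> carrier M" unfolding zero by (rule m[OF sz])
    show "inv_into (supported I) \<Theta> \<zero>\<^bsub>M\<^esub> = (\<lambda>_. 0)" unfolding zero by (rule l[OF sz])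
    fix x assume "x \<in> carrier M"
    then obtain c where c: "c \<in> supported I" "x = \<Theta> c" using ex by blast
    show "t \<odot>\<^bsub>M\<^esub> x \<in> carrier M" for t unfolding c(2) smult[OF c(1)] by (rule m[OF ss[OF c(1)]])
    show "inv_into (supported I) \<Theta> (t \<odot>\<^bsub>M\<^esub> x) = (\<lambda>i. t * inv_into (supported I) \<Theta> x i)" for t
      unfolding c(2) smult[OF c(1)] l[OF ss[OF c(1)]] l[OF c(1)] ..
    fix y assume "y \<in> carrier M"
    then obtain c' where c': "c' \<in> supported I" "y = \<Theta> c'" using ex by blast
    show "x \<oplus>\<^bsub>M\<^esub> y \<in> carrier M" unfolding c(2) c'(2) add[OF c(1) c'(1)] by (rule m[OF sa[OF c(1) c'(1)]])
    show "inv_into (supported I) \<Theta> (x \<oplus>\<^bsub>M\<^esub> y) = (\<lambda>i. inv_into (supported I) \<Theta> x i + inv_into (supported I) \<Theta> y i)"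
      unfolding c(2) c'(2) add[OF c(1) c'(1)] l[OF sa[OF c(1) c'(1)]] l[OF c(1)] l[OF c'(1)] ..
  qed
qed

lemma poly_alg_fields:
  "carrier (poly_alg :: (complex^'n^'n, 'n::finite bipoly) grep) = UNIV" "add (poly_alg :: (complex^'n^'n, 'n bipoly) grep) = (+)"
  "zero (poly_alg :: (complex^'n^'n, 'n bipoly) grep) = 0" "smult (poly_alg :: (complex^'n^'n, 'n bipoly) grep) = scl"
  by (simp_all add: poly_alg_def Const_mult fun_eq_iff)

lemma power_rep_fields:
  "add (power_rep k :: (complex^'n^'n, 'n::finite bipoly) grep) = (+)" "zero (power_rep k :: (complex^'n^'n, 'n bipoly) grep) = 0"
  "smult (power_rep k :: (complex^'n^'n, 'n bipoly) grep) = scl" "act (power_rep k :: (complex^'n^'n, 'n bipoly) grep) w = subst (var_act w)"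
  by (simp_all add: power_rep_def sub_grep_def poly_alg_def Const_mult fun_eq_iff)

definition pw :: "nat \<Rightarrow> 'n::finite \<Rightarrow> 'n bimon" where "pw k i = Poly_Mapping.single (Inl i) k"

lemma pw_eq_iff: "k > 0 \<Longrightarrow> pw k i = pw k j \<longleftrightarrow> i = j"
  unfolding pw_def by (metis lookup_single_eq lookup_single_not_eq neq0_conv sum.inject(1))

lemma Var_power_pw: "Var (Inl i) ^ k = gen (pw k i)"
  by (simp add: Var_power pw_def)

lemma power_rep_carrier:
  "carrier (power_rep k :: (complex^'n^'n, 'n::finite bipoly) grep) = {f. Poly_Mapping.keys f \<subseteq> range (pw k)}"
proof -
  have U: "lin_subspace (UNIV :: 'n bipoly set)" by (simp add: lin_subspace_def)
  note sp = lin_span_props[where R = "range (\<lambda>i :: 'n. Var (Inl i) ^ k)", OF poly_alg_fields U subset_UNIV]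
  have "lin_span poly_alg (range (\<lambda>i :: 'n. Var (Inl i) ^ k)) = {f :: 'n bipoly. Poly_Mapping.keys f \<subseteq> range (pw k)}"
  proof (intro equalityI subsetI)
    have "lin_span poly_alg (range (\<lambda>i :: 'n. Var (Inl i) ^ k)) \<subseteq> {f :: 'n bipoly. Poly_Mapping.keys f \<subseteq> range (pw k)}"
      by (rule sp(4)[OF lin_subspace_keys]) (auto simp: Var_power_pw)
    then show "f \<in> {f. Poly_Mapping.keys f \<subseteq> range (pw k)}" if h: "f \<in> lin_span poly_alg (range (\<lambda>i :: 'n. Var (Inl i) ^ k))" for f
      using h by blast
    fix f :: "'n bipoly" assume f: "f \<in> {f. Poly_Mapping.keys f \<subseteq> range (pw k)}"
    show "f \<in> lin_span poly_alg (range (\<lambda>i :: 'n. Var (Inl i) ^ k))"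
    proof (rule lin_subspace_keys_in[OF sp(1)])
      fix x assume "x \<in> Poly_Mapping.keys f"
      then obtain i where "x = pw k i" using f by auto
      then have "gen x \<in> range (\<lambda>i :: 'n. Var (Inl i) ^ k)" by (simp add: Var_power_pw[symmetric])
      then show "gen x \<in> lin_span poly_alg (range (\<lambda>i :: 'n. Var (Inl i) ^ k))" by (rule subsetD[OF sp(3)])
    qed
  qed
  then show ?thesis by (simp add: power_rep_def sub_grep_def)
qed

lemma power_rep_coordinatized:
  assumes k: "k > 0"
  shows "coordinatized (power_rep k :: (complex^'n^'n, 'n::finite bipoly) grep) UNIV (\<lambda>f i. Poly_Mapping.lookup f (pw k i))"
proof
  let ?g = "\<lambda>c. \<Sum>i\<in>UNIV. Poly_Mapping.single (pw k i) (c i) :: 'n bipoly"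
  have lg: "Poly_Mapping.lookup (?g c) (pw k i) = c i" for c i
    by (simp add: lookup_sum lookup_single when_def pw_eq_iff[OF k])
  have lo: "Poly_Mapping.lookup (?g c) m = 0" if "m \<notin> range (pw k)" for c m
    unfolding lookup_sum using that by (intro sum.neutral) (auto simp: lookup_single when_def)
  show "finite (UNIV :: 'n set)" by simp
  show "bij_betw (\<lambda>f i. Poly_Mapping.lookup f (pw k i)) (carrier (power_rep k :: (complex^'n^'n, 'n bipoly) grep)) (supported UNIV)"
  proof (rule bij_betwI[where g = ?g])
    show "?g \<in> supported UNIV \<rightarrow> carrier (power_rep k :: (complex^'n^'n, 'n bipoly) grep)"
      unfolding power_rep_carrier using lo by (auto simp: in_keys_iff)
    show "?g (\<lambda>i. Poly_Mapping.lookup f (pw k i)) = f" if "f \<in> carrier (power_rep k :: (complex^'n^'n, 'n bipoly) grep)" for f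
    proof (rule poly_mapping_eqI)
      fix m
      show "Poly_Mapping.lookup (?g (\<lambda>i. Poly_Mapping.lookup f (pw k i))) m = Poly_Mapping.lookup f m"
      proof (cases "m \<in> range (pw k)")
        case True
        then obtain i where m: "m = pw k i" by blast
        show ?thesis unfolding m by (rule lg)
      next
        case False
        then have "m \<notin> Poly_Mapping.keys f" using that unfolding power_rep_carrier by blast
        then show ?thesis using lo[OF False] by (simp add: in_keys_iff)
      qed
    qed
  qed (use lg in \<open>auto simp: supported_def\<close>)
  have S: "lin_subspace (carrier (power_rep k :: (complex^'n^'n, 'n bipoly) grep))"
    unfolding power_rep_carrier by (rule lin_subspace_keys)
  note S' = lin_subspaceD[OF S]
  show "\<zero>\<^bsub>power_rep k :: (complex^'n^'n, 'n bipoly) grep\<^esub> \<in> carrier (power_rep k)" using S'(1) by (simp add: power_rep_fields)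
  show "x \<oplus>\<^bsub>power_rep k :: (complex^'n^'n, 'n bipoly) grep\<^esub> y \<in> carrier (power_rep k)"
    if "x \<in> carrier (power_rep k :: (complex^'n^'n, 'n bipoly) grep)" "y \<in> carrier (power_rep k :: (complex^'n^'n, 'n bipoly) grep)" for x y
    unfolding power_rep_fields using S'(2) that by blast
  show "c \<odot>\<^bsub>power_rep k :: (complex^'n^'n, 'n bipoly) grep\<^esub> x \<in> carrier (power_rep k)"
    if "x \<in> carrier (power_rep k :: (complex^'n^'n, 'n bipoly) grep)" for x c
    unfolding power_rep_fields using S'(3) that by blast
qed (simp_all add: power_rep_fields lookup_add)

section \<open>Equivariant maps from V to the coinvariants\<close>

context coinv_model
begin

lemma gen_pw: "gen (pw k i) = xm (\<lambda>l. if l = i then k else 0)"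
  by (simp add: pw_def single_Inl xm_def)

lemma pact_pw:
  assumes "\<sigma> permutes UNIV" shows "pact \<sigma> \<eta> (gen (pw k i)) = scl (\<eta> i ^ k) (gen (pw k (\<sigma> i)))"
proof -
  have "(\<Prod>l\<in>UNIV. \<eta> l ^ (if l = i then k else 0)) = (\<Prod>l\<in>{i}. \<eta> l ^ (if l = i then k else 0))"
    by (rule prod.mono_neutral_right) auto
  moreover have "finv \<sigma> l = i \<longleftrightarrow> l = \<sigma> i" for l using permutes_inv_eq[OF assms, of l i] by auto
  ultimately show ?thesis unfolding gen_pw pact_xm by simp
qed

definition cJ :: "'n bipoly \<Rightarrow> 'n bipoly set"
  where "cJ f = (\<lambda>f. f) ` J +>\<^bsub>x_alg :: (complex^'n^'n, 'n bipoly) grep\<^esub> f"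

lemma coinv_eq: "coinv (G_group r p) = quot_grep (x_alg :: (complex^'n^'n, 'n bipoly) grep) ((\<lambda>f. f) ` J)"
  unfolding coinv_def J_def by (simp only: image_ident)

lemma coinv_presented:
  "presented_alg (coinv (G_group r p :: (complex^'n^'n) set)) x_polys cJ J (\<lambda>w. subst (var_act w)) (G_group r p)"
proof -
  interpret xa: presented_alg "x_alg :: (complex^'n^'n, 'n bipoly) grep" x_polys "\<lambda>f. f" "{0}" "\<lambda>w. subst (var_act w)" "G_group r p"
    by (rule x_alg_presented) (use r_gt_1 in simp)
  show ?thesis unfolding coinv_eq cJ_def[abs_def]
  proof (rule xa.presented_alg_quot)
    show "lin_subspace J" by (rule J_subspace)
    show "J \<subseteq> x_polys" by (rule J_xideal(2))
    show "{0} \<subseteq> J" using lin_subspaceD(1)[OF J_subspace] by simp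
    fix f :: "'n bipoly" assume f: "f \<in> J"
    show "f * g \<in> J" if "g \<in> x_polys" for g by (rule xidealD(2)[OF J_xideal(1) f that])
    fix w :: "complex^'n^'n" assume "w \<in> G_group r p"
    then obtain \<sigma> \<eta> where G: "G_data r p \<sigma> \<eta>" "w = wmat \<sigma> \<eta>" by (rule G_groupE)
    show "subst (var_act w) f \<in> J" unfolding G(2) act_pact[OF G(1)] by (rule J_pact[OF G(1) f])
  qed
qed

sublocale co: presented_alg "coinv (G_group r p :: (complex^'n^'n) set)" x_polys cJ J "\<lambda>w. subst (var_act w)" "G_group r p"
  by (rule coinv_presented)

lemma gr_coinv: "gr (coinv (G_group r p)) d = cJ ` gr (x_alg :: (complex^'n^'n, 'n bipoly) grep) d"
  unfolding coinv_eq gr_quot_grep cJ_def ..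

lemma gr_x_subspace: "lin_subspace (gr (x_alg :: (complex^'n^'n, 'n bipoly) grep) d)"
proof -
  have "gr (x_alg :: (complex^'n^'n, 'n bipoly) grep) d = x_polys \<inter> {f. Poly_Mapping.keys f \<subseteq> {x. mon_deg x = d}}"
    unfolding gr_x_alg by auto
  moreover have "lin_subspace (A \<inter> B)" if "lin_subspace A" "lin_subspace B" for A B :: "'n bipoly set"
    using that by (auto simp: lin_subspace_def)
  ultimately show ?thesis using x_polys_subspace lin_subspace_keys by metis
qed

definition Vh :: "(complex^'n^'n, 'n bipoly) grep" where "Vh = power_rep (Suc h)"

lemma Vh_carrier: "carrier Vh = {f. Poly_Mapping.keys f \<subseteq> range (pw (Suc h))}"
  unfolding Vh_def by (rule power_rep_carrier)

lemmas Vh_fields = power_rep_fields[where k = "Suc h", where 'n = 'n, folded Vh_def]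

lemma Vh_subspace: "lin_subspace (carrier Vh)"
  unfolding Vh_carrier by (rule lin_subspace_keys)

lemma pact_Vh:
  assumes G: "G_data r p \<sigma> \<eta>" and f: "f \<in> carrier Vh" shows "pact \<sigma> \<eta> f \<in> carrier Vh"
proof -
  have \<sigma>: "\<sigma> permutes UNIV" using G by (simp add: G_data_def)
  let ?Z = "{f. pact \<sigma> \<eta> f \<in> carrier Vh}"
  have Z: "lin_subspace ?Z"
    unfolding lin_subspace_def by (auto simp: pact_add pact_scl intro: lin_subspaceD(1-3)[OF Vh_subspace])
  have "f \<in> ?Z"
  proof (rule lin_subspace_keys_in[OF Z])
    fix x assume "x \<in> Poly_Mapping.keys f"
    then obtain i where x: "x = pw (Suc h) i" using f by (auto simp: Vh_carrier)
    have "gen (pw (Suc h) (\<sigma> i)) \<in> carrier Vh" by (simp add: Vh_carrier)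
    then have "pact \<sigma> \<eta> (gen x) \<in> carrier Vh" unfolding x pact_pw[OF \<sigma>] by (rule lin_subspaceD(3)[OF Vh_subspace])
    then show "gen x \<in> ?Z" by simp
  qed
  then show ?thesis by simp
qed

text \<open>The linear map from V to polynomials that takes x_i^(h+1) to \<open>gg c i\<close>,
  defined on all polynomials by reading off the coefficients of these powers.\<close>

definition Tc :: "(nat \<Rightarrow> complex) \<Rightarrow> 'n bipoly \<Rightarrow> 'n bipoly"
  where "Tc c f = (\<Sum>i\<in>UNIV. scl (Poly_Mapping.lookup f (pw (Suc h) i)) (gg c i))"

lemma Tc_add: "Tc c (f + g) = Tc c f + Tc c g"
  by (simp add: Tc_def lookup_add scl_left_add sum.distrib)

lemma Tc_scl: "Tc c (scl t f) = scl t (Tc c f)"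
  unfolding Tc_def scl_sum scl_scl lookup_scl ..

lemma Tc_gen: "Tc c (gen (pw (Suc h) i)) = gg c i"
proof -
  have "Tc c (gen (pw (Suc h) i)) = (\<Sum>l\<in>{i}. scl (Poly_Mapping.lookup (gen (pw (Suc h) i)) (pw (Suc h) l)) (gg c l))"
    unfolding Tc_def by (rule sum.mono_neutral_right) (auto simp: lookup_single when_def pw_eq_iff scl_zero_left)
  then show ?thesis by (simp add: scl_one)
qed

lemma Tc_param_add: "Tc (\<lambda>k. c k + c' k) f = Tc c f + Tc c' f"
  unfolding Tc_def gg_add scl_add sum.distrib ..

lemma Tc_param_scl: "Tc (\<lambda>k. t * c k) f = scl t (Tc c f)"
  unfolding Tc_def gg_scl scl_sum scl_scl by (simp only: mult.commute)

lemma Tc_param_zero: "Tc (\<lambda>_. 0) f = 0"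
  unfolding Tc_def gg_zero by simp

lemma gg_gr: assumes "c \<in> supported (Kd d)" shows "gg c j \<in> gr (x_alg :: (complex^'n^'n, 'n bipoly) grep) (int d)"
  unfolding gg_def
proof (rule lin_subspaceD(6)[OF gr_x_subspace])
  fix k assume k: "k \<in> {..<CARD('n)}"
  show "scl (c k) (GG k j) \<in> gr (x_alg :: (complex^'n^'n, 'n bipoly) grep) (int d)"
  proof (cases "k \<in> Kd d")
    case True
    then have "GG k j \<in> gr (x_alg :: (complex^'n^'n, 'n bipoly) grep) (int d)"
      using GG_x_polys GG_degree unfolding gr_x_alg Kd_def by blast
    then show ?thesis by (rule lin_subspaceD(3)[OF gr_x_subspace])
  next
    case False
    then show ?thesis using supportedD[OF assms False] lin_subspaceD(1)[OF gr_x_subspace] by (simp add: scl_zero_left)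
  qed
qed

lemma Tc_gr: "c \<in> supported (Kd d) \<Longrightarrow> Tc c f \<in> gr (x_alg :: (complex^'n^'n, 'n bipoly) grep) (int d)"
  unfolding Tc_def by (intro lin_subspaceD(6)[OF gr_x_subspace] lin_subspaceD(3)[OF gr_x_subspace] gg_gr)

lemma Tc_x_polys: "Tc c f \<in> x_polys"
  unfolding Tc_def by (intro lin_subspaceD(6)[OF x_polys_subspace] lin_subspaceD(3)[OF x_polys_subspace] gg_x_polys)

lemma root_power_Suc_h: "\<eta> ^ r = 1 \<Longrightarrow> \<eta> ^ Suc h = (\<eta> :: complex) ^ (s + eps)"
  unfolding h_eq by (simp add: power_add power_mult)

lemma Tc_pact:
  assumes G: "G_data r p \<sigma> \<eta>" and f: "f \<in> carrier Vh" shows "Tc c (pact \<sigma> \<eta> f) = pact \<sigma> \<eta> (Tc c f)"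
proof (rule linear_eqI[where T = "\<lambda>f. Tc c (pact \<sigma> \<eta> f)" and T' = "\<lambda>f. pact \<sigma> \<eta> (Tc c f)"])
  fix x assume "x \<in> Poly_Mapping.keys f"
  then obtain i where x: "x = pw (Suc h) i" using f by (auto simp: Vh_carrier)
  have \<sigma>: "\<sigma> permutes UNIV" and \<eta>: "\<eta> i ^ r = 1" using G by (auto simp: G_data_def)
  show "Tc c (pact \<sigma> \<eta> (gen x)) = pact \<sigma> \<eta> (Tc c (gen x))"
    unfolding x pact_pw[OF \<sigma>] Tc_scl Tc_gen gg_pact[OF G] root_power_Suc_h[OF \<eta>] ..
qed (simp_all only: Tc_add Tc_scl pact_add pact_scl)

definition Theta :: "(nat \<Rightarrow> complex) \<Rightarrow> 'n bipoly \<Rightarrow> 'n bipoly set"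
  where "Theta c = (\<lambda>f\<in>carrier Vh. cJ (Tc c f))"

definition Hd :: "nat \<Rightarrow> (complex, 'n bipoly \<Rightarrow> 'n bipoly set) module"
  where "Hd d = equiv_hom (G_group r p) Vh (piece (coinv (G_group r p)) (int d))"

lemma Hd_carrier:
  "F \<in> carrier (Hd d) \<longleftrightarrow> F \<in> carrier Vh \<rightarrow>\<^sub>E cJ ` gr (x_alg :: (complex^'n^'n, 'n bipoly) grep) (int d) \<and>
    (\<forall>x\<in>carrier Vh. \<forall>y\<in>carrier Vh. F (x + y) = F x \<oplus>\<^bsub>coinv (G_group r p)\<^esub> F y) \<and>
    (\<forall>c. \<forall>x\<in>carrier Vh. F (scl c x) = c \<odot>\<^bsub>coinv (G_group r p)\<^esub> F x) \<and>
    (\<forall>(\<sigma> :: 'n \<Rightarrow> 'n) \<eta>. G_data r p \<sigma> \<eta> \<longrightarrow> (\<forall>x\<in>carrier Vh. F (pact \<sigma> \<eta> x) = act (coinv (G_group r p)) (wmat \<sigma> \<eta>) (F x)))"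
proof -
  have "(\<forall>w\<in>G_group r p. \<forall>x\<in>carrier Vh. F (subst (var_act w) x) = act (coinv (G_group r p)) w (F x)) \<longleftrightarrow>
    (\<forall>(\<sigma> :: 'n \<Rightarrow> 'n) \<eta>. G_data r p \<sigma> \<eta> \<longrightarrow> (\<forall>x\<in>carrier Vh. F (pact \<sigma> \<eta> x) = act (coinv (G_group r p)) (wmat \<sigma> \<eta>) (F x)))" (is "?A \<longleftrightarrow> ?B")
  proof
    assume A: ?A
    show ?B
    proof (intro allI impI ballI)
      fix \<sigma> :: "'n \<Rightarrow> 'n" and \<eta> x assume G: "G_data r p \<sigma> \<eta>" and x: "x \<in> carrier Vh"
      have "wmat \<sigma> \<eta> \<in> G_group r p" by (rule wmat_mem[OF G]) (use r_gt_1 in simp)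
      then show "F (pact \<sigma> \<eta> x) = act (coinv (G_group r p)) (wmat \<sigma> \<eta>) (F x)"
        using A x unfolding act_pact[OF G, symmetric] by blast
    qed
  next
    assume B: ?B
    show ?A
    proof (intro ballI)
      fix w :: "complex^'n^'n" and x assume w: "w \<in> G_group r p" and x: "x \<in> carrier Vh"
      obtain \<sigma> \<eta> where G: "G_data r p \<sigma> \<eta>" "w = wmat \<sigma> \<eta>" by (rule G_groupE[OF w])
      show "F (subst (var_act w) x) = act (coinv (G_group r p)) w (F x)"
        unfolding G(2) act_pact[OF G(1)] using B G(1) x by blast
    qed
  qed
  then show ?thesis unfolding Hd_def equiv_hom_def by (simp add: piece_def gr_coinv Vh_fields)
qed

lemma Hd_fields:
  "F \<oplus>\<^bsub>Hd d\<^esub> F' = (\<lambda>x\<in>carrier Vh. F x \<oplus>\<^bsub>coinv (G_group r p)\<^esub> F' x)"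
  "c \<odot>\<^bsub>Hd d\<^esub> F = (\<lambda>x\<in>carrier Vh. c \<odot>\<^bsub>coinv (G_group r p)\<^esub> F x)"
  "\<zero>\<^bsub>Hd d\<^esub> = (\<lambda>x\<in>carrier Vh. \<zero>\<^bsub>coinv (G_group r p)\<^esub>)"
  by (simp_all add: Hd_def equiv_hom_def piece_def)

lemma co_act: "G_data r p \<sigma> \<eta> \<Longrightarrow> f \<in> x_polys \<Longrightarrow> act (coinv (G_group r p)) (wmat \<sigma> \<eta>) (cJ f) = cJ (pact \<sigma> \<eta> f)"
  using co.act[OF wmat_mem, of \<sigma> \<eta> f] r_gt_1 by (simp add: act_pact)

lemma Theta_mem: assumes c: "c \<in> supported (Kd d)" shows "Theta c \<in> carrier (Hd d)"
  unfolding Hd_carrier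
proof (intro conjI allI impI ballI)
  show "Theta c \<in> carrier Vh \<rightarrow>\<^sub>E cJ ` gr (x_alg :: (complex^'n^'n, 'n bipoly) grep) (int d)"
    unfolding Theta_def using Tc_gr[OF c] by (intro restrict_PiE_iff[THEN iffD2]) auto
  fix x assume x: "x \<in> carrier Vh"
  show "Theta c (scl t x) = t \<odot>\<^bsub>coinv (G_group r p)\<^esub> Theta c x" for t
    using x lin_subspaceD(3)[OF Vh_subspace x] by (simp add: Theta_def co.smult[OF Tc_x_polys] Tc_scl)
  show "Theta c (pact \<sigma> \<eta> x) = act (coinv (G_group r p)) (wmat \<sigma> \<eta>) (Theta c x)" if G: "G_data r p \<sigma> \<eta>" for \<sigma> :: "'n \<Rightarrow> 'n" and \<eta>
    using x pact_Vh[OF G x] by (simp add: Theta_def co_act[OF G Tc_x_polys] Tc_pact[OF G x])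
  fix y assume y: "y \<in> carrier Vh"
  show "Theta c (x + y) = Theta c x \<oplus>\<^bsub>coinv (G_group r p)\<^esub> Theta c y"
    using x y lin_subspaceD(2)[OF Vh_subspace x y] by (simp add: Theta_def co.add[OF Tc_x_polys Tc_x_polys] Tc_add)
qed

lemma pw_Vh: "gen (pw (Suc h) i) \<in> carrier Vh" by (simp add: Vh_carrier)

lemma Theta_inj: "inj_on Theta (supported (Kd d))"
proof (rule inj_onI)
  fix c c' assume c: "c \<in> supported (Kd d)" "c' \<in> supported (Kd d)" and eq: "Theta c = Theta c'"
  fix j :: 'n
  have "Theta c (gen (pw (Suc h) j)) = Theta c' (gen (pw (Suc h) j))" using eq by simp
  then have "cJ (gg c j) = cJ (gg c' j)" using pw_Vh by (simp add: Theta_def Tc_gen)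
  then have "gg (\<lambda>k. c k - c' k) j \<in> J" unfolding gg_diff using co.eq_iff[OF gg_x_polys gg_x_polys] by simp
  moreover have "(\<lambda>k. c k - c' k) \<in> supported (Kd d)" using c by (simp add: supported_def)
  ultimately have "(\<lambda>k. c k - c' k) = (\<lambda>_. 0)" using gg_independent by blast
  then show "c = c'" by (simp add: fun_eq_iff)
qed

lemma tdeg_x: "f \<in> x_polys \<Longrightarrow> x \<in> Poly_Mapping.keys f \<Longrightarrow> mon_deg x = int (tdeg x)"
  by (auto simp: x_polys_iff mon_deg_eq tdeg_def)

text \<open>An equivariant map is determined by the image of one x_j^(h+1), since W permutes the
  lines of these powers transitively. That image is semi-invariant modulo J under the stabilizer of
  \<open>j\<close>, so \<open>semi_invariant_YY\<close> describes it.\<close>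

lemma Theta_surj: assumes F: "F \<in> carrier (Hd d)" shows "\<exists>c\<in>supported (Kd d). F = Theta c"
proof -
  note F' = F[unfolded Hd_carrier]
  have Fext: "F \<in> carrier Vh \<rightarrow>\<^sub>E cJ ` gr (x_alg :: (complex^'n^'n, 'n bipoly) grep) (int d)" using F' by blast
  have Fadd: "F (x + y) = F x \<oplus>\<^bsub>coinv (G_group r p)\<^esub> F y" if "x \<in> carrier Vh" "y \<in> carrier Vh" for x y using F' that by blast
  have Fscl: "F (scl c x) = c \<odot>\<^bsub>coinv (G_group r p)\<^esub> F x" if "x \<in> carrier Vh" for c x using F' that by blast
  have Fact: "F (pact \<sigma> \<eta> x) = act (coinv (G_group r p)) (wmat \<sigma> \<eta>) (F x)" if "G_data r p \<sigma> \<eta>" "x \<in> carrier Vh" for \<sigma> \<eta> x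
    using F' that by blast
  define j :: 'n where "j = undefined"
  define P where "P i = gen (pw (Suc h) i)" for i :: 'n
  have P: "P i \<in> carrier Vh" for i unfolding P_def by (rule pw_Vh)
  have "F (P j) \<in> cJ ` gr (x_alg :: (complex^'n^'n, 'n bipoly) grep) (int d)" using Fext P by blast
  then obtain g where g: "g \<in> gr (x_alg :: (complex^'n^'n, 'n bipoly) grep) (int d)" "F (P j) = cJ g" by blast
  have gx: "g \<in> x_polys" using g(1) unfolding gr_x_alg by blast
  have "g \<in> YY j d"
  proof (rule semi_invariant_YY[OF gx])
    show "tdeg x = d" if "x \<in> Poly_Mapping.keys g" for x
      using g(1) tdeg_x[OF gx that] that unfolding gr_x_alg by auto
    fix \<sigma> :: "'n \<Rightarrow> 'n" and \<eta> assume G: "G_data r p \<sigma> \<eta>" and \<sigma>j: "\<sigma> j = j"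
    have \<sigma>: "\<sigma> permutes UNIV" and \<eta>: "\<eta> j ^ r = 1" using G by (auto simp: G_data_def)
    have "pact \<sigma> \<eta> (P j) = scl (\<eta> j ^ (s + eps)) (P j)"
      unfolding P_def pact_pw[OF \<sigma>] root_power_Suc_h[OF \<eta>] \<sigma>j ..
    then have "cJ (pact \<sigma> \<eta> g) = cJ (scl (\<eta> j ^ (s + eps)) g)"
      using Fact[OF G P, of j] Fscl[OF P, of "\<eta> j ^ (s + eps)" j] unfolding g(2) co_act[OF G gx] co.smult[OF gx] by simp
    then show "pact \<sigma> \<eta> g - scl (\<eta> j ^ (s + eps)) g \<in> J"
      using co.eq_iff[OF pact_x_polys[OF gx] lin_subspaceD(3)[OF x_polys_subspace gx]] by blast
  qed
  then obtain c where c: "c \<in> supported (Kd d)" "g - gg c j \<in> J" unfolding YY_def by blast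
  have Fj: "F (P j) = cJ (gg c j)" unfolding g(2) using co.eq_iff[OF gx gg_x_polys] c(2) by blast
  have FP: "F (P i) = Theta c (P i)" for i
  proof -
    \<comment> \<open>This permutation matrix takes x_j^(h+1) to x_i^(h+1) and \<open>gg c j\<close>
      to \<open>gg c i\<close>.\<close>
    let ?t = "Transposition.transpose j i"
    have t: "?t permutes UNIV" by (rule permutes_swap_id) simp_all
    note G = G_data_perm[OF t]
    have "pact ?t (\<lambda>_. 1) (P j) = P i" unfolding P_def pact_pw[OF t] by (simp add: scl_one)
    then have "F (P i) = cJ (pact ?t (\<lambda>_. 1) (gg c j))"
      using Fact[OF G P, of j] unfolding Fj co_act[OF G gg_x_polys] by simp
    also have "\<dots> = cJ (gg c i)" unfolding gg_pact[OF G] by (simp add: scl_one)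
    also have "\<dots> = Theta c (P i)" using P[of i] unfolding Theta_def P_def by (simp add: Tc_gen)
    finally show ?thesis .
  qed
  have T: "Theta c \<in> carrier (Hd d)" by (rule Theta_mem[OF c(1)])
  note T' = T[unfolded Hd_carrier]
  have "F f = Theta c f" if f: "f \<in> carrier Vh" for f
  proof -
    let ?Z = "{f \<in> carrier Vh. F f = Theta c f}"
    have Z: "lin_subspace ?Z"
      unfolding lin_subspace_def
    proof (intro conjI ballI allI)
      show sc: "scl t x \<in> ?Z" if "x \<in> ?Z" for t x
        using that lin_subspaceD(3)[OF Vh_subspace] Fscl T' by simp
      have "scl 0 (P j) \<in> ?Z" using sc FP P by blast
      then show "0 \<in> ?Z" by (simp add: scl_zero_left)
      show "x + y \<in> ?Z" if "x \<in> ?Z" "y \<in> ?Z" for x y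
        using that lin_subspaceD(2)[OF Vh_subspace] Fadd T' by simp
    qed
    have "f \<in> ?Z"
    proof (rule lin_subspace_keys_in[OF Z])
      fix x assume "x \<in> Poly_Mapping.keys f"
      then obtain i where x: "gen x = P i" using f by (auto simp: Vh_carrier P_def)
      show "gen x \<in> ?Z" unfolding x using P FP by blast
    qed
    then show ?thesis by simp
  qed
  moreover have "Theta c \<in> carrier Vh \<rightarrow>\<^sub>E cJ ` gr (x_alg :: (complex^'n^'n, 'n bipoly) grep) (int d)" using T' by blast
  ultimately have "F = Theta c" using Fext by (intro PiE_ext[where k = "carrier Vh"])
  then show ?thesis using c(1) by blast
qed

lemma vdim_Hd: "vdim (Hd d) = card (Kd d)"
proof -
  have C: "coordinatized (Hd d) (Kd d) (inv_into (supported (Kd d)) Theta)"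
  proof (rule coordinatized_inverse)
    show "finite (Kd d)" by (simp add: Kd_def)
    show "bij_betw Theta (supported (Kd d)) (carrier (Hd d))"
      unfolding bij_betw_def using Theta_inj Theta_mem Theta_surj by blast
    show "Theta c \<oplus>\<^bsub>Hd d\<^esub> Theta c' = Theta (\<lambda>i. c i + c' i)" for c c'
      unfolding Hd_fields by (rule restrict_ext[of "carrier Vh", THEN trans[OF _ Theta_def[symmetric]]])
        (simp add: Theta_def co.add[OF Tc_x_polys Tc_x_polys] Tc_param_add)
    show "t \<odot>\<^bsub>Hd d\<^esub> Theta c = Theta (\<lambda>i. t * c i)" for t c
      unfolding Hd_fields by (rule restrict_ext[of "carrier Vh", THEN trans[OF _ Theta_def[symmetric]]])
        (simp add: Theta_def co.smult[OF Tc_x_polys] Tc_param_scl)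
    show "\<zero>\<^bsub>Hd d\<^esub> = Theta (\<lambda>_. 0)"
      unfolding Hd_fields Theta_def Tc_param_zero co.zero ..
  qed
  interpret C: coordinatized "Hd d" "Kd d" "inv_into (supported (Kd d)) Theta" by (rule C)
  show ?thesis by (rule C.vdim_eq)
qed

lemma vdim_Vh: "vdim Vh = CARD('n)"
proof -
  interpret P: coordinatized "power_rep (Suc h) :: (complex^'n^'n, 'n bipoly) grep" UNIV "\<lambda>f i. Poly_Mapping.lookup f (pw (Suc h) i)"
    by (rule power_rep_coordinatized) simp
  show ?thesis unfolding Vh_def by (rule P.vdim_eq)
qed

text \<open>Several candidates may have the same degree, and the multiplicity of d among the
  \<open>exd k\<close> is the dimension of the space of equivariant maps to degree d.\<close>

lemma exponents_eq: "exponents_in (G_group r p) (coinv (G_group r p)) Vh = sort (map exd [0..<CARD('n)])"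
  unfolding exponents_in_def
proof (rule the_equality)
  let ?es = "sort (map exd [0..<CARD('n)])"
  have cnt: "count_list ?es i = card (Kd i)" for i
  proof -
    have "count_list ?es i = length (filter ((=) i) ?es)" by (rule count_list_eq_length_filter)
    also have "\<dots> = length (filter ((=) i) (map exd [0..<CARD('n)]))" by (metis filter_sort length_sort)
    also have "\<dots> = card (Kd i)" unfolding length_filter_conv_card Kd_def by (rule arg_cong[where f = card]) auto
    finally show ?thesis .
  qed
  have mult: "multiplicity_in (G_group r p) (piece (coinv (G_group r p)) (int i)) Vh = card (Kd i)" for i
    unfolding multiplicity_in_def Hd_def[symmetric] by (rule vdim_Hd)
  show "sorted ?es \<and> length ?es = vdim Vh \<and>
      (\<forall>i. multiplicity_in (G_group r p) (piece (coinv (G_group r p)) (int i)) Vh = count_list ?es i)"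
    by (simp add: mult cnt vdim_Vh)
  fix es assume es: "sorted es \<and> length es = vdim Vh \<and>
      (\<forall>i. multiplicity_in (G_group r p) (piece (coinv (G_group r p)) (int i)) Vh = count_list es i)"
  have cm: "count (mset xs) i = count_list xs i" for xs and i :: nat by (induction xs) auto
  \<comment> \<open>The multiplicities determine the multiset, and sortedness then determines the
    list.\<close>
  have "mset es = mset ?es" by (rule multiset_eqI) (use es mult cnt cm in metis)
  then have "mset es = mset (map exd [0..<CARD('n)])" by simp
  then show "es = ?es" using es properties_for_sort by metis
qed

theorem exponent_sum: "sum_list (exponents_in (G_group r p) (coinv (G_group r p)) Vh) = N"
proof -
  have "sum_list (sort xs) = sum_list xs" for xs :: "nat list" by (metis mset_sort sum_mset_sum_list)
  then show ?thesis unfolding exponents_eq sum_exd[symmetric] by (simp add: interv_sum_list_conv_sum_set_nat atLeast0LessThan)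
qed

end

section \<open>Traces and determinants\<close>

lemma hom_sum:
  fixes f :: "'a::comm_ring_1 \<Rightarrow> 'b::comm_ring_1"
  assumes "\<And>x y. f (x + y) = f x + f y" shows "f (sum g S) = (\<Sum>x\<in>S. f (g x))"
proof -
  have "f 0 + f 0 = f 0 + 0" using assms[of 0 0] by simp
  then have "f 0 = 0" by (simp only: add_left_cancel)
  then show ?thesis by (induction S rule: infinite_finite_induct) (simp_all add: assms)
qed

lemma hom_prod:
  fixes f :: "'a::comm_ring_1 \<Rightarrow> 'b::comm_ring_1"
  assumes "\<And>x y. f (x * y) = f x * f y" "f 1 = 1" shows "f (prod g S) = (\<Prod>x\<in>S. f (g x))"
  by (induction S rule: infinite_finite_induct) (simp_all add: assms)

lemma hom_power:
  fixes f :: "'a::comm_ring_1 \<Rightarrow> 'b::comm_ring_1"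
  assumes "\<And>x y. f (x * y) = f x * f y" "f 1 = 1" shows "f (x ^ k) = f x ^ k"
  by (induction k) (simp_all add: assms)

lemma det_hom:
  fixes f :: "'a::comm_ring_1 \<Rightarrow> 'b::comm_ring_1" and A :: "'a^'n::finite^'n"
  assumes add: "\<And>x y. f (x + y) = f x + f y" and mult: "\<And>x y. f (x * y) = f x * f y" and one: "f 1 = 1"
  shows "f (det A) = det (\<chi> i j. f (A $ i $ j))"
proof -
  have "f 0 + f 0 = f 0 + 0" using add[of 0 0] by simp
  then have z: "f 0 = 0" by (simp only: add_left_cancel)
  have "f (- 1) + f 1 = 0" using add[of "- 1" 1] z by simp
  then have m: "f (- 1) = - 1" using one by (simp add: eq_neg_iff_add_eq_0)
  have "f (of_int (sign q)) = of_int (sign q)" for q :: "'n \<Rightarrow> 'n"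
    by (cases q rule: sign_cases) (simp_all add: one m)
  then show ?thesis unfolding det_def by (simp add: hom_sum[of f, OF add] mult hom_prod[of f, OF mult one])
qed

lemma fixsum_hom:
  fixes f :: "'a::comm_ring_1 \<Rightarrow> 'b::comm_ring_1"
  assumes add: "\<And>x y. f (x + y) = f x + f y" and mult: "\<And>x y. f (x * y) = f x * f y" and one: "f 1 = 1"
  shows "f (fixsum h \<sigma> b) = fixsum h \<sigma> (\<lambda>i. f (b i))"
  unfolding fixsum_def hom_sum[of f, OF add] hom_prod[of f, OF mult one] hom_power[of f, OF mult one] ..

text \<open>The weight of x_i with the grading variable attached. Power series come first because
  evaluation at 0 is a ring homomorphism on them; the results are transported to Laurent
  series.\<close>

definition lb :: "('n \<Rightarrow> complex) \<Rightarrow> 'n \<Rightarrow> complex fps" where "lb \<eta> i = fps_X * fps_const (\<eta> i)"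

lemma fps_to_fls_lb: "fps_to_fls (lb \<eta> i) = fls_X * fls_const (\<eta> i)"
  unfolding lb_def fls_times_fps_to_fls by simp

text \<open>At t = 0 the matrix is the identity, so the determinant has constant coefficient
  1.\<close>

lemma det_one_minus_nonzero: "det (mat 1 - bmat \<sigma> (\<lambda>i. fps_to_fls (lb \<eta> i)) :: complex fls^'n::finite^'n) \<noteq> 0"
proof -
  let ?B = "mat 1 - bmat \<sigma> (lb \<eta>) :: complex fps^'n^'n"
  have 1: "(\<chi> i j. fps_to_fls (?B $ i $ j)) = mat 1 - bmat \<sigma> (\<lambda>i. fps_to_fls (lb \<eta> i))"
    by (simp add: vec_eq_iff mat_def bmat_def)
  have 2: "(\<chi> i j. fps_nth (?B $ i $ j) 0) = (mat 1 :: complex^'n^'n)"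
    by (simp add: vec_eq_iff mat_def bmat_def lb_def)
  have "fps_nth (det ?B) 0 = det (\<chi> i j. fps_nth (?B $ i $ j) 0)"
    by (rule det_hom) simp_all
  then have "fps_nth (det ?B) 0 = 1" unfolding 2 by simp
  then have "det ?B \<noteq> 0" by auto
  moreover have "fps_to_fls (det ?B) = det (\<chi> i j. fps_to_fls (?B $ i $ j))"
    by (rule det_hom) (simp_all add: fls_times_fps_to_fls)
  ultimately show ?thesis unfolding 1 by (metis fps_to_fls_eq_0_iff)
qed

lemma det_one_minus_bmat:
  "det_one_minus k (bmat \<sigma> (\<lambda>i. \<eta> i ^ k)) = det (mat 1 - bmat \<sigma> (\<lambda>i. fps_to_fls (lb \<eta> i) ^ k))"
proof -
  have "fls_X ^ k * fls_const (\<eta> i ^ k) = fps_to_fls (lb \<eta> i) ^ k" for i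
    unfolding fps_to_fls_lb power_mult_distrib by (simp add: fls_const_power)
  then have "(\<chi> i j. fls_X ^ k * fls_const (bmat \<sigma> (\<lambda>i. \<eta> i ^ k) $ i $ j)) = bmat \<sigma> (\<lambda>i. fps_to_fls (lb \<eta> i) ^ k)"
    by (simp add: vec_eq_iff bmat_def)
  then show ?thesis unfolding det_one_minus_def by simp
qed

lemma fixsum_nth:
  "fls_nth (fixsum h \<sigma> (\<lambda>i. fps_to_fls (lb \<eta> i))) i
    = (\<Sum>m | (\<forall>l. m l \<le> h) \<and> (\<forall>l. m (\<sigma> l) = m l) \<and> int (\<Sum>l\<in>UNIV. m l) = i. \<Prod>l\<in>(UNIV :: 'n::finite set). \<eta> l ^ m l)"
proof -
  let ?F = "{m :: 'n \<Rightarrow> nat. (\<forall>l. m l \<le> h) \<and> (\<forall>l. m (\<sigma> l) = m l)}"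
  have mono: "(\<Prod>l\<in>UNIV. lb \<eta> l ^ m l) = fps_X ^ (\<Sum>l\<in>UNIV. m l) * fps_const (\<Prod>l\<in>UNIV. \<eta> l ^ m l)" for m :: "'n \<Rightarrow> nat"
  proof -
    have "fps_const (\<Prod>l\<in>UNIV. \<eta> l ^ m l) = (\<Prod>l\<in>UNIV. fps_const (\<eta> l) ^ m l)"
      by (subst hom_prod[of fps_const]) (simp_all add: fps_const_power)
    then show ?thesis unfolding lb_def power_mult_distrib prod.distrib power_sum by simp
  qed
  have coef: "fps_nth (\<Prod>l\<in>UNIV. lb \<eta> l ^ m l) k = (if (\<Sum>l\<in>UNIV. m l) = k then \<Prod>l\<in>UNIV. \<eta> l ^ m l else 0)" for m :: "'n \<Rightarrow> nat" and k
    unfolding mono by (auto simp: fps_X_power_mult_nth)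
  have "fixsum h \<sigma> (\<lambda>i. fps_to_fls (lb \<eta> i)) = fps_to_fls (fixsum h \<sigma> (lb \<eta>))"
    by (rule fixsum_hom[symmetric]) (simp_all add: fls_times_fps_to_fls)
  then have "fls_nth (fixsum h \<sigma> (\<lambda>i. fps_to_fls (lb \<eta> i))) i = (if i < 0 then 0 else fps_nth (fixsum h \<sigma> (lb \<eta>)) (nat i))" by simp
  also have "\<dots> = (\<Sum>m\<in>?F. if int (\<Sum>l\<in>UNIV. m l) = i then \<Prod>l\<in>UNIV. \<eta> l ^ m l else 0)"
  proof (cases "i < 0")
    case True
    then have "int (\<Sum>l\<in>UNIV. m l) \<noteq> i" for m :: "'n \<Rightarrow> nat" using of_nat_0_le_iff[of "\<Sum>l\<in>UNIV. m l", where 'a = int] by linarith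
    then show ?thesis using True by simp
  next
    case False
    then have it: "int t = i \<longleftrightarrow> t = nat i" for t by linarith
    show ?thesis unfolding fixsum_def fps_sum_nth coef it if_not_P[OF False] ..
  qed
  also have "\<dots> = (\<Sum>m\<in>{m \<in> ?F. int (\<Sum>l\<in>UNIV. m l) = i}. \<Prod>l\<in>UNIV. \<eta> l ^ m l)"
    by (subst sum.inter_filter) (simp_all add: finite_bounded)
  also have "{m \<in> ?F. int (\<Sum>l\<in>UNIV. m l) = i} = {m. (\<forall>l. m l \<le> h) \<and> (\<forall>l. m (\<sigma> l) = m l) \<and> int (\<Sum>l\<in>UNIV. m l) = i}" by blast
  finally show ?thesis .
qed

section \<open>The graded quotient\<close>

context coinv_model
begin

lemma lookup_pact_pw:
  assumes k: "k > 0" and \<sigma>: "\<sigma> permutes UNIV" and f: "Poly_Mapping.keys f \<subseteq> range (pw k)"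
  shows "Poly_Mapping.lookup (pact \<sigma> \<eta> f) (pw k i) = (\<Sum>j\<in>UNIV. bmat \<sigma> (\<lambda>j. \<eta> j ^ k) $ i $ j * Poly_Mapping.lookup f (pw k j))"
proof (rule functional_eqI[where T = "\<lambda>f. Poly_Mapping.lookup (pact \<sigma> \<eta> f) (pw k i)"
      and T' = "\<lambda>f. \<Sum>j\<in>UNIV. bmat \<sigma> (\<lambda>j. \<eta> j ^ k) $ i $ j * Poly_Mapping.lookup f (pw k j)"])
  fix x assume "x \<in> Poly_Mapping.keys f"
  then obtain l where x: "x = pw k l" using f by blast
  have "(\<Sum>j\<in>UNIV. bmat \<sigma> (\<lambda>j. \<eta> j ^ k) $ i $ j * Poly_Mapping.lookup (gen x) (pw k j))
      = (\<Sum>j\<in>{l}. bmat \<sigma> (\<lambda>j. \<eta> j ^ k) $ i $ j * Poly_Mapping.lookup (gen x) (pw k j))"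
    by (rule sum.mono_neutral_right) (auto simp: x lookup_single when_def pw_eq_iff[OF k])
  then show "Poly_Mapping.lookup (pact \<sigma> \<eta> (gen x)) (pw k i) = (\<Sum>j\<in>UNIV. bmat \<sigma> (\<lambda>j. \<eta> j ^ k) $ i $ j * Poly_Mapping.lookup (gen x) (pw k j))"
    unfolding x pact_pw[OF \<sigma>] by (auto simp: lookup_single when_def pw_eq_iff[OF k] bmat_def)
qed (simp_all add: pact_add pact_scl lookup_add distrib_left sum.distrib sum_distrib_left mult.left_commute)

lemma endo_matrix_power:
  assumes k: "k > 0" and G: "G_data r p \<sigma> \<eta>"
  shows "endo_matrix (power_rep k :: (complex^'n^'n, 'n bipoly) grep) (\<lambda>j. Var (Inl j) ^ k) (act (power_rep k :: (complex^'n^'n, 'n bipoly) grep) (wmat \<sigma> \<eta>))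
    = bmat \<sigma> (\<lambda>j. \<eta> j ^ k)"
proof -
  interpret P: coordinatized "power_rep k :: (complex^'n^'n, 'n bipoly) grep" UNIV "\<lambda>f i. Poly_Mapping.lookup f (pw k i)"
    by (rule power_rep_coordinatized[OF k])
  have \<sigma>: "\<sigma> permutes UNIV" using G by (simp add: G_data_def)
  have mem: "gen (pw k j) \<in> carrier (power_rep k :: (complex^'n^'n, 'n bipoly) grep)" for j
    unfolding power_rep_carrier by simp
  have u: "P.unit j = gen (pw k j)" for j
    by (rule P.coord_inj[OF P.unit_closed mem]) (auto simp: P.coord_unit lookup_single when_def pw_eq_iff[OF k] fun_eq_iff)
  have cl: "pact \<sigma> \<eta> (gen (pw k j)) \<in> carrier (power_rep k :: (complex^'n^'n, 'n bipoly) grep)" for j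
    unfolding pact_pw[OF \<sigma>] power_rep_carrier by (rule lin_subspaceD(3)[OF lin_subspace_keys]) simp
  have co: "coords (power_rep k :: (complex^'n^'n, 'n bipoly) grep) UNIV (\<lambda>j. gen (pw k j)) x i = Poly_Mapping.lookup x (pw k i)"
    if x: "x \<in> carrier (power_rep k :: (complex^'n^'n, 'n bipoly) grep)" for x i
  proof -
    have "coords (power_rep k :: (complex^'n^'n, 'n bipoly) grep) UNIV (\<lambda>j. P.unit (id j)) x = (\<lambda>j\<in>UNIV. Poly_Mapping.lookup x (pw k (id j)))"
      by (rule P.unit_basis(2)[OF bij_betw_id x])
    then show ?thesis unfolding id_apply u by simp
  qed
  have lk: "Poly_Mapping.lookup (pact \<sigma> \<eta> (gen (pw k j))) (pw k i) = bmat \<sigma> (\<lambda>j. \<eta> j ^ k) $ i $ j" for i j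
    unfolding pact_pw[OF \<sigma>] by (auto simp: lookup_single when_def pw_eq_iff[OF k] bmat_def)
  show ?thesis
    unfolding endo_matrix_def power_rep_fields act_pact[OF G] Var_power_pw co[OF cl] lk
    by (simp only: vec_eq_iff vec_lambda_beta simp_thms)
qed

section \<open>The diagonal coinvariant ring and the quotient L\<close>

lemma poly_presented:
  "presented_alg (poly_alg :: (complex^'n^'n, 'n bipoly) grep) UNIV (\<lambda>f. f) {0} (\<lambda>w. subst (var_act w)) (G_group r p)"
  by (rule poly_alg_presented) (use r_gt_1 in simp)

lemma poly_ideal_I:
  assumes "lin_subspace A" "\<And>f g. f \<in> A \<Longrightarrow> f * g \<in> A"
  shows "ideal A (poly_alg :: (complex^'n^'n, 'n bipoly) grep)"
  using presented_alg.ideal_image[OF poly_presented assms(1) subset_UNIV] assms(2) by simp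

definition DI :: "'n bipoly set" where "DI = diag_ideal (G_group r p)"

lemma DI_minimal:
  assumes "lin_subspace A" "\<And>f g. f \<in> A \<Longrightarrow> f * g \<in> A"
    and "\<And>f. (\<And>\<sigma> \<eta>. G_data r p \<sigma> \<eta> \<Longrightarrow> pact \<sigma> \<eta> f = f) \<Longrightarrow> Poly_Mapping.lookup f 0 = 0 \<Longrightarrow> f \<in> A"
  shows "DI \<subseteq> A"
  unfolding DI_def diag_ideal_def
proof (rule ring.genideal_minimal[OF presented_alg.ring[OF poly_presented] poly_ideal_I[OF assms(1,2)]])
  show "{f \<in> invariants (G_group r p) (poly_alg :: (complex^'n^'n, 'n bipoly) grep). Poly_Mapping.lookup f 0 = 0} \<subseteq> A"
  proof
    fix f assume f: "f \<in> {f \<in> invariants (G_group r p) (poly_alg :: (complex^'n^'n, 'n bipoly) grep). Poly_Mapping.lookup f 0 = 0}"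
    show "f \<in> A"
    proof (rule assms(3))
      fix \<sigma> :: "'n \<Rightarrow> 'n" and \<eta> assume G: "G_data r p \<sigma> \<eta>"
      have "wmat \<sigma> \<eta> \<in> G_group r p" by (rule wmat_mem[OF G]) (use r_gt_1 in simp)
      then show "pact \<sigma> \<eta> f = f" using f act_pact[OF G, of f] by (simp add: invariants_def)
    qed (use f in simp)
  qed
qed

lemma DI_ideal: "ideal DI (poly_alg :: (complex^'n^'n, 'n bipoly) grep)"
  unfolding DI_def diag_ideal_def
  by (rule ring.genideal_ideal[OF presented_alg.ring[OF poly_presented]]) simp

lemma DI_gen:
  assumes "\<And>\<sigma> \<eta>. G_data r p \<sigma> \<eta> \<Longrightarrow> pact \<sigma> \<eta> f = f" "Poly_Mapping.lookup f 0 = 0"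
  shows "f \<in> DI"
proof -
  have "act (poly_alg :: (complex^'n^'n, 'n bipoly) grep) w f = f" if w: "w \<in> G_group r p" for w
  proof -
    obtain \<sigma> \<eta> where G: "G_data r p \<sigma> \<eta>" "w = wmat \<sigma> \<eta>" by (rule G_groupE[OF w])
    show ?thesis unfolding G(2) poly_alg_simps act_pact[OF G(1)] by (rule assms(1)[OF G(1)])
  qed
  then have "f \<in> {f \<in> invariants (G_group r p) (poly_alg :: (complex^'n^'n, 'n bipoly) grep). Poly_Mapping.lookup f 0 = 0}"
    using assms(2) by (simp add: invariants_def)
  then show ?thesis unfolding DI_def diag_ideal_def
    by (rule subsetD[OF ring.genideal_self[OF presented_alg.ring[OF poly_presented]], rotated]) simp
qed

text \<open>By this inclusion the symbol map factors through the diagonal coinvariant ring, so its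
  image is a quotient of that ring.\<close>

lemma DI_kernel: "DI \<subseteq> kernel"
  by (rule DI_minimal[OF kernel_subspace kernel_mult]) (auto intro: invariants_kernel)

text \<open>The polynomials that \<open>pact \<sigma> \<eta>\<close> sends into \<open>DI\<close>
  form an ideal, and it contains the generating invariants because these are fixed.\<close>

lemma DI_pact: assumes G: "G_data r p \<sigma> \<eta>" and f: "f \<in> DI" shows "pact \<sigma> \<eta> f \<in> DI"
proof -
  note i = ideal_subspace[OF DI_ideal]
  have "DI \<subseteq> {f. pact \<sigma> \<eta> f \<in> DI}"
  proof (rule DI_minimal)
    show "lin_subspace {f. pact \<sigma> \<eta> f \<in> DI}"
      unfolding lin_subspace_def by (auto simp: pact_add pact_scl intro: lin_subspaceD(1-3)[OF i(1)])
    show "f * g \<in> {f. pact \<sigma> \<eta> f \<in> DI}" if "f \<in> {f. pact \<sigma> \<eta> f \<in> DI}" for f g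
      using that i(2) by (simp add: pact_mult)
    show "f \<in> {f. pact \<sigma> \<eta> f \<in> DI}" if "\<And>\<sigma> \<eta>. G_data r p \<sigma> \<eta> \<Longrightarrow> pact \<sigma> \<eta> f = f" "Poly_Mapping.lookup f 0 = 0" for f
      using DI_gen[of f] that G by simp
  qed
  then show ?thesis using f by blast
qed

definition cD :: "'n bipoly \<Rightarrow> 'n bipoly set"
  where "cD f = (\<lambda>f. f) ` DI +>\<^bsub>poly_alg :: (complex^'n^'n, 'n bipoly) grep\<^esub> f"

lemma diag_coinv_eq: "diag_coinv (G_group r p) = quot_grep (poly_alg :: (complex^'n^'n, 'n bipoly) grep) ((\<lambda>f. f) ` DI)"
  unfolding diag_coinv_def DI_def by (simp only: image_ident)

lemma diag_presented:
  "presented_alg (diag_coinv (G_group r p :: (complex^'n^'n) set)) UNIV cD DI (\<lambda>w. subst (var_act w)) (G_group r p)"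
  unfolding diag_coinv_eq cD_def[abs_def]
proof (rule presented_alg.presented_alg_quot[OF poly_presented])
  note i = ideal_subspace[OF DI_ideal]
  show "lin_subspace DI" by (rule i(1))
  show "{0} \<subseteq> DI" using lin_subspaceD(1)[OF i(1)] by simp
  show "f * g \<in> DI" if "f \<in> DI" for f g by (rule i(2)[OF that])
  fix w :: "complex^'n^'n" and f :: "'n bipoly" assume w: "w \<in> G_group r p" and f: "f \<in> DI"
  obtain \<sigma> \<eta> where G: "G_data r p \<sigma> \<eta>" "w = wmat \<sigma> \<eta>" by (rule G_groupE[OF w])
  show "subst (var_act w) f \<in> DI" unfolding G(2) act_pact[OF G(1)] by (rule DI_pact[OF G(1) f])
qed simp

sublocale dc: presented_alg "diag_coinv (G_group r p :: (complex^'n^'n) set)" UNIV cD DI "\<lambda>w. subst (var_act w)" "G_group r p"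
  by (rule diag_presented)

lemma kernel_subst: assumes "w \<in> G_group r p" "f \<in> kernel" shows "subst (var_act w) f \<in> kernel"
proof -
  obtain \<sigma> \<eta> where G: "G_data r p \<sigma> \<eta>" "w = wmat \<sigma> \<eta>" by (rule G_groupE[OF assms(1)])
  show ?thesis unfolding G(2) act_pact[OF G(1)] by (rule kernel_pact[OF G(1) assms(2)])
qed

definition KL :: "'n bipoly set set" where "KL = cD ` kernel"

lemma KL_ideal: "ideal KL (diag_coinv (G_group r p))"
  unfolding KL_def by (rule dc.ideal_image[OF kernel_subspace subset_UNIV kernel_mult])

lemma KL_stable: "act_stable (G_group r p) (diag_coinv (G_group r p)) KL"
  unfolding act_stable_def KL_def using dc.act[OF _ UNIV_I] kernel_subst by auto

lemma Psi_mon_deg: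
  "Psi (restr (\<lambda>x. mon_deg x = e) f) m = (if int (\<Sum>i\<in>UNIV. m i) = int N + e then Psi f m else 0)"
proof (rule functional_eqI[where T = "\<lambda>f. Psi (restr (\<lambda>x. mon_deg x = e) f) m"
      and T' = "\<lambda>f. if int (\<Sum>i\<in>UNIV. m i) = int N + e then Psi f m else 0"])
  fix x
  show "Psi (restr (\<lambda>x. mon_deg x = e) (gen x)) m = (if int (\<Sum>i\<in>UNIV. m i) = int N + e then Psi (gen x) m else 0)"
  proof (cases "Psi (gen x) m = 0")
    case False
    then show ?thesis using Psi_gen_degree[OF False] by (auto simp: restr_gen)
  qed (simp add: restr_gen)
qed (simp_all add: restr_add restr_scl Psi_add Psi_scl)

lemma gr_poly: "gr (poly_alg :: (complex^'n^'n, 'n bipoly) grep) d = {f. \<forall>x\<in>Poly_Mapping.keys f. mon_deg x = d}"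
  by (simp add: poly_alg_def)

lemma gr_diag: "gr (diag_coinv (G_group r p)) d = cD ` {f. \<forall>x\<in>Poly_Mapping.keys f. mon_deg x = d}"
  unfolding diag_coinv_eq gr_quot_grep gr_poly cD_def ..

lemma cD_finsum:
  assumes "finite A" shows "(\<Oplus>\<^bsub>diag_coinv (G_group r p)\<^esub>a\<in>A. cD (g a)) = cD (\<Sum>a\<in>A. g a)"
proof -
  interpret R: ring "diag_coinv (G_group r p :: (complex^'n^'n) set)" by (rule dc.ring)
  have cl: "cD f \<in> carrier (diag_coinv (G_group r p))" for f unfolding dc.carrier by blast
  show ?thesis using assms
  proof (induction A rule: finite_induct)
    case (insert a A)
    have "(\<Oplus>\<^bsub>diag_coinv (G_group r p)\<^esub>a\<in>insert a A. cD (g a)) = cD (g a) \<oplus>\<^bsub>diag_coinv (G_group r p)\<^esub> (\<Oplus>\<^bsub>diag_coinv (G_group r p)\<^esub>a\<in>A. cD (g a))"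
      by (rule R.finsum_insert[OF insert.hyps]) (use cl in auto)
    then show ?case unfolding insert.IH dc.add[OF UNIV_I UNIV_I] sum.insert[OF insert.hyps] .
  qed (simp add: dc.zero)
qed

text \<open>Symbols of different degree are supported on exponent vectors of different total, so
  each homogeneous component of an element of \<open>kernel\<close> has symbol zero.\<close>

lemma KL_homogeneous: "homogeneous (diag_coinv (G_group r p)) KL"
  unfolding homogeneous_def
proof
  fix k assume "k \<in> KL"
  then obtain f where f: "f \<in> kernel" "k = cD f" unfolding KL_def by blast
  let ?g = "\<lambda>d. restr (\<lambda>x. mon_deg x = d) f"
  let ?D = "mon_deg ` Poly_Mapping.keys f"
  have "Psi (?g d) m = 0" for d m using f(1) unfolding Psi_mon_deg kernel_def by simp
  then have "cD (?g d) \<in> KL" for d unfolding KL_def kernel_def by blast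
  moreover have "cD (?g d) \<in> gr (diag_coinv (G_group r p)) d" for d
    unfolding gr_diag by (intro imageI CollectI ballI) (simp add: keys_restr)
  moreover have "(\<Oplus>\<^bsub>diag_coinv (G_group r p)\<^esub>d\<in>?D. cD (?g d)) = k"
    unfolding f(2) by (subst cD_finsum) (simp_all add: sum_restr)
  ultimately show "\<exists>D g. finite D \<and> (\<forall>d\<in>D. g d \<in> KL \<inter> gr (diag_coinv (G_group r p)) d) \<and> k = (\<Oplus>\<^bsub>diag_coinv (G_group r p)\<^esub>d\<in>D. g d)"
    by (intro exI[of _ ?D] exI[of _ "\<lambda>d. cD (?g d)"]) auto
qed

definition LQ :: "(complex^'n^'n, 'n bipoly set set) grep" where "LQ = quot_grep (diag_coinv (G_group r p)) KL"

definition cL :: "'n bipoly \<Rightarrow> 'n bipoly set set"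
  where "cL f = KL +>\<^bsub>diag_coinv (G_group r p :: (complex^'n^'n) set)\<^esub> cD f"

lemma LQ_presented: "presented_alg LQ UNIV cL kernel (\<lambda>w. subst (var_act w)) (G_group r p)"
  unfolding LQ_def KL_def cL_def[abs_def]
  by (rule dc.presented_alg_quot[OF kernel_subspace subset_UNIV DI_kernel kernel_subst kernel_mult])

sublocale LL: presented_alg LQ UNIV cL kernel "\<lambda>w. subst (var_act w)" "G_group r p"
  by (rule LQ_presented)

definition phiL where "phiL = LL.lift_coord Psi"

lemma phiL_cL: "phiL (cL f) = Psi f"
  unfolding phiL_def by (rule LL.lift_coord_eq) (auto simp: Psi_diff kernel_def)

lemma LQ_coordinatized: "coordinatized LQ box phiL"
  unfolding phiL_def
proof (rule LL.coordinatized_part[where S' = UNIV])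
  show "range Psi = supported box"
  proof (intro equalityI subsetI)
    show "u \<in> supported box" if "u \<in> range Psi" for u using that Psi_support by (auto simp: supported_def)
    fix u assume "u \<in> supported box"
    then have "\<And>m. m \<notin> box \<Longrightarrow> u m = 0" by (rule supportedD)
    then obtain f where "\<forall>m. Psi f m = u m" using Psi_surj by blast
    then have "Psi f = u" by (simp add: fun_eq_iff)
    then show "u \<in> range Psi" by blast
  qed
qed (auto simp: Psi_add Psi_scl fun_eq_iff kernel_def finite_box lin_subspace_def LL.carrier)

text \<open>Degree d of L is degree \<open>N + d\<close> of A, as the class of 1 corresponds to
  v.\<close>

definition KK :: "int \<Rightarrow> ('n \<Rightarrow> nat) set" where "KK d = {m \<in> box. int (\<Sum>i\<in>UNIV. m i) = int N + d}"

lemma gr_LQ_image: "gr LQ d = cL ` {f. \<forall>x\<in>Poly_Mapping.keys f. mon_deg x = d}"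
  unfolding LQ_def gr_quot_grep gr_diag cL_def image_image ..

lemma gr_LQ: "gr LQ d = {a \<in> carrier LQ. phiL a \<in> supported (KK d)}"
proof (intro equalityI subsetI)
  fix a assume "a \<in> gr LQ d"
  then obtain f where f: "\<And>x. x \<in> Poly_Mapping.keys f \<Longrightarrow> mon_deg x = d" "a = cL f" unfolding gr_LQ_image by blast
  have "Psi f m = 0" if m: "m \<notin> KK d" for m
  proof (rule ccontr)
    assume nz: "Psi f m \<noteq> 0"
    then have "m \<in> box" using Psi_support by blast
    then show False using Psi_degree[OF f(1) nz] m by (simp add: KK_def)
  qed
  then show "a \<in> {a \<in> carrier LQ. phiL a \<in> supported (KK d)}"
    unfolding f(2) using LL.carrier by (simp add: supported_def phiL_cL)
next
  fix a assume a: "a \<in> {a \<in> carrier LQ. phiL a \<in> supported (KK d)}"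
  then obtain f where f: "a = cL f" using LL.carrier by auto
  have "phiL a \<in> supported (KK d)" using a by blast
  then have "Psi f \<in> supported (KK d)" unfolding f phiL_cL .
  then have "\<And>m. \<not> (m \<in> box \<and> int (\<Sum>i\<in>UNIV. m i) = int N + d) \<Longrightarrow> Psi f m = 0" by (simp add: supported_def KK_def)
  \<comment> \<open>The given representative need not be homogeneous; it is exchanged for a
    homogeneous one with the same symbol.\<close>
  from Psi_surj_graded[of d "Psi f", OF this] obtain f' where f': "\<forall>x\<in>Poly_Mapping.keys f'. mon_deg x = d" "\<forall>m. Psi f' m = Psi f m" by blast
  have "f - f' \<in> kernel" using f'(2) by (simp add: kernel_def Psi_diff)
  then have "a = cL f'" unfolding f using LL.eq_iff[OF UNIV_I UNIV_I] by simp
  then show "a \<in> gr LQ d" unfolding gr_LQ_image using f'(1) by blast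
qed

text \<open>\<open>\<eta> i ^ Suc h\<close> is \<open>\<eta> i ^ (s + eps)\<close>, and the s-th
  power of the product of all entries is 1. So the exterior power carries exactly the character by
  which the actions on A and on L differ.\<close>

lemma det_Vh:
  assumes G: "G_data r p \<sigma> \<eta>" shows "det (bmat \<sigma> (\<lambda>j. \<eta> j ^ Suc h)) = chi \<sigma> \<eta>"
proof -
  have \<sigma>: "\<sigma> permutes UNIV" and \<eta>: "\<And>i. \<eta> i ^ r = 1" and det: "(\<Prod>i\<in>UNIV. \<eta> i) ^ s = 1" using G by (auto simp: G_data_def s_def)
  have "(\<Prod>i\<in>UNIV. \<eta> i ^ Suc h) = (\<Prod>i\<in>UNIV. \<eta> i ^ s * \<eta> i ^ eps)"
    unfolding root_power_Suc_h[OF \<eta>] power_add ..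
  also have "\<dots> = (\<Prod>i\<in>UNIV. \<eta> i) ^ s * (\<Prod>i\<in>UNIV. \<eta> i ^ eps)" by (simp add: prod.distrib prod_power_distrib)
  finally show ?thesis unfolding det_bmat[OF \<sigma>] chi_def det by simp
qed

text \<open>In the coordinates of the box w acts on L as on monomials, up to the inverse of
  \<open>chi \<sigma> \<eta>\<close>. The exterior power restores this factor and shifts the degree
  by \<open>N\<close>, which leaves the sum over fixed monomials.\<close>

theorem graded_trace:
  assumes G: "G_data r p \<sigma> \<eta>"
  shows "endo_trace (piece (tensor LQ (ext_power CARD('n) (int N) Vh)) i) (act (tensor LQ (ext_power CARD('n) (int N) Vh)) (wmat \<sigma> \<eta>))
    = fls_nth (fixsum h \<sigma> (\<lambda>i. fps_to_fls (lb \<eta> i))) i"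
proof -
  let ?w = "wmat \<sigma> \<eta>"
  have \<sigma>: "\<sigma> permutes UNIV" and \<eta>: "\<And>i. \<eta> i ^ r = 1" using G by (auto simp: G_data_def)
  have w: "?w \<in> G_group r p" by (rule wmat_mem[OF G]) (use r_gt_1 in simp)
  have actV: "act Vh ?w x = pact \<sigma> \<eta> x" for x unfolding Vh_fields act_pact[OF G] ..
  interpret P: coordinatized Vh UNIV "\<lambda>f i. Poly_Mapping.lookup f (pw (Suc h) i)"
    unfolding Vh_def by (rule power_rep_coordinatized) simp
  \<comment> \<open>The acting set is the singleton of w, so constant functions can serve as the
    families of matrices.\<close>
  interpret X: ext_space Vh "\<lambda>f i. Poly_Mapping.lookup f (pw (Suc h) i)" idx "{?w}" "\<lambda>_. bmat \<sigma> (\<lambda>j. \<eta> j ^ Suc h)" "int N"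
  proof
    show "bij_betw idx UNIV {..<CARD('n)}" by (rule idx)
    fix w' x assume w': "w' \<in> {?w}" and x: "x \<in> carrier Vh"
    show "act Vh w' x \<in> carrier Vh" using w' pact_Vh[OF G x] by (simp add: actV)
    show "Poly_Mapping.lookup (act Vh w' x) (pw (Suc h) i) = (\<Sum>j\<in>UNIV. bmat \<sigma> (\<lambda>j. \<eta> j ^ Suc h) $ i $ j * Poly_Mapping.lookup x (pw (Suc h) j))" for i
      using w' x lookup_pact_pw[OF _ \<sigma>, of "Suc h" x \<eta> i] by (simp add: actV Vh_carrier)
  qed
  interpret XE: coordinatized X.E "{()}" X.phi_e by (rule X.ext_coordinatized)
  interpret XL: coordinatized LQ box phiL by (rule LQ_coordinatized)
  \<comment> \<open>The matrix of w on L, read off from \<open>Psi_U\<close>: row \<open>m\<close>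
    has a single entry, in the column of \<open>m\<close> composed with
    \<open>\<sigma>\<close>.\<close>
  define RA where "RA m m' = inverse (chi \<sigma> \<eta>) * (\<Prod>i\<in>UNIV. \<eta> i ^ m (\<sigma> i)) * of_bool (m' = (\<lambda>i. m (\<sigma> i)))" for m m' :: "'n \<Rightarrow> nat"
  have ch: "chi \<sigma> \<eta> \<noteq> 0" by (rule chi_nonzero[OF \<eta>])
  have box_perm: "(\<lambda>i. m (\<sigma> i)) \<in> box \<longleftrightarrow> m \<in> box" for m :: "'n \<Rightarrow> nat"
  proof -
    have "m i \<le> h" if "\<forall>i. m (\<sigma> i) \<le> h" for i
      using spec[OF that, of "finv \<sigma> i"] unfolding permutes_inverses(1)[OF \<sigma>] .
    then have "(\<forall>i. m (\<sigma> i) \<le> h) \<longleftrightarrow> (\<forall>i. m i \<le> h)" by blast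
    then show ?thesis by (simp add: box_def)
  qed
  have sum_perm: "(\<Sum>i\<in>UNIV. m (\<sigma> i)) = (\<Sum>i\<in>UNIV. m i)" for m :: "'n \<Rightarrow> nat"
    using sum.permute[OF \<sigma>, of m] by (simp add: comp_def)
  define Fx where "Fx m \<longleftrightarrow> (\<forall>i. m (\<sigma> i) = m i)" for m :: "'n \<Rightarrow> nat"
  have Fx_iff: "m = (\<lambda>i. m (\<sigma> i)) \<longleftrightarrow> Fx m" for m :: "'n \<Rightarrow> nat"
    unfolding Fx_def fun_eq_iff by (intro iff_allI eq_commute)
  have prod_perm: "(\<Prod>i\<in>UNIV. \<eta> i ^ m (\<sigma> i)) = (\<Prod>i\<in>UNIV. \<eta> i ^ m i)" if "Fx m" for m :: "'n \<Rightarrow> nat"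
    by (rule prod.cong) (use that in \<open>simp_all add: Fx_def\<close>)
  interpret T: tensor_line LQ box phiL X.E X.phi_e "{?w}" "\<lambda>_. RA" "\<lambda>_. det (bmat \<sigma> (\<lambda>j. \<eta> j ^ Suc h))" "int N" KK
  proof
    show "gr LQ d = {a \<in> carrier LQ. phiL a \<in> supported (KK d)}" for d by (rule gr_LQ)
    show "KK d \<subseteq> box" for d unfolding KK_def by blast
    show "gr X.E d = (if d = int N then carrier X.E else {\<zero>\<^bsub>X.E\<^esub>})" for d by (rule X.ext_gr)
    show "RA m' m = 0" if "m \<in> KK d" "m' \<in> box" "m' \<notin> KK d" for m m' d
    proof (rule ccontr)
      assume "RA m' m \<noteq> 0"
      then have "m = (\<lambda>i. m' (\<sigma> i))" by (auto simp: RA_def)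
      then have e: "(\<Sum>i\<in>UNIV. m i) = (\<Sum>i\<in>UNIV. m' i)" using sum_perm[of m'] by simp
      show False using that unfolding KK_def mem_Collect_eq e by blast
    qed
    fix w' assume w': "w' \<in> {?w}"
    show "act X.E w' b \<in> carrier X.E" if "b \<in> carrier X.E" for b by (rule X.ext_act(1)[OF w' that])
    show "X.phi_e (act X.E w' b) () = det (bmat \<sigma> (\<lambda>j. \<eta> j ^ Suc h)) * X.phi_e b ()" if "b \<in> carrier X.E" for b
      by (rule X.ext_act(2)[OF w' that])
    fix a assume "a \<in> carrier LQ"
    then obtain f where f: "a = cL f" using LL.carrier by auto
    have a: "act LQ w' a = cL (pact \<sigma> \<eta> f)" unfolding f using w' LL.act[OF w UNIV_I] by (simp add: act_pact[OF G])
    show "act LQ w' a \<in> carrier LQ" unfolding a LL.carrier by blast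
    fix m
    have "chi \<sigma> \<eta> * Psi (pact \<sigma> \<eta> f) m = (\<Prod>i\<in>UNIV. \<eta> i ^ m (\<sigma> i)) * Psi f (\<lambda>i. m (\<sigma> i))"
      using Psi_U[OF \<sigma> \<eta>, where f = f and m = m] by (simp add: Uop_def)
    then have val: "Psi (pact \<sigma> \<eta> f) m = inverse (chi \<sigma> \<eta>) * (\<Prod>i\<in>UNIV. \<eta> i ^ m (\<sigma> i)) * Psi f (\<lambda>i. m (\<sigma> i))"
      using ch by (simp add: field_simps)
    have S: "(\<Sum>m'\<in>box. RA m m' * Psi f m') = RA m (\<lambda>i. m (\<sigma> i)) * Psi f (\<lambda>i. m (\<sigma> i))"
    proof (cases "m \<in> box")
      case True
      then have "(\<Sum>m'\<in>box. RA m m' * Psi f m') = (\<Sum>m'\<in>{\<lambda>i. m (\<sigma> i)}. RA m m' * Psi f m')"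
        by (intro sum.mono_neutral_right) (auto simp: finite_box box_perm RA_def)
      then show ?thesis by simp
    next
      case False
      then have n: "(\<lambda>i. m (\<sigma> i)) \<notin> box" by (simp add: box_perm)
      then have "(\<Sum>m'\<in>box. RA m m' * Psi f m') = 0" by (intro sum.neutral) (auto simp: RA_def)
      then show ?thesis using Psi_support[OF n, of f] by simp
    qed
    show "phiL (act LQ w' a) m = (\<Sum>m'\<in>box. RA m m' * phiL a m')"
      unfolding a unfolding f phiL_cL val S by (simp add: RA_def)
  qed
  have "endo_trace (piece (tensor LQ X.E) i) (act (tensor LQ X.E) ?w) = chi \<sigma> \<eta> * (\<Sum>m\<in>KK (i - int N). RA m m)"
    using T.tensor_trace[of ?w i] unfolding det_Vh[OF G] by simp
  also have "\<dots> = (\<Sum>m\<in>KK (i - int N). if Fx m then \<Prod>i\<in>UNIV. \<eta> i ^ m i else 0)"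
    unfolding sum_distrib_left
  proof (rule sum.cong[OF refl])
    fix m
    have "RA m m = inverse (chi \<sigma> \<eta>) * (\<Prod>i\<in>UNIV. \<eta> i ^ m (\<sigma> i)) * of_bool (Fx m)" unfolding RA_def Fx_iff ..
    then show "chi \<sigma> \<eta> * RA m m = (if Fx m then \<Prod>i\<in>UNIV. \<eta> i ^ m i else 0)"
      using ch by (cases "Fx m") (simp_all add: prod_perm)
  qed
  also have "\<dots> = (\<Sum>m\<in>{m \<in> KK (i - int N). Fx m}. \<Prod>i\<in>UNIV. \<eta> i ^ m i)"
  proof (rule sum.inter_filter[symmetric])
    show "finite (KK (i - int N))" by (rule finite_subset[OF _ finite_box]) (auto simp: KK_def)
  qed
  also have "{m \<in> KK (i - int N). Fx m} = {m. (\<forall>l. m l \<le> h) \<and> (\<forall>l. m (\<sigma> l) = m l) \<and> int (\<Sum>l\<in>UNIV. m l) = i}"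
  proof -
    have "int N + (i - int N) = i" by linarith
    then show ?thesis unfolding KK_def box_def Fx_def by (simp only: mem_Collect_eq conj_assoc) blast
  qed
  finally show ?thesis unfolding X.ext_power_eq fixsum_nth .
qed

text \<open>A polynomial in the x_i vanishes in L iff its symbol, which is \<open>Q f\<close>, is
  zero, and \<open>annihilator_eq_J\<close> says that this means membership in \<open>J\<close>.
  Both algebras are thus the same quotient of the polynomials in the x_i.\<close>

lemma x_image_iso: "graded_iso (G_group r p) (x_image (G_group r p) KL) (coinv (G_group r p :: (complex^'n^'n) set))"
proof -
  let ?A = "x_image (G_group r p :: (complex^'n^'n) set) KL" and ?B = "coinv (G_group r p :: (complex^'n^'n) set)"
  have "KL +>\<^bsub>diag_coinv (G_group r p)\<^esub> (diag_ideal (G_group r p) +>\<^bsub>poly_alg :: (complex^'n^'n, 'n bipoly) grep\<^esub> f) = cL f" for f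
    unfolding cL_def cD_def DI_def by (simp only: image_ident)
  then have A: "?A = sub_grep LQ (cL ` x_polys)" unfolding x_image_def LQ_def by simp
  have Af: "carrier ?A = cL ` x_polys" "gr ?A d = gr LQ d \<inter> cL ` x_polys" "x \<oplus>\<^bsub>?A\<^esub> y = x \<oplus>\<^bsub>LQ\<^esub> y" "x \<otimes>\<^bsub>?A\<^esub> y = x \<otimes>\<^bsub>LQ\<^esub> y"
    "\<one>\<^bsub>?A\<^esub> = \<one>\<^bsub>LQ\<^esub>" "c \<odot>\<^bsub>?A\<^esub> x = c \<odot>\<^bsub>LQ\<^esub> x" "act ?A w x = act LQ w x" for d x y c w
    unfolding A by (simp_all add: sub_grep_def)
  define \<phi> where "\<phi> z = cJ (SOME f. f \<in> x_polys \<and> cL f = z)" for z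
  have eq: "cL f = cL g \<longleftrightarrow> cJ f = cJ g" if "f \<in> x_polys" "g \<in> x_polys" for f g
  proof -
    have fg: "f - g \<in> x_polys" by (rule lin_subspaceD(5)[OF x_polys_subspace that])
    have "cL f = cL g \<longleftrightarrow> f - g \<in> kernel" by (rule LL.eq_iff[OF UNIV_I UNIV_I])
    also have "\<dots> \<longleftrightarrow> f - g \<in> J" unfolding kernel_def mem_Collect_eq Psi_x_polys[OF fg] by (rule annihilator_eq_J[OF fg])
    also have "\<dots> \<longleftrightarrow> cJ f = cJ g" by (rule co.eq_iff[OF that, symmetric])
    finally show ?thesis .
  qed
  have \<phi>: "\<phi> (cL f) = cJ f" if f: "f \<in> x_polys" for f
  proof -
    have "\<exists>g. g \<in> x_polys \<and> cL g = cL f" using f by blast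
    from someI_ex[OF this] show ?thesis unfolding \<phi>_def using eq[OF _ f] by blast
  qed
  have iso: "\<phi> \<in> ring_iso ?A ?B"
    unfolding ring_iso_def
  proof (intro CollectI conjI ring_hom_memI)
    show "\<phi> x \<in> carrier ?B" if "x \<in> carrier ?A" for x
      using that \<phi> unfolding Af co.carrier by auto
    show "\<phi> (x \<otimes>\<^bsub>?A\<^esub> y) = \<phi> x \<otimes>\<^bsub>?B\<^esub> \<phi> y" if "x \<in> carrier ?A" "y \<in> carrier ?A" for x y
    proof -
      obtain f g where fg: "f \<in> x_polys" "x = cL f" "g \<in> x_polys" "y = cL g" using \<open>x \<in> _\<close> \<open>y \<in> _\<close> unfolding Af by blast
      show ?thesis unfolding fg(2,4) Af LL.mult[OF UNIV_I UNIV_I] \<phi>[OF fg(1)] \<phi>[OF fg(3)] co.mult[OF fg(1,3)]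
        by (rule \<phi>[OF x_polys_mult[OF fg(1,3)]])
    qed
    show "\<phi> (x \<oplus>\<^bsub>?A\<^esub> y) = \<phi> x \<oplus>\<^bsub>?B\<^esub> \<phi> y" if "x \<in> carrier ?A" "y \<in> carrier ?A" for x y
    proof -
      obtain f g where fg: "f \<in> x_polys" "x = cL f" "g \<in> x_polys" "y = cL g" using \<open>x \<in> _\<close> \<open>y \<in> _\<close> unfolding Af by blast
      show ?thesis unfolding fg(2,4) Af LL.add[OF UNIV_I UNIV_I] \<phi>[OF fg(1)] \<phi>[OF fg(3)] co.add[OF fg(1,3)]
        by (rule \<phi>[OF lin_subspaceD(2)[OF x_polys_subspace fg(1,3)]])
    qed
    show "\<phi> \<one>\<^bsub>?A\<^esub> = \<one>\<^bsub>?B\<^esub>" unfolding Af LL.one co.one by (rule \<phi>[OF x_polys_one])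
    show "bij_betw \<phi> (carrier ?A) (carrier ?B)"
      unfolding bij_betw_def
    proof
      show "inj_on \<phi> (carrier ?A)" unfolding Af
      proof (rule inj_onI)
        fix x y assume "x \<in> cL ` x_polys" "y \<in> cL ` x_polys" and e: "\<phi> x = \<phi> y"
        then obtain f g where fg: "f \<in> x_polys" "x = cL f" "g \<in> x_polys" "y = cL g" by blast
        have "cJ f = cJ g" using e unfolding fg(2,4) \<phi>[OF fg(1)] \<phi>[OF fg(3)] .
        then show "x = y" unfolding fg(2,4) eq[OF fg(1,3)] .
      qed
      show "\<phi> ` carrier ?A = carrier ?B" unfolding Af co.carrier image_image using \<phi> by (intro image_cong refl)
    qed
  qed
  have sm: "\<phi> (c \<odot>\<^bsub>?A\<^esub> x) = c \<odot>\<^bsub>?B\<^esub> \<phi> x" if x: "x \<in> carrier ?A" for c x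
  proof -
    obtain f where f: "f \<in> x_polys" "x = cL f" using x unfolding Af by blast
    show ?thesis unfolding f(2) Af LL.smult[OF UNIV_I] \<phi>[OF f(1)] co.smult[OF f(1)]
      by (rule \<phi>[OF lin_subspaceD(3)[OF x_polys_subspace f(1)]])
  qed
  have ac: "\<phi> (act ?A w x) = act ?B w (\<phi> x)" if w: "w \<in> G_group r p" and x: "x \<in> carrier ?A" for w x
  proof -
    obtain f where f: "f \<in> x_polys" "x = cL f" using x unfolding Af by blast
    show ?thesis unfolding f(2) Af LL.act[OF w UNIV_I] \<phi>[OF f(1)] co.act[OF w f(1)]
      by (rule \<phi>[OF co.act_closed[OF w f(1)]])
  qed
  have grd: "\<phi> ` gr ?A d = gr ?B d" for d
  proof (intro equalityI subsetI)
    fix z assume "z \<in> \<phi> ` gr ?A d"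
    then obtain f where f: "f \<in> x_polys" "cL f \<in> gr LQ d" "z = \<phi> (cL f)" unfolding Af by blast
    \<comment> \<open>The class of \<open>f\<close> is homogeneous in L although \<open>f\<close>
      itself may not be; its part of degree d has the same symbol and hence the same class.\<close>
    define g where "g = restr (\<lambda>x. mon_deg x = d) f"
    have gx: "g \<in> x_polys" unfolding g_def by (rule restr_x_polys[OF f(1)])
    have sup: "Psi f \<in> supported (KK d)" using f(2) unfolding gr_LQ by (simp add: phiL_cL)
    have "Psi g m = Psi f m" for m
    proof (cases "m \<in> KK d")
      case False
      then have "Psi f m = 0" by (rule supportedD[OF sup])
      then show ?thesis unfolding g_def Psi_mon_deg by simp
    qed (simp add: g_def Psi_mon_deg KK_def)
    then have "f - g \<in> kernel" by (simp add: kernel_def Psi_diff)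
    then have "cL f = cL g" using LL.eq_iff[OF UNIV_I UNIV_I] by blast
    then have "z = cJ g" unfolding f(3) using \<phi>[OF gx] by simp
    moreover have "g \<in> gr (x_alg :: (complex^'n^'n, 'n bipoly) grep) d"
      unfolding gr_x_alg using gx by (simp add: g_def keys_restr)
    ultimately show "z \<in> gr ?B d" unfolding gr_coinv by blast
  next
    fix z assume "z \<in> gr ?B d"
    then obtain f where f: "f \<in> gr (x_alg :: (complex^'n^'n, 'n bipoly) grep) d" "z = cJ f" unfolding gr_coinv by blast
    then have fx: "f \<in> x_polys" "\<forall>x\<in>Poly_Mapping.keys f. mon_deg x = d" unfolding gr_x_alg by blast+
    then have "cL f \<in> gr ?A d" unfolding Af gr_LQ_image by blast
    then show "z \<in> \<phi> ` gr ?A d" unfolding f(2) \<phi>[OF fx(1), symmetric] by (rule imageI)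
  qed
  show ?thesis unfolding graded_iso_def
    by (rule bexI[OF _ iso]) (intro conjI allI ballI sm ac grd)
qed

lemma main:
  "\<exists>K. ideal K (diag_coinv (G_group r p :: (complex^'n^'n) set)) \<and> act_stable (G_group r p) (diag_coinv (G_group r p)) K \<and>
      homogeneous (diag_coinv (G_group r p)) K \<and>
    (let L = quot_grep (diag_coinv (G_group r p)) K;
         e = int (sum_list (exponents_in (G_group r p) (coinv (G_group r p)) (power_rep (h + 1) :: (complex^'n^'n, 'n bipoly) grep)));
         M = tensor L (ext_power CARD('n) e (power_rep (h + 1) :: (complex^'n^'n, 'n bipoly) grep))
     in (\<forall>w\<in>G_group r p. \<forall>i::int.
           endo_trace (piece M i) (act M w) =
           fls_nth (det_one_minus (h + 1)
                      (endo_matrix (power_rep (h + 1) :: (complex^'n^'n, 'n bipoly) grep) (\<lambda>j::'n. Var (Inl j) ^ (h + 1)) (act (power_rep (h + 1) :: (complex^'n^'n, 'n bipoly) grep) w))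
                    / det_one_minus 1
                      (endo_matrix (power_rep 1 :: (complex^'n^'n, 'n bipoly) grep) (\<lambda>j::'n. Var (Inl j)) (act (power_rep 1 :: (complex^'n^'n, 'n bipoly) grep) w))) i)
      \<and> graded_iso (G_group r p) (x_image (G_group r p) K) (coinv (G_group r p)))"
proof (rule exI[of _ KL], intro conjI KL_ideal KL_stable KL_homogeneous)
  have es: "sum_list (exponents_in (G_group r p) (coinv (G_group r p)) (power_rep (h + 1) :: (complex^'n^'n, 'n bipoly) grep)) = N"
    using exponent_sum unfolding Vh_def by simp
  have tr: "endo_trace (piece (tensor LQ (ext_power CARD('n) (int N) Vh)) i) (act (tensor LQ (ext_power CARD('n) (int N) Vh)) w)
      = fls_nth (det_one_minus (h + 1)
                      (endo_matrix (power_rep (h + 1) :: (complex^'n^'n, 'n bipoly) grep) (\<lambda>j::'n. Var (Inl j) ^ (h + 1)) (act (power_rep (h + 1) :: (complex^'n^'n, 'n bipoly) grep) w))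
                    / det_one_minus 1
                      (endo_matrix (power_rep 1 :: (complex^'n^'n, 'n bipoly) grep) (\<lambda>j::'n. Var (Inl j)) (act (power_rep 1 :: (complex^'n^'n, 'n bipoly) grep) w))) i"
    if w: "w \<in> G_group r p" for w i
  proof -
    obtain \<sigma> \<eta> where G: "G_data r p \<sigma> \<eta>" "w = wmat \<sigma> \<eta>" by (rule G_groupE[OF w])
    have \<sigma>: "\<sigma> permutes UNIV" using G(1) by (simp add: G_data_def)
    have m1: "endo_matrix (power_rep (h + 1) :: (complex^'n^'n, 'n bipoly) grep) (\<lambda>j::'n. Var (Inl j) ^ (h + 1)) (act (power_rep (h + 1) :: (complex^'n^'n, 'n bipoly) grep) w) = bmat \<sigma> (\<lambda>j. \<eta> j ^ (h + 1))"
      unfolding G(2) by (rule endo_matrix_power[OF _ G(1)]) simp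
    have m2: "endo_matrix (power_rep 1 :: (complex^'n^'n, 'n bipoly) grep) (\<lambda>j::'n. Var (Inl j)) (act (power_rep 1 :: (complex^'n^'n, 'n bipoly) grep) w) = bmat \<sigma> (\<lambda>j. \<eta> j ^ 1)"
    proof -
      have "endo_matrix (power_rep 1 :: (complex^'n^'n, 'n bipoly) grep) (\<lambda>j::'n. Var (Inl j) ^ 1) (act (power_rep 1 :: (complex^'n^'n, 'n bipoly) grep) (wmat \<sigma> \<eta>)) = bmat \<sigma> (\<lambda>j. \<eta> j ^ 1)"
        by (rule endo_matrix_power[OF _ G(1)]) simp
      then show ?thesis unfolding G(2) power_one_right .
    qed
    have eq: "fixsum h \<sigma> (\<lambda>i. fps_to_fls (lb \<eta> i)) * det (mat 1 - bmat \<sigma> (\<lambda>i. fps_to_fls (lb \<eta> i))) = det (mat 1 - bmat \<sigma> (\<lambda>i. fps_to_fls (lb \<eta> i) ^ (h + 1)))"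
      using fixsum_det[OF \<sigma>, of h "\<lambda>i. fps_to_fls (lb \<eta> i)"] unfolding Suc_eq_plus1 .
    \<comment> \<open>The quotient of Laurent series is exact: the numerator is
      \<open>fixsum\<close> times the denominator, which is nonzero.\<close>
    have q: "det_one_minus (h + 1) (bmat \<sigma> (\<lambda>j. \<eta> j ^ (h + 1))) / det_one_minus 1 (bmat \<sigma> (\<lambda>j. \<eta> j ^ 1)) = fixsum h \<sigma> (\<lambda>i. fps_to_fls (lb \<eta> i))"
      unfolding det_one_minus_bmat eq[symmetric] unfolding power_one_right
      by (rule nonzero_mult_div_cancel_right[OF det_one_minus_nonzero])
    show ?thesis unfolding m1 m2 q unfolding G(2) by (rule graded_trace[OF G(1)])
  qed
  have V: "(power_rep (h + 1) :: (complex^'n^'n, 'n bipoly) grep) = Vh" unfolding Vh_def by simp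
  show "let L = quot_grep (diag_coinv (G_group r p)) KL;
         e = int (sum_list (exponents_in (G_group r p) (coinv (G_group r p)) (power_rep (h + 1) :: (complex^'n^'n, 'n bipoly) grep)));
         M = tensor L (ext_power CARD('n) e (power_rep (h + 1) :: (complex^'n^'n, 'n bipoly) grep))
     in (\<forall>w\<in>G_group r p. \<forall>i::int.
           endo_trace (piece M i) (act M w) =
           fls_nth (det_one_minus (h + 1)
                      (endo_matrix (power_rep (h + 1) :: (complex^'n^'n, 'n bipoly) grep) (\<lambda>j::'n. Var (Inl j) ^ (h + 1)) (act (power_rep (h + 1) :: (complex^'n^'n, 'n bipoly) grep) w))
                    / det_one_minus 1
                      (endo_matrix (power_rep 1 :: (complex^'n^'n, 'n bipoly) grep) (\<lambda>j::'n. Var (Inl j)) (act (power_rep 1 :: (complex^'n^'n, 'n bipoly) grep) w))) i)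
      \<and> graded_iso (G_group r p) (x_image (G_group r p) KL) (coinv (G_group r p))"
    unfolding Let_def es LQ_def[symmetric] unfolding V
    by (intro conjI ballI allI x_image_iso tr[unfolded V])
qed

end

theorem theorem8p2:
  fixes r p h :: nat
    and W :: "(complex^'n^'n) set"
    and V hstar :: "(complex^'n^'n, 'n::finite bipoly) grep"
  assumes "r > 1" and "p > 0" and "p dvd r"
    and W: "W = G_group r p"
    and irred: "irreducible_rep W (std_rep :: (complex^'n^'n, complex^'n) rep)"
    and h: "h = (if p < r then r * (CARD('n) - 1) + r div p else r * (CARD('n) - 1))"
    and V: "V = power_rep (h + 1)"
    and hstar: "hstar = power_rep 1"
  shows "\<exists>K. ideal K (diag_coinv W) \<and> act_stable W (diag_coinv W) K \<and> homogeneous (diag_coinv W) K \<and>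
    (let L = quot_grep (diag_coinv W) K;
         e = int (sum_list (exponents_in W (coinv W) V));
         M = tensor L (ext_power CARD('n) e V)
     in (\<forall>w\<in>W. \<forall>i::int.
           endo_trace (piece M i) (act M w) =
           fls_nth (det_one_minus (h + 1)
                      (endo_matrix V (\<lambda>j::'n. Var (Inl j) ^ (h + 1)) (act V w))
                    / det_one_minus 1
                      (endo_matrix hstar (\<lambda>j::'n. Var (Inl j)) (act hstar w))) i)
      \<and> graded_iso W (x_image W K) (coinv W))"
proof -
  obtain idx :: "'n \<Rightarrow> nat" where idx: "bij_betw idx UNIV {..<CARD('n)}"
    using ex_bij_betw_finite_nat[of "UNIV :: 'n set"] by (auto simp: atLeast0LessThan)
  interpret M: coinv_model r p idx
    using assms(1-3) idx by unfold_locales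
  have hh: "h = M.h" unfolding M.h_def h ..
  show ?thesis unfolding V hstar W hh by (rule M.main)
qed

end
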